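(* Let $\Omega\subset\mathbb R^{m+1}$ be open, let $F$ be an elliptic integrand on $\Omega$, let $h>0$, and let $(M_i)_i$ be a sequence of $F$-stable $m$-dimensional manifolds (with boundary) in $\Omega$ such that for every compact $K\subset\Omega$ $$\limsup_{i\to\infty}\mathcal H^{m-1}(\partial M_i\cap K)<+\infty .$$ Then the area blow-up set $$Z:=\Big\{x\in\overline\Omega:\ \limsup_{i\to\infty}\mathcal H^m(M_i\cap B_r(x))=+\infty\ \text{ for every } r>0\Big\}$$ is an $(m,h)$-set in $\Omega$ with respect to $F$ (that is, $Z\cap\Omega$ is an $(m,h)$-set).
   Context: Integrands. An elliptic integrand on the open set $\Omega\subset\mathbb R^{m+1}$ is a $C^2$ function $F:\Omega\times(\mathbb R^{m+1}\setminus\{0\})\to(0,\infty)$ which is even and one-homogeneous in the second variable, $F(x,\lambda\nu)=|\lambda|F(x,\nu)$ for $\lambda\neq0$, convex in the second variable, and satisfies $\langle D_2^2F(x,\nu)\eta,\eta\rangle>0$ for all $x\in\Omega$, $\nu\in\mathbb S^m$, $0\ne\eta\perp\nu$. Notation: $F_i=\partial F/\partial\nu_i$, $F_{ij}=\partial^2F/\partial\nu_i\partial\nu_j$, $\partial_iF_j=\partial^2F/\partial x_i\partial\nu_j$; repeated indices are summed. Stability. Manifolds $M\subset\Omega$ are $C^2$, properly embedded in $\Omega$, possibly with boundary $\partial M$, with unit normal $\nu_M$. For $U\subset\Omega$ open, $\mathbf F(M,U)=\int_{M\cap U}F(x,\nu_M)\,d\mathcal H^m$. $M$ is $F$-stable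 if for every $g\in C^1_c(\Omega\setminus\partial M,\mathbb R^{m+1})$, with $\varphi_t(x)=x+tg(x)$ and $U\subset\subset\Omega$ an open set containing $\operatorname{spt} g$, one has $\frac{d}{dt}\mathbf F(\varphi_t(M),U)|_{t=0}=0$ ($F$-stationarity) and $\frac{d^2}{dt^2}\mathbf F(\varphi_t(M),U)|_{t=0}\ge0$. $(m,h)$-sets. A relatively closed set $Z\subset\Omega$ is an $(m,h)$-set in $\Omega$ with respect to $F$ if: whenever $f:\Omega\to\mathbb R$ is $C^2$, $f|_Z$ has a local maximum at $p\in Z$ and $Df(p)\neq0$, then $$F_{ij}\Big(p,\tfrac{Df(p)}{|Df(p)|}\Big)D_{ij}f(p)+(\partial_iF_i)\Big(p,\tfrac{Df(p)}{|Df(p)|}\Big)|Df(p)|\le h\,|Df(p)|.$$ $B_r(x)$ is the open ball in $\mathbb R^{m+1}$. *)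

theory Defs
  imports "HOL-Analysis.Analysis"
begin

section \<open>Hausdorff measure\<close>

text \<open>
  The measures are normalised by the volume of the unit ball, so that the \<open>n\<close>-dimensional
  measure on an \<open>n\<close>-dimensional space is Lebesgue measure and the \<open>0\<close>-dimensional one counts
  points. The empty set needs a case of its own because of \<open>0 ^ 0 = 1\<close>.
\<close>

definition hausdorff_weight :: "nat \<Rightarrow> 'a::metric_space set \<Rightarrow> ennreal" where
  "hausdorff_weight k C =
     (if C = {} then 0 else ennreal (unit_ball_vol (real k) * (diameter C / 2) ^ k))"

definition hausdorff_premeasure :: "nat \<Rightarrow> real \<Rightarrow> 'a::metric_space set \<Rightarrow> ennreal" where
  "hausdorff_premeasure k d A =
     (INF C \<in> {C :: nat \<Rightarrow> 'a set. A \<subseteq> (\<Union>i. C i) \<and> (\<forall>i. bounded (C i) \<and> diameter (C i) \<le> d)}.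
        \<Sum>i. hausdorff_weight k (C i))"

definition hausdorff_outer :: "nat \<Rightarrow> 'a::metric_space set \<Rightarrow> ennreal" where
  "hausdorff_outer k A = (SUP d \<in> {0<..}. hausdorff_premeasure k d A)"

text \<open>The restriction of the outer measure to its Caratheodory-measurable sets.\<close>

definition hausdorff_measure :: "nat \<Rightarrow> 'a::metric_space measure" where
  "hausdorff_measure k =
     measure_of UNIV (lambda_system UNIV (Pow UNIV) (hausdorff_outer k)) (hausdorff_outer k)"

lemma hausdorff_premeasure_countable_subadditive:
  fixes A :: "nat \<Rightarrow> 'a::metric_space set"
  shows "hausdorff_premeasure k d (\<Union>i. A i) \<le> (\<Sum>i. hausdorff_premeasure k d (A i))"
proof (rule ennreal_le_epsilon)
  fix e :: real
  assume fin: "(\<Sum>i. hausdorff_premeasure k d (A i)) < top" and "0 < e"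
  have "\<exists>C. A i \<subseteq> (\<Union>j. C j) \<and> (\<forall>j. bounded (C j) \<and> diameter (C j) \<le> d) \<and>
          (\<Sum>j. hausdorff_weight k (C j)) < hausdorff_premeasure k d (A i) + e * (1/2)^Suc i" for i
  proof -
    have "hausdorff_premeasure k d (A i) < top"
      by (rule ennreal_suminf_lessD[OF fin])
    then have "hausdorff_premeasure k d (A i) < hausdorff_premeasure k d (A i) + e * (1/2)^Suc i"
      using \<open>0 < e\<close> by (auto simp: ennreal_zero_less_mult_iff ennreal_add_left_cancel_less [where b = 0, simplified])
    then show ?thesis
      unfolding hausdorff_premeasure_def[of k d "A i"] INF_less_iff by auto
  qed
  then obtain C where C: "\<And>i. A i \<subseteq> (\<Union>j. C i j)"
      "\<And>i j. bounded (C i j)" "\<And>i j. diameter (C i j) \<le> d"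
      "\<And>i. (\<Sum>j. hausdorff_weight k (C i j))
              < hausdorff_premeasure k d (A i) + e * (1/2)^Suc i"
    by metis
  define D where "D = (\<lambda>n. case prod_decode n of (i, j) \<Rightarrow> C i j)"
  have "(\<Union>i. A i) \<subseteq> (\<Union>n. D n)"
  proof
    fix x assume "x \<in> (\<Union>i. A i)"
    then obtain i j where "x \<in> C i j" using C(1) by blast
    then have "x \<in> D (prod_encode (i, j))" by (simp add: D_def)
    then show "x \<in> (\<Union>n. D n)" by blast
  qed
  moreover have "bounded (D n) \<and> diameter (D n) \<le> d" for n
    using C(2,3) by (simp add: D_def split: prod.split)
  ultimately have "hausdorff_premeasure k d (\<Union>i. A i) \<le> (\<Sum>n. hausdorff_weight k (D n))"
    unfolding hausdorff_premeasure_def by (intro INF_lower) auto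
  also have "\<dots> = (\<Sum>n. (\<lambda>(i, j). hausdorff_weight k (C i j)) (prod_decode n))"
    by (simp add: D_def case_prod_unfold)
  also have "\<dots> = (\<Sum>i. \<Sum>j. hausdorff_weight k (C i j))"
    by (rule suminf_ennreal_2dimen) simp
  also have "\<dots> \<le> (\<Sum>i. hausdorff_premeasure k d (A i) + e * (1/2)^Suc i)"
    using C(4) by (intro suminf_le) (auto intro: less_imp_le)
  also have "\<dots> = (\<Sum>i. hausdorff_premeasure k d (A i)) + (\<Sum>i. ennreal e * ennreal ((1/2)^Suc i))"
    using \<open>0 < e\<close> by (subst suminf_add) (auto simp del: ennreal_suminf_cmult simp add: ennreal_mult[symmetric])
  also have "(\<Sum>i. ennreal e * ennreal ((1/2)^Suc i)) = e"
    unfolding ennreal_suminf_cmult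
    by (subst suminf_ennreal_eq[OF zero_le_power power_half_series]) auto
  finally show "hausdorff_premeasure k d (\<Union>i. A i) \<le> (\<Sum>i. hausdorff_premeasure k d (A i)) + e" .
qed

lemma outer_measure_space_hausdorff_outer:
  "outer_measure_space (Pow UNIV) (hausdorff_outer k :: 'a::metric_space set \<Rightarrow> ennreal)"
proof -
  have "hausdorff_premeasure k d ({} :: 'a set) = 0" if "0 < d" for d
  proof -
    have "hausdorff_premeasure k d ({} :: 'a set) \<le> (\<Sum>i. hausdorff_weight k ((\<lambda>_. {} :: 'a set) i))"
      unfolding hausdorff_premeasure_def using that by (intro INF_lower) auto
    then show ?thesis by (simp add: hausdorff_weight_def)
  qed
  then have "hausdorff_outer k ({} :: 'a set) = 0"
    unfolding hausdorff_outer_def by (intro antisym SUP_least) auto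
  moreover have "hausdorff_outer k A \<le> hausdorff_outer k B" if "A \<subseteq> B" for A B :: "'a set"
    unfolding hausdorff_outer_def hausdorff_premeasure_def
    using that by (intro SUP_mono' INF_superset_mono) auto
  moreover have "hausdorff_outer k (\<Union>i. A i) \<le> (\<Sum>i. hausdorff_outer k (A i))"
    for A :: "nat \<Rightarrow> 'a set"
    unfolding hausdorff_outer_def[of k "\<Union>i. A i"]
  proof (rule SUP_least)
    fix d :: real assume "d \<in> {0<..}"
    have "hausdorff_premeasure k d (\<Union>i. A i) \<le> (\<Sum>i. hausdorff_premeasure k d (A i))"
      by (rule hausdorff_premeasure_countable_subadditive)
    also have "\<dots> \<le> (\<Sum>i. hausdorff_outer k (A i))"
      unfolding hausdorff_outer_def using \<open>d \<in> {0<..}\<close>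
      by (intro suminf_le SUP_upper) auto
    finally show "hausdorff_premeasure k d (\<Union>i. A i) \<le> (\<Sum>i. hausdorff_outer k (A i))" .
  qed
  ultimately show ?thesis
    unfolding outer_measure_space_def positive_def increasing_def countably_subadditive_def by auto
qed

lemma emeasure_hausdorff_measure:
  assumes "A \<in> sets (hausdorff_measure k)"
  shows "emeasure (hausdorff_measure k) A = hausdorff_outer k (A :: 'a::metric_space set)"
proof -
  interpret P: sigma_algebra "UNIV :: 'a set" "Pow UNIV" by (rule sigma_algebra_Pow)
  let ?L = "lambda_system UNIV (Pow UNIV) (hausdorff_outer k) :: 'a set set"
  have ms: "measure_space UNIV ?L (hausdorff_outer k)"
    by (rule P.caratheodory_lemma[OF outer_measure_space_hausdorff_outer])
  then interpret L: sigma_algebra UNIV ?L by (simp add: measure_space_def)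
  have "A \<in> ?L" using assms
    unfolding hausdorff_measure_def sets_measure_of[OF L.space_closed] L.sigma_sets_eq .
  with ms show ?thesis
    unfolding hausdorff_measure_def
    by (intro emeasure_measure_of_sigma) (simp_all add: measure_space_def)
qed


section \<open>Differentiability classes and partial derivatives\<close>

definition C1_on :: "'a::real_normed_vector set \<Rightarrow> ('a \<Rightarrow> 'b::real_normed_vector) \<Rightarrow> bool" where
  "C1_on S f \<longleftrightarrow>
     (\<exists>f' :: 'a \<Rightarrow> 'a \<Rightarrow>\<^sub>L 'b.
        (\<forall>x\<in>S. (f has_derivative blinfun_apply (f' x)) (at x)) \<and> continuous_on S f')"

definition C2_on :: "'a::real_normed_vector set \<Rightarrow> ('a \<Rightarrow> 'b::real_normed_vector) \<Rightarrow> bool" where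
  "C2_on S f \<longleftrightarrow>
     (\<exists>f' :: 'a \<Rightarrow> 'a \<Rightarrow>\<^sub>L 'b.
        (\<forall>x\<in>S. (f has_derivative blinfun_apply (f' x)) (at x)) \<and> C1_on S f')"

definition partial :: "'n \<Rightarrow> (real^'n \<Rightarrow> real) \<Rightarrow> real^'n \<Rightarrow> real" where
  "partial i f x = deriv (\<lambda>t. f (x + t *\<^sub>R axis i 1)) 0"

definition grad :: "(real^'n \<Rightarrow> real) \<Rightarrow> real^'n \<Rightarrow> real^'n" where
  "grad f x = (\<chi> i. partial i f x)"


section \<open>Elliptic integrands\<close>

text \<open>
  An integrand is a curried function \<open>F x \<nu>\<close>; only its values at \<open>\<nu> \<noteq> 0\<close> are meaningful.
  In index notation, \<open>dF2 F i j\<close> is $F_{ij}$ and \<open>dxF F i j\<close> is $\partial_i F_j$.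
\<close>

definition dF :: "(real^'n \<Rightarrow> real^'n \<Rightarrow> real) \<Rightarrow> 'n \<Rightarrow> real^'n \<Rightarrow> real^'n \<Rightarrow> real" where
  "dF F i x \<nu> = partial i (F x) \<nu>"

definition dF2 :: "(real^'n \<Rightarrow> real^'n \<Rightarrow> real) \<Rightarrow> 'n \<Rightarrow> 'n \<Rightarrow> real^'n \<Rightarrow> real^'n \<Rightarrow> real" where
  "dF2 F i j x \<nu> = partial i (dF F j x) \<nu>"

definition dxF :: "(real^'n \<Rightarrow> real^'n \<Rightarrow> real) \<Rightarrow> 'n \<Rightarrow> 'n \<Rightarrow> real^'n \<Rightarrow> real^'n \<Rightarrow> real" where
  "dxF F i j x \<nu> = partial i (\<lambda>y. dF F j y \<nu>) x"

text \<open>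
  Since the complement of the origin is not convex, convexity in the second variable refers to
  the continuous one-homogeneous extension by \<open>0\<close> at the origin.
\<close>

definition elliptic_integrand ::
    "(real^'n) set \<Rightarrow> (real^'n \<Rightarrow> real^'n \<Rightarrow> real) \<Rightarrow> bool" where
  "elliptic_integrand \<Omega> F \<longleftrightarrow>
     C2_on (\<Omega> \<times> (UNIV - {0})) (\<lambda>(x, \<nu>). F x \<nu>) \<and>
     (\<forall>x\<in>\<Omega>. \<forall>\<nu>. \<nu> \<noteq> 0 \<longrightarrow> F x \<nu> > 0) \<and>
     (\<forall>x\<in>\<Omega>. \<forall>\<nu> c. \<nu> \<noteq> 0 \<longrightarrow> c \<noteq> 0 \<longrightarrow> F x (c *\<^sub>R \<nu>) = \<bar>c\<bar> * F x \<nu>) \<and>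
     (\<forall>x\<in>\<Omega>. convex_on UNIV (\<lambda>\<nu>. if \<nu> = 0 then 0 else F x \<nu>)) \<and>
     (\<forall>x\<in>\<Omega>. \<forall>\<nu> \<eta>. norm \<nu> = 1 \<longrightarrow> \<eta> \<noteq> 0 \<longrightarrow> \<eta> \<bullet> \<nu> = 0 \<longrightarrow>
        (\<Sum>i\<in>UNIV. \<Sum>j\<in>UNIV. dF2 F i j x \<nu> * \<eta> $ i * \<eta> $ j) > 0)"


section \<open>Hypersurfaces with boundary\<close>

text \<open>
  Submanifolds are of codimension one. They are described by ambient $C^2$ charts that flatten
  them to a coordinate hyperplane, or to a coordinate half-hyperplane near a boundary point.
\<close>

definition C2_chart ::
    "'a::real_normed_vector set \<Rightarrow> 'a set \<Rightarrow> ('a \<Rightarrow> 'a) \<Rightarrow> ('a \<Rightarrow> 'a) \<Rightarrow> bool" where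
  "C2_chart U V \<phi> \<psi> \<longleftrightarrow>
     open U \<and> open V \<and> homeomorphism U V \<phi> \<psi> \<and> C2_on U \<phi> \<and> C2_on V \<psi>"

definition interior_points :: "(real^'n) set \<Rightarrow> (real^'n) set" where
  "interior_points M =
     {p \<in> M. \<exists>U V \<phi> \<psi> k. C2_chart U V \<phi> \<psi> \<and> p \<in> U \<and> \<phi> ` (M \<inter> U) = {y \<in> V. y $ k = 0}}"

definition boundary_points :: "(real^'n) set \<Rightarrow> (real^'n) set" where
  "boundary_points M =
     {p \<in> M. \<exists>U V \<phi> \<psi> k l. C2_chart U V \<phi> \<psi> \<and> p \<in> U \<and> k \<noteq> l \<and> \<phi> p $ l = 0 \<and>
        \<phi> ` (M \<inter> U) = {y \<in> V. y $ k = 0 \<and> y $ l \<ge> 0}}"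

text \<open>For an embedded submanifold, properness of the inclusion into \<open>\<Omega>\<close> means closedness in \<open>\<Omega>\<close>.\<close>

definition proper_hypersurface :: "(real^'n) set \<Rightarrow> (real^'n) set \<Rightarrow> bool" where
  "proper_hypersurface \<Omega> M \<longleftrightarrow>
     M \<subseteq> \<Omega> \<and> closedin (top_of_set \<Omega>) M \<and> M = interior_points M \<union> boundary_points M"

text \<open>
  The velocities of one-sided curves at a boundary point fill only a half-space of the tangent
  space, hence the span. The definition makes sense for arbitrary sets and is applied below to
  the deformed sets, which are only $C^1$ submanifolds.
\<close>

definition tangent_space :: "(real^'n) set \<Rightarrow> real^'n \<Rightarrow> (real^'n) set" where
  "tangent_space M p =
     span {v. \<exists>\<gamma> :: real \<Rightarrow> real^'n. \<gamma> 0 = p \<and> (\<forall>\<^sub>F t in at_right 0. \<gamma> t \<in> M) \<and>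
             (\<gamma> has_vector_derivative v) (at_right 0)}"

text \<open>
  The normal is determined up to sign, pointwise and without continuity of the choice. This is
  immaterial because integrands are even, and it covers non-orientable hypersurfaces.
\<close>

definition unit_normal :: "(real^'n) set \<Rightarrow> real^'n \<Rightarrow> real^'n" where
  "unit_normal M p = (SOME \<nu>. norm \<nu> = 1 \<and> (\<forall>v\<in>tangent_space M p. v \<bullet> \<nu> = 0))"


section \<open>Stability\<close>

definition energy ::
    "nat \<Rightarrow> (real^'n \<Rightarrow> real^'n \<Rightarrow> real) \<Rightarrow> (real^'n) set \<Rightarrow> (real^'n) set \<Rightarrow> real" where
  "energy m F M U = (LINT x : M \<inter> U | hausdorff_measure m. F x (unit_normal M x))"

definition support :: "('a::topological_space \<Rightarrow> 'b::zero) \<Rightarrow> 'a set" where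
  "support g = closure {x. g x \<noteq> 0}"

definition admissible_variation ::
    "(real^'n) set \<Rightarrow> (real^'n) set \<Rightarrow> (real^'n \<Rightarrow> real^'n) \<Rightarrow> (real^'n) set \<Rightarrow> bool" where
  "admissible_variation \<Omega> M g U \<longleftrightarrow>
     C1_on UNIV g \<and> compact (support g) \<and> support g \<subseteq> \<Omega> - boundary_points M \<and>
     open U \<and> compact (closure U) \<and> closure U \<subseteq> \<Omega> \<and> support g \<subseteq> U"

definition deformed_energy ::
    "nat \<Rightarrow> (real^'n \<Rightarrow> real^'n \<Rightarrow> real) \<Rightarrow> (real^'n) set \<Rightarrow> (real^'n) set \<Rightarrow>
     (real^'n \<Rightarrow> real^'n) \<Rightarrow> real \<Rightarrow> real" where
  "deformed_energy m F M U g t = energy m F ((\<lambda>x. x + t *\<^sub>R g x) ` M) U"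

definition F_stationary ::
    "nat \<Rightarrow> (real^'n) set \<Rightarrow> (real^'n \<Rightarrow> real^'n \<Rightarrow> real) \<Rightarrow> (real^'n) set \<Rightarrow> bool" where
  "F_stationary m \<Omega> F M \<longleftrightarrow>
     (\<forall>g U. admissible_variation \<Omega> M g U \<longrightarrow>
        (deformed_energy m F M U g has_real_derivative 0) (at 0))"

text \<open>
  In the second-variation clause \<open>E'\<close> is the derivative of the energy near \<open>t = 0\<close> and \<open>c\<close> is
  its second derivative at \<open>0\<close>. Both exist for every admissible variation.
\<close>

definition F_stable ::
    "nat \<Rightarrow> (real^'n) set \<Rightarrow> (real^'n \<Rightarrow> real^'n \<Rightarrow> real) \<Rightarrow> (real^'n) set \<Rightarrow> bool" where
  "F_stable m \<Omega> F M \<longleftrightarrow>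
     F_stationary m \<Omega> F M \<and>
     (\<forall>g U. admissible_variation \<Omega> M g U \<longrightarrow>
        (\<exists>E' c. (\<forall>\<^sub>F t in nhds 0. (deformed_energy m F M U g has_real_derivative E' t) (at t)) \<and>
                (E' has_real_derivative c) (at 0) \<and> c \<ge> 0))"


section \<open>\<open>(m,h)\<close>-sets and the area blow-up set\<close>

text \<open>The number \<open>m\<close> is one less than the dimension of the ambient space, here \<open>CARD('n)\<close>.\<close>

definition mh_set ::
    "(real^'n) set \<Rightarrow> (real^'n \<Rightarrow> real^'n \<Rightarrow> real) \<Rightarrow> real \<Rightarrow> (real^'n) set \<Rightarrow> bool" where
  "mh_set \<Omega> F h Z \<longleftrightarrow>
     closedin (top_of_set \<Omega>) Z \<and>
     (\<forall>f p. C2_on \<Omega> f \<longrightarrow> p \<in> Z \<longrightarrow> (\<exists>e>0. \<forall>y \<in> Z \<inter> ball p e. f y \<le> f p) \<longrightarrow> grad f p \<noteq> 0 \<longrightarrow>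
        (let \<nu> = grad f p /\<^sub>R norm (grad f p) in
           (\<Sum>i\<in>UNIV. \<Sum>j\<in>UNIV. dF2 F i j p \<nu> * partial i (partial j f) p)
           + (\<Sum>i\<in>UNIV. dxF F i i p \<nu>) * norm (grad f p)
           \<le> h * norm (grad f p)))"

definition area_blowup_set :: "nat \<Rightarrow> (real^'n) set \<Rightarrow> (nat \<Rightarrow> (real^'n) set) \<Rightarrow> (real^'n) set" where
  "area_blowup_set m \<Omega> M =
     {x \<in> closure \<Omega>. \<forall>r>0. limsup (\<lambda>i. hausdorff_outer m (M i \<inter> ball x r)) = \<infinity>}"

end

theory Submission
  imports Defs
begin

text \<open>
  Suppose the inequality fails at a maximum point \<open>p\<close> of \<open>f\<close> on the blow-up set \<open>Z\<close>. Subtracting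
  \<open>f p + \<epsilon> |x - p|\<^sup>2\<close> makes the maximum strict with value \<open>0\<close>, and the divergence of the field
  \<open>G = F\<^sub>\<nu> (x, N)\<close>, \<open>N = D f\<close>, is still positive at \<open>p\<close>. Stationarity of \<open>M\<^sub>i\<close> is tested with
  \<open>\<zeta> \<eta> \<psi> (f) G\<close>, where \<open>\<psi> u = exp (\<Lambda> u) (max 0 (u + \<delta>))\<^sup>2\<close>, \<open>\<eta>\<close> is a cutoff near \<open>p\<close> and \<open>\<zeta>\<close> vanishes
  near the boundary of \<open>M\<^sub>i\<close>. Where the normal \<open>\<nu>\<close> is parallel to \<open>N\<close>, the first variation of \<open>G\<close> is
  \<open>F (x, \<nu>)\<close> times its divergence. For the other normals the derivative of \<open>\<psi>\<close> contributes at least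
  \<open>\<Lambda> \<psi>\<close> times the excess \<open>F (x, \<nu>) F (x, N) - \<langle>F\<^sub>\<nu> (x, \<nu>), N\<rangle> \<langle>F\<^sub>\<nu> (x, N), \<nu>\<rangle>\<close>, which by ellipticity is
  nonnegative and vanishes only for \<open>\<nu>\<close> parallel to \<open>N\<close>. So for \<open>\<Lambda>\<close> large the main term is bounded below near
  \<open>p\<close>. The error from \<open>D \<eta>\<close> lives on a compact set disjoint from \<open>Z\<close>, hence of bounded area,
  and \<open>\<zeta>\<close> can be chosen with error bounded by the \<open>(m - 1)\<close>-dimensional measure of the boundary. Therefore the
  area of \<open>M\<^sub>i\<close> stays bounded near \<open>p\<close>, which contradicts \<open>p \<in> Z\<close>.
\<close>

section \<open>Lebesgue measure and linear maps\<close>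

text \<open>Stationarity speaks about the derivative of the energy of deformed sets, so the first
  variation has to be extracted from Hausdorff measure itself. At negative \<open>t\<close> the
  one-sided bound \<open>E t \<le> E 0 + t a + o(t)\<close> forces \<open>a \<le> 0\<close>, so
  upper bounds for the measure of images suffice. They come from comparing a surface near a point
  with its tangent plane, where Hausdorff measure is a multiple of Lebesgue measure; the multiple
  cancels, whatever its value. The field \<open>F\<nu> (x, N)\<close> is chosen for two
  cancellations due to homogeneity. At a normal parallel to \<open>N\<close> the position derivative
  of \<open>F\<close> drops out and a divergence remains, which at \<open>p\<close> is the left side
  of the \<open>(m,h)\<close> inequality up to a positive factor. The gradient of
  \<open>\<psi> (f)\<close>, parallel to \<open>N\<close>, pairs with the field to exactly the
  excess. The order of choices matters: \<open>\<Lambda>\<close> depends on \<open>p\<close> alone,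
  then a radius \<open>r\<close> is fixed, and only then \<open>\<delta>\<close>, of order
  \<open>\<epsilon> r^2\<close>, so that \<open>{f \<ge> -\<delta>}\<close> misses the blow-up set
  in the annulus where \<open>D \<eta>\<close> lives. Uniformity in \<open>i\<close> rests on an
  area ratio constant that depends on the dimension only.\<close>

lemma translation_invariant_proportional_lborel:
  fixes N :: "'a::euclidean_space measure"
  assumes "sigma_finite_measure N" and sN[measurable_cong]: "sets N = sets borel"
    and inv: "\<And>v. distr N borel ((+) v) = N"
    and [measurable]: "A \<in> sets borel" "C \<in> sets borel"
  shows "emeasure N A * emeasure lborel C = emeasure N C * emeasure lborel A"
proof -
  interpret N: sigma_finite_measure N by fact
  interpret P: pair_sigma_finite N lborel ..
  have tr: "(\<integral>\<^sup>+y. indicator C (x + y) \<partial>lborel) = emeasure lborel C" for x :: 'a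
  proof -
    have "(\<integral>\<^sup>+y. indicator C (x + y) \<partial>lborel) = (\<integral>\<^sup>+y. indicator C y \<partial>distr lborel borel ((+) x))"
      by (subst nn_integral_distr) auto
    then show ?thesis by (simp add: lborel_distr_plus)
  qed
  have lb: "distr lborel borel (\<lambda>y. x - y) = lborel" for x :: 'a
    using lborel_affine[of "-1" x] by (simp add: density_1)
  have rf: "(\<integral>\<^sup>+y. indicator A (x - y) \<partial>lborel) = emeasure lborel A" for x :: 'a
  proof -
    have "(\<integral>\<^sup>+y. indicator A (x - y) \<partial>lborel) = (\<integral>\<^sup>+y. indicator A y \<partial>distr lborel borel (\<lambda>y. x - y))"
      by (subst nn_integral_distr) auto
    then show ?thesis by (simp add: lb)
  qed
  have sh: "(\<integral>\<^sup>+x. indicator A x * indicator C (x + y) \<partial>N) = (\<integral>\<^sup>+x. indicator A (x - y) * indicator C x \<partial>N)" for y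
  proof -
    have "(\<integral>\<^sup>+x. indicator A (x - y) * indicator C x \<partial>N) = (\<integral>\<^sup>+x. indicator A (x - y) * indicator C x \<partial>distr N borel ((+) y))"
      by (simp only: inv)
    also have "\<dots> = (\<integral>\<^sup>+x. indicator A x * indicator C (x + y) \<partial>N)"
      by (subst nn_integral_distr) (auto simp: add.commute)
    finally show ?thesis by simp
  qed
  \<comment> \<open>Uniqueness of Haar measure by Fubini: \<open>1_A(x) 1_C(x + y)\<close> is
    integrated in both orders, and shifting \<open>x\<close> by \<open>y\<close> in the inner
    \<open>N\<close>-integral turns it into \<open>1_A(x - y) 1_C(x)\<close>. The cross-multiplied
    form stays meaningful for sets of measure 0 or infinity.\<close>
  have "emeasure N A * emeasure lborel C = (\<integral>\<^sup>+x. indicator A x * emeasure lborel C \<partial>N)"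
    by (subst nn_integral_multc) (auto simp: sN)
  also have "\<dots> = (\<integral>\<^sup>+x. \<integral>\<^sup>+y. indicator A x * indicator C (x + y) \<partial>lborel \<partial>N)"
    by (intro nn_integral_cong) (simp add: nn_integral_cmult tr)
  also have "\<dots> = (\<integral>\<^sup>+y. \<integral>\<^sup>+x. indicator A x * indicator C (x + y) \<partial>N \<partial>lborel)"
    by (rule P.Fubini'[symmetric]) measurable
  also have "\<dots> = (\<integral>\<^sup>+y. \<integral>\<^sup>+x. indicator A (x - y) * indicator C x \<partial>N \<partial>lborel)"
    by (simp add: sh)
  also have "\<dots> = (\<integral>\<^sup>+x. \<integral>\<^sup>+y. indicator A (x - y) * indicator C x \<partial>lborel \<partial>N)"
    by (rule P.Fubini') measurable
  also have "\<dots> = (\<integral>\<^sup>+x. indicator C x * emeasure lborel A \<partial>N)"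
    by (intro nn_integral_cong) (subst mult.commute, simp add: nn_integral_cmult rf)
  also have "\<dots> = emeasure N C * emeasure lborel A"
    by (subst nn_integral_multc) (auto simp: sN)
  finally show ?thesis .
qed

lemma borel_linear_image:
  fixes f :: "real^'n \<Rightarrow> real^'n"
  assumes "linear f" "inj f" "S \<in> sets borel"
  shows "f ` S \<in> sets borel"
proof -
  obtain g where g: "linear g" "g \<circ> f = id" using linear_injective_left_inverse[OF assms(1,2)] by blast
  then have "f \<circ> g = id" using linear_inverse_left[OF assms(1) g(1)] by simp
  then have "f ` S = g -` S" using g(2) by (auto simp: fun_eq_iff image_iff) metis
  moreover have "g \<in> borel_measurable borel"
    using g(1) by (intro borel_measurable_continuous_onI linear_continuous_on linear_linear[THEN iffD1]) (simp add: linear_conv_bounded_linear)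
  ultimately show ?thesis using measurable_sets_borel[of g borel S] assms(3) by simp
qed

definition linear_volume :: "(real^'n \<Rightarrow> real^'n) \<Rightarrow> ennreal" where
  "linear_volume f = emeasure lborel (f ` cbox 0 1)"

lemma emeasure_lborel_cbox_cart:
  fixes a b :: "real^'n"
  assumes "\<And>i. a$i \<le> b$i"
  shows "emeasure lborel (cbox a b) = (\<Prod>i\<in>UNIV. b$i - a$i)"
proof -
  have "emeasure lborel (cbox a b) = (\<Prod>k\<in>Basis. (b - a) \<bullet> k)"
    using assms by (auto simp: emeasure_lborel_cbox_eq Basis_vec_def inner_axis)
  also have "(\<Prod>k\<in>Basis. (b - a) \<bullet> k) = (\<Prod>i\<in>UNIV. b$i - a$i)"
  proof (rule prod.reindex_cong[of "\<lambda>i. axis i 1"])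
    show "inj (\<lambda>i. axis i (1::real) :: real^'n)" by (auto simp: inj_def axis_eq_axis)
  qed (auto simp: Basis_vec_def inner_axis)
  finally show ?thesis .
qed

text \<open>Linearity of \<open>f\<close> makes the volume of \<open>f\<close>-images a translation
  invariant measure, hence a multiple of Lebesgue measure, and the unit cube identifies the
  multiple. The measure is realised as the image measure under the inverse \<open>g\<close>.\<close>

lemma linear_volume_scale:
  fixes f :: "real^'n \<Rightarrow> real^'n"
  assumes f: "linear f" "inj f" and S: "S \<in> sets borel"
  shows "emeasure lborel (f ` S) = linear_volume f * emeasure lborel S"
proof -
  obtain g where g: "linear g" "g \<circ> f = id" using linear_injective_left_inverse[OF f] by blast
  have fg: "f \<circ> g = id" using linear_inverse_left[OF f(1) g(1)] g(2) by simp
  have im: "f ` S = g -` S" for S using g(2) fg by (auto simp: fun_eq_iff image_iff) metis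
  have [measurable]: "g \<in> borel_measurable borel"
    using g(1) by (intro borel_measurable_continuous_onI linear_continuous_on) (simp add: linear_conv_bounded_linear)
  have [measurable]: "f \<in> borel_measurable borel"
    using f(1) by (intro borel_measurable_continuous_onI linear_continuous_on) (simp add: linear_conv_bounded_linear)
  define N where "N = distr lborel borel g"
  have N: "emeasure N A = emeasure lborel (f ` A)" if "A \<in> sets borel" for A
    using that by (simp add: N_def emeasure_distr im)
  have comp: "bounded (f ` cbox a b)" for a b
    using f(1) by (intro bounded_linear_image) (auto simp: linear_conv_bounded_linear)
  have sf: "sigma_finite_measure N"
  proof
    let ?A = "range (\<lambda>n::nat. cbox (- (real n *\<^sub>R One)) (real n *\<^sub>R One :: real^'n))"
    have "emeasure N (cbox a b) \<noteq> \<infinity>" for a b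
      using N[of "cbox a b"] emeasure_bounded_finite[OF comp, of a b] by (auto simp: less_top)
    moreover have "(\<Union>n::nat. cbox (- (real n *\<^sub>R One)) (real n *\<^sub>R One :: real^'n)) = UNIV"
    proof -
      have "box a b \<subseteq> cbox a b" for a b :: "real^'n" by (rule box_subset_cbox)
      then have "UNIV \<subseteq> (\<Union>n::nat. cbox (- (real n *\<^sub>R One)) (real n *\<^sub>R One :: real^'n))"
        unfolding UN_box_eq_UNIV[symmetric] by (rule UN_mono[OF subset_refl])
      then show ?thesis by (rule subset_antisym[OF subset_UNIV])
    qed
    ultimately show "\<exists>A. countable A \<and> A \<subseteq> sets N \<and> \<Union>A = space N \<and> (\<forall>a\<in>A. emeasure N a \<noteq> \<infinity>)"
      by (intro exI[of _ ?A]) (auto simp: N_def)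
  qed
  have inv: "distr N borel ((+) v) = N" for v
  proof -
    have "distr N borel ((+) v) = distr lborel borel (\<lambda>x. v + g x)"
      by (simp add: N_def distr_distr o_def)
    also have "(\<lambda>x. v + g x) = (\<lambda>x. g (f v + x))"
      using linear_add[OF g(1)] g(2) by (auto simp: fun_eq_iff)
    also have "distr lborel borel (\<lambda>x. g (f v + x)) = distr (distr lborel borel ((+) (f v))) borel g"
      by (subst distr_distr) (auto simp: o_def)
    finally show ?thesis by (simp add: lborel_distr_plus N_def)
  qed
  have "emeasure N S * emeasure lborel (cbox 0 1 :: (real^'n) set) = emeasure N (cbox 0 1) * emeasure lborel S"
    by (rule translation_invariant_proportional_lborel[OF sf _ inv S]) (auto simp: N_def)
  moreover have "emeasure lborel (cbox 0 1 :: (real^'n) set) = 1"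
    by (subst emeasure_lborel_cbox_cart) auto
  ultimately show ?thesis using S by (simp add: N linear_volume_def)
qed

lemma linear_volume_comp:
  fixes f g :: "real^'n \<Rightarrow> real^'n"
  assumes "linear f" "inj f" "linear g" "inj g"
  shows "linear_volume (f \<circ> g) = linear_volume f * linear_volume g"
proof -
  have "linear_volume (f \<circ> g) = emeasure lborel (f ` (g ` cbox 0 1))"
    by (simp add: linear_volume_def image_comp)
  also have "\<dots> = linear_volume f * linear_volume g"
    using linear_volume_scale[OF assms(1,2) borel_linear_image[OF assms(3,4)]] by (simp add: linear_volume_def)
  finally show ?thesis .
qed

lemma linear_volume_id: "linear_volume (\<lambda>x::real^'n. x) = 1"
  by (simp add: linear_volume_def emeasure_lborel_cbox_cart)

text \<open>Both sides are multiplicative, so elementary matrices suffice. Diagonal matrices turn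
  the cube into a box and transpositions preserve it; only shears need an argument. The condition on
  the determinant is an object-level implication so that the induction carries it to the
  factors.\<close>

lemma linear_volume_eq_det_matrix:
  fixes A :: "real^'n^'n"
  shows "det A \<noteq> 0 \<longrightarrow> linear_volume ((*v) A) = \<bar>det A\<bar>"
proof (induction A rule: induct_matrix_elementary)
  case (1 A B)
  have mc: "(*v) (A ** B) = (*v) A \<circ> (*v) B" by (auto simp: matrix_vector_mul_assoc)
  show ?case
  proof
    assume "det (A ** B) \<noteq> 0"
    then have d: "det A \<noteq> 0" "det B \<noteq> 0" by (auto simp: det_mul)
    then have "inj ((*v) A)" "inj ((*v) B)"
      using det_nz_iff_inj[of "(*v) A"] det_nz_iff_inj[of "(*v) B"] by auto
    then show "linear_volume ((*v) (A ** B)) = \<bar>det (A ** B)\<bar>"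
      using 1 d by (simp only: mc linear_volume_comp matrix_vector_mul_linear)
         (simp add: det_mul abs_mult ennreal_mult)
  qed
next
  case (2 A i)
  then show ?case using det_zero_row(1) by blast
next
  case (3 A)
  show ?case
  proof
    assume "det A \<noteq> 0"
    have dA: "det A = (\<Prod>i\<in>UNIV. A$i$i)" by (rule det_diagonal) (use 3 in auto)
    then have nz: "A$i$i \<noteq> 0" for i using \<open>det A \<noteq> 0\<close> by auto
    have Av: "(A *v x)$i = A$i$i * x$i" for x i
    proof -
      have "(A *v x)$i = (\<Sum>j\<in>UNIV. if j = i then A$i$i * x$i else 0)"
        unfolding matrix_vector_mult_def vec_lambda_beta by (intro sum.cong) (use 3[of i] in auto)
      then show ?thesis by simp
    qed
    let ?a = "(\<chi> i. min 0 (A$i$i)) :: real^'n" and ?b = "(\<chi> i. max 0 (A$i$i)) :: real^'n"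
    have "(*v) A ` cbox 0 1 = cbox ?a ?b"
    proof (intro set_eqI iffI)
      fix y assume "y \<in> (*v) A ` cbox 0 1"
      then obtain x where x: "y = A *v x" "x \<in> cbox 0 1" by auto
      have "min 0 (A$i$i) \<le> A$i$i * x$i \<and> A$i$i * x$i \<le> max 0 (A$i$i)" for i
      proof -
        have "0 \<le> x$i" "x$i \<le> 1" using x(2) by (auto simp: mem_box_cart)
        then show ?thesis
        proof (cases "A$i$i \<ge> 0")
          case True
          then show ?thesis using \<open>0 \<le> x$i\<close> mult_left_le[OF \<open>x$i \<le> 1\<close> True] by (auto simp: min_def max_def)
        next
          case False
          then show ?thesis using \<open>0 \<le> x$i\<close> mult_left_le[OF \<open>x$i \<le> 1\<close>, of "- A$i$i"]
            by (auto simp: min_def max_def mult_nonpos_nonneg)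
        qed
      qed
      then show "y \<in> cbox ?a ?b" by (simp add: x(1) mem_box_cart Av)
    next
      fix y assume y: "y \<in> cbox ?a ?b"
      define x where "x = (\<chi> i. y$i / A$i$i)"
      have "A *v x = y" by (auto simp: vec_eq_iff Av x_def nz)
      moreover have "0 \<le> y$i / A$i$i \<and> y$i / A$i$i \<le> 1" for i
      proof -
        have "min 0 (A$i$i) \<le> y$i" "y$i \<le> max 0 (A$i$i)" using y by (simp_all add: mem_box_cart)
        then show ?thesis using nz[of i] by (cases "A$i$i > 0") (simp_all add: min_def max_def divide_le_eq zero_le_divide_iff split: if_splits)
      qed
      then have "x \<in> cbox 0 1" by (simp add: x_def mem_box_cart)
      ultimately show "y \<in> (*v) A ` cbox 0 1" by (metis imageI)
    qed
    then have "linear_volume ((*v) A) = ennreal (\<Prod>i\<in>UNIV. ?b$i - ?a$i)"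
      by (simp only: linear_volume_def) (rule emeasure_lborel_cbox_cart, auto)
    also have "(\<Prod>i\<in>UNIV. ?b$i - ?a$i) = (\<Prod>i\<in>UNIV. \<bar>A$i$i\<bar>)"
      by (intro prod.cong) (auto simp: min_def max_def)
    also have "\<dots> = \<bar>det A\<bar>" by (simp add: dA abs_prod)
    finally show "linear_volume ((*v) A) = \<bar>det A\<bar>" .
  qed
next
  case (4 m n)
  let ?A = "(\<chi> i j. mat 1 $ i $ Transposition.transpose m n j) :: real^'n^'n"
  have Av: "(?A *v x)$i = x $ Transposition.transpose m n i" for x i
  proof -
    have "(i = Transposition.transpose m n j) = (j = Transposition.transpose m n i)" for j
      by (metis transpose_involutory)
    then have "(?A *v x)$i = (\<Sum>j\<in>UNIV. if j = Transposition.transpose m n i then x$j else 0)"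
      unfolding matrix_vector_mult_def mat_def vec_lambda_beta by (intro sum.cong) auto
    then show ?thesis by simp
  qed
  have "\<bar>det ?A\<bar> = 1"
    using det_permute_columns[OF permutes_swap_id[of m UNIV n], of "mat 1 :: real^'n^'n"] 4
    by (simp add: sign_swap_id abs_mult)
  moreover have "(*v) ?A ` cbox 0 1 = cbox 0 1"
  proof -
    have inv: "?A *v (?A *v x) = x" for x by (simp add: vec_eq_iff Av)
    have "?A *v x \<in> cbox 0 1" if "x \<in> cbox 0 1" for x using that by (simp add: mem_box_cart Av)
    then show ?thesis using inv by (metis (no_types, lifting) image_subset_iff subsetI subset_antisym image_eqI)
  qed
  ultimately show ?case by (simp add: linear_volume_def emeasure_lborel_cbox_cart)
next
  case (5 m n c)
  \<comment> \<open>The shears form a one-parameter group, and \<open>S (2 * a)\<close> is conjugate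
    to \<open>S a\<close> by stretching coordinate \<open>m\<close> by 2. Hence the volume factor of
    \<open>S c\<close> equals its own square; being invertible, it is 1.\<close>
  define S where "S c = (\<chi> i j. if i = m \<and> j = n then c else of_bool (i = j) :: real^'n^'n)" for c :: real
  have Sv: "(S c *v x)$i = x$i + (if i = m then c * x$n else 0)" for x c i
  proof -
    have "(S c *v x)$i = (\<Sum>j\<in>UNIV. (if j = i then x$j else 0) + (if j = n then (if i = m then c * x$n else 0) else 0))"
      unfolding matrix_vector_mult_def S_def using 5 by (auto intro!: sum.cong)
    then show ?thesis by (simp add: sum.distrib)
  qed
  have det1: "det (S c) = 1" for c
  proof -
    have "S c = (\<chi> k. if k = m then row m (mat 1) + c *s row n (mat 1) else row k (mat 1))"
      using 5 by (auto simp: vec_eq_iff S_def row_def mat_def)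
    then have "det (S c) = det (mat 1 :: real^'n^'n)" using det_row_operation[OF 5, of "mat 1" c] by simp
    then show ?thesis by simp
  qed
  have injS: "inj ((*v) (S c))" for c using det_nz_iff_inj[of "(*v) (S c)"] det1[of c] by auto
  have add: "(*v) (S (a + b)) = (*v) (S a) \<circ> (*v) (S b)" for a b
    using 5 by (auto simp: fun_eq_iff vec_eq_iff Sv algebra_simps)
  have mul: "linear_volume ((*v) (S (a + b))) = linear_volume ((*v) (S a)) * linear_volume ((*v) (S b))" for a b
    by (simp only: add linear_volume_comp injS matrix_vector_mul_linear)
  have scl: "linear_volume ((*v) (S (2 * a))) = linear_volume ((*v) (S a))" for a
  proof -
    define D where "D t x = (\<chi> i. if i = m then t * x$i else x$i)" for t :: real and x :: "real^'n"
    have lD: "linear (D t)" for t by (rule linearI) (auto simp: D_def vec_eq_iff algebra_simps)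
    have DD: "D 2 (D (1/2) x) = x" "D (1/2) (D 2 x) = x" for x by (auto simp: D_def vec_eq_iff)
    have iD: "inj (D 2)" "inj (D (1/2))" using DD by (metis injI)+
    have "linear_volume (D 2 \<circ> D (1/2)) = 1"
      using linear_volume_id[where 'n='n] DD by (simp add: o_def)
    then have d: "linear_volume (D 2) * linear_volume (D (1/2)) = 1"
      by (simp add: linear_volume_comp lD iD)
    have "(*v) (S (2 * a)) = D 2 \<circ> ((*v) (S a) \<circ> D (1/2))"
      using 5 by (auto simp: fun_eq_iff vec_eq_iff Sv D_def)
    then have "linear_volume ((*v) (S (2 * a))) = linear_volume (D 2 \<circ> ((*v) (S a) \<circ> D (1/2)))" by simp
    also have "\<dots> = linear_volume (D 2) * (linear_volume ((*v) (S a)) * linear_volume (D (1/2)))"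
      by (simp add: linear_volume_comp lD iD injS matrix_vector_mul_linear inj_compose linear_compose)
    also have "\<dots> = linear_volume ((*v) (S a)) * (linear_volume (D 2) * linear_volume (D (1/2)))"
      by (simp add: ac_simps)
    finally show ?thesis by (simp add: d)
  qed
  have "linear_volume ((*v) (S (c + c))) = linear_volume ((*v) (S c)) * linear_volume ((*v) (S c))" by (rule mul)
  then have eq: "linear_volume ((*v) (S c)) = linear_volume ((*v) (S c)) * linear_volume ((*v) (S c))"
    using scl[of c] by simp
  have "(*v) (S (c + - c)) = (\<lambda>x. x)" by (auto simp: fun_eq_iff vec_eq_iff Sv)
  then have inv: "linear_volume ((*v) (S c)) * linear_volume ((*v) (S (- c))) = 1"
    using mul[of c "-c"] by (simp add: linear_volume_id)
  have "linear_volume ((*v) (S c)) = linear_volume ((*v) (S c)) * linear_volume ((*v) (S c)) * linear_volume ((*v) (S (- c)))"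
    using inv by (simp add: mult.assoc)
  also have "\<dots> = 1" by (simp only: eq[symmetric] inv)
  finally have "linear_volume ((*v) (S c)) = 1" .
  then show ?case using det1[of c] by (simp add: S_def)
qed

lemma emeasure_lborel_linear_image:
  fixes f :: "real^'n \<Rightarrow> real^'n"
  assumes "linear f" "inj f" "S \<in> sets borel"
  shows "emeasure lborel (f ` S) = ennreal \<bar>det (matrix f)\<bar> * emeasure lborel S"
  using linear_volume_scale[OF assms] linear_volume_eq_det_matrix[of "matrix f"] det_nz_iff_inj[OF assms(1)] assms
  by simp

section \<open>Hausdorff measure\<close>

lemma hausdorff_outer_empty: "hausdorff_outer k {} = 0"
  using outer_measure_space_hausdorff_outer[of k] by (auto simp: outer_measure_space_def positive_def)

lemma hausdorff_outer_mono: "A \<subseteq> B \<Longrightarrow> hausdorff_outer k A \<le> hausdorff_outer k B"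
  using outer_measure_space_hausdorff_outer[of k] by (auto simp: outer_measure_space_def increasing_def)

lemma hausdorff_outer_UN:
  "hausdorff_outer k (\<Union>i. A i) \<le> (\<Sum>i. hausdorff_outer k (A i))" for A :: "nat \<Rightarrow> 'a::metric_space set"
  using hausdorff_premeasure_countable_subadditive[of k _ A]
  unfolding hausdorff_outer_def[of k "\<Union>i. A i"]
  by (intro SUP_least) (rule order_trans, assumption, intro suminf_le, auto simp: hausdorff_outer_def intro!: SUP_upper)

lemma hausdorff_outer_Un:
  fixes A B :: "'a::metric_space set"
  shows "hausdorff_outer k (A \<union> B) \<le> hausdorff_outer k A + hausdorff_outer k B"
proof -
  let ?C = "\<lambda>i::nat. if i = 0 then A else if i = 1 then B else {}"
  have "?C 0 \<union> ?C 1 \<subseteq> (\<Union>i. ?C i)" by blast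
  then have "hausdorff_outer k (A \<union> B) \<le> hausdorff_outer k (\<Union>i. ?C i)" by (intro hausdorff_outer_mono) simp
  also have "\<dots> \<le> (\<Sum>i. hausdorff_outer k (?C i))" by (rule hausdorff_outer_UN)
  also have "\<dots> = (\<Sum>i\<in>{0,1}. hausdorff_outer k (?C i))"
    by (rule suminf_finite) (auto simp: hausdorff_outer_empty)
  finally show ?thesis by simp
qed

lemma hausdorff_outer_finite_UN:
  fixes A :: "'i \<Rightarrow> 'a::metric_space set"
  assumes "finite I"
  shows "hausdorff_outer k (\<Union>i\<in>I. A i) \<le> (\<Sum>i\<in>I. hausdorff_outer k (A i))"
  using assms
proof induction
  case (insert i I)
  then show ?case
    using hausdorff_outer_Un[of k "A i" "\<Union>i\<in>I. A i"] by simp (meson add_left_mono order_trans)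
qed (simp add: hausdorff_outer_empty)

section \<open>Additivity on separated sets and measurability of Borel sets\<close>

lemma hausdorff_premeasure_antimono:
  assumes "d \<le> e" shows "hausdorff_premeasure k e A \<le> hausdorff_premeasure k d A"
  unfolding hausdorff_premeasure_def using assms by (intro INF_superset_mono) (auto intro: order_trans)

lemma hausdorff_premeasure_le_outer: "0 < d \<Longrightarrow> hausdorff_premeasure k d A \<le> hausdorff_outer k A"
  unfolding hausdorff_outer_def by (intro SUP_upper) auto

text \<open>With mesh \<open>d\<close> below the gap \<open>e\<close> no covering set meets both
  \<open>A\<close> and \<open>B\<close>, so a cover of the union splits into covers of the two
  parts. Sets that miss a part are replaced by the empty set, which has weight 0 also for
  \<open>k = 0\<close>.\<close>

lemma hausdorff_premeasure_separated:
  fixes A B :: "'a::metric_space set"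
  assumes sep: "\<And>x y. x \<in> A \<Longrightarrow> y \<in> B \<Longrightarrow> e \<le> dist x y" and "0 < d" "d < e"
  shows "hausdorff_premeasure k d A + hausdorff_premeasure k d B \<le> hausdorff_premeasure k d (A \<union> B)"
  unfolding hausdorff_premeasure_def[of k d "A \<union> B"]
proof (rule INF_greatest)
  fix C :: "nat \<Rightarrow> 'a set"
  assume "C \<in> {C. A \<union> B \<subseteq> (\<Union>i. C i) \<and> (\<forall>i. bounded (C i) \<and> diameter (C i) \<le> d)}"
  then have C: "A \<union> B \<subseteq> (\<Union>i. C i)" "\<And>i. bounded (C i)" "\<And>i. diameter (C i) \<le> d" by auto
  let ?CA = "\<lambda>i. if C i \<inter> A = {} then {} else C i" and ?CB = "\<lambda>i. if C i \<inter> B = {} then {} else C i"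
  have "hausdorff_premeasure k d A \<le> (\<Sum>i. hausdorff_weight k (?CA i))"
    unfolding hausdorff_premeasure_def using C \<open>0 < d\<close> by (intro INF_lower) (auto; blast)
  moreover have "hausdorff_premeasure k d B \<le> (\<Sum>i. hausdorff_weight k (?CB i))"
    unfolding hausdorff_premeasure_def using C \<open>0 < d\<close> by (intro INF_lower) (auto; blast)
  ultimately have "hausdorff_premeasure k d A + hausdorff_premeasure k d B \<le>
      (\<Sum>i. hausdorff_weight k (?CA i)) + (\<Sum>i. hausdorff_weight k (?CB i))" by (rule add_mono)
  also have "\<dots> = (\<Sum>i. hausdorff_weight k (?CA i) + hausdorff_weight k (?CB i))"
    by (rule suminf_add) auto
  also have "\<dots> \<le> (\<Sum>i. hausdorff_weight k (C i))"
  proof (intro suminf_le)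
    fix i
    have "C i \<inter> A = {} \<or> C i \<inter> B = {}"
    proof (rule ccontr)
      assume "\<not> ?thesis"
      then obtain x y where "x \<in> C i" "x \<in> A" "y \<in> C i" "y \<in> B" by auto
      then show False using sep[of x y] diameter_bounded_bound[OF C(2), of x i y] C(3)[of i] \<open>d < e\<close> by auto
    qed
    then show "hausdorff_weight k (?CA i) + hausdorff_weight k (?CB i) \<le> hausdorff_weight k (C i)"
      by (auto simp: hausdorff_weight_def)
  qed auto
  finally show "hausdorff_premeasure k d A + hausdorff_premeasure k d B \<le> (\<Sum>i. hausdorff_weight k (C i))" .
qed

lemma hausdorff_outer_separated:
  fixes A B :: "'a::metric_space set"
  assumes sep: "\<And>x y. x \<in> A \<Longrightarrow> y \<in> B \<Longrightarrow> e \<le> dist x y" and "0 < e"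
  shows "hausdorff_outer k (A \<union> B) = hausdorff_outer k A + hausdorff_outer k B"
proof (rule antisym[OF hausdorff_outer_Un])
  have le: "hausdorff_premeasure k a A + hausdorff_premeasure k b B \<le> hausdorff_outer k (A \<union> B)"
    if "0 < a" "0 < b" for a b
  proof -
    define d where "d = min (min a b) (e/2)"
    have d: "0 < d" "d < e" "d \<le> a" "d \<le> b" using that \<open>0 < e\<close> by (auto simp: d_def)
    have "hausdorff_premeasure k a A + hausdorff_premeasure k b B \<le> hausdorff_premeasure k d A + hausdorff_premeasure k d B"
      by (intro add_mono hausdorff_premeasure_antimono d)
    also have "\<dots> \<le> hausdorff_premeasure k d (A \<union> B)"
      by (rule hausdorff_premeasure_separated[OF sep d(1,2)])
    also have "\<dots> \<le> hausdorff_outer k (A \<union> B)" by (rule hausdorff_premeasure_le_outer[OF d(1)])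
    finally show ?thesis .
  qed
  have "hausdorff_outer k A + hausdorff_outer k B = (SUP a\<in>{0<..}. hausdorff_premeasure k a A + hausdorff_outer k B)"
    unfolding hausdorff_outer_def[of k A] by (subst ennreal_SUP_add_left) auto
  also have "\<dots> = (SUP a\<in>{0<..}. SUP b\<in>{0<..}. hausdorff_premeasure k a A + hausdorff_premeasure k b B)"
    unfolding hausdorff_outer_def[of k B] by (subst ennreal_SUP_add_right) auto
  also have "\<dots> \<le> hausdorff_outer k (A \<union> B)"
    by (intro SUP_least) (use le in auto)
  finally show "hausdorff_outer k A + hausdorff_outer k B \<le> hausdorff_outer k (A \<union> B)" .
qed

text \<open>Caratheodory's criterion: the layers of \<open>X - C\<close> at distance about \<open>1 / j\<close> from \<open>C\<close> have
  summable measure, since every other one of them is separated.\<close>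

lemma closed_caratheodory_hausdorff:
  fixes C X :: "'a::metric_space set"
  assumes "closed C" "C \<noteq> {}"
  shows "hausdorff_outer k (X \<inter> C) + hausdorff_outer k (X - C) \<le> hausdorff_outer k X"
proof (cases "hausdorff_outer k X = \<infinity>")
  case False
  let ?\<mu> = "hausdorff_outer k"
  define Y where "Y n = {x \<in> X. 1 / Suc n \<le> infdist x C}" for n
  define R where "R n = {x \<in> X. 1 / Suc (Suc n) \<le> infdist x C \<and> infdist x C < 1 / Suc n}" for n
  have inf_le: "infdist x C \<le> infdist y C + dist x y" for x y by (rule infdist_triangle)
  have part: "?\<mu> (X \<inter> C) + ?\<mu> (Y n) \<le> ?\<mu> X" for n
  proof -
    have "?\<mu> (X \<inter> C \<union> Y n) = ?\<mu> (X \<inter> C) + ?\<mu> (Y n)"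
    proof (rule hausdorff_outer_separated)
      fix x y assume "x \<in> X \<inter> C" "y \<in> Y n"
      then show "1 / Suc n \<le> dist x y" using inf_le[of y x] by (auto simp: Y_def dist_commute)
    qed simp
    moreover have "?\<mu> (X \<inter> C \<union> Y n) \<le> ?\<mu> X" by (rule hausdorff_outer_mono) (auto simp: Y_def)
    ultimately show ?thesis by simp
  qed
  \<comment> \<open>\<open>p\<close> selects a parity. Points of an earlier layer of that parity
    have distance at least \<open>1 / (2 N + p)\<close> from \<open>C\<close>, points of layer
    \<open>2 N + p\<close> less than \<open>1 / (2 N + p + 1)\<close>, and the difference is a
    positive gap.\<close>
  have alt: "(\<Sum>i<N. ?\<mu> (R (2 * i + p))) = ?\<mu> (\<Union>i<N. R (2 * i + p))" for N p
  proof (induction N)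
    case (Suc N)
    have "?\<mu> ((\<Union>i<N. R (2 * i + p)) \<union> R (2 * N + p)) = ?\<mu> (\<Union>i<N. R (2 * i + p)) + ?\<mu> (R (2 * N + p))"
    \<comment> \<open>For \<open>N = 0\<close> the union is empty; with \<open>p = 0\<close> the gap
      below would contain a division by zero.\<close>
    proof (cases "N = 0")
      case False
      show ?thesis
      proof (rule hausdorff_outer_separated)
        fix x y assume x: "x \<in> (\<Union>i<N. R (2 * i + p))" and y: "y \<in> R (2 * N + p)"
        then obtain i where i: "i < N" "x \<in> R (2 * i + p)" by auto
        have "real (2 * i + p) + 2 \<le> real (2 * N + p)" using i(1) by auto
        then have "1 / real (2 * N + p) \<le> 1 / (real (2 * i + p) + 2)"
          by (intro divide_left_mono) auto
        also have "\<dots> \<le> infdist x C" using i(2) by (auto simp: R_def add.commute)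
        finally have "1 / real (2 * N + p) \<le> infdist x C" .
        moreover have "infdist y C < 1 / (real (2 * N + p) + 1)" using y by (auto simp: R_def add.commute)
        ultimately show "1 / real (2 * N + p) - 1 / (real (2 * N + p) + 1) \<le> dist x y"
          using inf_le[of x y] by linarith
      next
        show "0 < 1 / real (2 * N + p) - 1 / (real (2 * N + p) + 1)"
          using False by (simp add: divide_strict_left_mono)
      qed
    qed (simp add: hausdorff_outer_empty)
    moreover have "(\<Union>i<Suc N. R (2 * i + p)) = (\<Union>i<N. R (2 * i + p)) \<union> R (2 * N + p)"
      by (auto simp: less_Suc_eq)
    ultimately show ?case using Suc by simp
  qed (simp add: hausdorff_outer_empty)
  have half: "(\<Sum>i<N. ?\<mu> (R (2 * i + p))) \<le> ?\<mu> X" for N p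
    unfolding alt by (rule hausdorff_outer_mono) (auto simp: R_def)
  have sum2: "(\<Sum>j<2*N. ?\<mu> (R j)) = (\<Sum>i<N. ?\<mu> (R (2 * i + 0))) + (\<Sum>i<N. ?\<mu> (R (2 * i + 1)))" for N
    by (induction N) (auto simp: ac_simps)
  have "(\<Sum>j<N. ?\<mu> (R j)) \<le> ?\<mu> X + ?\<mu> X" for N
  proof -
    have "(\<Sum>j<N. ?\<mu> (R j)) \<le> (\<Sum>j<2*N. ?\<mu> (R j))" by (intro sum_mono2) auto
    also have "\<dots> \<le> ?\<mu> X + ?\<mu> X" unfolding sum2 by (intro add_mono half)
    finally show ?thesis .
  qed
  then have "(\<Sum>j. ?\<mu> (R j)) \<le> ?\<mu> X + ?\<mu> X"
    unfolding suminf_eq_SUP by (intro SUP_least)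
  then have fin: "(\<Sum>j. ?\<mu> (R j)) < \<infinity>" using False
    by (auto simp: less_top[symmetric] top_unique)
  show ?thesis
  proof (rule ennreal_le_epsilon)
    fix e :: real assume "0 < e"
    let ?S = "\<Sum>j. ?\<mu> (R j)"
    \<comment> \<open>Tails of a convergent series become small. In \<open>ennreal\<close> the
      partial sum may be cancelled only because \<open>fin\<close> makes it finite.\<close>
    have "\<exists>n. (\<Sum>j. ?\<mu> (R (j + n))) \<le> ennreal e"
    proof (cases "?S = 0")
      case True
      then have "?\<mu> (R j) = 0" for j by (subst (asm) suminf_eq_zero_iff) auto
      then show ?thesis by auto
    next
      case False
      have "?S - e < ?S" using fin False \<open>0 < e\<close> by (intro ennreal_between) (auto simp: zero_less_iff_neq_zero)
      then have "?S - e < (SUP n. \<Sum>j<n. ?\<mu> (R j))" by (simp only: suminf_eq_SUP)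
      then obtain n where n: "?S - e < (\<Sum>j<n. ?\<mu> (R j))" by (auto simp: less_SUP_iff)
      have S: "?S = (\<Sum>j. ?\<mu> (R (j + n))) + (\<Sum>j<n. ?\<mu> (R j))" by (rule suminf_offset) simp
      have pf: "(\<Sum>j<n. ?\<mu> (R j)) < top" using S fin by (auto simp: less_top[symmetric])
      have "?S \<le> e + (\<Sum>j<n. ?\<mu> (R j))"
        using n by (metis add.commute ennreal_minus_le_iff less_imp_le)
      then have "(\<Sum>j<n. ?\<mu> (R j)) + (\<Sum>j. ?\<mu> (R (j + n))) \<le> (\<Sum>j<n. ?\<mu> (R j)) + e"
        using S by (simp add: add.commute)
      moreover have "(\<Sum>j<n. ?\<mu> (R j)) \<noteq> \<infinity>" unfolding infinity_ennreal_def by (rule less_imp_neq[OF pf])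
      ultimately show ?thesis unfolding ennreal_add_left_cancel_le by blast
    qed
    then obtain n where n: "(\<Sum>j. ?\<mu> (R (j + n))) \<le> ennreal e" ..
    have "X - C \<subseteq> Y n \<union> (\<Union>j. R (j + n))"
    proof
      fix x assume x: "x \<in> X - C"
      then have "infdist x C \<noteq> 0" using in_closed_iff_infdist_zero[OF assms, of x] by blast
      then have pos: "0 < infdist x C" using infdist_nonneg[of x C] by linarith
      show "x \<in> Y n \<union> (\<Union>j. R (j + n))"
      proof (cases "1 / Suc n \<le> infdist x C")
        case False
        obtain k where k: "1 / Suc k \<le> infdist x C" using nat_approx_posE[OF pos] by (metis less_imp_le)
        define l where "l = (LEAST k. 1 / Suc k \<le> infdist x C)"
        have l: "1 / Suc l \<le> infdist x C" unfolding l_def by (rule LeastI[of _ k]) (rule k)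
        have "n < l"
        proof (rule ccontr)
          assume "\<not> n < l"
          then have "1 / real (Suc n) \<le> 1 / Suc l" by (intro divide_left_mono) auto
          then show False using False l by linarith
        qed
        then obtain q where q: "l = Suc q" "n \<le> q" by (metis less_Suc_eq_le lessE order.strict_implies_order)
        have "\<not> 1 / Suc q \<le> infdist x C" using not_less_Least[of q "\<lambda>k. 1 / Suc k \<le> infdist x C"] q(1) by (auto simp: l_def)
        then have "x \<in> R q" using l x q by (auto simp: R_def)
        then show ?thesis using q(2) by (auto intro!: exI[of _ "q - n"])
      qed (use x in \<open>auto simp: Y_def\<close>)
    qed
    then have "?\<mu> (X - C) \<le> ?\<mu> (Y n \<union> (\<Union>j. R (j + n)))" by (rule hausdorff_outer_mono)
    also have "\<dots> \<le> ?\<mu> (Y n) + ?\<mu> (\<Union>j. R (j + n))" by (rule hausdorff_outer_Un)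
    also have "\<dots> \<le> ?\<mu> (Y n) + e"
      by (intro add_left_mono order_trans[OF hausdorff_outer_UN n])
    finally have "?\<mu> (X \<inter> C) + ?\<mu> (X - C) \<le> ?\<mu> (X \<inter> C) + (?\<mu> (Y n) + e)" by (intro add_left_mono)
    also have "\<dots> = (?\<mu> (X \<inter> C) + ?\<mu> (Y n)) + e" by (simp add: ac_simps)
    also have "\<dots> \<le> ?\<mu> X + e" by (intro add_right_mono part)
    finally show "?\<mu> (X \<inter> C) + ?\<mu> (X - C) \<le> ?\<mu> X + e" .
  qed
qed simp

lemma sets_hausdorff_measure_eq:
  "sets (hausdorff_measure k :: 'a::metric_space measure) = lambda_system UNIV (Pow UNIV) (hausdorff_outer k)"
proof -
  interpret P: sigma_algebra "UNIV :: 'a set" "Pow UNIV" by (rule sigma_algebra_Pow)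
  have ms: "measure_space UNIV (lambda_system UNIV (Pow UNIV) (hausdorff_outer k) :: 'a set set) (hausdorff_outer k)"
    by (rule P.caratheodory_lemma[OF outer_measure_space_hausdorff_outer])
  then interpret L: sigma_algebra UNIV "lambda_system UNIV (Pow UNIV) (hausdorff_outer k) :: 'a set set" by (simp add: measure_space_def)
  show ?thesis
    unfolding hausdorff_measure_def sets_measure_of[OF L.space_closed] L.sigma_sets_eq ..
qed

lemma space_hausdorff_measure[simp]: "space (hausdorff_measure k) = UNIV"
  by (simp add: hausdorff_measure_def space_measure_of_conv)

lemma borel_sets_hausdorff_measure:
  assumes "A \<in> sets borel" shows "A \<in> sets (hausdorff_measure k :: 'a::metric_space measure)"
proof -
  have closed: "C \<in> sets (hausdorff_measure k)" if "closed C" for C :: "'a set"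
  proof (cases "C = {}")
    case False
    have "hausdorff_outer k (C \<inter> X) + hausdorff_outer k ((UNIV - C) \<inter> X) = hausdorff_outer k X" for X
    proof (rule antisym)
      have "C \<inter> X = X \<inter> C" "(UNIV - C) \<inter> X = X - C" by auto
      then show "hausdorff_outer k (C \<inter> X) + hausdorff_outer k ((UNIV - C) \<inter> X) \<le> hausdorff_outer k X"
        using closed_caratheodory_hausdorff[OF that False, of k X] by simp
      have "X = C \<inter> X \<union> (UNIV - C) \<inter> X" by auto
      then show "hausdorff_outer k X \<le> hausdorff_outer k (C \<inter> X) + hausdorff_outer k ((UNIV - C) \<inter> X)"
        by (metis hausdorff_outer_Un)
    qed
    then show ?thesis by (auto simp: sets_hausdorff_measure_eq lambda_system_def)
  qed simp
  have "sets (borel :: 'a measure) \<subseteq> sets (hausdorff_measure k)"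
  proof -
    have "{S :: 'a set. closed S} \<subseteq> sets (hausdorff_measure k)" using closed by auto
    then have "sigma_sets (space (hausdorff_measure k)) {S :: 'a set. closed S} \<subseteq> sets (hausdorff_measure k)"
      by (rule sets.sigma_sets_subset)
    then show ?thesis unfolding borel_eq_closed by (subst sets_measure_of) auto
  qed
  then show ?thesis using assms by blast
qed

lemma emeasure_hausdorff_borel:
  "A \<in> sets borel \<Longrightarrow> emeasure (hausdorff_measure k) A = hausdorff_outer k A"
  by (simp add: emeasure_hausdorff_measure borel_sets_hausdorff_measure)

lemma measurable_hausdorff_measure:
  "f \<in> borel_measurable borel \<Longrightarrow> f \<in> borel_measurable (hausdorff_measure k)"
  using borel_sets_hausdorff_measure[of _ k] by (auto simp: measurable_def)

section \<open>Lipschitz maps, isometries and finite covers\<close>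

lemma hausdorff_outer_lipschitz:
  fixes f :: "'a::metric_space \<Rightarrow> 'b::metric_space"
  assumes lip: "\<And>x y. x \<in> A \<Longrightarrow> y \<in> A \<Longrightarrow> dist (f x) (f y) \<le> L * dist x y" and "0 < L"
  shows "hausdorff_outer k (f ` A) \<le> ennreal (L ^ k) * hausdorff_outer k A"
  unfolding hausdorff_outer_def[of k "f ` A"]
proof (rule SUP_least)
  fix d :: real assume "d \<in> {0<..}"
  then have d: "0 < d" "0 < d / L" using \<open>0 < L\<close> by auto
  have "hausdorff_premeasure k d (f ` A) \<le> ennreal (L ^ k) * hausdorff_premeasure k (d / L) A"
  proof -
    have "hausdorff_premeasure k d (f ` A) \<le> ennreal (L ^ k) * (\<Sum>i. hausdorff_weight k (C i))"
      if C: "A \<subseteq> (\<Union>i. C i)" "\<And>i. bounded (C i) \<and> diameter (C i) \<le> d / L" for C :: "nat \<Rightarrow> 'a set"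
    proof -
      \<comment> \<open>Covering sets are cut down to \<open>C i \<inter> A\<close>, because the
        Lipschitz bound is available on \<open>A\<close> only.\<close>
      have diam: "dist (f x) (f y) \<le> L * diameter (C i)" if "x \<in> C i \<inter> A" "y \<in> C i \<inter> A" for x y i
      proof -
        have "dist x y \<le> diameter (C i)" using that C(2)[of i] by (intro diameter_bounded_bound) auto
        then show ?thesis using lip[of x y] that \<open>0 < L\<close> by (meson IntD2 mult_left_mono less_imp_le order_trans)
      qed
      have bd: "bounded (f ` (C i \<inter> A))" for i
      proof (cases "C i \<inter> A = {}")
        case False
        then obtain x where "x \<in> C i \<inter> A" by auto
        then show ?thesis using diam[of x i] unfolding bounded_def by (intro exI[of _ "f x"]) auto
      qed simp
      have di: "diameter (f ` (C i \<inter> A)) \<le> L * diameter (C i)" if "C i \<inter> A \<noteq> {}" for i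
        using that unfolding diameter_def[of "f ` _"] by (auto intro!: cSUP_least intro: diam)
      have "L * diameter (C i) \<le> d" for i using C(2)[of i] \<open>0 < L\<close> by (simp add: field_simps)
      then have di2: "diameter (f ` (C i \<inter> A)) \<le> d" for i
        using di[of i] d by (cases "C i \<inter> A = {}") (auto intro: order_trans)
      have cov: "f ` A \<subseteq> (\<Union>i. f ` (C i \<inter> A))" using C(1) by blast
      have "hausdorff_premeasure k d (f ` A) \<le> (\<Sum>i. hausdorff_weight k (f ` (C i \<inter> A)))"
        unfolding hausdorff_premeasure_def using cov bd di2 by (intro INF_lower) auto
      also have "\<dots> \<le> (\<Sum>i. ennreal (L ^ k) * hausdorff_weight k (C i))"
      proof (intro suminf_le)
        fix i
        show "hausdorff_weight k (f ` (C i \<inter> A)) \<le> ennreal (L ^ k) * hausdorff_weight k (C i)"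
        proof (cases "C i \<inter> A = {}")
          case False
          have "(diameter (f ` (C i \<inter> A)) / 2) ^ k \<le> (L * (diameter (C i) / 2)) ^ k"
            using di[OF False] bd[of i] by (intro power_mono) (auto intro: diameter_ge_0)
          then have "unit_ball_vol k * (diameter (f ` (C i \<inter> A)) / 2) ^ k \<le> L ^ k * (unit_ball_vol k * (diameter (C i) / 2) ^ k)"
            by (simp only: power_mult_distrib mult.left_commute[of "L ^ k"]) (intro mult_left_mono, auto)
          moreover have "0 \<le> diameter (C i)" using C(2) by (auto intro: diameter_ge_0)
          ultimately show ?thesis using False \<open>0 < L\<close>
            by (auto simp: hausdorff_weight_def ennreal_mult[symmetric] intro!: ennreal_leI)
        qed (simp add: hausdorff_weight_def)
      qed auto
      finally show ?thesis by simp
    qed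
    \<comment> \<open>Dividing by \<open>L ^ k\<close> first leaves a lower bound for every cover,
      so the infimum can be taken; afterwards the factor is multiplied back.\<close>
    then have "hausdorff_premeasure k d (f ` A) / ennreal (L ^ k) \<le> hausdorff_premeasure k (d / L) A"
      unfolding hausdorff_premeasure_def[of k "d/L" A] using \<open>0 < L\<close>
      by (intro INF_greatest divide_le_posI_ennreal) (auto simp: mult.commute)
    then have "ennreal (L ^ k) * (hausdorff_premeasure k d (f ` A) / ennreal (L ^ k)) \<le> ennreal (L ^ k) * hausdorff_premeasure k (d / L) A"
      by (rule mult_left_mono) auto
    moreover have "ennreal (L ^ k) * (hausdorff_premeasure k d (f ` A) / ennreal (L ^ k)) = hausdorff_premeasure k d (f ` A)"
      using \<open>0 < L\<close> by (subst ennreal_times_divide, subst mult.commute, subst mult_divide_eq_ennreal) auto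
    ultimately show ?thesis by simp
  qed
  also have "\<dots> \<le> ennreal (L ^ k) * hausdorff_outer k A"
    by (intro mult_left_mono hausdorff_premeasure_le_outer d) auto
  finally show "hausdorff_premeasure k d (f ` A) \<le> ennreal (L ^ k) * hausdorff_outer k A" .
qed

lemma hausdorff_outer_isometry:
  assumes "\<And>x y. x \<in> A \<Longrightarrow> y \<in> A \<Longrightarrow> dist (f x) (f y) = dist x y"
  shows "hausdorff_outer k (f ` A) = hausdorff_outer k A"
proof (rule antisym)
  show "hausdorff_outer k (f ` A) \<le> hausdorff_outer k A"
    using hausdorff_outer_lipschitz[of A f 1 k] assms by simp
  have inj: "inj_on f A" using assms by (intro inj_onI) (metis dist_eq_0_iff)
  have "hausdorff_outer k (the_inv_into A f ` (f ` A)) \<le> hausdorff_outer k (f ` A)"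
  proof -
    have "dist (the_inv_into A f x) (the_inv_into A f y) \<le> 1 * dist x y" if "x \<in> f ` A" "y \<in> f ` A" for x y
      using that assms by (auto simp: the_inv_into_f_f[OF inj])
    then show ?thesis using hausdorff_outer_lipschitz[of "f ` A" "the_inv_into A f" 1 k] by simp
  qed
  then show "hausdorff_outer k A \<le> hausdorff_outer k (f ` A)"
    by (simp add: image_image the_inv_into_f_f[OF inj] cong: image_cong)
qed

lemma hausdorff_premeasure_finite_cover:
  fixes C :: "'i \<Rightarrow> 'a::metric_space set"
  assumes "finite I" "A \<subseteq> (\<Union>i\<in>I. C i)" "\<And>i. i \<in> I \<Longrightarrow> bounded (C i) \<and> diameter (C i) \<le> d" "0 \<le> d"
  shows "hausdorff_premeasure k d A \<le> (\<Sum>i\<in>I. hausdorff_weight k (C i))"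
proof -
  obtain h where h: "bij_betw h {0..<card I} I" using ex_bij_betw_nat_finite[OF assms(1)] by auto
  let ?D = "\<lambda>n. if n < card I then C (h n) else {}"
  have "A \<subseteq> (\<Union>n. ?D n)"
  proof
    fix x assume "x \<in> A"
    then obtain i where "i \<in> I" "x \<in> C i" using assms(2) by auto
    then obtain n where "n < card I" "h n = i" using h by (metis atLeastLessThan_iff bij_betw_iff_bijections)
    then show "x \<in> (\<Union>n. ?D n)" using \<open>x \<in> C i\<close> by (auto intro!: exI[of _ n])
  qed
  moreover have "bounded (?D n) \<and> diameter (?D n) \<le> d" for n
    using assms(3)[of "h n"] h assms(4) by (auto dest!: bij_betwE)
  ultimately have "hausdorff_premeasure k d A \<le> (\<Sum>n. hausdorff_weight k (?D n))"
    unfolding hausdorff_premeasure_def by (intro INF_lower) auto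
  also have "\<dots> = (\<Sum>n\<in>{0..<card I}. hausdorff_weight k (?D n))"
    by (rule suminf_finite) (auto simp: hausdorff_weight_def)
  also have "\<dots> = (\<Sum>n\<in>{0..<card I}. hausdorff_weight k (C (h n)))" by simp
  also have "\<dots> = (\<Sum>i\<in>I. hausdorff_weight k (C i))" by (rule sum.reindex_bij_betw[OF h])
  finally show ?thesis .
qed

section \<open>Hausdorff measure on hyperplanes\<close>

definition hyperplane :: "real^'n \<Rightarrow> (real^'n) set" where
  "hyperplane \<nu> = {y. y \<bullet> \<nu> = 0}"

lemma closed_hyperplane: "closed (hyperplane \<nu>)"
  unfolding hyperplane_def by (intro closed_Collect_eq continuous_intros)

text \<open>The cube is cut into \<open>N ^ m\<close> subcubes of diameter at most
  \<open>2 n / N\<close>, where \<open>n\<close> is the ambient dimension and enters through the sum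
  norm. The resulting bound for the total weight is the same for every \<open>N\<close>, so it
  bounds the premeasure at every scale.\<close>

lemma hausdorff_outer_coordinate_cube_finite:
  assumes "CARD('n) = m + 1"
  shows "hausdorff_outer m {y::real^'n. y $ k = 0 \<and> (\<forall>i. \<bar>y $ i\<bar> \<le> 1)} < \<infinity>"
proof -
  let ?Q = "{y::real^'n. y $ k = 0 \<and> (\<forall>i. \<bar>y $ i\<bar> \<le> 1)}" and ?n = "real CARD('n)"
  let ?B = "unit_ball_vol (real m) * ?n ^ m"
  have "hausdorff_premeasure m d ?Q \<le> ennreal ?B" if "0 < d" for d
  proof -
    obtain N :: nat where N: "2 * ?n / d < real N" using reals_Archimedean2 by blast
    have "0 < 2 * ?n / d" using that by simp
    then have Npos: "0 < real N" using N by linarith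
    have Nd: "2 * ?n / N \<le> d" using N that Npos by (simp add: field_simps)
    define I where "I = (UNIV - {k}) \<rightarrow>\<^sub>E {..<N}"
    define C where "C g = {y::real^'n. y $ k = 0 \<and> (\<forall>i. i \<noteq> k \<longrightarrow> - 1 + 2 * real (g i) / N \<le> y $ i \<and> y $ i \<le> - 1 + 2 * (real (g i) + 1) / N)}"
      for g :: "'n \<Rightarrow> nat"
    have finI: "finite I" unfolding I_def by (intro finite_PiE) auto
    have cardI: "card I = N ^ m" unfolding I_def using assms by (simp add: card_PiE)
    have dist: "dist x y \<le> 2 * ?n / N" if "x \<in> C g" "y \<in> C g" for x y g
    proof -
      have "\<bar>(x - y) $ i\<bar> \<le> 2 / N" for i
      proof (cases "i = k")
        case False
        have e: "- 1 + 2 * (real (g i) + 1) / N = - 1 + 2 * real (g i) / N + 2 / N" by (simp add: add_divide_distrib)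
        have "- 1 + 2 * real (g i) / N \<le> x $ i" "x $ i \<le> - 1 + 2 * real (g i) / N + 2 / N"
          "- 1 + 2 * real (g i) / N \<le> y $ i" "y $ i \<le> - 1 + 2 * real (g i) / N + 2 / N"
          using that False e by (auto simp: C_def)
        then show ?thesis by (simp add: abs_le_iff)
      qed (use that in \<open>auto simp: C_def\<close>)
      then have "(\<Sum>i\<in>UNIV. \<bar>(x - y) $ i\<bar>) \<le> (\<Sum>i\<in>(UNIV::'n set). 2 / N)" by (intro sum_mono)
      then show ?thesis using norm_le_l1_cart[of "x - y"] by (simp add: dist_norm mult.commute)
    qed
    have bd: "bounded (C g)" for g
    proof (cases "C g = {}")
      case False
      then obtain x where "x \<in> C g" by auto
      then show ?thesis using dist unfolding bounded_def by blast
    qed simp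
    have diam: "diameter (C g) \<le> 2 * ?n / N" for g
      unfolding diameter_def using Npos by (auto intro!: cSUP_least dist)
    have "?Q \<subseteq> (\<Union>g\<in>I. C g)"
    proof
      fix y assume y: "y \<in> ?Q"
      \<comment> \<open>A coordinate equal to 1 would get the index \<open>N\<close> from the floor,
        one too many, and is put into the last cell. The value \<open>undefined\<close> at
        \<open>k\<close> makes \<open>g\<close> extensional, as membership in \<open>I\<close>
        demands.\<close>
      define g where "g i = (if i = k then undefined else if y $ i = 1 then N - 1 else nat \<lfloor>(y $ i + 1) * N / 2\<rfloor>)" for i
      have gi: "g i < N \<and> real (g i) \<le> (y $ i + 1) * N / 2 \<and> (y $ i + 1) * N / 2 \<le> real (g i) + 1" if "i \<noteq> k" for i
      proof (cases "y $ i = 1")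
        case True
        then show ?thesis using that Npos by (auto simp: g_def of_nat_diff)
      next
        case False
        have yi: "- 1 \<le> y $ i" "y $ i < 1" using y False by (auto simp: abs_le_iff order_less_le)
        then have "0 \<le> (y $ i + 1) * N / 2" by simp
        moreover have "(y $ i + 1) * N / 2 < N" using yi Npos by simp
        ultimately show ?thesis using that False by (auto simp: g_def nat_less_iff floor_less_iff; linarith)
      qed
      have "g \<in> I" using gi by (auto simp: I_def g_def PiE_def extensional_def)
      moreover have "y \<in> C g" using y gi Npos by (auto simp: C_def field_simps)
      ultimately show "y \<in> (\<Union>g\<in>I. C g)" by blast
    qed
    then have "hausdorff_premeasure m d ?Q \<le> (\<Sum>g\<in>I. hausdorff_weight m (C g))"
      using that Nd diam by (intro hausdorff_premeasure_finite_cover) (auto intro!: finI bd intro: order_trans)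
    also have "\<dots> \<le> (\<Sum>g\<in>I. ennreal (unit_ball_vol m * (?n / N) ^ m))"
    proof (rule sum_mono)
      fix g
      have "diameter (C g) / 2 \<le> ?n / N" using diam[of g] by (simp add: mult.commute)
      then have "(diameter (C g) / 2) ^ m \<le> (?n / N) ^ m" by (intro power_mono) (auto intro: diameter_ge_0 bd)
      then show "hausdorff_weight m (C g) \<le> ennreal (unit_ball_vol m * (?n / N) ^ m)"
        unfolding hausdorff_weight_def by (auto intro!: ennreal_leI mult_left_mono)
    qed
    also have "\<dots> = ennreal ?B"
      using Npos by (simp add: cardI power_divide ennreal_of_nat_eq_real_of_nat ennreal_mult[symmetric] del: ennreal_numeral)
    finally show ?thesis .
  qed
  then have "hausdorff_outer m ?Q \<le> ennreal ?B" unfolding hausdorff_outer_def by (auto intro: SUP_least)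
  then show ?thesis by (rule order_le_less_trans) auto
qed

lemma orthogonal_image_hyperplane:
  fixes f :: "real^'n \<Rightarrow> real^'n"
  assumes "orthogonal_transformation f" "f a = b"
  shows "f ` hyperplane a = hyperplane b"
proof -
  have "f y \<in> hyperplane b \<longleftrightarrow> y \<in> hyperplane a" for y
    using assms by (auto simp: hyperplane_def orthogonal_transformation_def)
  moreover have "surj f" using assms(1) by (rule orthogonal_transformation_surj)
  ultimately show ?thesis by (auto simp: image_iff) (metis surjD)
qed

lemma hausdorff_outer_orthogonal:
  fixes f :: "real^'n \<Rightarrow> real^'n"
  shows "orthogonal_transformation f \<Longrightarrow> hausdorff_outer k (f ` A) = hausdorff_outer k A"
  by (rule hausdorff_outer_isometry) (simp add: orthogonal_transformation_isometry)

lemma hausdorff_outer_translation: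
  "hausdorff_outer k ((+) a ` A) = hausdorff_outer k (A :: 'a::real_normed_vector set)"
  by (rule hausdorff_outer_isometry) simp

lemma hausdorff_outer_hyperplane_ball:
  assumes "CARD('n) = m + 1"
  obtains K where "K \<ge> 0"
    "\<And>\<nu> c::real^'n. \<And>r. norm \<nu> = 1 \<Longrightarrow> 0 < r \<Longrightarrow> hausdorff_outer m (hyperplane \<nu> \<inter> cball c r) \<le> ennreal (K * r ^ m)"
proof -
  fix k :: 'n
  let ?Q = "{y::real^'n. y $ k = 0 \<and> (\<forall>i. \<bar>y $ i\<bar> \<le> 1)}"
  define K where "K = enn2real (hausdorff_outer m ?Q)"
  have K: "hausdorff_outer m ?Q = ennreal K"
    using hausdorff_outer_coordinate_cube_finite[OF assms, of k] by (simp add: K_def)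
  show thesis
  proof (rule that)
    show "K \<ge> 0" by (simp add: K_def)
  next
    fix \<nu> c :: "real^'n" and r :: real assume \<nu>: "norm \<nu> = 1" and "0 < r"
    obtain f where f: "orthogonal_transformation f" "f (axis k (1::real)) = \<nu>"
      by (rule orthogonal_transformation_exists_1[OF norm_axis_1[of k] \<nu>])
    \<comment> \<open>Projecting the centre into the hyperplane does not increase its distance to
      points of the hyperplane, so for an arbitrary centre a rotated and scaled copy of the cube
      around \<open>p\<close> covers the disc.\<close>
    define p where "p = c - (c \<bullet> \<nu>) *\<^sub>R \<nu>"
    have nn: "\<nu> \<bullet> \<nu> = 1" using \<nu> by (simp add: norm_eq_sqrt_inner)
    let ?g = "\<lambda>y. p + r *\<^sub>R f y"
    have "hyperplane \<nu> \<inter> cball c r \<subseteq> ?g ` ?Q"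
    proof
      fix y assume y: "y \<in> hyperplane \<nu> \<inter> cball c r"
      have "(y - p) \<bullet> (y - p) + (c \<bullet> \<nu>)\<^sup>2 = (y - c) \<bullet> (y - c)"
        using y nn by (simp add: p_def hyperplane_def algebra_simps inner_commute power2_eq_square)
      then have "(norm (y - p))\<^sup>2 \<le> (norm (y - c))\<^sup>2" by (simp add: power2_norm_eq_inner)
        (metis le_add_same_cancel1 zero_le_power2)
      then have le: "norm (y - p) \<le> r" using y by (auto simp: dist_norm norm_minus_commute intro: order_trans power2_le_imp_le)
      have "(y - p) /\<^sub>R r \<in> hyperplane \<nu>" using y nn by (simp add: p_def hyperplane_def algebra_simps)
      then obtain z where z: "z \<in> hyperplane (axis k 1)" "f z = (y - p) /\<^sub>R r"
        using orthogonal_image_hyperplane[OF f] by (metis image_iff)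
      have "norm z = norm ((y - p) /\<^sub>R r)" using z(2) orthogonal_transformation_norm[OF f(1), of z] by simp
      also have "\<dots> = norm (y - p) / r" using \<open>0 < r\<close> unfolding norm_scaleR by (simp add: divide_inverse mult.commute)
      also have "\<dots> \<le> 1" using le \<open>0 < r\<close> by simp
      finally have "\<bar>z $ i\<bar> \<le> 1" for i using component_le_norm_cart[of z i] by linarith
      then have "z \<in> ?Q" using z(1) by (simp add: hyperplane_def inner_axis)
      moreover have "y = ?g z" using z(2) \<open>0 < r\<close> by simp
      ultimately show "y \<in> ?g ` ?Q" by blast
    qed
    then have "hausdorff_outer m (hyperplane \<nu> \<inter> cball c r) \<le> hausdorff_outer m (?g ` ?Q)"
      by (rule hausdorff_outer_mono)
    also have "\<dots> \<le> ennreal (r ^ m) * hausdorff_outer m ?Q"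
      using \<open>0 < r\<close> by (intro hausdorff_outer_lipschitz)
        (auto simp: dist_norm scaleR_diff_right[symmetric] orthogonal_transformation_norm[OF f(1)]
          orthogonal_transformation_linear[OF f(1), THEN linear_diff, symmetric])
    also have "\<dots> = ennreal (K * r ^ m)"
      unfolding K using \<open>0 < r\<close> by (simp add: ennreal_mult[symmetric] K_def mult.commute)
    finally show "hausdorff_outer m (hyperplane \<nu> \<inter> cball c r) \<le> ennreal (K * r ^ m)" .
  qed
qed

definition slab :: "real^'n \<Rightarrow> (real^'n) set \<Rightarrow> (real^'n) set" where
  "slab \<nu> B = {x. x - (x \<bullet> \<nu>) *\<^sub>R \<nu> \<in> B \<and> 0 \<le> x \<bullet> \<nu> \<and> x \<bullet> \<nu> \<le> 1}"

lemma slab_borel: "B \<in> sets borel \<Longrightarrow> slab \<nu> B \<in> sets borel"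
proof -
  assume [measurable]: "B \<in> sets borel"
  have [measurable]: "(\<lambda>x. x - (x \<bullet> \<nu>) *\<^sub>R \<nu>) \<in> borel_measurable borel" by measurable
  have "slab \<nu> B = {x \<in> space borel. x - (x \<bullet> \<nu>) *\<^sub>R \<nu> \<in> B \<and> 0 \<le> x \<bullet> \<nu> \<and> x \<bullet> \<nu> \<le> 1}"
    by (simp add: slab_def)
  also have "\<dots> \<in> sets borel" by measurable
  finally show ?thesis .
qed

text \<open>Thickening by the unit interval in the normal direction turns \<open>m\<close>-dimensional Hausdorff measure on
  a hyperplane into a translation invariant measure of the whole space.\<close>

lemma hausdorff_hyperplane_lborel:
  fixes \<nu> :: "real^'n"
  assumes "CARD('n) = m + 1" and \<nu>: "norm \<nu> = 1"
  obtains c where "c < \<infinity>"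
    "\<And>B. B \<in> sets borel \<Longrightarrow> B \<subseteq> hyperplane \<nu> \<Longrightarrow> hausdorff_outer m B = c * emeasure lborel (slab \<nu> B)"
proof -
  obtain K where K: "\<And>\<nu> c::real^'n. \<And>r. norm \<nu> = 1 \<Longrightarrow> 0 < r \<Longrightarrow> hausdorff_outer m (hyperplane \<nu> \<inter> cball c r) \<le> ennreal (K * r ^ m)"
    using hausdorff_outer_hyperplane_ball[OF assms(1)] by metis
  have nn: "\<nu> \<bullet> \<nu> = 1" using \<nu> by (simp add: norm_eq_sqrt_inner)
  let ?T = "hyperplane \<nu>"
  have [measurable]: "?T \<in> sets borel" by (simp add: closed_hyperplane)
  \<comment> \<open>The identity carries the measure from its Caratheodory algebra to the Borel
    algebra, where it can be combined with Lebesgue measure.\<close>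
  define H where "H = distr (hausdorff_measure m) borel (\<lambda>x::real^'n. x)"
  have idm: "(\<lambda>x::real^'n. x) \<in> hausdorff_measure m \<rightarrow>\<^sub>M borel" by (intro measurable_hausdorff_measure) simp
  have sH[simp, measurable_cong]: "sets H = sets borel" by (simp add: H_def)
  have spH[simp]: "space H = UNIV" by (simp add: H_def)
  have H: "emeasure H A = hausdorff_outer m A" if "A \<in> sets borel" for A
    using that by (simp add: H_def emeasure_distr[OF idm] emeasure_hausdorff_borel)
  define D where "D = density H (indicator ?T)"
  have sD[simp, measurable_cong]: "sets D = sets borel" by (simp add: D_def)
  have D: "emeasure D A = hausdorff_outer m (?T \<inter> A)" if "A \<in> sets borel" for A
  proof -
    have "emeasure D A = (\<integral>\<^sup>+x. indicator (?T \<inter> A) x \<partial>H)"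
      using that by (simp add: D_def emeasure_density indicator_inter_arith)
    then show ?thesis using that by (simp add: H)
  qed
  interpret D: sigma_finite_measure D
  proof
    have "emeasure D (cball 0 (real (Suc n))) \<noteq> \<infinity>" for n
      using K[OF \<nu>, of "real (Suc n)" 0] by (auto simp: D top_unique)
    moreover have "\<exists>n. norm x \<le> real (Suc n)" for x :: "real^'n"
    proof -
      obtain n :: nat where "norm x \<le> n" using real_arch_simple by blast
      then show ?thesis by (intro exI[of _ n]) auto
    qed
    ultimately show "\<exists>A. countable A \<and> A \<subseteq> sets D \<and> \<Union>A = space D \<and> (\<forall>a\<in>A. emeasure D a \<noteq> \<infinity>)"
      by (intro exI[of _ "range (\<lambda>n. cball 0 (real (Suc n)))"]) (auto simp: D_def)
  qed
  interpret DL: pair_sigma_finite D lborel ..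
  \<comment> \<open>Coordinates along and across the hyperplane: \<open>N\<close> is the image of
    the product of Hausdorff measure on the hyperplane with length in direction
    \<open>\<nu>\<close>. A translation splits accordingly, and each factor is invariant under its
    part.\<close>
  define \<Phi> where "\<Phi> = (\<lambda>(y, s::real). y + s *\<^sub>R \<nu>)"
  have [measurable]: "\<Phi> \<in> borel_measurable (D \<Otimes>\<^sub>M lborel)" unfolding \<Phi>_def by measurable
  define N where "N = distr (D \<Otimes>\<^sub>M lborel) borel \<Phi>"
  have N: "emeasure N A = (\<integral>\<^sup>+y. emeasure lborel {s. y + s *\<^sub>R \<nu> \<in> A} \<partial>D)" if [measurable]: "A \<in> sets borel" for A
  proof -
    have "emeasure N A = emeasure (D \<Otimes>\<^sub>M lborel) (\<Phi> -` A \<inter> space (D \<Otimes>\<^sub>M lborel))"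
      unfolding N_def by (rule emeasure_distr) measurable
    also have "\<dots> = (\<integral>\<^sup>+y. emeasure lborel (Pair y -` (\<Phi> -` A \<inter> space (D \<Otimes>\<^sub>M lborel))) \<partial>D)"
      by (rule lborel.emeasure_pair_measure_alt) measurable
    also have "\<dots> = (\<integral>\<^sup>+y. emeasure lborel {s. y + s *\<^sub>R \<nu> \<in> A} \<partial>D)"
      by (intro nn_integral_cong arg_cong2[where f=emeasure]) (auto simp: \<Phi>_def space_pair_measure D_def)
    finally show ?thesis .
  qed
  have Dtr: "distr D borel ((+) w) = D" if w: "w \<in> ?T" for w
  proof (rule measure_eqI)
    fix A assume "A \<in> sets (distr D borel ((+) w))"
    then have [measurable]: "A \<in> sets borel" by simp
    have m: "(+) w -` A \<in> sets borel" by (rule measurable_sets_borel[of "(+) w" borel]) auto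
    have "(+) w ` (?T \<inter> (+) w -` A) = ?T \<inter> A"
    proof (intro set_eqI iffI)
      fix x assume "x \<in> ?T \<inter> A"
      then have "x - w \<in> ?T \<inter> (+) w -` A" using w by (auto simp: hyperplane_def algebra_simps)
      then show "x \<in> (+) w ` (?T \<inter> (+) w -` A)" by (metis add.commute diff_add_cancel imageI)
    qed (use w in \<open>auto simp: hyperplane_def algebra_simps\<close>)
    then have "hausdorff_outer m (?T \<inter> (+) w -` A) = hausdorff_outer m (?T \<inter> A)"
      by (metis hausdorff_outer_translation)
    then show "emeasure (distr D borel ((+) w)) A = emeasure D A"
      using m by (simp add: emeasure_distr D D_def[THEN arg_cong, of space])
  qed simp
  have inv: "distr N borel ((+) v) = N" for v
  proof (rule measure_eqI)
    fix A assume "A \<in> sets (distr N borel ((+) v))"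
    then have [measurable]: "A \<in> sets borel" by simp
    define a w where "a = v \<bullet> \<nu>" and "w = v - a *\<^sub>R \<nu>"
    have w: "w \<in> ?T" by (simp add: w_def a_def hyperplane_def nn algebra_simps)
    have v: "v = w + a *\<^sub>R \<nu>" by (simp add: w_def)
    have m: "(+) v -` A \<in> sets borel" by (rule measurable_sets_borel[of "(+) v" borel]) auto
    have lb: "emeasure lborel {s. w + y + (a + s) *\<^sub>R \<nu> \<in> A} = emeasure lborel {s. w + y + s *\<^sub>R \<nu> \<in> A}" for y
    proof -
      have ms: "{s. w + y + s *\<^sub>R \<nu> \<in> A} \<in> sets borel"
      proof -
        have "(\<lambda>s. w + y + s *\<^sub>R \<nu>) \<in> borel_measurable borel" by measurable
        then show ?thesis using measurable_sets_borel[of "\<lambda>s. w + y + s *\<^sub>R \<nu>" borel A] by (simp add: vimage_def)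
      qed
      have "emeasure (distr lborel borel ((+) a)) {s. w + y + s *\<^sub>R \<nu> \<in> A} = emeasure lborel {s. w + y + (a + s) *\<^sub>R \<nu> \<in> A}"
        using ms by (subst emeasure_distr) (auto intro!: arg_cong2[where f=emeasure])
      then show ?thesis by (simp add: lborel_distr_plus)
    qed
    define G where "G y = emeasure lborel {s. y + s *\<^sub>R \<nu> \<in> A}" for y
    have Gm: "G \<in> borel_measurable borel"
    proof -
      have "(\<lambda>y. emeasure lborel (Pair y -` {z \<in> space (borel \<Otimes>\<^sub>M lborel). fst z + snd z *\<^sub>R \<nu> \<in> A})) \<in> borel_measurable borel"
        by (rule lborel.measurable_emeasure_Pair) measurable
      then show ?thesis by (simp add: G_def[abs_def] space_pair_measure vimage_def)
    qed
    have "emeasure (distr N borel ((+) v)) A = emeasure N ((+) v -` A)"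
      by (subst emeasure_distr) (auto simp: N_def)
    also have "\<dots> = (\<integral>\<^sup>+y. emeasure lborel {s. v + (y + s *\<^sub>R \<nu>) \<in> A} \<partial>D)" using N[OF m] by simp
    also have "\<dots> = (\<integral>\<^sup>+y. emeasure lborel {s. (w + y) + (a + s) *\<^sub>R \<nu> \<in> A} \<partial>D)"
      by (simp add: v algebra_simps)
    also have "\<dots> = (\<integral>\<^sup>+y. emeasure lborel {s. (w + y) + s *\<^sub>R \<nu> \<in> A} \<partial>D)" by (simp add: lb)
    also have "\<dots> = (\<integral>\<^sup>+y. G (w + y) \<partial>D)" by (simp add: G_def)
    also have "\<dots> = (\<integral>\<^sup>+y. G y \<partial>distr D borel ((+) w))"
      using Gm by (subst nn_integral_distr) auto
    also have "\<dots> = emeasure N A" by (simp add: Dtr[OF w] N G_def)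
    finally show "emeasure (distr N borel ((+) v)) A = emeasure N A" .
  qed (simp add: N_def)
  have slab: "emeasure N (slab \<nu> B) = hausdorff_outer m B" if B[measurable]: "B \<in> sets borel" and BT: "B \<subseteq> ?T" for B
  proof -
    have "emeasure N (slab \<nu> B) = (\<integral>\<^sup>+y. emeasure lborel {s. y + s *\<^sub>R \<nu> \<in> slab \<nu> B} \<partial>D)"
      by (rule N[OF slab_borel]) simp
    also have "\<dots> = (\<integral>\<^sup>+y. indicator B y \<partial>D)"
    proof (rule nn_integral_cong_AE)
      have "AE y in D. y \<in> ?T" unfolding D_def by (subst AE_density) (auto simp: indicator_def)
      then show "AE y in D. emeasure lborel {s. y + s *\<^sub>R \<nu> \<in> slab \<nu> B} = indicator B y"
      proof eventually_elim
        case (elim y)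
        then have "(y + s *\<^sub>R \<nu>) \<bullet> \<nu> = s" for s by (simp add: hyperplane_def nn inner_add_left)
        then have "{s. y + s *\<^sub>R \<nu> \<in> slab \<nu> B} = (if y \<in> B then {0..1} else {})"
          unfolding slab_def by auto
        then show ?case by simp
      qed
    qed
    also have "\<dots> = emeasure D B" by (simp add: nn_integral_indicator)
    also have "\<dots> = hausdorff_outer m B" using BT by (simp add: D Int_absorb1)
    finally show ?thesis .
  qed
  have sf: "sigma_finite_measure N"
  proof
    let ?A = "\<lambda>k::nat. {x. x - (x \<bullet> \<nu>) *\<^sub>R \<nu> \<in> cball 0 (real (Suc k)) \<and> \<bar>x \<bullet> \<nu>\<bar> \<le> real k}"
    have meas: "?A k \<in> sets borel" for k
      by (intro borel_closed closed_Collect_conj closed_Collect_le continuous_intros) (auto intro!: closed_Collect_le continuous_intros)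
    have fin: "emeasure N (?A k) \<noteq> \<infinity>" for k
    proof -
      have "emeasure N (?A k) = (\<integral>\<^sup>+y. emeasure lborel {s. y + s *\<^sub>R \<nu> \<in> ?A k} \<partial>D)" by (rule N[OF meas])
      also have "\<dots> \<le> (\<integral>\<^sup>+y. ennreal (2 * k) * indicator (cball 0 (real (Suc k))) y \<partial>D)"
      proof (rule nn_integral_mono_AE)
        have "AE y in D. y \<in> ?T" unfolding D_def by (subst AE_density) (auto simp: indicator_def)
        then show "AE y in D. emeasure lborel {s. y + s *\<^sub>R \<nu> \<in> ?A k} \<le> ennreal (2 * k) * indicator (cball 0 (real (Suc k))) y"
        proof eventually_elim
          case (elim y)
          then have "(y + s *\<^sub>R \<nu>) \<bullet> \<nu> = s" for s by (simp add: hyperplane_def nn inner_add_left)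
          then have "{s. y + s *\<^sub>R \<nu> \<in> ?A k} = (if y \<in> cball 0 (real (Suc k)) then {-real k..real k} else {})"
            by auto
          then show ?case by simp
        qed
      qed
      also have "\<dots> = ennreal (2 * k) * emeasure D (cball 0 (real (Suc k)))"
        by (subst nn_integral_cmult_indicator) auto
      also have "\<dots> < \<infinity>"
        using order_le_less_trans[OF K[OF \<nu>, of "real (Suc k)" 0] ennreal_less_top]
        by (simp add: D ennreal_mult_less_top)
      finally show ?thesis by simp
    qed
    have cov: "(\<Union>k. ?A k) = UNIV"
    proof -
      have "\<exists>k::nat. norm (x - (x \<bullet> \<nu>) *\<^sub>R \<nu>) \<le> Suc k \<and> \<bar>x \<bullet> \<nu>\<bar> \<le> k" for x
      proof -
        obtain k :: nat where "max (norm (x - (x \<bullet> \<nu>) *\<^sub>R \<nu>)) \<bar>x \<bullet> \<nu>\<bar> \<le> k" using real_arch_simple by blast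
        then show ?thesis by (intro exI[of _ k]) auto
      qed
      then show ?thesis by auto
    qed
    show "\<exists>A. countable A \<and> A \<subseteq> sets N \<and> \<Union>A = space N \<and> (\<forall>a\<in>A. emeasure N a \<noteq> \<infinity>)"
      using meas fin cov by (intro exI[of _ "range ?A"]) (auto simp: N_def)
  qed
  define c where "c = emeasure N (cbox 0 1)"
  have main: "hausdorff_outer m B = c * emeasure lborel (slab \<nu> B)" if "B \<in> sets borel" "B \<subseteq> ?T" for B
  proof -
    have "emeasure N (slab \<nu> B) * emeasure lborel (cbox 0 1 :: (real^'n) set) = c * emeasure lborel (slab \<nu> B)"
      unfolding c_def
      by (rule translation_invariant_proportional_lborel[OF sf _ inv]) (auto simp: N_def slab_borel that)
    then show ?thesis by (simp add: slab[OF that] emeasure_lborel_cbox_cart)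
  qed
  \<comment> \<open>The slab over the unit disc contains a ball and so has positive volume; an
    infinite factor would contradict the finite measure of the disc.\<close>
  have "c < \<infinity>"
  proof (rule ccontr)
    assume "\<not> c < \<infinity>"
    then have c: "c = \<infinity>" by (simp add: less_top[symmetric])
    let ?B = "?T \<inter> cball 0 1"
    have "ball ((1/2) *\<^sub>R \<nu>) (1/2) \<subseteq> slab \<nu> ?B"
    proof
      fix x assume "x \<in> ball ((1/2) *\<^sub>R \<nu>) (1/2)"
      then have x: "norm (x - (1/2) *\<^sub>R \<nu>) < 1/2" by (simp add: dist_norm norm_minus_commute)
      let ?z = "x - (1/2) *\<^sub>R \<nu>"
      have "\<bar>?z \<bullet> \<nu>\<bar> < 1/2" using Cauchy_Schwarz_ineq2[of ?z \<nu>] x \<nu> by simp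
      then have z: "\<bar>x \<bullet> \<nu> - 1/2\<bar> < 1/2" by (simp add: inner_diff_left nn)
      have e: "x - (x \<bullet> \<nu>) *\<^sub>R \<nu> = ?z - (?z \<bullet> \<nu>) *\<^sub>R \<nu>" by (simp add: inner_diff_left nn algebra_simps)
      have "norm (?z - (?z \<bullet> \<nu>) *\<^sub>R \<nu>) \<le> norm ?z + norm ((?z \<bullet> \<nu>) *\<^sub>R \<nu>)" by (rule norm_triangle_ineq4)
      then have "norm (x - (x \<bullet> \<nu>) *\<^sub>R \<nu>) \<le> norm ?z + \<bar>?z \<bullet> \<nu>\<bar>"
        unfolding e norm_scaleR \<nu> by simp
      then have "norm (x - (x \<bullet> \<nu>) *\<^sub>R \<nu>) \<le> 1" using x \<open>\<bar>?z \<bullet> \<nu>\<bar> < 1/2\<close> by linarith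
      moreover have "x - (x \<bullet> \<nu>) *\<^sub>R \<nu> \<in> ?T" by (simp add: hyperplane_def inner_diff_left nn)
      moreover have "0 \<le> x \<bullet> \<nu>" "x \<bullet> \<nu> \<le> 1" using z by linarith+
      ultimately show "x \<in> slab \<nu> ?B" by (simp add: slab_def)
    qed
    then have "emeasure lborel (ball ((1/2) *\<^sub>R \<nu>) (1/2)) \<le> emeasure lborel (slab \<nu> ?B)"
      by (rule emeasure_mono) (auto intro!: slab_borel)
    moreover have "emeasure lborel (ball ((1/2) *\<^sub>R \<nu>) (1/2)) > 0"
      by (simp add: emeasure_ball unit_ball_vol_pos)
    ultimately have "emeasure lborel (slab \<nu> ?B) \<noteq> 0" by auto
    then have "hausdorff_outer m ?B = \<infinity>"
      using main[of ?B] c by (auto simp: ennreal_top_mult)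
    then show False using K[OF \<nu>, of 1 0] by (simp add: top_unique)
  qed
  then show thesis using main that by blast
qed

section \<open>Determinants, and cofactors as area factors on hyperplanes\<close>

lemma inner_self_unit: "norm \<nu> = 1 \<Longrightarrow> \<nu> \<bullet> \<nu> = 1"
  by (simp add: norm_eq_sqrt_inner)

lemma det_matrix_comp:
  fixes f g :: "real^'n \<Rightarrow> real^'n"
  assumes "linear f" "linear g"
  shows "det (matrix (f \<circ> g)) = det (matrix f) * det (matrix g)"
  using matrix_compose[OF assms(2,1)] by (simp add: det_mul)

lemma abs_det_orthogonal_transformation:
  fixes f :: "real^'n \<Rightarrow> real^'n"
  assumes "orthogonal_transformation f"
  shows "\<bar>det (matrix f)\<bar> = 1"
proof -
  have "orthogonal_matrix (matrix f)" using assms orthogonal_transformation_matrix[of f] by simp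
  then show ?thesis using det_orthogonal_matrix[of "matrix f"] by auto
qed

text \<open>Matrix determinant lemma. After conjugation by a rotation that takes a basis vector to
  \<open>\<nu>\<close>, the map is the identity with one column replaced, and Cramer's lemma for
  \<open>mat 1\<close> reads off its determinant.\<close>

lemma det_rank_one_update:
  fixes u \<nu> :: "real^'n"
  assumes \<nu>: "norm \<nu> = 1"
  shows "det (matrix (\<lambda>w. w + (w \<bullet> \<nu>) *\<^sub>R u)) = 1 + u \<bullet> \<nu>"
proof -
  fix k :: 'n
  obtain Q where Q: "orthogonal_transformation Q" "Q (axis k (1::real)) = \<nu>"
    by (rule orthogonal_transformation_exists_1[OF norm_axis_1[of k] \<nu>])
  have lQ: "linear Q" using Q(1) by (rule orthogonal_transformation_linear)
  obtain u' where u': "Q u' = u" using orthogonal_transformation_surj[OF Q(1)] by (metis surjD)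
  let ?S = "\<lambda>w. w + (w \<bullet> \<nu>) *\<^sub>R u" and ?S' = "\<lambda>w. w + (w $ k) *\<^sub>R u'"
  have lS: "linear ?S" by (rule linearI) (simp_all add: algebra_simps inner_add_left)
  have lS': "linear ?S'" by (rule linearI) (simp_all add: algebra_simps)
  have ip: "Q x \<bullet> \<nu> = x $ k" for x
    using Q by (metis orthogonal_transformation_def inner_axis real_inner_1_right mult.right_neutral inner_real_def)
  have "?S \<circ> Q = Q \<circ> ?S'"
    by (auto simp: fun_eq_iff ip linear_add[OF lQ] linear_scale[OF lQ] u')
  then have "det (matrix ?S) * det (matrix Q) = det (matrix Q) * det (matrix ?S')"
    using det_matrix_comp[OF lS lQ] det_matrix_comp[OF lQ lS'] by metis
  moreover have "det (matrix Q) \<noteq> 0" using abs_det_orthogonal_transformation[OF Q(1)] by auto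
  ultimately have e: "det (matrix ?S) = det (matrix ?S')" by simp
  let ?x = "axis k 1 + u'"
  have "matrix ?S' = (\<chi> i j. if j = k then (mat 1 *v ?x) $ i else mat 1 $ i $ j)"
    unfolding matrix_vector_mul_lid by (auto simp: matrix_def vec_eq_iff mat_def axis_def)
  then have "det (matrix ?S') = ?x $ k" using cramer_lemma[of k "mat 1" ?x] by simp
  also have "\<dots> = 1 + u \<bullet> \<nu>" using ip[of u'] by (simp add: u')
  finally show ?thesis using e by simp
qed

text \<open>The vector \<open>n\<close> is the cofactor matrix of \<open>L\<close> applied to \<open>\<nu>\<close>.\<close>

lemma hausdorff_outer_linear_image_hyperplane:
  fixes L :: "real^'n \<Rightarrow> real^'n" and \<nu> n :: "real^'n"
  assumes card: "CARD('n) = m + 1" and L: "linear L" "inj L" and \<nu>: "norm \<nu> = 1"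
    and n: "\<And>w. n \<bullet> L w = det (matrix L) * (\<nu> \<bullet> w)"
    and B: "B \<in> sets borel" "B \<subseteq> hyperplane \<nu>"
  shows "hausdorff_outer m (L ` B) = ennreal (norm n) * hausdorff_outer m B"
proof -
  have nn: "\<nu> \<bullet> \<nu> = 1" using \<nu> by (rule inner_self_unit)
  have dL: "det (matrix L) \<noteq> 0" using det_nz_iff_inj[OF L(1)] L(2) by simp
  have "n \<noteq> 0" using n[of \<nu>] nn dL by auto
  define \<nu>' where "\<nu>' = n /\<^sub>R norm n"
  have \<nu>': "norm \<nu>' = 1" using \<open>n \<noteq> 0\<close> by (simp add: \<nu>'_def)
  have n\<nu>': "n = norm n *\<^sub>R \<nu>'" using \<open>n \<noteq> 0\<close> by (simp add: \<nu>'_def)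
  obtain R where R: "orthogonal_transformation R" "R \<nu>' = \<nu>"
    by (rule orthogonal_transformation_exists_1[OF \<nu>' \<nu>])
  have lR: "linear R" using R(1) by (rule orthogonal_transformation_linear)
  obtain w\<^sub>0 where w0: "L w\<^sub>0 = \<nu>'" using linear_injective_imp_surjective[OF L] by (metis surjD)
  \<comment> \<open>\<open>S\<close> fixes the hyperplane pointwise and sends \<open>\<nu>\<close>
    to the \<open>L\<close>-preimage of \<open>\<nu>'\<close>. So \<open>L \<circ> S\<close> agrees
    with \<open>L\<close> on \<open>B\<close> but sends \<open>\<nu>\<close> to the unit normal of
    the image plane, and the rotation \<open>R\<close> brings that plane back. The composition
    \<open>K\<close> preserves the hyperplane and the height over it, hence maps slabs to slabs, and
    its determinant has absolute value \<open>norm n\<close>.\<close>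
  define S where "S w = w + (w \<bullet> \<nu>) *\<^sub>R (w\<^sub>0 - \<nu>)" for w
  have lS: "linear S" unfolding S_def by (rule linearI) (simp_all add: algebra_simps inner_add_left)
  have "n \<bullet> \<nu>' = norm n" using n\<nu>' inner_self_unit[OF \<nu>'] by (metis inner_scaleR_left mult.right_neutral)
  then have "det (matrix L) * (\<nu> \<bullet> w\<^sub>0) = norm n" using n[of w\<^sub>0] w0 by simp
  moreover have "det (matrix S) = \<nu> \<bullet> w\<^sub>0"
    using det_rank_one_update[OF \<nu>, of "w\<^sub>0 - \<nu>"] by (simp add: S_def[abs_def] inner_diff_left inner_diff_right nn inner_commute)
  ultimately have dLS: "det (matrix (L \<circ> S)) = norm n" using det_matrix_comp[OF L(1) lS] by simp
  define K where "K = R \<circ> (L \<circ> S)"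
  have lK: "linear K" unfolding K_def by (intro linear_compose lS L lR)
  have dK: "\<bar>det (matrix K)\<bar> = norm n"
    unfolding K_def using det_matrix_comp[OF lR linear_compose[OF lS L(1)]] dLS abs_det_orthogonal_transformation[OF R(1)]
    by (simp add: abs_mult)
  then have iK: "inj K" using det_nz_iff_inj[OF lK] \<open>n \<noteq> 0\<close> by auto
  have Kip: "K x \<bullet> \<nu> = x \<bullet> \<nu>" for x
  proof -
    have "K x \<bullet> \<nu> = L (S x) \<bullet> \<nu>'" unfolding K_def using R by (metis comp_apply orthogonal_transformation_def)
    also have "\<dots> = (n \<bullet> L (S x)) / norm n" unfolding \<nu>'_def by (simp add: inner_commute divide_inverse)
    also have "n \<bullet> L (S x) = det (matrix L) * (\<nu> \<bullet> S x)" by (rule n)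
    also have "\<nu> \<bullet> S x = (x \<bullet> \<nu>) * (\<nu> \<bullet> w\<^sub>0)"
      by (simp add: S_def inner_add_right inner_diff_right nn inner_commute algebra_simps)
    also have "det (matrix L) * ((x \<bullet> \<nu>) * (\<nu> \<bullet> w\<^sub>0)) / norm n = x \<bullet> \<nu>"
      unfolding mult.left_commute[of "det (matrix L)"] \<open>det (matrix L) * (\<nu> \<bullet> w\<^sub>0) = norm n\<close>
      using \<open>n \<noteq> 0\<close> by simp
    finally show ?thesis .
  qed
  have K\<nu>: "K \<nu> = \<nu>" by (simp add: K_def S_def nn w0 R(2))
  have KB: "K ` B = R ` L ` B"
    using B(2) by (auto simp: K_def S_def hyperplane_def image_image intro!: image_cong)
  have slabK: "K ` slab \<nu> B = slab \<nu> (K ` B)"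
  proof (intro set_eqI iffI)
    fix y assume "y \<in> slab \<nu> (K ` B)"
    then obtain b where b: "b \<in> B" "y - (y \<bullet> \<nu>) *\<^sub>R \<nu> = K b" "0 \<le> y \<bullet> \<nu>" "y \<bullet> \<nu> \<le> 1" by (auto simp: slab_def)
    define x where "x = b + (y \<bullet> \<nu>) *\<^sub>R \<nu>"
    have "b \<bullet> \<nu> = 0" using b(1) B(2) by (auto simp: hyperplane_def)
    then have xn: "x \<bullet> \<nu> = y \<bullet> \<nu>" by (simp add: x_def inner_add_left nn)
    then have "x \<in> slab \<nu> B" using b by (simp add: slab_def x_def)
    moreover have "K x = y" by (simp add: x_def linear_add[OF lK] linear_scale[OF lK] K\<nu> b(2)[symmetric])
    ultimately show "y \<in> K ` slab \<nu> B" by auto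
  next
    fix y assume "y \<in> K ` slab \<nu> B"
    then obtain x where x: "x \<in> slab \<nu> B" "y = K x" by auto
    have "y - (y \<bullet> \<nu>) *\<^sub>R \<nu> = K (x - (x \<bullet> \<nu>) *\<^sub>R \<nu>)"
      by (simp add: x(2) Kip linear_diff[OF lK] linear_scale[OF lK] K\<nu>)
    then show "y \<in> slab \<nu> (K ` B)" using x by (auto simp: slab_def Kip)
  qed
  obtain c where c: "\<And>B. B \<in> sets borel \<Longrightarrow> B \<subseteq> hyperplane \<nu> \<Longrightarrow> hausdorff_outer m B = c * emeasure lborel (slab \<nu> B)"
    using hausdorff_hyperplane_lborel[OF card \<nu>] by metis
  have "hausdorff_outer m (L ` B) = hausdorff_outer m (K ` B)"
    unfolding KB by (rule hausdorff_outer_orthogonal[OF R(1), symmetric])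
  also have "\<dots> = c * emeasure lborel (slab \<nu> (K ` B))"
    using B Kip by (intro c borel_linear_image lK iK) (auto simp: hyperplane_def)
  also have "\<dots> = c * (ennreal (norm n) * emeasure lborel (slab \<nu> B))"
    unfolding slabK[symmetric] by (subst emeasure_lborel_linear_image[OF lK iK slab_borel[OF B(1)]]) (simp add: dK)
  also have "\<dots> = ennreal (norm n) * (c * emeasure lborel (slab \<nu> B))" by (simp add: ac_simps)
  also have "\<dots> = ennreal (norm n) * hausdorff_outer m B" by (simp add: c[OF B])
  finally show ?thesis .
qed

text \<open>The components are determinants of the map that agrees with \<open>L\<close> on the
  hyperplane and sends \<open>\<nu>\<close> to a basis vector. In this form continuity in
  \<open>L\<close> and \<open>\<nu>\<close> is immediate and no inverse of \<open>L\<close> appears;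
  its length is the factor by which \<open>L\<close> scales area on the hyperplane.\<close>

definition cofactor :: "(real^'n \<Rightarrow> real^'n) \<Rightarrow> real^'n \<Rightarrow> real^'n" where
  "cofactor L \<nu> = (\<chi> j. det (matrix (\<lambda>w. L (w - (w \<bullet> \<nu>) *\<^sub>R \<nu>) + (w \<bullet> \<nu>) *\<^sub>R axis j 1)))"

text \<open>The map behind component \<open>j\<close> is \<open>L\<close> after the rank one update
  that sends \<open>\<nu>\<close> to the preimage of \<open>axis j 1\<close>. Hence the component is
  \<open>det L\<close> times the inner product of that preimage with \<open>\<nu>\<close>, and
  linearity of the inverse gives the rest.\<close>

lemma cofactor_inner:
  fixes L :: "real^'n \<Rightarrow> real^'n"
  assumes L: "linear L" "inj L" and \<nu>: "norm \<nu> = 1"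
  shows "cofactor L \<nu> \<bullet> L w = det (matrix L) * (\<nu> \<bullet> w)"
proof -
  obtain g where g: "linear g" "g \<circ> L = id" using linear_injective_left_inverse[OF L] by blast
  have Lg: "L (g z) = z" "g (L z) = z" for z
    using linear_inverse_left[OF L(1) g(1)] g(2) by (metis comp_apply id_apply)+
  have c: "cofactor L \<nu> $ j = det (matrix L) * (g (axis j 1) \<bullet> \<nu>)" for j
  proof -
    let ?S = "\<lambda>w. w + (w \<bullet> \<nu>) *\<^sub>R (g (axis j 1) - \<nu>)"
    have lS: "linear ?S" by (rule linearI) (simp_all add: algebra_simps inner_add_left)
    have "(\<lambda>w. L (w - (w \<bullet> \<nu>) *\<^sub>R \<nu>) + (w \<bullet> \<nu>) *\<^sub>R axis j 1) = L \<circ> ?S"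
      using Lg by (auto simp: fun_eq_iff linear_add[OF L(1)] linear_diff[OF L(1)] linear_scale[OF L(1)] algebra_simps)
    then have "cofactor L \<nu> $ j = det (matrix L) * det (matrix ?S)"
      unfolding cofactor_def using det_matrix_comp[OF L(1) lS] by simp
    then show ?thesis
      using det_rank_one_update[OF \<nu>, of "g (axis j 1) - \<nu>"] by (simp add: inner_diff_left inner_self_unit[OF \<nu>])
  qed
  have "cofactor L \<nu> \<bullet> z = det (matrix L) * (g z \<bullet> \<nu>)" for z
  proof -
    have z: "z = (\<Sum>j\<in>UNIV. z $ j *\<^sub>R axis j 1)" using basis_expansion[of z] by (simp add: scalar_mult_eq_scaleR)
    have "g z = (\<Sum>j\<in>UNIV. z $ j *\<^sub>R g (axis j 1))"
      by (subst z) (simp add: linear_sum[OF g(1)] linear_scale[OF g(1)])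
    then have "det (matrix L) * (g z \<bullet> \<nu>) = (\<Sum>j\<in>UNIV. cofactor L \<nu> $ j * z $ j)"
      by (simp add: inner_sum_left sum_distrib_left c ac_simps)
    then show ?thesis by (simp add: inner_vec_def)
  qed
  then show ?thesis by (simp add: Lg inner_commute)
qed

text \<open>Differentiate the Leibniz formula. A permutation other than the identity moves at least
  two points, so after one factor is differentiated an off-diagonal entry of the identity matrix,
  that is a zero, is still left in the product.\<close>

lemma has_derivative_det_identity:
  "((det :: real^'n^'n \<Rightarrow> real) has_derivative trace) (at (mat 1))"
proof -
  let ?P = "{p. p permutes (UNIV :: 'n set)}"
  have comp: "((\<lambda>A :: real^'n^'n. A $ i $ j) has_derivative (\<lambda>B. B $ i $ j)) (at (mat 1))" for i j
    by (rule bounded_linear_imp_has_derivative) (intro bounded_linear_compose[OF bounded_linear_vec_nth] bounded_linear_vec_nth)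
  have "((\<lambda>A :: real^'n^'n. \<Sum>p\<in>?P. of_int (sign p) * (\<Prod>i\<in>UNIV. A $ i $ p i)) has_derivative
      (\<lambda>B. \<Sum>p\<in>?P. of_int (sign p) * (\<Sum>i\<in>UNIV. B $ i $ p i * (\<Prod>j\<in>UNIV - {i}. mat 1 $ j $ p j)))) (at (mat 1))"
    by (intro has_derivative_sum has_derivative_mult_right has_derivative_prod comp)
  moreover have "(\<Sum>p\<in>?P. of_int (sign p) * (\<Sum>i\<in>UNIV. B $ i $ p i * (\<Prod>j\<in>UNIV - {i}. mat 1 $ j $ p j))) = trace B"
    for B :: "real^'n^'n"
  proof -
    have z: "of_int (sign p) * (\<Sum>i\<in>UNIV. B $ i $ p i * (\<Prod>j\<in>UNIV - {i}. mat 1 $ j $ p j)) = (0::real)"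
      if "p \<in> ?P - {id}" for p
    proof -
      have p: "p permutes UNIV" "p \<noteq> id" using that by auto
      have "(\<Prod>j\<in>UNIV - {i}. mat 1 $ j $ p j) = (0::real)" for i
      proof -
        have "\<exists>j. j \<noteq> i \<and> p j \<noteq> j"
        proof (rule ccontr)
          assume no: "\<not> ?thesis"
          then have "p i = i" using permutes_inj[OF p(1)] by (metis injD)
          then show False using no p(2) by (auto simp: fun_eq_iff)
        qed
        then obtain j where "j \<noteq> i" "p j \<noteq> j" by auto
        then have "mat 1 $ j $ p j = (0::real)" by (simp add: mat_def)
        then show ?thesis using \<open>j \<noteq> i\<close> by (intro prod_zero) auto
      qed
      then show ?thesis by (simp only: mult_zero_right sum.neutral_const)
    qed
    have "(\<Sum>p\<in>?P. of_int (sign p) * (\<Sum>i\<in>UNIV. B $ i $ p i * (\<Prod>j\<in>UNIV - {i}. mat 1 $ j $ p j)))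
        = of_int (sign (id :: 'n \<Rightarrow> 'n)) * (\<Sum>i\<in>UNIV. B $ i $ id i * (\<Prod>j\<in>UNIV - {i}. mat 1 $ j $ id j))"
      by (subst sum.remove[of ?P id]) (auto simp: z permutes_id finite_permutations simp del: sign_id intro!: sum.neutral)
    also have "\<dots> = trace B" by (simp add: trace_def mat_def sign_id)
    finally show ?thesis .
  qed
  ultimately show ?thesis by (simp add: det_def[abs_def])
qed

lemma det_near_identity:
  assumes "0 < e"
  obtains d where "0 < d" "\<And>B :: real^'n^'n. norm B < d \<Longrightarrow> \<bar>det (mat 1 + B) - 1 - trace B\<bar> \<le> e * norm B"
proof -
  obtain d where d: "0 < d" "\<And>y :: real^'n^'n. norm (y - mat 1) < d \<Longrightarrow> norm (det y - det (mat 1 :: real^'n^'n) - trace (y - mat 1)) \<le> e * norm (y - mat 1)"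
    using has_derivative_det_identity[where 'n='n] assms unfolding has_derivative_at_alt by metis
  show thesis
  proof (rule that[OF d(1)])
    fix B :: "real^'n^'n" assume "norm B < d"
    then show "\<bar>det (mat 1 + B) - 1 - trace B\<bar> \<le> e * norm B" using d(2)[of "mat 1 + B"] by simp
  qed
qed

lemma continuous_on_det:
  fixes A :: "'a::topological_space \<Rightarrow> real^'n^'n"
  assumes "\<And>i j. continuous_on S (\<lambda>x. A x $ i $ j)"
  shows "continuous_on S (\<lambda>x. det (A x))"
  unfolding det_def by (intro continuous_intros assms)

lemma continuous_on_cofactor:
  fixes A :: "'a::topological_space \<Rightarrow> (real^'n) \<Rightarrow>\<^sub>L (real^'n)"
  assumes "continuous_on S A" "continuous_on S \<nu>"
  shows "continuous_on S (\<lambda>x. cofactor (A x) (\<nu> x))"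
proof -
  have "continuous_on S (\<lambda>x. A x (axis j 1 - (axis j 1 \<bullet> \<nu> x) *\<^sub>R \<nu> x) $ i + ((axis j 1 \<bullet> \<nu> x) *\<^sub>R axis k 1) $ i)" for i j k
    by (intro continuous_intros assms)
  then show ?thesis
    unfolding cofactor_def by (intro continuous_on_vec_lambda continuous_on_det) (simp add: matrix_def)
qed

lemma norm_matrix_le:
  fixes f :: "(real^'n) \<Rightarrow>\<^sub>L (real^'n)"
  shows "norm (matrix f) \<le> real CARD('n) * (real CARD('n) * norm f)"
proof -
  have "norm (matrix f) \<le> (\<Sum>i\<in>UNIV. norm (matrix f $ i))" by (simp add: norm_vec_def L2_set_le_sum)
  also have "\<dots> \<le> (\<Sum>i\<in>(UNIV :: 'n set). real CARD('n) * norm f)"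
  proof (rule sum_mono)
    fix i
    have "norm (matrix f $ i) \<le> (\<Sum>j\<in>UNIV. \<bar>matrix f $ i $ j\<bar>)" by (rule norm_le_l1_cart)
    also have "\<dots> \<le> (\<Sum>j\<in>(UNIV :: 'n set). norm f)"
    proof (rule sum_mono)
      fix j
      have "\<bar>matrix f $ i $ j\<bar> \<le> norm (f (axis j 1))" by (simp add: matrix_def component_le_norm_cart)
      also have "\<dots> \<le> norm f" using norm_blinfun[of f "axis j 1"] by simp
      finally show "\<bar>matrix f $ i $ j\<bar> \<le> norm f" .
    qed
    finally show "norm (matrix f $ i) \<le> real CARD('n) * norm f" by simp
  qed
  finally show ?thesis by simp
qed

definition tr :: "(real^'n \<Rightarrow> real^'n) \<Rightarrow> real" where
  "tr f = (\<Sum>i\<in>UNIV. f (axis i 1) $ i)"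

lemma abs_tr_le: "\<bar>tr (blinfun_apply f)\<bar> \<le> real CARD('n) * norm f" for f :: "(real^'n) \<Rightarrow>\<^sub>L (real^'n)"
proof -
  have "\<bar>tr f\<bar> \<le> (\<Sum>i\<in>UNIV. \<bar>f (axis i 1) $ i\<bar>)" unfolding tr_def by (rule sum_abs)
  also have "\<dots> \<le> (\<Sum>i\<in>(UNIV :: 'n set). norm f)"
  proof (rule sum_mono)
    fix i show "\<bar>f (axis i 1) $ i\<bar> \<le> norm f"
      using component_le_norm_cart[of "f (axis i 1)" i] norm_blinfun[of f "axis i 1"] by simp
  qed
  finally show ?thesis by simp
qed

lemma norm_adjoint_blinfun:
  fixes A :: "(real^'n) \<Rightarrow>\<^sub>L (real^'n)"
  shows "norm (adjoint A x) \<le> norm A * norm x"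
proof -
  have lA: "linear A" by (simp add: linear_conv_bounded_linear blinfun.bounded_linear_right)
  have "adjoint A x \<bullet> adjoint A x \<le> norm x * norm (A (adjoint A x))"
    unfolding adjoint_clauses(2)[OF lA] by (rule norm_cauchy_schwarz)
  also have "\<dots> \<le> norm x * (norm A * norm (adjoint A x))" by (intro mult_left_mono norm_blinfun) auto
  finally have "norm (adjoint A x) * norm (adjoint A x) \<le> (norm A * norm x) * norm (adjoint A x)"
    by (simp add: power2_norm_eq_inner[symmetric] power2_eq_square ac_simps)
  then show ?thesis by (cases "adjoint A x = 0") auto
qed

text \<open>First order expansion of \<open>n = cofactor (I + t A) \<nu>\<close>, read off from
  \<open>n + t A\<^sup>T n = det (I + t A) \<nu>\<close>.\<close>

lemma cofactor_expansion:
  assumes "0 < e" "0 \<le> R"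
  obtains d where "0 < d"
    "\<And>(A :: (real^'n) \<Rightarrow>\<^sub>L (real^'n)) \<nu> t. norm A \<le> R \<Longrightarrow> norm \<nu> = 1 \<Longrightarrow> \<bar>t\<bar> < d \<Longrightarrow>
       norm (cofactor (id_blinfun + t *\<^sub>R A) \<nu> - \<nu> - t *\<^sub>R (tr A *\<^sub>R \<nu> - adjoint A \<nu>)) \<le> e * \<bar>t\<bar>"
proof -
  let ?N = "real CARD('n) * real CARD('n)"
  define e1 where "e1 = e / (2 * (?N * R + 1))"
  have pos: "0 < ?N * R + 1" using assms by (simp add: add_nonneg_pos)
  then have e1: "0 < e1" using assms by (simp add: e1_def)
  obtain d1 where d1: "0 < d1" "\<And>B :: real^'n^'n. norm B < d1 \<Longrightarrow> \<bar>det (mat 1 + B) - 1 - trace B\<bar> \<le> e1 * norm B"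
    using det_near_identity[OF e1] by metis
  \<comment> \<open>\<open>Q\<close> will bound \<open>norm (n - \<nu>) / |t|\<close>. The four
    entries of \<open>d\<close> secure, in this order, the determinant expansion,
    \<open>|t| \<le> 1\<close>, injectivity of \<open>I + t A\<close>, and that the quadratic error
    \<open>|t| R Q |t|\<close> stays below \<open>e / 2 |t|\<close>; the other half of
    \<open>e\<close> goes to the determinant through \<open>e1\<close>.\<close>
  define Q where "Q = real CARD('n) * R + e1 * (?N * R + 1) + 2 * R * (1 + real CARD('n) * R + e1 * (?N * R + 1))"
  define d where "d = min (d1 / (?N * R + 1)) (min 1 (min (1 / (2 * (R + 1))) (e / (2 * (R * Q + 1)))))"
  have Q0: "0 \<le> Q" unfolding Q_def using assms e1 pos by (intro add_nonneg_nonneg mult_nonneg_nonneg) auto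
  have d: "0 < d" unfolding d_def using d1(1) pos assms Q0 by (auto intro!: divide_pos_pos add_nonneg_pos)
  show thesis
  proof (rule that[OF d])
    fix A :: "(real^'n) \<Rightarrow>\<^sub>L (real^'n)" and \<nu> :: "real^'n" and t :: real
    assume A: "norm A \<le> R" and \<nu>: "norm \<nu> = 1" and t: "\<bar>t\<bar> < d"
    have t1: "\<bar>t\<bar> * (?N * R + 1) < d1" "\<bar>t\<bar> \<le> 1" "\<bar>t\<bar> * (2 * (R + 1)) < 1" "\<bar>t\<bar> * (2 * (R * Q + 1)) \<le> e"
      using t pos assms Q0 unfolding d_def by (auto simp: pos_less_divide_eq pos_le_divide_eq add_nonneg_pos less_imp_le)
    let ?L = "id_blinfun + t *\<^sub>R A" and ?B = "t *\<^sub>R matrix (blinfun_apply A)"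
    have Lx: "?L x = x + t *\<^sub>R A x" for x by (simp add: blinfun.bilinear_simps)
    have lL: "linear ?L" by (simp add: linear_conv_bounded_linear blinfun.bounded_linear_right)
    have Ax: "norm (A x) \<le> R * norm x" for x using norm_blinfun[of A x] A by (meson mult_right_mono norm_ge_zero order_trans)
    have "\<bar>t\<bar> * R < 1" using t1(3) by (simp add: algebra_simps)
    have iL: "inj ?L"
    proof (subst linear_injective_0[OF lL], intro allI impI)
      fix x assume "?L x = 0"
      then have "x = - (t *\<^sub>R A x)" by (simp add: Lx eq_neg_iff_add_eq_0)
      then have "norm x = \<bar>t\<bar> * norm (A x)" by (metis norm_minus_cancel norm_scaleR real_norm_def)
      then have "norm x \<le> \<bar>t\<bar> * R * norm x" using Ax[of x] by (simp add: mult.assoc mult_left_mono)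
      then show "x = 0" using \<open>\<bar>t\<bar> * R < 1\<close> by (metis le_less_trans less_irrefl mult.commute mult_less_cancel_left_disj mult.right_neutral norm_le_zero_iff not_le)
    qed
    define n where "n = cofactor ?L \<nu>"
    have lA: "linear A" by (simp add: linear_conv_bounded_linear blinfun.bounded_linear_right)
    have Ad: "adjoint A x \<bullet> y = x \<bullet> A y" for x y by (simp add: adjoint_clauses(2)[OF lA])
    have Adn: "norm (adjoint A x) \<le> R * norm x" for x
      using order_trans[OF norm_adjoint_blinfun mult_right_mono[OF A norm_ge_zero]] .
    define D where "D = det (matrix ?L)"
    have mL: "matrix ?L = mat 1 + ?B"
      by (auto simp: matrix_def vec_eq_iff Lx mat_def axis_def)
    have nB: "norm ?B \<le> \<bar>t\<bar> * (?N * R)"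
      using norm_matrix_le[of A] A by (simp add: mult.assoc) (intro mult_left_mono order_trans[OF norm_matrix_le], auto intro!: mult_left_mono)
    have trB: "trace ?B = t * tr A" by (simp add: trace_def tr_def matrix_def sum_distrib_left)
    have "norm ?B < d1" using nB t1(1) by (simp add: algebra_simps)
    then have "\<bar>D - 1 - t * tr A\<bar> \<le> e1 * norm ?B" using d1(2)[of ?B] by (simp add: D_def mL trB)
    also have "\<dots> \<le> e1 * (\<bar>t\<bar> * (?N * R + 1))" using nB e1 by (intro mult_left_mono) (auto simp: algebra_simps)
    finally have D1: "\<bar>D - 1 - t * tr A\<bar> \<le> e1 * (?N * R + 1) * \<bar>t\<bar>" by (simp add: ac_simps)
    also have "e1 * (?N * R + 1) = e / 2"
    proof -
      have "e / (2 * P) * P = e / 2" if "0 < P" for P :: real using that by simp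
      then show ?thesis unfolding e1_def using pos by blast
    qed
    finally have D1': "\<bar>D - 1 - t * tr A\<bar> \<le> (e / 2) * \<bar>t\<bar>" .
    have tA: "\<bar>tr A\<bar> \<le> real CARD('n) * R" using abs_tr_le[of A] A by (meson mult_left_mono of_nat_0_le_iff order_trans)
    have "n + t *\<^sub>R adjoint A n = D *\<^sub>R \<nu>"
    proof (rule vector_eq_rdot[THEN iffD1], rule allI)
      fix w
      have "(n + t *\<^sub>R adjoint A n) \<bullet> w = n \<bullet> ?L w" by (simp add: Lx inner_add_left inner_add_right Ad)
      also have "\<dots> = (D *\<^sub>R \<nu>) \<bullet> w" unfolding n_def by (simp add: cofactor_inner[OF lL iL \<nu>] D_def)
      finally show "(n + t *\<^sub>R adjoint A n) \<bullet> w = (D *\<^sub>R \<nu>) \<bullet> w" .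
    qed
    then have n: "n = D *\<^sub>R \<nu> - t *\<^sub>R adjoint A n" by (simp add: eq_diff_eq)
    have Dm: "\<bar>D - 1\<bar> \<le> (real CARD('n) * R + e1 * (?N * R + 1)) * \<bar>t\<bar>"
    proof -
      have "\<bar>t * tr A\<bar> \<le> real CARD('n) * R * \<bar>t\<bar>" using tA by (simp add: abs_mult mult.commute mult_left_mono)
      then show ?thesis using D1 by (simp add: algebra_simps)
    qed
    \<comment> \<open>The equation for \<open>n\<close> is implicit. A crude bound for
      \<open>norm n\<close> put into it gives \<open>norm (n - \<nu>) \<le> Q |t|\<close>, and this
      put into it once more gives the expansion.\<close>
    have "norm n \<le> \<bar>D\<bar> + \<bar>t\<bar> * norm (adjoint A n)"
      using norm_triangle_ineq4[of "D *\<^sub>R \<nu>" "t *\<^sub>R adjoint A n"] n \<nu> by simp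
    also have "\<bar>t\<bar> * norm (adjoint A n) \<le> \<bar>t\<bar> * (R * norm n)" by (intro mult_left_mono Adn) auto
    also have "\<bar>t\<bar> * (R * norm n) \<le> (1/2) * norm n"
      using t1(3) by (subst mult.assoc[symmetric], intro mult_right_mono) (auto simp: algebra_simps)
    finally have nn: "norm n \<le> 2 * \<bar>D\<bar>" by simp
    have D2: "\<bar>D\<bar> \<le> 1 + (real CARD('n) * R + e1 * (?N * R + 1))"
    proof -
      have "(real CARD('n) * R + e1 * (?N * R + 1)) * \<bar>t\<bar> \<le> (real CARD('n) * R + e1 * (?N * R + 1)) * 1"
        using t1(2) assms e1 pos by (intro mult_left_mono add_nonneg_nonneg mult_nonneg_nonneg) auto
      then have "\<bar>D - 1\<bar> \<le> real CARD('n) * R + e1 * (?N * R + 1)"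
        by (intro order_trans[OF Dm]) (simp only: mult_1_right)
      moreover have "\<bar>D\<bar> \<le> 1 + z" if "\<bar>D - 1\<bar> \<le> z" for z using that by linarith
      ultimately show ?thesis by blast
    qed
    have "n - \<nu> = (D - 1) *\<^sub>R \<nu> - t *\<^sub>R adjoint A n" using n by (simp add: algebra_simps)
    then have "norm (n - \<nu>) \<le> \<bar>D - 1\<bar> + \<bar>t\<bar> * norm (adjoint A n)"
      using norm_triangle_ineq4[of "(D - 1) *\<^sub>R \<nu>" "t *\<^sub>R adjoint A n"] \<nu> by simp
    also have "\<bar>t\<bar> * norm (adjoint A n) \<le> \<bar>t\<bar> * (R * (2 * \<bar>D\<bar>))"
      using nn assms by (intro mult_left_mono order_trans[OF Adn]) auto
    also have "\<dots> \<le> \<bar>t\<bar> * (R * (2 * (1 + (real CARD('n) * R + e1 * (?N * R + 1)))))"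
      using D2 assms by (intro mult_left_mono) auto
    finally have nu: "norm (n - \<nu>) \<le> Q * \<bar>t\<bar>" using Dm unfolding Q_def by (simp add: algebra_simps)
    have "n - \<nu> - t *\<^sub>R (tr A *\<^sub>R \<nu> - adjoint A \<nu>) = (D - 1 - t * tr A) *\<^sub>R \<nu> - t *\<^sub>R adjoint A (n - \<nu>)"
      by (subst n) (simp add: linear_diff[OF adjoint_linear[OF lA]] algebra_simps)
    then have "norm (n - \<nu> - t *\<^sub>R (tr A *\<^sub>R \<nu> - adjoint A \<nu>)) \<le> \<bar>D - 1 - t * tr A\<bar> + \<bar>t\<bar> * norm (adjoint A (n - \<nu>))"
      using norm_triangle_ineq4[of "(D - 1 - t * tr A) *\<^sub>R \<nu>" "t *\<^sub>R adjoint A (n - \<nu>)"] \<nu> by simp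
    also have "\<bar>t\<bar> * norm (adjoint A (n - \<nu>)) \<le> \<bar>t\<bar> * (R * (Q * \<bar>t\<bar>))"
      using nu assms by (intro mult_left_mono order_trans[OF Adn]) auto
    also have "\<bar>t\<bar> * (R * (Q * \<bar>t\<bar>)) \<le> (e / 2) * \<bar>t\<bar>"
      using t1(4) by (subst mult.commute[of "\<bar>t\<bar>"], intro mult_right_mono) (auto simp: algebra_simps)
    finally show "norm (cofactor ?L \<nu> - \<nu> - t *\<^sub>R (tr A *\<^sub>R \<nu> - adjoint A \<nu>)) \<le> e * \<bar>t\<bar>"
      using D1' unfolding n_def by (simp add: algebra_simps)
  qed
qed

section \<open>Hypersurfaces\<close>

text \<open>Mean value inequality for \<open>f - f' p\<close> on a ball where the derivative differs
  from \<open>f' p\<close> by at most \<open>e\<close>. Both points may vary while the linear map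
  stays frozen at \<open>p\<close>; this two-point form yields flatness of surfaces and the
  bilipschitz comparisons below.\<close>

lemma C1_strong_differentiability:
  fixes f :: "'a::real_normed_vector \<Rightarrow> 'b::real_normed_vector"
  assumes "open S" "p \<in> S" and d: "\<And>x. x \<in> S \<Longrightarrow> (f has_derivative blinfun_apply (f' x)) (at x)"
    and c: "continuous_on S f'" and "0 < e"
  obtains r where "0 < r" "ball p r \<subseteq> S" "\<And>x. x \<in> ball p r \<Longrightarrow> norm (f' x - f' p) \<le> e"
    "\<And>x y. x \<in> ball p r \<Longrightarrow> y \<in> ball p r \<Longrightarrow> norm (f y - f x - f' p (y - x)) \<le> e * norm (y - x)"
proof -
  obtain r1 where r1: "0 < r1" "ball p r1 \<subseteq> S" using assms(1,2) open_contains_ball by blast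
  have "continuous (at p) f'" using c assms(1,2) by (simp add: continuous_on_eq_continuous_at)
  then obtain r2 where r2: "0 < r2" "\<And>x. dist x p < r2 \<Longrightarrow> dist (f' x) (f' p) < e"
    using \<open>0 < e\<close> unfolding continuous_at_eps_delta by blast
  define r where "r = min r1 r2"
  have r: "0 < r" "ball p r \<subseteq> S" using r1 r2(1) by (auto simp: r_def)
  have near: "norm (f' x - f' p) \<le> e" if "x \<in> ball p r" for x
    using that r2(2)[of x] by (auto simp: r_def dist_norm norm_minus_commute less_imp_le)
  have "norm (f y - f x - f' p (y - x)) \<le> e * norm (y - x)" if xy: "x \<in> ball p r" "y \<in> ball p r" for x y
  proof -
    have "norm (f y - f x - f' p (y - x)) \<le> norm (y - x) * e"
    proof (rule differentiable_bound_linearization[where S = "ball p r" and f' = "\<lambda>x. blinfun_apply (f' x)"])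
      fix t :: real assume t: "t \<in> {0..1}"
      have "(1 - t) *\<^sub>R x + t *\<^sub>R y \<in> ball p r" using t xy by (intro convexD[OF convex_ball]) auto
      then show "x + t *\<^sub>R (y - x) \<in> ball p r" by (simp add: algebra_simps)
    next
      fix z assume z: "z \<in> ball p r"
      then show "(f has_derivative blinfun_apply (f' z)) (at z within ball p r)"
        using d[of z] r(2) by (blast intro: has_derivative_at_withinI)
      have "onorm (\<lambda>h. f' z h - f' p h) = norm (f' z - f' p)"
        by (simp add: norm_blinfun.rep_eq minus_blinfun.rep_eq)
      then show "onorm (blinfun_apply (f' z) - blinfun_apply (f' p)) \<le> e"
        using near[OF z] by (simp add: fun_diff_def)
    qed (use r in auto)
    then show ?thesis by (simp add: mult.commute)
  qed
  then show thesis using that r near by blast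
qed

text \<open>A Lebesgue number of the cover of \<open>K\<close> by the balls of strong
  differentiability serves as \<open>r\<close>. Half of \<open>e\<close> pays for replacing the
  derivative at the centre of the ball by the derivative at \<open>x\<close>.\<close>

lemma C1_uniform_differentiability:
  fixes f :: "'a::real_normed_vector \<Rightarrow> 'b::real_normed_vector"
  assumes "open S" "compact K" "K \<subseteq> S" and d: "\<And>x. x \<in> S \<Longrightarrow> (f has_derivative blinfun_apply (f' x)) (at x)"
    and c: "continuous_on S f'" and "0 < e"
  obtains r where "0 < r" "\<And>x y. x \<in> K \<Longrightarrow> norm (y - x) < r \<Longrightarrow> y \<in> S \<and> norm (f y - f x - f' x (y - x)) \<le> e * norm (y - x)"
proof -
  have "\<exists>r>0. ball p r \<subseteq> S \<and> (\<forall>x\<in>ball p r. norm (f' x - f' p) \<le> e/2) \<and>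
      (\<forall>x\<in>ball p r. \<forall>y\<in>ball p r. norm (f y - f x - f' p (y - x)) \<le> e/2 * norm (y - x))" if "p \<in> K" for p
    by (rule C1_strong_differentiability[OF assms(1) _ d c, of p "e/2"]) (use assms that in auto)
  then obtain R where R: "\<And>p. p \<in> K \<Longrightarrow> 0 < R p \<and> ball p (R p) \<subseteq> S \<and> (\<forall>x\<in>ball p (R p). norm (f' x - f' p) \<le> e/2) \<and>
      (\<forall>x\<in>ball p (R p). \<forall>y\<in>ball p (R p). norm (f y - f x - f' p (y - x)) \<le> e/2 * norm (y - x))" by metis
  obtain r where r: "0 < r" "\<And>x. x \<in> K \<Longrightarrow> \<exists>G\<in>(\<lambda>p. ball p (R p)) ` K. ball x r \<subseteq> G"
  proof (rule Heine_Borel_lemma[OF assms(2), of "(\<lambda>p. ball p (R p)) ` K"])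
    show "K \<subseteq> \<Union> ((\<lambda>p. ball p (R p)) ` K)" using R by force
  qed auto
  show thesis
  proof (rule that[OF r(1)])
    fix x y assume x: "x \<in> K" and y: "norm (y - x) < r"
    obtain p where p: "p \<in> K" "ball x r \<subseteq> ball p (R p)" using r(2)[OF x] by auto
    have "x \<in> ball x r" "y \<in> ball x r" using y r(1) by (auto simp: dist_norm norm_minus_commute)
    then have xy: "x \<in> ball p (R p)" "y \<in> ball p (R p)" using p(2) by blast+
    have "norm ((f' x - f' p) (y - x)) \<le> e/2 * norm (y - x)"
      using norm_blinfun[of "f' x - f' p" "y - x"] R[OF p(1)] xy(1) by (meson mult_right_mono norm_ge_zero order_trans)
    moreover have "norm (f y - f x - f' p (y - x)) \<le> e/2 * norm (y - x)" using R[OF p(1)] xy by blast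
    moreover have "f y - f x - f' x (y - x) = (f y - f x - f' p (y - x)) - (f' x - f' p) (y - x)"
      by (simp add: blinfun.bilinear_simps)
    ultimately have "norm (f y - f x - f' x (y - x)) \<le> e/2 * norm (y - x) + e/2 * norm (y - x)"
      using norm_triangle_ineq4[of "f y - f x - f' p (y - x)" "(f' x - f' p) (y - x)"] by (simp only:)
    then show "y \<in> S \<and> norm (f y - f x - f' x (y - x)) \<le> e * norm (y - x)"
      using xy(2) R[OF p(1)] by (auto simp: field_simps)
  qed
qed

lemma C1_on_imp_continuous_on: "C1_on S f \<Longrightarrow> continuous_on S f"
  unfolding C1_on_def by (meson continuous_at_imp_continuous_on has_derivative_continuous)

lemma C2_on_imp_C1_on: "C2_on S f \<Longrightarrow> C1_on S f"
  unfolding C2_on_def using C1_on_imp_continuous_on by (auto simp: C1_on_def[of S f])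

section \<open>Tangent spaces read off in flattening charts\<close>

definition velocity :: "(real^'n) set \<Rightarrow> real^'n \<Rightarrow> real^'n \<Rightarrow> bool" where
  "velocity M p v \<longleftrightarrow> (\<exists>\<gamma> :: real \<Rightarrow> real^'n. \<gamma> 0 = p \<and> (\<forall>\<^sub>F t in at_right 0. \<gamma> t \<in> M) \<and>
     (\<gamma> has_vector_derivative v) (at_right 0))"

lemma tangent_space_velocity: "tangent_space M p = span {v. velocity M p v}"
  by (simp add: tangent_space_def velocity_def)

text \<open>A \<open>C\<^sup>1\<close> chart with sign \<open>s = 0\<close> at an interior and \<open>s = 1\<close> at a boundary point.\<close>

locale flattened =
  fixes M U V :: "(real^'n) set" and \<phi> \<psi> :: "real^'n \<Rightarrow> real^'n"
    and \<phi>' \<psi>' :: "real^'n \<Rightarrow> ((real^'n) \<Rightarrow>\<^sub>L (real^'n))" and k l :: 'n and s :: real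
  assumes oU: "open U" and oV: "open V" and homeo: "homeomorphism U V \<phi> \<psi>"
    and d\<phi>: "\<And>x. x \<in> U \<Longrightarrow> (\<phi> has_derivative blinfun_apply (\<phi>' x)) (at x)" and c\<phi>: "continuous_on U \<phi>'"
    and d\<psi>: "\<And>y. y \<in> V \<Longrightarrow> (\<psi> has_derivative blinfun_apply (\<psi>' y)) (at y)"
    and s: "0 \<le> s" and image: "\<phi> ` (M \<inter> U) = {y \<in> V. y $ k = 0 \<and> 0 \<le> s * y $ l}"
begin

lemma maps: "x \<in> U \<Longrightarrow> \<phi> x \<in> V" "y \<in> V \<Longrightarrow> \<psi> y \<in> U" "x \<in> U \<Longrightarrow> \<psi> (\<phi> x) = x" "y \<in> V \<Longrightarrow> \<phi> (\<psi> y) = y"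
  using homeo by (auto simp: homeomorphism_def)

lemma chart_point: "x \<in> M \<Longrightarrow> x \<in> U \<Longrightarrow> \<phi> x $ k = 0 \<and> 0 \<le> s * \<phi> x $ l"
  using image by blast

lemma chart_point_rev: "y \<in> V \<Longrightarrow> y $ k = 0 \<Longrightarrow> 0 \<le> s * y $ l \<Longrightarrow> \<psi> y \<in> M"
  using image maps by (smt (verit) IntD1 IntD2 image_iff mem_Collect_eq)

lemma deriv_inverse:
  assumes x: "x \<in> U"
  shows "\<psi>' (\<phi> x) (\<phi>' x v) = v" "\<phi>' x (\<psi>' (\<phi> x) w) = w"
proof -
  have "((\<lambda>x. \<psi> (\<phi> x)) has_derivative (\<lambda>v. \<psi>' (\<phi> x) (\<phi>' x v))) (at x)"
    by (rule has_derivative_compose[OF d\<phi>[OF x] d\<psi>[OF maps(1)[OF x]]])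
  moreover have "((\<lambda>x. \<psi> (\<phi> x)) has_derivative (\<lambda>v. v)) (at x)"
    by (rule has_derivative_transform_within_open[OF has_derivative_ident oU x]) (simp add: maps)
  ultimately show "\<psi>' (\<phi> x) (\<phi>' x v) = v" by (metis has_derivative_unique)
  have "(\<phi> has_derivative blinfun_apply (\<phi>' x)) (at (\<psi> (\<phi> x)))" using d\<phi>[OF x] x by (simp add: maps)
  then have "((\<lambda>y. \<phi> (\<psi> y)) has_derivative (\<lambda>w. \<phi>' x (\<psi>' (\<phi> x) w))) (at (\<phi> x))"
    by (rule has_derivative_compose[OF d\<psi>[OF maps(1)[OF x]]])
  moreover have "((\<lambda>y. \<phi> (\<psi> y)) has_derivative (\<lambda>v. v)) (at (\<phi> x))"
    by (rule has_derivative_transform_within_open[OF has_derivative_ident oV maps(1)[OF x]]) (simp add: maps)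
  ultimately show "\<phi>' x (\<psi>' (\<phi> x) w) = w" by (metis has_derivative_unique)
qed

lemma velocity_chart:
  assumes p: "p \<in> M" "p \<in> U" and v: "velocity M p v"
  shows "\<phi>' p v $ k = 0" and "\<phi> p $ l = 0 \<Longrightarrow> 0 \<le> s * \<phi>' p v $ l"
proof -
  obtain \<gamma> :: "real \<Rightarrow> real^'n" where \<gamma>: "\<gamma> 0 = p" "\<forall>\<^sub>F t in at_right 0. \<gamma> t \<in> M" "(\<gamma> has_vector_derivative v) (at_right 0)"
    using v by (auto simp: velocity_def)
  have "(\<gamma> \<longlongrightarrow> p) (at_right 0)"
    using has_vector_derivative_continuous[OF \<gamma>(3)] \<gamma>(1) by (simp add: continuous_within)
  then have "\<forall>\<^sub>F t in at_right 0. \<gamma> t \<in> U" using oU p(2) by (rule topological_tendstoD)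
  with \<gamma>(2) have ev: "\<forall>\<^sub>F t in at_right 0. \<phi> (\<gamma> t) $ k = 0 \<and> 0 \<le> s * \<phi> (\<gamma> t) $ l"
    by eventually_elim (use chart_point in auto)
  have "(\<phi> has_derivative blinfun_apply (\<phi>' p)) (at (\<gamma> 0) within \<gamma> ` {0<..})"
    using d\<phi>[OF p(2)] \<gamma>(1) by (auto intro: has_derivative_at_withinI)
  then have "((\<phi> \<circ> \<gamma>) has_vector_derivative \<phi>' p v) (at_right 0)"
    by (rule vector_derivative_diff_chain_within[OF \<gamma>(3)])
  then have "((\<lambda>t. \<phi> (\<gamma> t) $ j) has_real_derivative \<phi>' p v $ j) (at_right 0)" for j
    using bounded_linear.has_vector_derivative[OF bounded_linear_vec_nth, of "\<phi> \<circ> \<gamma>"]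
    by (auto simp: has_real_derivative_iff_has_vector_derivative)
  then have lim: "((\<lambda>t. (\<phi> (\<gamma> t) $ j - \<phi> p $ j) / t) \<longlongrightarrow> \<phi>' p v $ j) (at_right 0)" for j
    by (simp add: has_field_derivative_iff \<gamma>(1))
  have "\<forall>\<^sub>F t in at_right 0. (\<phi> (\<gamma> t) $ k - \<phi> p $ k) / t = 0"
    using ev by eventually_elim (use chart_point[OF p] in auto)
  then have "((\<lambda>t. (\<phi> (\<gamma> t) $ k - \<phi> p $ k) / t) \<longlongrightarrow> 0) (at_right 0)" by (rule tendsto_eventually)
  then show "\<phi>' p v $ k = 0" by (rule tendsto_unique[OF trivial_limit_at_right_real lim])
  assume z: "\<phi> p $ l = 0"
  have "\<forall>\<^sub>F t in at_right (0::real). 0 < t" by (rule eventually_at_right_less)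
  with ev have "\<forall>\<^sub>F t in at_right 0. 0 \<le> s * ((\<phi> (\<gamma> t) $ l - \<phi> p $ l) / t)"
    by eventually_elim (simp add: z)
  then show "0 \<le> s * \<phi>' p v $ l"
    by (intro tendsto_lowerbound[OF tendsto_mult[OF tendsto_const lim]]) auto
qed

text \<open>The curve is the pulled back segment \<open>\<phi> p + t \<phi>' p v\<close>. It stays
  in the half-space either because it starts strictly inside or because its direction does not point
  outwards.\<close>

lemma chart_velocity:
  assumes p: "p \<in> M" "p \<in> U" and k: "\<phi>' p v $ k = 0" and l: "0 < \<phi> p $ l \<or> 0 \<le> s * \<phi>' p v $ l"
  shows "velocity M p v"
  unfolding velocity_def
proof (intro exI conjI)
  let ?w = "\<phi>' p v" and ?\<gamma> = "\<lambda>t. \<psi> (\<phi> p + t *\<^sub>R \<phi>' p v)"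
  show "?\<gamma> 0 = p" using p by (simp add: maps)
  have lim: "((\<lambda>t. \<phi> p + t *\<^sub>R ?w) \<longlongrightarrow> \<phi> p + 0 *\<^sub>R ?w) (at_right 0)" by (intro tendsto_intros)
  then have e1: "\<forall>\<^sub>F t in at_right 0. \<phi> p + t *\<^sub>R ?w \<in> V"
    using oV maps(1)[OF p(2)] by (intro topological_tendstoD) auto
  have e2: "\<forall>\<^sub>F t in at_right 0. 0 \<le> s * (\<phi> p $ l + t * ?w $ l)"
  proof (cases "0 < \<phi> p $ l")
    case True
    have "((\<lambda>t. \<phi> p $ l + t * ?w $ l) \<longlongrightarrow> \<phi> p $ l + 0 * ?w $ l) (at_right 0)" by (intro tendsto_intros)
    then have "\<forall>\<^sub>F t in at_right 0. 0 < \<phi> p $ l + t * ?w $ l" using True by (intro order_tendstoD) auto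
    then show ?thesis by eventually_elim (use s in auto)
  next
    case False
    have "\<forall>\<^sub>F t in at_right (0::real). 0 < t" by (rule eventually_at_right_less)
    then show ?thesis
    proof eventually_elim
      case (elim t)
      have "0 \<le> s * \<phi> p $ l" using chart_point[OF p] by simp
      moreover have "0 \<le> t * (s * ?w $ l)" using False l elim by simp
      ultimately show ?case by (simp add: algebra_simps)
    qed
  qed
  show "\<forall>\<^sub>F t in at_right 0. ?\<gamma> t \<in> M"
    using e1 e2 by eventually_elim (rule chart_point_rev, use k chart_point[OF p] in auto)
  have "((\<lambda>t. \<phi> p + t *\<^sub>R ?w) has_vector_derivative ?w) (at_right 0)"
    by (auto intro!: derivative_eq_intros simp: has_vector_derivative_def)
  moreover have "(\<psi> has_derivative blinfun_apply (\<psi>' (\<phi> p))) (at (\<phi> p + 0 *\<^sub>R ?w) within (\<lambda>t. \<phi> p + t *\<^sub>R ?w) ` {0<..})"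
    using d\<psi>[OF maps(1)[OF p(2)]] by (auto intro: has_derivative_at_withinI)
  ultimately have "((\<psi> \<circ> (\<lambda>t. \<phi> p + t *\<^sub>R ?w)) has_vector_derivative \<psi>' (\<phi> p) ?w) (at_right 0)"
    by (rule vector_derivative_diff_chain_within)
  then show "(?\<gamma> has_vector_derivative v) (at_right 0)" by (simp add: o_def deriv_inverse[OF p(2)])
qed

text \<open>For \<open>v\<close> in the hyperplane at least one of \<open>v\<close> and
  \<open>- v\<close> is a velocity, since the sign condition holds for one of them. The span
  therefore fills the whole hyperplane also at boundary points.\<close>

lemma tangent_space_chart:
  assumes p: "p \<in> M" "p \<in> U"
  shows "tangent_space M p = {v. \<phi>' p v $ k = 0}"
proof
  have "subspace {v. \<phi>' p v $ k = 0}" by (auto simp: subspace_def blinfun.bilinear_simps)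
  then show "tangent_space M p \<subseteq> {v. \<phi>' p v $ k = 0}"
    unfolding tangent_space_velocity by (intro span_minimal) (use velocity_chart(1)[OF p] in auto)
  show "{v. \<phi>' p v $ k = 0} \<subseteq> tangent_space M p"
  proof
    fix v assume v: "v \<in> {v. \<phi>' p v $ k = 0}"
    show "v \<in> tangent_space M p"
    proof (cases "0 \<le> s * \<phi>' p v $ l")
      case True
      then have "velocity M p v" using v by (intro chart_velocity[OF p]) auto
      then show ?thesis unfolding tangent_space_velocity by (intro span_base) simp
    next
      case False
      then have "velocity M p (- v)" using v by (intro chart_velocity[OF p]) (auto simp: blinfun.bilinear_simps)
      then have "- (- v) \<in> tangent_space M p" unfolding tangent_space_velocity by (intro span_neg span_base) simp
      then show ?thesis by simp
    qed
  qed
qed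

end

lemma C2_chart_flattened:
  fixes U :: "(real^'n) set"
  assumes "C2_chart U V \<phi> \<psi>" "0 \<le> s" "\<phi> ` (M \<inter> U) = {y \<in> V. y $ k = 0 \<and> 0 \<le> s * y $ l}"
  obtains \<phi>' \<psi>' where "flattened M U V \<phi> \<psi> \<phi>' \<psi>' k l s"
proof -
  obtain \<phi>' where \<phi>': "\<forall>x\<in>U. (\<phi> has_derivative blinfun_apply (\<phi>' x)) (at x)" "continuous_on U \<phi>'"
    using assms(1) C2_on_imp_C1_on unfolding C2_chart_def C1_on_def by blast
  obtain \<psi>' where \<psi>': "\<forall>x\<in>V. (\<psi> has_derivative blinfun_apply (\<psi>' x)) (at x)"
    using assms(1) C2_on_imp_C1_on unfolding C2_chart_def C1_on_def by blast
  have "flattened M U V \<phi> \<psi> \<phi>' \<psi>' k l s"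
    using assms \<phi>' \<psi>' unfolding C2_chart_def by unfold_locales auto
  then show thesis by (rule that)
qed

lemma interior_point_flattened:
  assumes "p \<in> interior_points M"
  obtains U V \<phi> \<psi> \<phi>' \<psi>' k where "p \<in> U" "flattened M U V \<phi> \<psi> \<phi>' \<psi>' k k 0"
proof -
  obtain U V \<phi> \<psi> k where *: "C2_chart U V \<phi> \<psi>" "p \<in> U" "\<phi> ` (M \<inter> U) = {y \<in> V. y $ k = 0}"
    using assms by (auto simp: interior_points_def)
  obtain \<phi>' \<psi>' where "flattened M U V \<phi> \<psi> \<phi>' \<psi>' k k 0"
    by (rule C2_chart_flattened[OF *(1), of 0 M k k]) (use *(3) in auto)
  then show thesis by (rule that[OF *(2)])
qed

lemma boundary_point_flattened:
  assumes "p \<in> boundary_points M"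
  obtains U V \<phi> \<psi> \<phi>' \<psi>' k l where "p \<in> U" "k \<noteq> l" "\<phi> p $ l = 0" "flattened M U V \<phi> \<psi> \<phi>' \<psi>' k l 1"
proof -
  obtain U V \<phi> \<psi> k l where *: "C2_chart U V \<phi> \<psi>" "p \<in> U" "k \<noteq> l" "\<phi> p $ l = 0" "\<phi> ` (M \<inter> U) = {y \<in> V. y $ k = 0 \<and> y $ l \<ge> 0}"
    using assms by (auto simp: boundary_points_def)
  obtain \<phi>' \<psi>' where "flattened M U V \<phi> \<psi> \<phi>' \<psi>' k l 1"
    by (rule C2_chart_flattened[OF *(1), of 1 M k l]) (use *(5) in auto)
  then show thesis by (rule that[of U k l \<phi> V \<psi> \<phi>' \<psi>', OF *(2-4)])
qed

text \<open>The velocities fill a hyperplane at an interior point, but only a half-space of it at a boundary point.\<close>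

lemma boundary_interior_disjoint: "boundary_points M \<inter> interior_points M = {}"
proof (rule ccontr)
  assume "\<not> ?thesis"
  then obtain p where b: "p \<in> boundary_points M" and i: "p \<in> interior_points M" by blast
  have pM: "p \<in> M" using b by (simp add: boundary_points_def)
  obtain U V \<phi> \<psi> \<phi>' \<psi>' k where I: "p \<in> U" "flattened M U V \<phi> \<psi> \<phi>' \<psi>' k k 0" by (rule interior_point_flattened[OF i])
  obtain U2 V2 \<phi>2 \<psi>2 \<phi>2' \<psi>2' k2 l2 where B: "p \<in> U2" "k2 \<noteq> l2" "\<phi>2 p $ l2 = 0" "flattened M U2 V2 \<phi>2 \<psi>2 \<phi>2' \<psi>2' k2 l2 1"
    by (rule boundary_point_flattened[OF b])
  interpret I: flattened M U V \<phi> \<psi> \<phi>' \<psi>' k k 0 by (rule I(2))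
  interpret B: flattened M U2 V2 \<phi>2 \<psi>2 \<phi>2' \<psi>2' k2 l2 1 by (rule B(4))
  define v where "v = \<psi>2' (\<phi>2 p) (axis l2 1)"
  have v: "\<phi>2' p v = axis l2 1" by (simp add: v_def B.deriv_inverse[OF B(1)])
  have "velocity M p v" using B.chart_velocity[OF pM B(1)] v B(2) by (simp add: axis_def)
  then have "\<phi>' p v $ k = 0" by (rule I.velocity_chart(1)[OF pM I(1)])
  then have "velocity M p (- v)" by (intro I.chart_velocity[OF pM I(1)]) (simp_all add: blinfun.bilinear_simps)
  then have "0 \<le> 1 * \<phi>2' p (- v) $ l2" using B.velocity_chart(2)[OF pM B(1) _ B(3)] by blast
  then show False using v by (simp add: blinfun.bilinear_simps)
qed

text \<open>A chart around an interior point serves every point of \<open>M\<close> in its domain,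
  so the interior points are relatively open in \<open>M\<close> and the boundary points relatively
  closed.\<close>

lemma compact_hypersurface_Int:
  assumes "proper_hypersurface \<Omega> M" "compact K" "K \<subseteq> \<Omega>"
  shows "compact (M \<inter> K)" "compact (boundary_points M \<inter> K)"
proof -
  obtain T where T: "closed T" "M = \<Omega> \<inter> T" using assms(1) by (auto simp: proper_hypersurface_def closedin_closed)
  then have "M \<inter> K = K \<inter> T" using assms(3) by auto
  then show c: "compact (M \<inter> K)" using T assms(2) by (simp add: compact_Int_closed)
  define W where "W = \<Union>{U. open U \<and> M \<inter> U \<subseteq> interior_points M}"
  have W: "M \<inter> W = interior_points M"
  proof
    show "interior_points M \<subseteq> M \<inter> W"
    proof
      fix p assume "p \<in> interior_points M"
      then obtain U V \<phi> \<psi> k where p: "p \<in> M" "C2_chart U V \<phi> \<psi>" "p \<in> U" "\<phi> ` (M \<inter> U) = {y \<in> V. y $ k = 0}"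
        by (auto simp: interior_points_def)
      then have "M \<inter> U \<subseteq> interior_points M" unfolding interior_points_def by blast
      moreover have "open U" using p(2) by (simp add: C2_chart_def)
      ultimately show "p \<in> M \<inter> W" using p by (auto simp: W_def)
    qed
  qed (auto simp: W_def)
  have "M = interior_points M \<union> boundary_points M" using assms(1) by (simp add: proper_hypersurface_def)
  then have "boundary_points M \<inter> K = M \<inter> K \<inter> - W" using boundary_interior_disjoint[of M] W by blast
  moreover have "closed (- W)" unfolding W_def by (intro closed_Compl open_Union) auto
  ultimately show "compact (boundary_points M \<inter> K)" using c by (simp add: compact_Int_closed)
qed

text \<open>Only one direction is demanded: \<open>u\<close> vanishes on \<open>M\<close> but may
  vanish elsewhere, as near a boundary point, where \<open>M\<close> is one half of the zero set.
  Interior and boundary points are thereby treated alike.\<close>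

definition defining_function :: "(real^'n) set \<Rightarrow> (real^'n) set \<Rightarrow> (real^'n \<Rightarrow> real) \<Rightarrow> (real^'n \<Rightarrow> real^'n) \<Rightarrow> bool" where
  "defining_function M U u a \<longleftrightarrow> open U \<and> (\<forall>x\<in>U. (u has_derivative (\<lambda>h. a x \<bullet> h)) (at x)) \<and> continuous_on U a \<and>
     (\<forall>x\<in>U. a x \<noteq> 0) \<and> (\<forall>x\<in>M \<inter> U. u x = 0 \<and> tangent_space M x = {v. a x \<bullet> v = 0})"

definition C1_surface :: "(real^'n) set \<Rightarrow> bool" where
  "C1_surface M \<longleftrightarrow> (\<forall>p\<in>M. \<exists>U u a. p \<in> U \<and> defining_function M U u a)"

lemma (in flattened) defining_function_chart:
  "defining_function M U (\<lambda>x. \<phi> x $ k) (\<lambda>x. \<chi> j. \<phi>' x (axis j 1) $ k)"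
proof -
  have ip: "(\<chi> j. \<phi>' x (axis j 1) $ k) \<bullet> h = \<phi>' x h $ k" for x h
  proof -
    have h: "h = (\<Sum>j\<in>UNIV. h $ j *\<^sub>R axis j 1)" using basis_expansion[of h] by (simp add: scalar_mult_eq_scaleR)
    have "\<phi>' x h = (\<Sum>j\<in>UNIV. h $ j *\<^sub>R \<phi>' x (axis j 1))"
      by (subst h) (simp add: blinfun.sum_right blinfun.scaleR_right)
    then show ?thesis by (simp add: inner_vec_def mult.commute)
  qed
  show ?thesis
    unfolding defining_function_def
  proof (intro conjI ballI oU)
    fix x assume x: "x \<in> U"
    show "((\<lambda>x. \<phi> x $ k) has_derivative (\<lambda>h. (\<chi> j. \<phi>' x (axis j 1) $ k) \<bullet> h)) (at x)"
      unfolding ip by (rule bounded_linear.has_derivative[OF bounded_linear_vec_nth d\<phi>[OF x]])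
    show "(\<chi> j. \<phi>' x (axis j 1) $ k) \<noteq> 0"
    proof
      assume "(\<chi> j. \<phi>' x (axis j 1) $ k) = 0"
      then have "\<phi>' x (\<psi>' (\<phi> x) (axis k 1)) $ k = 0" using ip[of x] by (metis inner_zero_left)
      then show False by (simp add: deriv_inverse[OF x])
    qed
  next
    show "continuous_on U (\<lambda>x. \<chi> j. \<phi>' x (axis j 1) $ k)" by (intro continuous_intros c\<phi>)
  next
    fix x assume "x \<in> M \<inter> U"
    then show "\<phi> x $ k = 0" "tangent_space M x = {v. (\<chi> j. \<phi>' x (axis j 1) $ k) \<bullet> v = 0}"
      using chart_point tangent_space_chart by (auto simp: ip)
  qed
qed

lemma proper_hypersurface_C1_surface:
  assumes "proper_hypersurface \<Omega> M" shows "C1_surface M"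
  unfolding C1_surface_def
proof
  fix p assume "p \<in> M"
  then consider "p \<in> interior_points M" | "p \<in> boundary_points M" using assms by (auto simp: proper_hypersurface_def)
  then show "\<exists>U u a. p \<in> U \<and> defining_function M U u a"
    by cases (meson interior_point_flattened boundary_point_flattened flattened.defining_function_chart)+
qed

lemma unit_normal_cases:
  assumes "tangent_space M p = {v. b \<bullet> v = 0}" "norm b = 1"
  shows "unit_normal M p = b \<or> unit_normal M p = - b"
proof -
  let ?\<nu> = "unit_normal M p"
  have bb: "b \<bullet> b = 1" by (rule inner_self_unit[OF assms(2)])
  have "\<exists>\<nu>. norm \<nu> = 1 \<and> (\<forall>v\<in>tangent_space M p. v \<bullet> \<nu> = 0)"
    using assms by (intro exI[of _ b]) (auto simp: inner_commute)
  then have \<nu>: "norm ?\<nu> = 1" "\<And>v. b \<bullet> v = 0 \<Longrightarrow> v \<bullet> ?\<nu> = 0"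
    unfolding unit_normal_def using assms(1) by (auto dest!: someI_ex)
  define c where "c = b \<bullet> ?\<nu>"
  define w where "w = ?\<nu> - c *\<^sub>R b"
  have bw: "b \<bullet> w = 0" by (simp add: w_def c_def inner_diff_right bb)
  then have "w \<bullet> ?\<nu> = 0" by (rule \<nu>(2))
  then have "w \<bullet> w = 0" using bw by (simp add: w_def inner_diff_right inner_commute)
  then have e: "?\<nu> = c *\<^sub>R b" by (simp add: w_def)
  then have "\<bar>c\<bar> = 1" using \<nu>(1) assms(2) by (metis mult.right_neutral norm_scaleR real_norm_def)
  then have "c = 1 \<or> c = - 1" by linarith
  then show ?thesis using e by auto
qed

lemma C1_surface_normal:
  assumes "C1_surface M" "p \<in> M"
  shows "norm (unit_normal M p) = 1" "tangent_space M p = hyperplane (unit_normal M p)"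
proof -
  obtain U u a where U: "p \<in> U" "defining_function M U u a" using assms by (auto simp: C1_surface_def)
  then have a: "a p \<noteq> 0" "tangent_space M p = {v. a p \<bullet> v = 0}" using assms(2) by (auto simp: defining_function_def)
  let ?b = "a p /\<^sub>R norm (a p)"
  have b: "tangent_space M p = {v. ?b \<bullet> v = 0}" "norm ?b = 1" using a by auto
  have c: "unit_normal M p = ?b \<or> unit_normal M p = - ?b" by (rule unit_normal_cases[OF b])
  then show "norm (unit_normal M p) = 1" using b(2) by (metis norm_minus_cancel)
  have "{v. (- ?b) \<bullet> v = 0} = {v. ?b \<bullet> v = 0}" by simp
  with c have "{v. unit_normal M p \<bullet> v = 0} = {v. ?b \<bullet> v = 0}" by metis
  then show "tangent_space M p = hyperplane (unit_normal M p)"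
    unfolding b(1) hyperplane_def by (simp add: inner_commute)
qed

lemma defining_function_normal:
  assumes "defining_function M U u a" "x \<in> M" "x \<in> U"
  shows "unit_normal M x = a x /\<^sub>R norm (a x) \<or> unit_normal M x = - (a x /\<^sub>R norm (a x))"
proof (rule unit_normal_cases)
  have "a x \<noteq> 0" "tangent_space M x = {v. a x \<bullet> v = 0}" using assms by (auto simp: defining_function_def)
  then show "tangent_space M x = {v. (a x /\<^sub>R norm (a x)) \<bullet> v = 0}" "norm (a x /\<^sub>R norm (a x)) = 1" by simp_all
qed

text \<open>\<open>unit_normal\<close> is a pointwise choice and may jump in sign, but locally it is
  plus or minus the continuous field \<open>a / norm a\<close>, and an even function does not see
  the sign.\<close>

lemma continuous_on_even_normal:
  assumes M: "C1_surface M" and Q: "continuous_on (M \<times> sphere 0 1) (\<lambda>(x, \<nu>). Q x \<nu>)"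
    and even: "\<And>x \<nu>. x \<in> M \<Longrightarrow> norm \<nu> = 1 \<Longrightarrow> Q x (- \<nu>) = Q x \<nu>"
  shows "continuous_on M (\<lambda>x. Q x (unit_normal M x))"
  unfolding continuous_on_eq_continuous_within
proof
  fix p assume p: "p \<in> M"
  obtain U u a where U: "p \<in> U" "defining_function M U u a" using M p by (auto simp: C1_surface_def)
  have U': "open U" "continuous_on U a" "\<And>x. x \<in> U \<Longrightarrow> a x \<noteq> 0" using U(2) by (auto simp: defining_function_def)
  have "continuous_on (M \<inter> U) (\<lambda>x. (\<lambda>(x, \<nu>). Q x \<nu>) (x, a x /\<^sub>R norm (a x)))"
    by (rule continuous_on_compose2[OF Q])
      (use U' in \<open>auto intro!: continuous_intros continuous_on_subset[OF U'(2)]\<close>)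
  then have "continuous_on (M \<inter> U) (\<lambda>x. Q x (unit_normal M x))"
  proof (rule continuous_on_eq)
    fix x assume x: "x \<in> M \<inter> U"
    have "norm (a x /\<^sub>R norm (a x)) = 1" using U'(3)[of x] x by simp
    then show "(case (x, a x /\<^sub>R norm (a x)) of (x, \<nu>) \<Rightarrow> Q x \<nu>) = Q x (unit_normal M x)"
      using defining_function_normal[OF U(2), of x] even[of x] x by auto
  qed
  then have "continuous (at p within M \<inter> U) (\<lambda>x. Q x (unit_normal M x))"
    using p U(1) by (simp add: continuous_on_eq_continuous_within)
  moreover have "at p within M \<inter> U = at p within M" by (rule at_within_nhd[OF U(1) U'(1)]) auto
  ultimately show "continuous (at p within M) (\<lambda>x. Q x (unit_normal M x))" by simp
qed

text \<open>The defining function vanishes at both points, so its strong differentiability at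
  \<open>p\<close> bounds the component of the chord along the normal at \<open>p\<close>.\<close>

lemma C1_surface_flat:
  assumes M: "C1_surface M" and p: "p \<in> M" and "0 < e"
  obtains r where "0 < r"
    "\<And>x y. x \<in> M \<inter> ball p r \<Longrightarrow> y \<in> M \<inter> ball p r \<Longrightarrow> \<bar>(x - y) \<bullet> unit_normal M p\<bar> \<le> e * norm (x - y)"
proof -
  obtain U u a where U: "p \<in> U" "defining_function M U u a" using M p by (auto simp: C1_surface_def)
  have U': "open U" "continuous_on U a" "a p \<noteq> 0" "\<And>x. x \<in> U \<Longrightarrow> (u has_derivative (\<lambda>h. a x \<bullet> h)) (at x)"
    "\<And>x. x \<in> M \<inter> U \<Longrightarrow> u x = 0" using U by (auto simp: defining_function_def)
  define a' where "a' x = blinfun_inner_right (a x)" for x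
  have c': "continuous_on U a'" unfolding a'_def by (intro continuous_intros U')
  have d': "(u has_derivative blinfun_apply (a' x)) (at x)" if "x \<in> U" for x
    using U'(4)[OF that] by (simp add: a'_def)
  have e': "0 < e * norm (a p)" using \<open>0 < e\<close> U'(3) by simp
  obtain r where r: "0 < r" "ball p r \<subseteq> U"
      "\<And>x y. x \<in> ball p r \<Longrightarrow> y \<in> ball p r \<Longrightarrow> norm (u y - u x - a' p (y - x)) \<le> (e * norm (a p)) * norm (y - x)"
    using C1_strong_differentiability[OF U'(1) U(1) d' c' e'] by metis
  show thesis
  proof (rule that[OF r(1)])
    fix x y assume xy: "x \<in> M \<inter> ball p r" "y \<in> M \<inter> ball p r"
    then have "u x = 0" "u y = 0" using r(2) by (auto intro!: U'(5))
    then have "\<bar>a p \<bullet> (x - y)\<bar> \<le> e * norm (a p) * norm (x - y)" using r(3)[of y x] xy by (simp add: a'_def)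
    then have "\<bar>(a p /\<^sub>R norm (a p)) \<bullet> (x - y)\<bar> \<le> e * norm (x - y)"
      using U'(3) by (simp add: abs_mult field_simps)
    then show "\<bar>(x - y) \<bullet> unit_normal M p\<bar> \<le> e * norm (x - y)"
      using defining_function_normal[OF U(2) p U(1)] by (auto simp: inner_commute)
  qed
qed

section \<open>Area of hypersurfaces\<close>

lemma hausdorff_outer_relative_lipschitz:
  assumes lip: "\<And>x y. x \<in> A \<Longrightarrow> y \<in> A \<Longrightarrow> dist (f x) (f y) \<le> L * dist (g x) (g y)" and "0 < L"
  shows "hausdorff_outer k (f ` A) \<le> ennreal (L ^ k) * hausdorff_outer k (g ` A)"
proof -
  define h where "h = (\<lambda>z. f (inv_into A g z))"
  have h: "h (g x) = f x" if "x \<in> A" for x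
  proof -
    have "inv_into A g (g x) \<in> A" "g (inv_into A g (g x)) = g x" using that by (auto intro: inv_into_into f_inv_into_f)
    then have "dist (h (g x)) (f x) \<le> L * dist (g x) (g x)" using lip[OF _ that, of "inv_into A g (g x)"] by (simp add: h_def)
    then show ?thesis by simp
  qed
  have "hausdorff_outer k (h ` (g ` A)) \<le> ennreal (L ^ k) * hausdorff_outer k (g ` A)"
    by (rule hausdorff_outer_lipschitz[OF _ \<open>0 < L\<close>]) (use h lip in auto)
  also have "h ` (g ` A) = f ` A" using h by (auto simp: image_image intro!: image_cong)
  finally show ?thesis .
qed

definition project :: "real^'n \<Rightarrow> real^'n \<Rightarrow> real^'n" where
  "project \<nu> x = x - (x \<bullet> \<nu>) *\<^sub>R \<nu>"

lemma project_props:
  assumes "norm \<nu> = 1"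
  shows "project \<nu> x \<in> hyperplane \<nu>" "project \<nu> (x - y) = project \<nu> x - project \<nu> y"
    "norm (project \<nu> x) \<le> norm x" "norm x \<le> norm (project \<nu> x) + \<bar>x \<bullet> \<nu>\<bar>"
proof -
  have nn: "\<nu> \<bullet> \<nu> = 1" by (rule inner_self_unit[OF assms])
  show "project \<nu> x \<in> hyperplane \<nu>" by (simp add: project_def hyperplane_def inner_diff_left nn)
  show "project \<nu> (x - y) = project \<nu> x - project \<nu> y" by (simp add: project_def inner_diff_left algebra_simps)
  have "project \<nu> x \<bullet> project \<nu> x + (x \<bullet> \<nu>)\<^sup>2 = x \<bullet> x"
    by (simp add: project_def inner_diff_left inner_diff_right nn inner_commute power2_eq_square)
  then have "(norm (project \<nu> x))\<^sup>2 \<le> (norm x)\<^sup>2"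
    unfolding power2_norm_eq_inner by (metis le_add_same_cancel1 zero_le_power2)
  then show "norm (project \<nu> x) \<le> norm x" by (rule power2_le_imp_le) simp
  have "x = project \<nu> x + (x \<bullet> \<nu>) *\<^sub>R \<nu>" by (simp add: project_def)
  then have "norm x \<le> norm (project \<nu> x) + norm ((x \<bullet> \<nu>) *\<^sub>R \<nu>)" by (metis norm_triangle_ineq)
  then show "norm x \<le> norm (project \<nu> x) + \<bar>x \<bullet> \<nu>\<bar>" by (simp add: assms)
qed

text \<open>A set whose chords are tilted this little is a graph over the plane orthogonal to
  \<open>\<nu>\<close>: the slope bound 1/2 makes the inverse of the projection 2-Lipschitz. This
  costs the factor \<open>2 ^ m\<close> over the measure of a plane disc.\<close>

lemma area_ratio_exists:
  assumes "CARD('n) = m + 1"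
  obtains K where "0 \<le> K"
    "\<And>(S :: (real^'n) set) \<nu> c r. norm \<nu> = 1 \<Longrightarrow> (\<And>x y. x \<in> S \<Longrightarrow> y \<in> S \<Longrightarrow> \<bar>(x - y) \<bullet> \<nu>\<bar> \<le> 1/2 * norm (x - y)) \<Longrightarrow>
      0 < r \<Longrightarrow> S \<subseteq> cball c r \<Longrightarrow> hausdorff_outer m S \<le> ennreal (K * r ^ m)"
proof -
  obtain K where K: "0 \<le> K" "\<And>\<nu> c::real^'n. \<And>r. norm \<nu> = 1 \<Longrightarrow> 0 < r \<Longrightarrow> hausdorff_outer m (hyperplane \<nu> \<inter> cball c r) \<le> ennreal (K * r ^ m)"
    using hausdorff_outer_hyperplane_ball[OF assms] by metis
  show thesis
  proof (rule that)
    show "0 \<le> 2 ^ m * K" using K by simp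
    fix S :: "(real^'n) set" and \<nu> c r
    assume \<nu>: "norm \<nu> = 1" and flat: "\<And>x y. x \<in> S \<Longrightarrow> y \<in> S \<Longrightarrow> \<bar>(x - y) \<bullet> \<nu>\<bar> \<le> 1/2 * norm (x - y)"
      and r: "0 < r" "S \<subseteq> cball c r"
    have "hausdorff_outer m ((\<lambda>x. x) ` S) \<le> ennreal (2 ^ m) * hausdorff_outer m (project \<nu> ` S)"
    proof (rule hausdorff_outer_relative_lipschitz)
      fix x y assume "x \<in> S" "y \<in> S"
      then have "norm (x - y) \<le> norm (project \<nu> (x - y)) + 1/2 * norm (x - y)"
        using project_props(4)[OF \<nu>, of "x - y"] flat[of x y] by linarith
      then show "dist x y \<le> 2 * dist (project \<nu> x) (project \<nu> y)"
        by (simp add: dist_norm project_props(2)[OF \<nu>, symmetric])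
    qed simp
    also have "hausdorff_outer m (project \<nu> ` S) \<le> hausdorff_outer m (hyperplane \<nu> \<inter> cball (project \<nu> c) r)"
    proof (rule hausdorff_outer_mono, rule image_subsetI)
      fix x assume "x \<in> S"
      then have "norm (c - x) \<le> r" using r(2) by (auto simp: dist_norm)
      then have "norm (project \<nu> (c - x)) \<le> r" using project_props(3)[OF \<nu>] by (rule order_trans[rotated])
      then show "project \<nu> x \<in> hyperplane \<nu> \<inter> cball (project \<nu> c) r"
        using project_props(1)[OF \<nu>] by (simp add: dist_norm project_props(2)[OF \<nu>])
    qed
    also have "\<dots> \<le> ennreal (K * r ^ m)" by (rule K(2)[OF \<nu> r(1)])
    finally have "hausdorff_outer m S \<le> ennreal (2 ^ m) * ennreal (K * r ^ m)" by (simp add: mult_left_mono)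
    also have "\<dots> = ennreal (2 ^ m * K * r ^ m)" using K(1) r(1) by (simp add: ennreal_mult[symmetric] ac_simps)
    finally show "hausdorff_outer m S \<le> ennreal (2 ^ m * K * r ^ m)" .
  qed
qed

text \<open>\<open>K\<close> is obtained before the surface and depends on the dimension only,
  whereas \<open>r0\<close> depends on \<open>M\<close> and \<open>B\<close>. This independence
  makes the boundary cutoffs uniform along the sequence.\<close>

lemma C1_surface_area_ratio:
  assumes "CARD('n) = m + 1"
  obtains K where "0 \<le> K"
    "\<And>(M :: (real^'n) set) B. C1_surface M \<Longrightarrow> compact B \<Longrightarrow> B \<subseteq> M \<Longrightarrow>
      \<exists>r0>0. \<forall>c\<in>B. \<forall>r. 0 < r \<longrightarrow> r < r0 \<longrightarrow> hausdorff_outer m (M \<inter> cball c r) \<le> ennreal (K * r ^ m)"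
proof -
  obtain K where K: "0 \<le> K"
    "\<And>(S :: (real^'n) set) \<nu> c r. norm \<nu> = 1 \<Longrightarrow> (\<And>x y. x \<in> S \<Longrightarrow> y \<in> S \<Longrightarrow> \<bar>(x - y) \<bullet> \<nu>\<bar> \<le> 1/2 * norm (x - y)) \<Longrightarrow>
      0 < r \<Longrightarrow> S \<subseteq> cball c r \<Longrightarrow> hausdorff_outer m S \<le> ennreal (K * r ^ m)"
    using area_ratio_exists[OF assms] by blast
  show thesis
  proof (rule that[OF K(1)])
    fix M B :: "(real^'n) set" assume M: "C1_surface M" and B: "compact B" "B \<subseteq> M"
    have "\<exists>r>0. \<forall>x\<in>M \<inter> ball p r. \<forall>y\<in>M \<inter> ball p r. \<bar>(x - y) \<bullet> unit_normal M p\<bar> \<le> 1/2 * norm (x - y)" if "p \<in> B" for p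
      by (rule C1_surface_flat[OF M, of p "1/2"]) (use that B in auto)
    then obtain R where R: "\<And>p. p \<in> B \<Longrightarrow> 0 < R p \<and> (\<forall>x\<in>M \<inter> ball p (R p). \<forall>y\<in>M \<inter> ball p (R p). \<bar>(x - y) \<bullet> unit_normal M p\<bar> \<le> 1/2 * norm (x - y))"
      by metis
    obtain r0 where r0: "0 < r0" "\<And>x. x \<in> B \<Longrightarrow> \<exists>G\<in>(\<lambda>p. ball p (R p)) ` B. ball x r0 \<subseteq> G"
    proof (rule Heine_Borel_lemma[OF B(1), of "(\<lambda>p. ball p (R p)) ` B"])
      show "B \<subseteq> \<Union> ((\<lambda>p. ball p (R p)) ` B)" using R by force
    qed auto
    show "\<exists>r0>0. \<forall>c\<in>B. \<forall>r. 0 < r \<longrightarrow> r < r0 \<longrightarrow> hausdorff_outer m (M \<inter> cball c r) \<le> ennreal (K * r ^ m)"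
    proof (intro exI[of _ r0] conjI r0(1) ballI allI impI)
      fix c r assume c: "c \<in> B" and r: "0 < r" "r < r0"
      obtain p where p: "p \<in> B" "ball c r0 \<subseteq> ball p (R p)" using r0(2)[OF c] by auto
      have sub: "cball c r \<subseteq> ball p (R p)" using r p(2) by (auto simp: subset_iff)
      show "hausdorff_outer m (M \<inter> cball c r) \<le> ennreal (K * r ^ m)"
      proof (rule K(2)[of "unit_normal M p"])
        show "norm (unit_normal M p) = 1" using C1_surface_normal(1)[OF M] p B by auto
        fix x y assume "x \<in> M \<inter> cball c r" "y \<in> M \<inter> cball c r"
        then show "\<bar>(x - y) \<bullet> unit_normal M p\<bar> \<le> 1/2 * norm (x - y)" using R[OF p(1)] sub by blast
      qed (use r in auto)
    qed
  qed
qed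

lemma C1_surface_area_finite:
  fixes M :: "(real^'n) set"
  assumes "CARD('n) = m + 1" "C1_surface M" "compact (M \<inter> K)"
  shows "hausdorff_outer m (M \<inter> K) < \<infinity>"
proof -
  obtain C r0 where r0: "0 < r0" "\<And>c r. c \<in> M \<inter> K \<Longrightarrow> 0 < r \<Longrightarrow> r < r0 \<Longrightarrow> hausdorff_outer m (M \<inter> cball c r) \<le> ennreal (C * r ^ m)"
    using C1_surface_area_ratio[OF assms(1)] assms(2,3) by (metis inf_le1)
  obtain T where T: "finite T" "T \<subseteq> M \<inter> K" "M \<inter> K \<subseteq> (\<Union>c\<in>T. ball c (r0/2))"
    by (rule compactE_image[OF assms(3), of "M \<inter> K" "\<lambda>c. ball c (r0/2)"]) (use r0(1) in auto)
  have "M \<inter> K \<subseteq> (\<Union>c\<in>T. M \<inter> cball c (r0/2))" using T(3) by (force simp: subset_iff)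
  then have "hausdorff_outer m (M \<inter> K) \<le> hausdorff_outer m (\<Union>c\<in>T. M \<inter> cball c (r0/2))" by (rule hausdorff_outer_mono)
  also have "\<dots> \<le> (\<Sum>c\<in>T. hausdorff_outer m (M \<inter> cball c (r0/2)))" by (rule hausdorff_outer_finite_UN[OF T(1)])
  also have "\<dots> \<le> (\<Sum>c\<in>T. ennreal (C * (r0/2) ^ m))" proof (intro sum_mono r0(2))
    fix c assume "c \<in> T"
    then show "c \<in> M \<inter> K" using T(2) by blast
  qed (use r0(1) in auto)
  also have "\<dots> < \<infinity>" by (simp add: T(1) ennreal_mult_less_top of_nat_less_top)
  finally show ?thesis .
qed

text \<open>On a compact domain the inverse is continuous, so the image is a Borel preimage under
  it.\<close>

lemma borel_injective_image:
  fixes f :: "'a::euclidean_space \<Rightarrow> 'b::euclidean_space"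
  assumes K: "compact K" "continuous_on K f" "inj_on f K" and A: "A \<in> sets borel" "A \<subseteq> K"
  shows "f ` A \<in> sets borel"
proof -
  let ?g = "inv_into K f"
  have fK: "compact (f ` K)" by (rule compact_continuous_image[OF K(2,1)])
  have "continuous_on (f ` K) ?g" by (rule continuous_on_inv[OF K(2,1)]) (simp add: K(3))
  then have "?g \<in> borel_measurable (restrict_space borel (f ` K))" by (rule borel_measurable_continuous_on_restrict)
  then have "?g -` A \<inter> space (restrict_space borel (f ` K)) \<in> sets (restrict_space borel (f ` K))"
    using A(1) by (rule measurable_sets)
  moreover have "?g -` A \<inter> space (restrict_space borel (f ` K)) = f ` A"
    using A(2) K(3) by (auto simp: space_restrict_space image_iff)
  moreover have "f ` K \<in> sets borel" using fK by (simp add: compact_imp_closed)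
  ultimately show ?thesis by (auto simp: sets_restrict_space)
qed

text \<open>Near \<open>p\<close> the map \<open>\<phi>\<close> on \<open>M\<close> is, up to a
  Lipschitz factor close to 1, the projection to the tangent plane followed by \<open>L\<close>. The
  projection does not increase measure, and \<open>L\<close> scales measure on the plane by the
  length of the cofactor vector.\<close>

lemma local_area_bound:
  fixes M :: "(real^'n) set" and \<phi> :: "real^'n \<Rightarrow> real^'n"
  assumes card: "CARD('n) = m + 1" and M: "C1_surface M" and p: "p \<in> M"
    and cpt: "0 < r0" "compact (M \<inter> cball p r0)"
    and diff: "\<And>e. 0 < e \<Longrightarrow> \<exists>r>0. \<forall>x\<in>ball p r. \<forall>y\<in>ball p r. norm (\<phi> x - \<phi> y - L (x - y)) \<le> e * norm (x - y)"
    and L: "linear L" "inj L" and "0 < \<epsilon>"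
  shows "\<exists>r>0. \<forall>A\<in>sets borel. A \<subseteq> M \<inter> ball p r \<longrightarrow>
    hausdorff_outer m (\<phi> ` A) \<le> ennreal ((1 + \<epsilon>) * norm (cofactor L (unit_normal M p))) * hausdorff_outer m A"
proof -
  let ?\<nu> = "unit_normal M p"
  have \<nu>: "norm ?\<nu> = 1" using C1_surface_normal[OF M p] by simp
  have bl: "bounded_linear L" using L(1) by (simp add: linear_conv_bounded_linear)
  obtain B where B: "0 < B" "\<And>x. norm (L x) \<le> B * norm x" using bounded_linear.pos_bounded[OF bl] by (metis mult.commute)
  obtain c where c: "0 < c" "\<And>x. c * norm x \<le> norm (L x)" using linear_inj_bounded_below_pos[OF L] by metis
  \<comment> \<open>\<open>B\<close> and \<open>c\<close> bound \<open>L\<close> from above and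
    below. An error \<open>\<eta>\<close> in the flatness of \<open>M\<close> and in the
    linearisation of \<open>\<phi>\<close> leads to the Lipschitz constant
    \<open>1 + 2 (B + 1) \<eta> / c\<close>, whose \<open>m\<close>-th power must stay below
    \<open>1 + \<epsilon>\<close>.\<close>
  have "((\<lambda>\<eta>. (1 + 2 * (B + 1) * \<eta> / c) ^ m) \<longlongrightarrow> (1 + 2 * (B + 1) * 0 / c) ^ m) (at_right 0)"
    by (intro tendsto_intros) (use c in auto)
  then have "\<forall>\<^sub>F \<eta> in at_right 0. (1 + 2 * (B + 1) * \<eta> / c) ^ m < 1 + \<epsilon>"
    using \<open>0 < \<epsilon>\<close> by (intro order_tendstoD) auto
  moreover have "\<forall>\<^sub>F \<eta> in at_right (0::real). 0 < \<eta> \<and> \<eta> < 1/2"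
    by (auto simp: eventually_at_right_field intro!: exI[of _ "1/2"])
  ultimately have "\<forall>\<^sub>F \<eta> in at_right 0. (1 + 2 * (B + 1) * \<eta> / c) ^ m < 1 + \<epsilon> \<and> 0 < \<eta> \<and> \<eta> < 1/2"
    by eventually_elim auto
  then obtain \<eta> where \<eta>: "(1 + 2 * (B + 1) * \<eta> / c) ^ m < 1 + \<epsilon>" "0 < \<eta>" "\<eta> < 1/2"
    by (auto dest!: eventually_happens)
  obtain r1 where r1: "0 < r1" "\<And>x y. x \<in> M \<inter> ball p r1 \<Longrightarrow> y \<in> M \<inter> ball p r1 \<Longrightarrow> \<bar>(x - y) \<bullet> ?\<nu>\<bar> \<le> \<eta> * norm (x - y)"
    using C1_surface_flat[OF M p \<eta>(2)] by metis
  obtain r2 where r2: "0 < r2" "\<And>x y. x \<in> ball p r2 \<Longrightarrow> y \<in> ball p r2 \<Longrightarrow> norm (\<phi> x - \<phi> y - L (x - y)) \<le> \<eta> * norm (x - y)"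
    using diff[OF \<eta>(2)] by blast
  define r where "r = min (r0) (min (r1/2) r2)"
  have r: "0 < r" "r \<le> r0" "r \<le> r1/2" "r \<le> r2" using cpt(1) r1(1) r2(1) by (auto simp: r_def)
  let ?P = "project ?\<nu>" and ?\<Lambda> = "1 + 2 * (B + 1) * \<eta> / c"
  have \<Lambda>: "0 < ?\<Lambda>" using B(1) \<eta>(2) c(1) by (intro add_pos_pos divide_pos_pos) auto
  have proj: "norm (x - y) \<le> 2 * norm (?P x - ?P y)"
    if "x \<in> M \<inter> ball p r1" "y \<in> M \<inter> ball p r1" for x y
  proof -
    have "norm (x - y) \<le> norm (?P (x - y)) + \<eta> * norm (x - y)"
      using project_props(4)[OF \<nu>, of "x - y"] r1(2)[OF that] by linarith
    moreover have "\<eta> * norm (x - y) \<le> 1/2 * norm (x - y)" using \<eta>(3) by (intro mult_right_mono) auto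
    ultimately show ?thesis by (simp add: project_props(2)[OF \<nu>])
  qed
  show ?thesis
  proof (intro exI[of _ r] conjI r(1) ballI impI)
    fix A assume A: "A \<in> sets borel" "A \<subseteq> M \<inter> ball p r"
    have main: "dist (\<phi> x) (\<phi> y) \<le> ?\<Lambda> * dist ((L \<circ> ?P) x) ((L \<circ> ?P) y)" if x: "x \<in> A" and y: "y \<in> A" for x y
    proof -
      let ?d = "x - y"
      have in1: "x \<in> M \<inter> ball p r1" "y \<in> M \<inter> ball p r1" and in2: "x \<in> ball p r2" "y \<in> ball p r2"
        using x y A(2) r by auto
      have LP: "L (?P ?d) = L (?P x) - L (?P y)" by (simp add: project_props(2)[OF \<nu>] linear_diff[OF L(1)])
      have "L ?d = L (?P ?d) + (?d \<bullet> ?\<nu>) *\<^sub>R L ?\<nu>"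
        by (simp add: project_def linear_diff[OF L(1)] linear_scale[OF L(1)])
      then have "norm (L ?d) \<le> norm (L (?P ?d)) + \<bar>?d \<bullet> ?\<nu>\<bar> * norm (L ?\<nu>)" by (metis norm_triangle_ineq norm_scaleR real_norm_def)
      also have "\<bar>?d \<bullet> ?\<nu>\<bar> * norm (L ?\<nu>) \<le> (\<eta> * norm ?d) * B"
        using r1(2)[OF in1] B(2)[of ?\<nu>] \<nu> by (intro mult_mono) auto
      finally have 1: "norm (L ?d) \<le> norm (L (?P ?d)) + B * \<eta> * norm ?d" by (simp add: ac_simps)
      have "norm (\<phi> x - \<phi> y) \<le> norm (L ?d) + norm (\<phi> x - \<phi> y - L ?d)"
        using norm_triangle_ineq[of "L ?d" "\<phi> x - \<phi> y - L ?d"] by simp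
      then have 2: "norm (\<phi> x - \<phi> y) \<le> norm (L (?P ?d)) + (B + 1) * \<eta> * norm ?d"
        using 1 r2(2)[OF in2] by (simp add: algebra_simps)
      have "norm ?d \<le> 2 * norm (?P ?d)" using proj[OF in1] by (simp add: project_props(2)[OF \<nu>])
      also have "\<dots> \<le> 2 * (norm (L (?P ?d)) / c)" using c(2)[of "?P ?d"] c(1) by (simp add: field_simps)
      finally have "(B + 1) * \<eta> * norm ?d \<le> (B + 1) * \<eta> * (2 * (norm (L (?P ?d)) / c))"
        using B(1) \<eta>(2) by (intro mult_left_mono) auto
      then have "norm (\<phi> x - \<phi> y) \<le> norm (L (?P ?d)) + (B + 1) * \<eta> * (2 * (norm (L (?P ?d)) / c))" using 2 by linarith
      also have "\<dots> = ?\<Lambda> * norm (L (?P ?d))" by (simp add: algebra_simps)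
      finally show ?thesis by (simp add: dist_norm LP)
    qed
    have inj: "inj_on ?P (M \<inter> cball p r)"
    proof (rule inj_onI)
      fix x y assume "x \<in> M \<inter> cball p r" "y \<in> M \<inter> cball p r" "?P x = ?P y"
      moreover from this have "x \<in> M \<inter> ball p r1" "y \<in> M \<inter> ball p r1" using r r1(1) by auto
      ultimately show "x = y" using proj[of x y] by simp
    qed
    have cK: "compact (M \<inter> cball p r)"
    proof -
      have "M \<inter> cball p r = (M \<inter> cball p r0) \<inter> cball p r" using r(2) by auto
      then show ?thesis using cpt(2) by (metis compact_Int_closed closed_cball)
    qed
    have PA: "?P ` A \<in> sets borel"
    proof (rule borel_injective_image[OF cK _ inj A(1)])
      show "continuous_on (M \<inter> cball p r) ?P" unfolding project_def by (intro continuous_intros)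
      show "A \<subseteq> M \<inter> cball p r" using A(2) by auto
    qed
    have "hausdorff_outer m (\<phi> ` A) \<le> ennreal (?\<Lambda> ^ m) * hausdorff_outer m ((L \<circ> ?P) ` A)"
      by (rule hausdorff_outer_relative_lipschitz[OF main \<Lambda>])
    also have "(L \<circ> ?P) ` A = L ` (?P ` A)" by (simp add: image_comp)
    also have "hausdorff_outer m (L ` (?P ` A)) = ennreal (norm (cofactor L ?\<nu>)) * hausdorff_outer m (?P ` A)"
      using project_props(1)[OF \<nu>] by (intro hausdorff_outer_linear_image_hyperplane[OF card L \<nu> _ PA] cofactor_inner L \<nu>) auto
    also have "hausdorff_outer m (?P ` A) \<le> ennreal (1 ^ m) * hausdorff_outer m ((\<lambda>x. x) ` A)"
      by (rule hausdorff_outer_relative_lipschitz)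
        (auto simp: dist_norm project_props(2)[OF \<nu>, symmetric] intro: project_props(3)[OF \<nu>])
    also have "ennreal (?\<Lambda> ^ m) * (ennreal (norm (cofactor L ?\<nu>)) * (ennreal (1 ^ m) * hausdorff_outer m ((\<lambda>x. x) ` A)))
        = ennreal (?\<Lambda> ^ m * norm (cofactor L ?\<nu>)) * hausdorff_outer m A"
      using \<Lambda> by (simp add: ennreal_mult mult.assoc)
    also have "\<dots> \<le> ennreal ((1 + \<epsilon>) * norm (cofactor L ?\<nu>)) * hausdorff_outer m A"
      using \<eta>(1) by (intro mult_right_mono ennreal_leI) auto
    finally show "hausdorff_outer m (\<phi> ` A) \<le> ennreal ((1 + \<epsilon>) * norm (cofactor L ?\<nu>)) * hausdorff_outer m A"
      by (simp add: mult_left_mono)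
  qed
qed

text \<open>Upper half of a change of variables: on small pieces \<open>v\<close> and
  \<open>J\<close> are constant up to a factor \<open>\<theta> > 1\<close> and \<open>loc\<close>
  compares measures; countably many disjoint pieces exhaust \<open>S\<close>, and finally
  \<open>\<theta>\<close> tends to 1.\<close>

lemma integral_image_le:
  fixes \<phi> :: "real^'n \<Rightarrow> real^'n" and v J :: "real^'n \<Rightarrow> real" and u :: "real^'n \<Rightarrow> ennreal"
  assumes S: "S \<in> sets borel" and cv: "continuous_on S v" and cJ: "continuous_on S J"
    and pos: "\<And>x. x \<in> S \<Longrightarrow> 0 < v x" "\<And>x. x \<in> S \<Longrightarrow> 0 < J x"
    and u: "\<And>x. x \<in> S \<Longrightarrow> u (\<phi> x) = ennreal (v x)"
    and um: "(\<lambda>y. u y * indicator (\<phi> ` S) y) \<in> borel_measurable borel"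
    and img: "\<And>A. A \<in> sets borel \<Longrightarrow> \<phi> ` A \<in> sets borel"
    and loc: "\<And>x \<epsilon>. x \<in> S \<Longrightarrow> 0 < \<epsilon> \<Longrightarrow> \<exists>r>0. \<forall>A\<in>sets borel. A \<subseteq> S \<inter> ball x r \<longrightarrow>
      hausdorff_outer m (\<phi> ` A) \<le> ennreal ((1 + \<epsilon>) * J x) * hausdorff_outer m A"
  shows "(\<integral>\<^sup>+y. u y * indicator (\<phi> ` S) y \<partial>hausdorff_measure m) \<le> (\<integral>\<^sup>+x. ennreal (v x * J x) * indicator S x \<partial>hausdorff_measure m)"
    (is "?I \<le> ?X")
proof -
  let ?H = "hausdorff_measure m :: (real^'n) measure"
  have vJm: "(\<lambda>x. ennreal (v x * J x) * indicator S x) \<in> borel_measurable borel"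
  proof -
    have "(\<lambda>x. indicator S x *\<^sub>R (v x * J x)) \<in> borel_measurable borel"
      by (intro borel_measurable_continuous_on_indicator S continuous_intros cv cJ)
    then have "(\<lambda>x. ennreal (indicator S x *\<^sub>R (v x * J x))) \<in> borel_measurable borel" by simp
    also have "(\<lambda>x. ennreal (indicator S x *\<^sub>R (v x * J x))) = (\<lambda>x. ennreal (v x * J x) * indicator S x)"
      by (auto simp: fun_eq_iff indicator_def)
    finally show ?thesis .
  qed
  \<comment> \<open>The fourth power counts four comparisons: \<open>v\<close> is replaced by its
    value at the centre and back again, \<open>J\<close> is replaced once, and \<open>loc\<close> is
    used with \<open>1 + \<epsilon> = \<theta>\<close>.\<close>
  have step: "?I \<le> ennreal (\<theta> ^ 4) * ?X" if "1 < \<theta>" for \<theta>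
  proof (cases "S = {}")
    case False
    define good where "good A \<longleftrightarrow> (\<integral>\<^sup>+y. u y * indicator (\<phi> ` A) y \<partial>?H) \<le> ennreal (\<theta> ^ 4) * (\<integral>\<^sup>+x. ennreal (v x * J x) * indicator A x \<partial>?H)" for A
    have "\<exists>r>0. \<forall>A\<in>sets borel. A \<subseteq> S \<inter> ball x r \<longrightarrow> good A" if x: "x \<in> S" for x
    proof -
      obtain r1 where r1: "0 < r1" "\<And>A. A \<in> sets borel \<Longrightarrow> A \<subseteq> S \<inter> ball x r1 \<Longrightarrow>
          hausdorff_outer m (\<phi> ` A) \<le> ennreal (\<theta> * J x) * hausdorff_outer m A"
        using loc[OF x, of "\<theta> - 1"] \<open>1 < \<theta>\<close> by auto
      have vlim: "(v \<longlongrightarrow> v x) (at x within S)" and Jlim: "(J \<longlongrightarrow> J x) (at x within S)"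
        using cv cJ x by (auto simp: continuous_on_def)
      have vx: "0 < v x" "v x < \<theta> * v x" "v x / \<theta> < v x" and Jx: "0 < J x" "J x / \<theta> < J x"
        using pos[OF x] \<open>1 < \<theta>\<close> by (auto simp: field_simps)
      have "\<forall>\<^sub>F y in at x within S. v y < \<theta> * v x \<and> v x / \<theta> < v y \<and> J x / \<theta> < J y"
        using order_tendstoD(2)[OF vlim vx(2)] order_tendstoD(1)[OF vlim vx(3)] order_tendstoD(1)[OF Jlim Jx(2)]
        by eventually_elim auto
      then obtain r2 where r2: "0 < r2" "\<And>y. y \<in> S \<Longrightarrow> y \<noteq> x \<Longrightarrow> dist y x < r2 \<Longrightarrow> v y < \<theta> * v x \<and> v x / \<theta> < v y \<and> J x / \<theta> < J y"
        unfolding eventually_at by blast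
      have near: "v y \<le> \<theta> * v x" "v x \<le> \<theta> * v y" "J x \<le> \<theta> * J y" if "y \<in> S \<inter> ball x r2" for y
        using r2(2)[of y] that vx Jx \<open>1 < \<theta>\<close> by (cases "y = x"; auto simp: dist_commute field_simps)+
      show ?thesis
      proof (intro exI[of _ "min r1 r2"] conjI ballI impI)
        fix A assume A: "A \<in> sets borel" "A \<subseteq> S \<inter> ball x (min r1 r2)"
        have "(\<integral>\<^sup>+y. u y * indicator (\<phi> ` A) y \<partial>?H) \<le> (\<integral>\<^sup>+y. ennreal (\<theta> * v x) * indicator (\<phi> ` A) y \<partial>?H)"
        proof (rule nn_integral_mono)
          fix y
          show "u y * indicator (\<phi> ` A) y \<le> ennreal (\<theta> * v x) * indicator (\<phi> ` A) y"
          proof (cases "y \<in> \<phi> ` A")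
            case True
            then obtain z where z: "z \<in> A" "y = \<phi> z" by auto
            then have "z \<in> S" "z \<in> S \<inter> ball x r2" using A(2) by auto
            then show ?thesis using near(1)[of z] u[of z] z by (auto intro: ennreal_leI)
          qed simp
        qed
        also have "\<dots> = ennreal (\<theta> * v x) * hausdorff_outer m (\<phi> ` A)"
          using A(1) by (subst nn_integral_cmult_indicator) (auto simp: img borel_sets_hausdorff_measure emeasure_hausdorff_borel)
        also have "\<dots> \<le> ennreal (\<theta> * v x) * (ennreal (\<theta> * J x) * hausdorff_outer m A)"
          using A by (intro mult_left_mono r1(2)) auto
        also have "\<dots> = ennreal (\<theta> * v x * (\<theta> * J x)) * emeasure ?H A"
          using vx Jx \<open>1 < \<theta>\<close> A(1) by (simp add: ennreal_mult mult.assoc emeasure_hausdorff_borel)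
        also have "\<dots> = (\<integral>\<^sup>+y. ennreal (\<theta> * v x * (\<theta> * J x)) * indicator A y \<partial>?H)"
          using A(1) by (subst nn_integral_cmult_indicator) (auto simp: borel_sets_hausdorff_measure)
        also have "\<dots> \<le> (\<integral>\<^sup>+y. ennreal (\<theta> ^ 4) * (ennreal (v y * J y) * indicator A y) \<partial>?H)"
        proof (rule nn_integral_mono)
          fix y
          show "ennreal (\<theta> * v x * (\<theta> * J x)) * indicator A y \<le> ennreal (\<theta> ^ 4) * (ennreal (v y * J y) * indicator A y)"
          proof (cases "y \<in> A")
            case True
            then have y: "y \<in> S" "y \<in> S \<inter> ball x r2" using A(2) by auto
            have p: "0 < v y" "0 < J y" using pos[OF y(1)] by auto
            have "(\<theta> * v x) * (\<theta> * J x) \<le> (\<theta> * (\<theta> * v y)) * (\<theta> * (\<theta> * J y))"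
              using near(2,3)[OF y(2)] vx Jx p \<open>1 < \<theta>\<close> by (intro mult_mono mult_left_mono) auto
            also have "\<dots> = \<theta> ^ 4 * (v y * J y)" by (simp add: power4_eq_xxxx ac_simps)
            finally have "ennreal (\<theta> * v x * (\<theta> * J x)) \<le> ennreal (\<theta> ^ 4 * (v y * J y))" by (rule ennreal_leI)
            then show ?thesis using True p \<open>1 < \<theta>\<close> by (simp add: ennreal_mult)
          qed simp
        qed
        also have "\<dots> = ennreal (\<theta> ^ 4) * (\<integral>\<^sup>+x. ennreal (v x * J x) * indicator A x \<partial>?H)"
        proof (rule nn_integral_cmult)
          have "(\<lambda>x. ennreal (v x * J x) * indicator S x * indicator A x) \<in> borel_measurable borel"
            using vJm A(1) by measurable
          also have "(\<lambda>x. ennreal (v x * J x) * indicator S x * indicator A x) = (\<lambda>x. ennreal (v x * J x) * indicator A x)"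
            using A(2) by (auto simp: fun_eq_iff indicator_def)
          finally show "(\<lambda>x. ennreal (v x * J x) * indicator A x) \<in> borel_measurable ?H" by (rule measurable_hausdorff_measure)
        qed
        finally show "good A" unfolding good_def .
      qed (use r1 r2 in auto)
    qed
    then obtain R where R: "\<And>x. x \<in> S \<Longrightarrow> 0 < R x" "\<And>x A. x \<in> S \<Longrightarrow> A \<in> sets borel \<Longrightarrow> A \<subseteq> S \<inter> ball x (R x) \<Longrightarrow> good A"
      by metis
    obtain F' where F': "F' \<subseteq> (\<lambda>x. ball x (R x)) ` S" "countable F'" "\<Union>F' = \<Union> ((\<lambda>x. ball x (R x)) ` S)"
      by (rule Lindelof[of "(\<lambda>x. ball x (R x)) ` S"]) auto
    have SF: "S \<subseteq> \<Union>F'"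
    proof
      fix x assume "x \<in> S"
      then have "x \<in> ball x (R x)" using R(1) by simp
      then show "x \<in> \<Union>F'" unfolding F'(3) using \<open>x \<in> S\<close> by blast
    qed
    then have "F' \<noteq> {}" using False by auto
    define B where "B = from_nat_into F'"
    have B: "range B = F'" unfolding B_def by (rule range_from_nat_into[OF \<open>F' \<noteq> {}\<close> F'(2)])
    define A where "A n = S \<inter> disjointed B n" for n
    have "\<exists>x\<in>S. B n = ball x (R x)" for n using B F'(1) by blast
    then obtain X where X: "\<And>n. X n \<in> S" "\<And>n. B n = ball (X n) (R (X n))" by metis
    have Bm: "range B \<subseteq> sets borel" using X(2) by auto
    have Am: "A n \<in> sets borel" for n
      unfolding A_def using S sets.range_disjointed_sets[OF Bm] by auto
    have Asub: "A n \<subseteq> S \<inter> ball (X n) (R (X n))" for n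
      unfolding A_def using disjointed_subset[of B n] X(2) by auto
    have AS: "S = (\<Union>n. A n)" unfolding A_def using SF UN_disjointed_eq[of B] B by auto
    have dA: "disjoint_family A" unfolding A_def using disjoint_family_disjointed[of B]
      by (auto simp: disjoint_family_on_def)
    have ums: "(\<lambda>y. u y * indicator (\<phi> ` A n) y) \<in> borel_measurable ?H" for n
    proof -
      have [measurable]: "\<phi> ` A n \<in> sets borel" by (rule img[OF Am])
      have "(\<lambda>y. u y * indicator (\<phi> ` S) y * indicator (\<phi> ` A n) y) \<in> borel_measurable borel" using um by measurable
      also have "(\<lambda>y. u y * indicator (\<phi> ` S) y * indicator (\<phi> ` A n) y) = (\<lambda>y. u y * indicator (\<phi> ` A n) y)"
        using Asub[of n] by (auto simp: fun_eq_iff indicator_def)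
      finally show ?thesis by (rule measurable_hausdorff_measure)
    qed
    have term_le: "f n \<le> suminf f" for f :: "nat \<Rightarrow> ennreal" and n
      using sum_le_suminf[of f "{n}"] by simp
    \<comment> \<open>The pieces are disjoint but their images may overlap, because
      \<open>\<phi>\<close> is not assumed injective; hence an inequality.\<close>
    have "?I \<le> (\<integral>\<^sup>+y. (\<Sum>n. u y * indicator (\<phi> ` A n) y) \<partial>?H)"
    proof (rule nn_integral_mono)
      fix y
      show "u y * indicator (\<phi> ` S) y \<le> (\<Sum>n. u y * indicator (\<phi> ` A n) y)"
      proof (cases "y \<in> \<phi> ` S")
        case True
        then obtain n where "y \<in> \<phi> ` A n" using AS by blast
        then have "u y * indicator (\<phi> ` S) y \<le> (\<lambda>n. u y * indicator (\<phi> ` A n) y) n" using True by simp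
        also have "\<dots> \<le> (\<Sum>n. u y * indicator (\<phi> ` A n) y)"
          by (rule term_le)
        finally show ?thesis .
      qed simp
    qed
    also have "\<dots> = (\<Sum>n. \<integral>\<^sup>+y. u y * indicator (\<phi> ` A n) y \<partial>?H)" by (rule nn_integral_suminf[OF ums])
    also have "\<dots> \<le> (\<Sum>n. ennreal (\<theta> ^ 4) * (\<integral>\<^sup>+x. ennreal (v x * J x) * indicator (A n) x \<partial>?H))"
      using R(2)[OF X(1) Am Asub] unfolding good_def by (intro suminf_le) auto
    also have "\<dots> = ennreal (\<theta> ^ 4) * (\<Sum>n. \<integral>\<^sup>+x. ennreal (v x * J x) * indicator (A n) x \<partial>?H)" by simp
    also have "(\<Sum>n. \<integral>\<^sup>+x. ennreal (v x * J x) * indicator (A n) x \<partial>?H) = ?X"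
    proof -
      have e: "(\<lambda>x. ennreal (v x * J x) * indicator S x * indicator (A n) x) = (\<lambda>x. ennreal (v x * J x) * indicator (A n) x)" for n
        using Asub[of n] by (auto simp: fun_eq_iff indicator_def)
      have "(\<Sum>n. \<integral>\<^sup>+x. ennreal (v x * J x) * indicator S x * indicator (A n) x \<partial>?H)
          = (\<integral>\<^sup>+x. ennreal (v x * J x) * indicator S x * indicator (\<Union>n. A n) x \<partial>?H)"
        by (rule nn_integral_disjoint_family[symmetric])
          (use vJm dA Am in \<open>auto intro: measurable_hausdorff_measure borel_sets_hausdorff_measure\<close>)
      also have "\<dots> = ?X" unfolding AS[symmetric] by (intro nn_integral_cong) (simp add: indicator_def)
      finally show ?thesis by (simp only: e)
    qed
    finally show ?thesis .
  qed simp
  show ?thesis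
  \<comment> \<open>An infinite right side is trivial. Otherwise \<open>\<theta> = 2\<close> shows
    that the left side is finite, and the limit \<open>\<theta> \<rightarrow> 1\<close> can be taken
    in the reals.\<close>
  proof (cases ?X rule: ennreal_cases)
    case (real x)
    have "?I \<le> ennreal (2 ^ 4 * x)" using step[of 2] real by (simp add: ennreal_mult del: ennreal_numeral)
    then have "?I < top" by (rule order_le_less_trans) simp
    then obtain y where y: "0 \<le> y" "?I = ennreal y" by (cases ?I rule: ennreal_cases) auto
    have "y \<le> \<theta> ^ 4 * x" if "1 < \<theta>" for \<theta>
      using step[OF that] that unfolding y(2) real(2) using real(1) by (simp add: ennreal_mult[symmetric] ennreal_le_iff)
    then have "\<forall>\<^sub>F \<theta> in at_right 1. y \<le> \<theta> ^ 4 * x"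
      by (auto simp: eventually_at_right_field intro!: exI[of _ 2])
    moreover have "((\<lambda>\<theta>. \<theta> ^ 4 * x) \<longlongrightarrow> 1 ^ 4 * x) (at_right (1::real))" by (intro tendsto_intros)
    ultimately have "y \<le> 1 ^ 4 * x" by (intro tendsto_lowerbound) auto
    then show ?thesis unfolding y(2) real(2) by (intro ennreal_leI) simp
  qed simp
qed

section \<open>First variation\<close>

lemma adjoint_blinfun_components:
  fixes A :: "(real^'n) \<Rightarrow>\<^sub>L (real^'n)"
  shows "adjoint A x = (\<chi> j. x \<bullet> A (axis j 1))"
proof -
  have lA: "linear A" by (simp add: linear_conv_bounded_linear blinfun.bounded_linear_right)
  have "adjoint A x $ j = adjoint A x \<bullet> axis j 1" for j by (simp add: inner_axis)
  then show ?thesis by (simp add: vec_eq_iff adjoint_clauses(2)[OF lA])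
qed

lemma cofactor_minus:
  fixes L :: "real^'n \<Rightarrow> real^'n"
  assumes L: "linear L" "inj L" and \<nu>: "norm \<nu> = 1"
  shows "cofactor L (- \<nu>) = - cofactor L \<nu>" "cofactor L \<nu> \<noteq> 0"
proof -
  have \<nu>': "norm (- \<nu>) = 1" using \<nu> by simp
  obtain w where w: "L w = cofactor L (- \<nu>) + cofactor L \<nu>" using linear_injective_imp_surjective[OF L] by (metis surjD)
  have "(cofactor L (- \<nu>) + cofactor L \<nu>) \<bullet> L w = 0"
    unfolding inner_add_left cofactor_inner[OF L \<nu>] cofactor_inner[OF L \<nu>'] by simp
  then show "cofactor L (- \<nu>) = - cofactor L \<nu>" unfolding w by (simp add: eq_neg_iff_add_eq_0)
  have "cofactor L \<nu> \<bullet> L \<nu> \<noteq> 0"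
    unfolding cofactor_inner[OF L \<nu>] using det_nz_iff_inj[OF L(1)] L(2) inner_self_unit[OF \<nu>] by simp
  then show "cofactor L \<nu> \<noteq> 0" by auto
qed

lemma velocity_image:
  fixes f :: "real^'n \<Rightarrow> real^'n"
  assumes f: "(f has_derivative f') (at p)" and v: "velocity M p v"
  shows "velocity (f ` M) (f p) (f' v)"
proof -
  obtain \<gamma> :: "real \<Rightarrow> real^'n" where \<gamma>: "\<gamma> 0 = p" "\<forall>\<^sub>F t in at_right 0. \<gamma> t \<in> M" "(\<gamma> has_vector_derivative v) (at_right 0)"
    using v by (auto simp: velocity_def)
  have "(f has_derivative f') (at (\<gamma> 0) within \<gamma> ` {0<..})" using f \<gamma>(1) by (auto intro: has_derivative_at_withinI)
  then have "((f \<circ> \<gamma>) has_vector_derivative f' v) (at_right 0)"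
    by (rule vector_derivative_diff_chain_within[OF \<gamma>(3)])
  moreover have "\<forall>\<^sub>F t in at_right 0. (f \<circ> \<gamma>) t \<in> f ` M" using \<gamma>(2) by eventually_elim auto
  ultimately show ?thesis unfolding velocity_def using \<gamma>(1) by (intro exI[of _ "f \<circ> \<gamma>"]) auto
qed

locale integrand =
  fixes \<Omega> :: "(real^'n) set" and F :: "real^'n \<Rightarrow> real^'n \<Rightarrow> real"
    and F' :: "(real^'n) \<times> (real^'n) \<Rightarrow> ((real^'n) \<times> (real^'n)) \<Rightarrow>\<^sub>L real"
  assumes open_domain: "open \<Omega>"
    and deriv_F: "\<And>z. z \<in> \<Omega> \<times> (UNIV - {0}) \<Longrightarrow> ((\<lambda>(x, \<nu>). F x \<nu>) has_derivative blinfun_apply (F' z)) (at z)"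
    and cont_F': "continuous_on (\<Omega> \<times> (UNIV - {0})) F'"
    and F_pos: "\<And>x \<nu>. x \<in> \<Omega> \<Longrightarrow> \<nu> \<noteq> 0 \<Longrightarrow> 0 < F x \<nu>"
    and F_scale: "\<And>x \<nu> c. x \<in> \<Omega> \<Longrightarrow> \<nu> \<noteq> 0 \<Longrightarrow> c \<noteq> 0 \<Longrightarrow> F x (c *\<^sub>R \<nu>) = \<bar>c\<bar> * F x \<nu>"
begin

text \<open>The derivative at \<open>t = 0\<close> of
  \<open>F (x + t v) (cofactor (I + t A) \<nu>)\<close>. By homogeneity, evaluating \<open>F\<close>
  at the unnormalised cofactor vector yields energy density and area element at once, so no separate
  Jacobian has to be differentiated.\<close>

definition first_variation :: "real^'n \<Rightarrow> real^'n \<Rightarrow> real^'n \<Rightarrow> ((real^'n) \<Rightarrow>\<^sub>L (real^'n)) \<Rightarrow> real" where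
  "first_variation x \<nu> v A = F' (x, \<nu>) (v, tr A *\<^sub>R \<nu> - adjoint A \<nu>)"

lemma open_phase: "open (\<Omega> \<times> (UNIV - {0} :: (real^'n) set))"
  by (intro open_Times open_domain open_delete) simp

lemma cont_F: "continuous_on (\<Omega> \<times> (UNIV - {0})) (\<lambda>(x, \<nu>). F x \<nu>)"
  by (intro continuous_at_imp_continuous_on ballI) (rule has_derivative_continuous[OF deriv_F])

lemma F_even: "x \<in> \<Omega> \<Longrightarrow> \<nu> \<noteq> 0 \<Longrightarrow> F x (- \<nu>) = F x \<nu>"
  using F_scale[of x \<nu> "-1"] by simp

lemma F'_even:
  assumes "x \<in> \<Omega>" "\<nu> \<noteq> 0" shows "F' (x, - \<nu>) (v, - w) = F' (x, \<nu>) (v, w)"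
proof -
  have z: "(x, - \<nu>) \<in> \<Omega> \<times> (UNIV - {0})" "(x, \<nu>) \<in> \<Omega> \<times> (UNIV - {0})" using assms by auto
  have "((\<lambda>z. (fst z, - snd z)) has_derivative (\<lambda>z. (fst z, - snd z))) (at (x, \<nu>))"
    by (auto intro!: derivative_eq_intros)
  moreover have "((\<lambda>(x, \<nu>). F x \<nu>) has_derivative blinfun_apply (F' (x, - \<nu>))) (at (fst (x, \<nu>), - snd (x, \<nu>)))"
    using deriv_F[OF z(1)] by simp
  ultimately have "((\<lambda>z. (\<lambda>(x, \<nu>). F x \<nu>) (fst z, - snd z)) has_derivative (\<lambda>z. F' (x, - \<nu>) (fst z, - snd z))) (at (x, \<nu>))"
    by (rule has_derivative_compose)
  then have "((\<lambda>(x, \<nu>). F x \<nu>) has_derivative (\<lambda>z. F' (x, - \<nu>) (fst z, - snd z))) (at (x, \<nu>))"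
  proof (rule has_derivative_transform_within_open[OF _ open_phase z(2)])
    fix y assume "y \<in> \<Omega> \<times> (UNIV - {0 :: real^'n})"
    then show "(\<lambda>(x, \<nu>). F x \<nu>) (fst y, - snd y) = (\<lambda>(x, \<nu>). F x \<nu>) y" by (cases y) (simp add: F_even)
  qed
  then have "(\<lambda>z. F' (x, - \<nu>) (fst z, - snd z)) = blinfun_apply (F' (x, \<nu>))"
    using deriv_F[OF z(2)] by (rule has_derivative_unique)
  from fun_cong[OF this, of "(v, w)"] show ?thesis by simp
qed

lemma first_variation_even:
  assumes "x \<in> \<Omega>" "\<nu> \<noteq> 0" shows "first_variation x (- \<nu>) v A = first_variation x \<nu> v A"
proof -
  have "tr A *\<^sub>R (- \<nu>) - adjoint A (- \<nu>) = - (tr A *\<^sub>R \<nu> - adjoint A \<nu>)"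
    by (simp add: adjoint_blinfun_components vec_eq_iff)
  then show ?thesis unfolding first_variation_def using F'_even[OF assms] by metis
qed

lemma first_variation_expansion:
  assumes "compact K" "K \<subseteq> \<Omega>" "0 \<le> R" "0 < e"
  obtains d where "0 < d"
    "\<And>x \<nu> v A t. x \<in> K \<Longrightarrow> norm \<nu> = 1 \<Longrightarrow> norm v \<le> R \<Longrightarrow> norm A \<le> R \<Longrightarrow> \<bar>t\<bar> < d \<Longrightarrow>
      F (x + t *\<^sub>R v) (cofactor (id_blinfun + t *\<^sub>R A) \<nu>) \<le> F x \<nu> + t * first_variation x \<nu> v A + e * \<bar>t\<bar>"
proof -
  let ?S = "\<Omega> \<times> (UNIV - {0} :: (real^'n) set)" and ?K = "K \<times> sphere (0 :: real^'n) 1"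
  have cK: "compact ?K" and KS: "?K \<subseteq> ?S" using assms by (auto intro: compact_Times)
  have "bounded (F' ` ?K)"
    by (intro compact_imp_bounded compact_continuous_image cK continuous_on_subset[OF cont_F'] KS)
  then obtain B where B: "0 < B" "\<And>z. z \<in> ?K \<Longrightarrow> norm (F' z) \<le> B" by (auto simp: bounded_pos)
  \<comment> \<open>\<open>C |t|\<close> bounds the distance between \<open>(x, \<nu>)\<close> and
    its deformed counterpart. Half of the error \<open>e\<close> goes to the linearisation of
    \<open>F\<close> through \<open>e1\<close>, half to that of the cofactor through
    \<open>e2\<close>, multiplied by the bound \<open>B\<close> of \<open>F'\<close>.\<close>
  define C where "C = R + (real CARD('n) * R + R) + 1"
  have C: "0 < C" using assms(3) by (simp add: C_def add_nonneg_pos)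
  define e1 where "e1 = e / (2 * C)"
  define e2 where "e2 = min 1 (e / (2 * B))"
  have e12: "0 < e1" "0 < e2" "e2 \<le> 1" "e1 * C = e / 2" "B * e2 \<le> e / 2"
    using assms(4) C B(1) by (auto simp: e1_def e2_def min_def field_simps)
  obtain r where r: "0 < r" "\<And>z y. z \<in> ?K \<Longrightarrow> norm (y - z) < r \<Longrightarrow> y \<in> ?S \<and>
      norm ((\<lambda>(x, \<nu>). F x \<nu>) y - (\<lambda>(x, \<nu>). F x \<nu>) z - F' z (y - z)) \<le> e1 * norm (y - z)"
    using C1_uniform_differentiability[OF open_phase cK KS deriv_F cont_F' e12(1)] by metis
  obtain d1 where d1: "0 < d1"
    "\<And>(A :: (real^'n) \<Rightarrow>\<^sub>L (real^'n)) \<nu> t. norm A \<le> R \<Longrightarrow> norm \<nu> = 1 \<Longrightarrow> \<bar>t\<bar> < d1 \<Longrightarrow>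
       norm (cofactor (id_blinfun + t *\<^sub>R A) \<nu> - \<nu> - t *\<^sub>R (tr A *\<^sub>R \<nu> - adjoint A \<nu>)) \<le> e2 * \<bar>t\<bar>"
    using cofactor_expansion[OF e12(2) assms(3)] by metis
  show thesis
  proof (rule that)
    show "0 < min d1 (r / C)" using d1(1) r(1) C by simp
    fix x \<nu> v :: "real^'n" and A :: "(real^'n) \<Rightarrow>\<^sub>L (real^'n)" and t :: real
    assume x: "x \<in> K" and \<nu>: "norm \<nu> = 1" and v: "norm v \<le> R" and A: "norm A \<le> R" and t: "\<bar>t\<bar> < min d1 (r / C)"
    let ?n = "cofactor (id_blinfun + t *\<^sub>R A) \<nu>" and ?w = "tr A *\<^sub>R \<nu> - adjoint A \<nu>"
    have n: "norm (?n - \<nu> - t *\<^sub>R ?w) \<le> e2 * \<bar>t\<bar>" using d1(2)[OF A \<nu>] t by simp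
    have "norm ?w \<le> \<bar>tr A\<bar> * norm \<nu> + norm (adjoint A \<nu>)" using norm_triangle_ineq4[of "tr A *\<^sub>R \<nu>" "adjoint A \<nu>"] by simp
    also have "\<bar>tr A\<bar> * norm \<nu> \<le> real CARD('n) * R"
    proof -
      have "real CARD('n) * norm A \<le> real CARD('n) * R" using A by (intro mult_left_mono) auto
      then show ?thesis unfolding \<nu> mult_1_right by (rule order_trans[OF abs_tr_le])
    qed
    also have "norm (adjoint A \<nu>) \<le> R" using norm_adjoint_blinfun[of A \<nu>] A \<nu> by simp
    finally have w: "norm ?w \<le> real CARD('n) * R + R" by simp
    let ?z = "(x, \<nu>)" and ?y = "(x + t *\<^sub>R v, ?n)"
    have z: "?z \<in> ?K" using x \<nu> by simp
    have yz: "?y - ?z = t *\<^sub>R (v, ?w) + (0, ?n - \<nu> - t *\<^sub>R ?w)" by simp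
    have "norm (v, ?w) \<le> norm v + norm ?w" by (rule norm_Pair_le)
    then have "norm (v, ?w) \<le> R + (real CARD('n) * R + R)" using v w by linarith
    then have "norm (t *\<^sub>R (v, ?w)) \<le> \<bar>t\<bar> * (R + (real CARD('n) * R + R))"
      unfolding norm_scaleR by (intro mult_left_mono) auto
    moreover have "norm (0 :: real^'n, ?n - \<nu> - t *\<^sub>R ?w) \<le> 1 * \<bar>t\<bar>"
      using n e12(3) mult_right_mono[OF e12(3), of "\<bar>t\<bar>"] by (simp add: norm_Pair)
    ultimately have le: "norm (?y - ?z) \<le> \<bar>t\<bar> * C"
      unfolding yz using norm_triangle_ineq[of "t *\<^sub>R (v, ?w)" "(0, ?n - \<nu> - t *\<^sub>R ?w)"]
      unfolding C_def by (simp add: algebra_simps)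
    also have "\<dots> < r" using t C by (simp add: pos_less_divide_eq)
    finally have lt: "norm (?y - ?z) < r" .
    have "norm (F (x + t *\<^sub>R v) ?n - F x \<nu> - F' ?z (?y - ?z)) \<le> e1 * norm (?y - ?z)" using r(2)[OF z lt] by simp
    also have "\<dots> \<le> e1 * (\<bar>t\<bar> * C)" using le e12(1) by (intro mult_left_mono) auto
    also have "\<dots> = e / 2 * \<bar>t\<bar>" using e12(4) by (simp add: ac_simps)
    finally have 1: "norm (F (x + t *\<^sub>R v) ?n - F x \<nu> - F' ?z (?y - ?z)) \<le> e / 2 * \<bar>t\<bar>" .
    have "F' ?z (?y - ?z) = t * first_variation x \<nu> v A + F' ?z (0, ?n - \<nu> - t *\<^sub>R ?w)"
      unfolding yz first_variation_def by (simp only: blinfun.bilinear_simps real_scaleR_def)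
    moreover have "\<bar>F' ?z (0, ?n - \<nu> - t *\<^sub>R ?w)\<bar> \<le> B * (e2 * \<bar>t\<bar>)"
    proof -
      have "\<bar>F' ?z (0, ?n - \<nu> - t *\<^sub>R ?w)\<bar> \<le> norm (F' ?z) * norm (?n - \<nu> - t *\<^sub>R ?w)"
        using norm_blinfun[of "F' ?z" "(0, ?n - \<nu> - t *\<^sub>R ?w)"] by (simp add: norm_Pair)
      also have "\<dots> \<le> B * (e2 * \<bar>t\<bar>)" using B(2)[OF z] B(1) n by (intro mult_mono) auto
      finally show ?thesis .
    qed
    moreover have "B * (e2 * \<bar>t\<bar>) \<le> e / 2 * \<bar>t\<bar>" using mult_right_mono[OF e12(5), of "\<bar>t\<bar>"] by (simp add: mult.assoc)
    moreover have "y \<le> f + r + (k + k)" if "p = r + q" "\<bar>q\<bar> \<le> h" "h \<le> k" "norm (y - f - p) \<le> k" for y f p q r h k :: real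
      using that unfolding real_norm_def by linarith
    ultimately have "F (x + t *\<^sub>R v) ?n \<le> F x \<nu> + t * first_variation x \<nu> v A + (e / 2 * \<bar>t\<bar> + e / 2 * \<bar>t\<bar>)"
      using 1 by blast
    then show "F (x + t *\<^sub>R v) ?n \<le> F x \<nu> + t * first_variation x \<nu> v A + e * \<bar>t\<bar>" by simp
  qed
qed

end

lemma set_integrable_hausdorff:
  fixes h :: "real^'n \<Rightarrow> real"
  assumes "S \<in> sets borel" "continuous_on S h" "\<And>x. x \<in> S \<Longrightarrow> \<bar>h x\<bar> \<le> B" "hausdorff_outer m S < \<infinity>"
  shows "set_integrable (hausdorff_measure m) S h"
proof -
  have "integrable (hausdorff_measure m) (\<lambda>x. indicator S x *\<^sub>R (indicator S x *\<^sub>R h x))"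
  proof (rule integrableI_bounded_set_indicator)
    show "(\<lambda>x. indicator S x *\<^sub>R h x) \<in> borel_measurable (hausdorff_measure m)"
      by (intro measurable_hausdorff_measure borel_measurable_continuous_on_indicator assms)
    show "AE x in hausdorff_measure m. x \<in> S \<longrightarrow> norm (indicator S x *\<^sub>R h x) \<le> B" using assms(3) by auto
  qed (use assms in \<open>auto simp: borel_sets_hausdorff_measure emeasure_hausdorff_borel\<close>)
  moreover have "(\<lambda>x. indicator S x *\<^sub>R (indicator S x *\<^sub>R h x)) = (\<lambda>x. indicator S x *\<^sub>R h x)"
    by (auto simp: indicator_def fun_eq_iff)
  ultimately show ?thesis by (simp add: set_integrable_def)
qed

text \<open>The bound \<open>small\<close> makes \<open>t g\<close> a contraction with factor 1/2.
  Hence \<open>\<phi>\<close> is onto by Banach's fixed point theorem for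
  \<open>x \<mapsto> y - t g x\<close>, its inverse is 2-Lipschitz, and every \<open>L x\<close> is
  injective.\<close>

locale small_deformation =
  fixes g :: "real^'n \<Rightarrow> real^'n" and g' :: "real^'n \<Rightarrow> ((real^'n) \<Rightarrow>\<^sub>L (real^'n))" and R t :: real
  assumes deriv_g: "\<And>x. (g has_derivative blinfun_apply (g' x)) (at x)" and cont_g': "continuous_on UNIV g'"
    and bound_g': "\<And>x. norm (g' x) \<le> R" and small: "\<bar>t\<bar> * R \<le> 1/2"
begin

definition \<phi> where "\<phi> x = x + t *\<^sub>R g x"
definition \<psi> where "\<psi> = inv \<phi>"
definition L where "L x = id_blinfun + t *\<^sub>R g' x"

lemma g_lipschitz: "norm (g x - g y) \<le> R * norm (x - y)"
proof (rule differentiable_bound[of UNIV g "\<lambda>x. blinfun_apply (g' x)"])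
  fix x show "onorm (blinfun_apply (g' x)) \<le> R" using bound_g'[of x] by (simp add: norm_blinfun.rep_eq)
qed (use deriv_g in auto)

lemma tg_lipschitz: "norm (t *\<^sub>R g x - t *\<^sub>R g y) \<le> 1/2 * norm (x - y)"
proof -
  have "norm (t *\<^sub>R g x - t *\<^sub>R g y) = \<bar>t\<bar> * norm (g x - g y)" by (simp add: scaleR_diff_right[symmetric])
  also have "\<dots> \<le> \<bar>t\<bar> * (R * norm (x - y))" by (intro mult_left_mono g_lipschitz) auto
  also have "\<dots> \<le> 1/2 * norm (x - y)" using small by (simp only: mult.assoc[symmetric]) (intro mult_right_mono, auto)
  finally show ?thesis .
qed

lemma \<phi>_lower: "norm (x - y) \<le> 2 * norm (\<phi> x - \<phi> y)"
proof -
  have "x - y = (\<phi> x - \<phi> y) - (t *\<^sub>R g x - t *\<^sub>R g y)" by (simp add: \<phi>_def)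
  then have "norm (x - y) \<le> norm (\<phi> x - \<phi> y) + norm (t *\<^sub>R g x - t *\<^sub>R g y)" by (metis norm_triangle_ineq4)
  then show ?thesis using tg_lipschitz[of x y] by linarith
qed

lemma bij_\<phi>: "bij \<phi>"
proof (rule bijI)
  show "inj \<phi>"
  proof (rule injI)
    fix x y assume "\<phi> x = \<phi> y"
    then show "x = y" using \<phi>_lower[of x y] by simp
  qed
  show "surj \<phi>"
  proof (rule surjI)
    fix y
    have "\<exists>!x. x \<in> UNIV \<and> y - t *\<^sub>R g x = x"
    proof (rule Banach_fix)
      show "dist (y - t *\<^sub>R g x) (y - t *\<^sub>R g z) \<le> 1/2 * dist x z" for x z
        using tg_lipschitz[of x z] by (simp add: dist_norm norm_minus_commute)
    qed (auto simp: complete_UNIV)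
    then obtain x where "y - t *\<^sub>R g x = x" by blast
    then have "\<phi> x = y" by (simp add: \<phi>_def diff_eq_eq)
    then have "\<exists>x. \<phi> x = y" ..
    then show "\<phi> (SOME x. \<phi> x = y) = y" by (rule someI_ex)
  qed
qed

lemma \<phi>\<psi>: "\<phi> (\<psi> y) = y" "\<psi> (\<phi> x) = x"
  using surj_f_inv_f[OF bij_is_surj[OF bij_\<phi>]] inv_f_f[OF bij_is_inj[OF bij_\<phi>]] by (simp_all add: \<psi>_def)

lemma cont_\<phi>: "continuous_on S \<phi>"
proof -
  have "continuous_on S g" by (intro continuous_at_imp_continuous_on ballI) (rule has_derivative_continuous[OF deriv_g])
  then show ?thesis unfolding \<phi>_def by (intro continuous_intros)
qed

lemma cont_\<psi>: "continuous_on S \<psi>"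
proof (rule continuous_on_subset[OF lipschitz_on_continuous_on subset_UNIV])
  show "2-lipschitz_on UNIV \<psi>"
    using \<phi>_lower[of "\<psi> _" "\<psi> _"] by (intro lipschitz_onI) (simp_all add: \<phi>\<psi> dist_norm)
qed

lemma \<phi>_borel: "A \<in> sets borel \<Longrightarrow> \<phi> ` A \<in> sets borel"
proof -
  assume A: "A \<in> sets borel"
  have "\<phi> ` A = \<psi> -` A" using \<phi>\<psi> by (auto simp: image_iff) metis
  moreover have "\<psi> \<in> borel_measurable borel" by (rule borel_measurable_continuous_onI[OF cont_\<psi>])
  ultimately show ?thesis using measurable_sets_borel[of \<psi> borel A] A by simp
qed

lemma L_apply: "L x v = v + t *\<^sub>R g' x v"
  by (simp add: L_def blinfun.bilinear_simps)

lemma deriv_\<phi>: "(\<phi> has_derivative L x) (at x)"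
proof -
  have "(\<phi> has_derivative (\<lambda>v. v + t *\<^sub>R g' x v)) (at x)"
    unfolding \<phi>_def[abs_def] by (auto intro!: derivative_eq_intros deriv_g)
  then show ?thesis by (simp add: L_apply[abs_def])
qed

lemma linear_L: "linear (L x)"
  by (simp add: linear_conv_bounded_linear blinfun.bounded_linear_right)

lemma inj_L: "inj (L x)"
proof (subst linear_injective_0[OF linear_L], intro allI impI)
  fix v assume "L x v = 0"
  then have "v = - (t *\<^sub>R g' x v)" by (simp add: L_apply eq_neg_iff_add_eq_0)
  then have "norm v = \<bar>t\<bar> * norm (g' x v)" by (metis norm_minus_cancel norm_scaleR real_norm_def)
  also have "\<dots> \<le> \<bar>t\<bar> * (R * norm v)"
    using norm_blinfun[of "g' x" v] mult_right_mono[OF bound_g'[of x], of "norm v"] by (intro mult_left_mono) auto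
  also have "\<dots> \<le> 1/2 * norm v" using small by (simp only: mult.assoc[symmetric]) (intro mult_right_mono, auto)
  finally show "v = 0" by simp
qed

lemma cont_L: "continuous_on S L"
  unfolding L_def by (intro continuous_intros continuous_on_subset[OF cont_g']) auto

lemma strong_\<phi>:
  assumes "0 < e"
  shows "\<exists>r>0. \<forall>x\<in>ball p r. \<forall>y\<in>ball p r. norm (\<phi> x - \<phi> y - L p (x - y)) \<le> e * norm (x - y)"
  by (rule C1_strong_differentiability[OF open_UNIV UNIV_I deriv_\<phi> cont_L assms, of p]) blast

text \<open>Velocities are pushed forward by \<open>\<phi>\<close> and pulled back by
  \<open>\<psi>\<close>, and spans commute with linear maps. The image under \<open>L x\<close> of
  the orthogonal complement of the normal is the orthogonal complement of the cofactor vector, by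
  \<open>cofactor_inner\<close>.\<close>

lemma tangent_space_image:
  assumes M: "C1_surface M" and x: "x \<in> M"
  shows "tangent_space (\<phi> ` M) (\<phi> x) = {w. cofactor (L x) (unit_normal M x) \<bullet> w = 0}"
proof -
  obtain h where h: "linear h" "h \<circ> L x = id" using linear_injective_left_inverse[OF linear_L inj_L] by blast
  have Lh: "L x (h z) = z" "h (L x z) = z" for z
    using linear_inverse_left[OF linear_L h(1)] h(2) by (metis comp_apply id_apply)+
  have d\<psi>: "(\<psi> has_derivative h) (at (\<phi> x))"
  proof (rule has_derivative_inverse_basic[where T = UNIV])
    show "(\<phi> has_derivative L x) (at (\<psi> (\<phi> x)))" by (simp add: \<phi>\<psi> deriv_\<phi>)
    show "bounded_linear h" using h(1) by (simp add: linear_conv_bounded_linear)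
    show "continuous (at (\<phi> x)) \<psi>" using cont_\<psi>[of UNIV] by (simp add: continuous_on_eq_continuous_at)
  qed (use h \<phi>\<psi> in auto)
  have "{w. velocity (\<phi> ` M) (\<phi> x) w} = L x ` {v. velocity M x v}"
  proof (intro set_eqI iffI)
    fix w assume "w \<in> {w. velocity (\<phi> ` M) (\<phi> x) w}"
    then have "velocity (\<psi> ` \<phi> ` M) (\<psi> (\<phi> x)) (h w)" using velocity_image[OF d\<psi>] by auto
    then have "velocity M x (h w)" by (simp add: image_image \<phi>\<psi>)
    then show "w \<in> L x ` {v. velocity M x v}" using Lh(1)[of w] by (metis image_eqI mem_Collect_eq)
  qed (use velocity_image[OF deriv_\<phi>] in auto)
  then have "tangent_space (\<phi> ` M) (\<phi> x) = L x ` tangent_space M x"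
    unfolding tangent_space_velocity by (simp add: linear_span_image[OF linear_L])
  also have "\<dots> = {w. cofactor (L x) (unit_normal M x) \<bullet> w = 0}"
  proof -
    have d: "det (matrix (L x)) \<noteq> 0" using det_nz_iff_inj[OF linear_L] inj_L by simp
    have ip: "cofactor (L x) (unit_normal M x) \<bullet> L x v = 0 \<longleftrightarrow> v \<in> tangent_space M x" for v
      using cofactor_inner[OF linear_L inj_L C1_surface_normal(1)[OF M x], where w = v] d C1_surface_normal(2)[OF M x]
      by (simp add: hyperplane_def inner_commute)
    show ?thesis
    proof (intro set_eqI iffI)
      fix w assume "w \<in> {w. cofactor (L x) (unit_normal M x) \<bullet> w = 0}"
      then have "h w \<in> tangent_space M x" using ip[of "h w"] Lh(1)[of w] by simp
      then show "w \<in> L x ` tangent_space M x" using Lh(1)[of w] by (metis image_eqI)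
    qed (use ip in auto)
  qed
  finally show ?thesis .
qed

end

section \<open>The first variation inequality for stationary hypersurfaces\<close>

context integrand
begin

text \<open>Only an upper bound for the deformed energy is needed, because the deformation parameter may be negative.\<close>

lemma deformed_energy_le:
  assumes card: "CARD('n) = m + 1" and M: "C1_surface M" "M \<subseteq> \<Omega>"
    and cpt: "\<And>K. compact K \<Longrightarrow> K \<subseteq> \<Omega> \<Longrightarrow> compact (M \<inter> K)" and Mb: "M \<in> sets borel"
    and g: "small_deformation g g' R t" and U: "open U"
    and inv: "\<And>x. x \<in> U \<Longrightarrow> x + t *\<^sub>R g x \<in> U \<inter> \<Omega>" "\<And>x. x \<notin> U \<Longrightarrow> g x = 0"
    and z: "set_integrable (hausdorff_measure m) (M \<inter> U) z"
      "\<And>x. x \<in> M \<inter> U \<Longrightarrow> F (x + t *\<^sub>R g x) (cofactor (id_blinfun + t *\<^sub>R g' x) (unit_normal M x)) \<le> z x"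
  shows "deformed_energy m F M U g t \<le> (LINT x : M \<inter> U | hausdorff_measure m. z x)"
proof -
  interpret small_deformation g g' R t by (rule g)
  let ?H = "hausdorff_measure m :: (real^'n) measure"
  define S where "S = M \<inter> U"
  have S: "S \<in> sets borel" "S \<subseteq> M" unfolding S_def using Mb U by auto
  \<comment> \<open>By \<open>inv\<close> the deformation maps \<open>U\<close> into itself and is
    the identity outside, so the part of the deformed set in \<open>U\<close> comes from
    \<open>M \<inter> U\<close>.\<close>
  have \<phi>S: "\<phi> ` M \<inter> U = \<phi> ` S"
  proof
    show "\<phi> ` M \<inter> U \<subseteq> \<phi> ` S"
    proof
      fix y assume "y \<in> \<phi> ` M \<inter> U"
      then obtain x where x: "x \<in> M" "y = \<phi> x" "y \<in> U" by auto
      then have "x \<in> U" using inv(2)[of x] by (cases "x \<in> U") (auto simp: \<phi>_def)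
      then show "y \<in> \<phi> ` S" using x by (auto simp: S_def)
    qed
  qed (use inv(1) in \<open>auto simp: S_def \<phi>_def\<close>)
  have \<phi>\<Omega>: "\<phi> x \<in> \<Omega>" if "x \<in> M" for x
    using inv(1)[of x] inv(2)[of x] that M(2) by (cases "x \<in> U") (auto simp: \<phi>_def)
  let ?\<nu> = "unit_normal M"
  have \<nu>: "norm (?\<nu> x) = 1" if "x \<in> M" for x using C1_surface_normal(1)[OF M(1) that] .
  define n where "n x = cofactor (L x) (?\<nu> x)" for x
  define w where "w x = F (\<phi> x) (n x)" for x
  define J where "J x = norm (n x)" for x
  have n0: "n x \<noteq> 0" if "x \<in> M" for x
    unfolding n_def by (rule cofactor_minus(2)[OF linear_L inj_L \<nu>[OF that]])
  have wpos: "0 < w x" if "x \<in> M" for x unfolding w_def by (intro F_pos \<phi>\<Omega> n0 that)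
  have Jpos: "0 < J x" if "x \<in> M" for x unfolding J_def using n0[OF that] by simp
  have cof: "continuous_on (M \<times> sphere 0 1) (\<lambda>p. cofactor (L (fst p)) (snd p))"
    by (intro continuous_on_cofactor continuous_intros continuous_on_compose2[OF cont_L[of UNIV]]) auto
  have cw: "continuous_on M w"
    unfolding w_def n_def
  proof (rule continuous_on_even_normal[OF M(1)])
    have "continuous_on (M \<times> sphere 0 1) (\<lambda>p. (\<lambda>(x, \<nu>). F x \<nu>) (\<phi> (fst p), cofactor (L (fst p)) (snd p)))"
    proof (rule continuous_on_compose2[OF cont_F])
      show "continuous_on (M \<times> sphere 0 1) (\<lambda>p. (\<phi> (fst p), cofactor (L (fst p)) (snd p)))"
        by (intro continuous_on_Pair cof continuous_on_compose2[OF cont_\<phi>[of UNIV]] continuous_intros) auto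
      show "(\<lambda>p. (\<phi> (fst p), cofactor (L (fst p)) (snd p))) ` (M \<times> sphere 0 1) \<subseteq> \<Omega> \<times> (UNIV - {0})"
        using \<phi>\<Omega> cofactor_minus(2)[OF linear_L inj_L] by auto
    qed
    then show "continuous_on (M \<times> sphere 0 1) (\<lambda>(x, \<nu>). F (\<phi> x) (cofactor (L x) \<nu>))"
      by (simp add: case_prod_beta)
    fix x and \<nu> :: "real^'n" assume "x \<in> M" "norm \<nu> = 1"
    then show "F (\<phi> x) (cofactor (L x) (- \<nu>)) = F (\<phi> x) (cofactor (L x) \<nu>)"
      using cofactor_minus[OF linear_L inj_L, of \<nu> x] F_even[OF \<phi>\<Omega>] by simp
  qed
  have cJ: "continuous_on M J"
    unfolding J_def n_def
  proof (rule continuous_on_even_normal[OF M(1)])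
    show "continuous_on (M \<times> sphere 0 1) (\<lambda>(x, \<nu>). norm (cofactor (L x) \<nu>))"
      using continuous_on_norm[OF cof] by (simp add: case_prod_beta)
    fix x and \<nu> :: "real^'n" assume "x \<in> M" "norm \<nu> = 1"
    then show "norm (cofactor (L x) (- \<nu>)) = norm (cofactor (L x) \<nu>)"
      using cofactor_minus[OF linear_L inj_L, of \<nu> x] by simp
  qed
  \<comment> \<open>By homogeneity \<open>v\<close> is the energy density at the image point with
    its unit normal, and \<open>J\<close> is the area factor; their product is \<open>w\<close>, the
    quantity bounded by \<open>z\<close>.\<close>
  define v where "v x = w x / J x" for x
  have cv: "continuous_on M v" unfolding v_def
    using Jpos by (intro continuous_intros cw cJ) (metis less_irrefl)
  have vpos: "0 < v x" if "x \<in> M" for x unfolding v_def using wpos[OF that] Jpos[OF that] by simp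
  have vJ: "v x * J x = w x" if "x \<in> M" for x unfolding v_def using Jpos[OF that] by simp
  let ?f = "\<lambda>y. F y (unit_normal (\<phi> ` M) y)"
  have f\<phi>: "?f (\<phi> x) = v x" if x: "x \<in> M" for x
  proof -
    let ?b = "n x /\<^sub>R norm (n x)"
    have "tangent_space (\<phi> ` M) (\<phi> x) = {w. ?b \<bullet> w = 0}"
      using tangent_space_image[OF M(1) x] n0[OF x] by (simp add: n_def)
    moreover have "norm ?b = 1" using n0[OF x] by simp
    ultimately have "unit_normal (\<phi> ` M) (\<phi> x) = ?b \<or> unit_normal (\<phi> ` M) (\<phi> x) = - ?b"
      by (rule unit_normal_cases)
    moreover have "F (\<phi> x) ?b = v x"
      using F_scale[OF \<phi>\<Omega>[OF x] n0[OF x], of "inverse (norm (n x))"] n0[OF x]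
      by (simp add: v_def w_def J_def divide_inverse mult.commute)
    moreover have "?b \<noteq> 0" using n0[OF x] by simp
    ultimately show ?thesis using F_even[OF \<phi>\<Omega>[OF x], of ?b] by metis
  qed
  \<comment> \<open>Transporting the density back by \<open>\<psi>\<close> shows that it is
    measurable, which is not visible from \<open>unit_normal\<close> of the deformed set, a
    pointwise choice.\<close>
  have ind: "indicator (\<phi> ` S) y *\<^sub>R ?f y = indicator S (\<psi> y) *\<^sub>R v (\<psi> y)" for y
  proof (cases "\<psi> y \<in> S")
    case True
    then have "y \<in> \<phi> ` S" using \<phi>\<psi>(1)[of y] by (metis imageI)
    moreover have "?f y = v (\<psi> y)" using f\<phi>[of "\<psi> y"] True S(2) by (auto simp: \<phi>\<psi>)
    ultimately show ?thesis using True by simp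
  next
    case False
    then have "y \<notin> \<phi> ` S" using \<phi>\<psi>(2) by auto
    then show ?thesis using False by simp
  qed
  have fm: "(\<lambda>y. indicator (\<phi> ` S) y *\<^sub>R ?f y) \<in> borel_measurable borel"
  proof -
    have "(\<lambda>x. indicator S x *\<^sub>R v x) \<in> borel_measurable borel"
      by (intro borel_measurable_continuous_on_indicator S(1) continuous_on_subset[OF cv S(2)])
    moreover have "\<psi> \<in> borel_measurable borel" by (rule borel_measurable_continuous_onI[OF cont_\<psi>])
    ultimately have "(\<lambda>y. indicator S (\<psi> y) *\<^sub>R v (\<psi> y)) \<in> borel_measurable borel" by measurable
    then show ?thesis by (simp only: ind)
  qed
  have f0: "0 \<le> indicator (\<phi> ` S) y *\<^sub>R ?f y" for y
    unfolding ind using vpos[of "\<psi> y"] S(2) by (auto simp: indicator_def less_imp_le)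
  \<comment> \<open>For a nonnegative measurable function the Bochner integral is
    \<open>enn2real\<close> of the nonnegative integral. \<open>enn2real\<close> is monotone below a
    finite bound, which integrability of \<open>z\<close> supplies.\<close>
  have "deformed_energy m F M U g t = (\<integral>y. indicator (\<phi> ` S) y *\<^sub>R ?f y \<partial>?H)"
    using \<phi>S by (simp add: deformed_energy_def energy_def set_lebesgue_integral_def \<phi>_def[abs_def])
  also have "\<dots> = enn2real (\<integral>\<^sup>+y. ennreal (indicator (\<phi> ` S) y *\<^sub>R ?f y) \<partial>?H)"
    using f0 by (intro integral_eq_nn_integral measurable_hausdorff_measure[OF fm]) auto
  finally have E: "deformed_energy m F M U g t = enn2real (\<integral>\<^sup>+y. ennreal (indicator (\<phi> ` S) y *\<^sub>R ?f y) \<partial>?H)" .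
  have ei: "ennreal (indicator (\<phi> ` S) y *\<^sub>R ?f y) = ennreal (?f y) * indicator (\<phi> ` S) y" for y
    by (simp add: indicator_def)
  have "(\<integral>\<^sup>+y. ennreal (?f y) * indicator (\<phi> ` S) y \<partial>?H) \<le> (\<integral>\<^sup>+x. ennreal (v x * J x) * indicator S x \<partial>?H)"
  proof (rule integral_image_le)
    show "(\<lambda>y. ennreal (?f y) * indicator (\<phi> ` S) y) \<in> borel_measurable borel"
      using measurable_compose[OF fm measurable_ennreal] by (simp only: ei)
    fix x and \<epsilon> :: real assume x: "x \<in> S" and \<epsilon>: "0 < \<epsilon>"
    have xM: "x \<in> M" using x S(2) by auto
    obtain r0 where r0: "0 < r0" "cball x r0 \<subseteq> \<Omega>"
      using open_domain xM M(2) open_contains_cball by blast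
    have "compact (M \<inter> cball x r0)" by (rule cpt[OF compact_cball r0(2)])
    then obtain r where r: "0 < r" "\<And>A. A \<in> sets borel \<Longrightarrow> A \<subseteq> M \<inter> ball x r \<Longrightarrow>
        hausdorff_outer m (\<phi> ` A) \<le> ennreal ((1 + \<epsilon>) * norm (cofactor (L x) (?\<nu> x))) * hausdorff_outer m A"
      using local_area_bound[OF card M(1) xM r0(1) _ strong_\<phi> linear_L inj_L \<epsilon>] by blast
    show "\<exists>r>0. \<forall>A\<in>sets borel. A \<subseteq> S \<inter> ball x r \<longrightarrow>
        hausdorff_outer m (\<phi> ` A) \<le> ennreal ((1 + \<epsilon>) * J x) * hausdorff_outer m A"
      using r S(2) unfolding J_def n_def by (intro exI[of _ r]) blast
  qed (use S vpos Jpos f\<phi> \<phi>_borel in \<open>auto intro: continuous_on_subset[OF cv] continuous_on_subset[OF cJ]\<close>)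
  also have "\<dots> \<le> (\<integral>\<^sup>+x. ennreal (indicator S x *\<^sub>R z x) \<partial>?H)"
  proof (rule nn_integral_mono)
    fix x
    show "ennreal (v x * J x) * indicator S x \<le> ennreal (indicator S x *\<^sub>R z x)"
    proof (cases "x \<in> S")
      case True
      then have "w x \<le> z x" using z(2)[of x] by (simp add: w_def n_def \<phi>_def L_def S_def)
      moreover have "v x * J x = w x" using True S(2) by (intro vJ) auto
      ultimately show ?thesis using True by (simp add: ennreal_leI)
    qed simp
  qed
  also have "\<dots> = ennreal (LINT x : S | ?H. z x)"
    unfolding set_lebesgue_integral_def
  proof (rule nn_integral_eq_integral)
    show "integrable ?H (\<lambda>x. indicator S x *\<^sub>R z x)" using z(1) by (simp add: set_integrable_def S_def)
    have "0 \<le> z x" if "x \<in> S" for x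
      using z(2)[of x] that wpos[of x] S(2) by (force simp: w_def n_def \<phi>_def L_def S_def)
    then show "AE x in ?H. 0 \<le> indicator S x *\<^sub>R z x" by (auto simp: indicator_def)
  qed
  finally have le: "(\<integral>\<^sup>+y. ennreal (?f y) * indicator (\<phi> ` S) y \<partial>?H) \<le> ennreal (LINT x : S | ?H. z x)" .
  have "0 \<le> (LINT x : S | ?H. z x)"
    unfolding set_lebesgue_integral_def
  proof (rule integral_nonneg_AE)
    have "0 \<le> z x" if "x \<in> S" for x
      using z(2)[of x] that wpos[of x] S(2) by (force simp: w_def n_def \<phi>_def L_def S_def)
    then show "AE x in ?H. 0 \<le> indicator S x *\<^sub>R z x" by (auto simp: indicator_def)
  qed
  moreover have "enn2real (\<integral>\<^sup>+y. ennreal (?f y) * indicator (\<phi> ` S) y \<partial>?H) \<le> enn2real (ennreal (LINT x : S | ?H. z x))"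
    by (rule enn2real_mono[OF le]) simp
  ultimately have "enn2real (\<integral>\<^sup>+y. ennreal (?f y) * indicator (\<phi> ` S) y \<partial>?H) \<le> (LINT x : S | ?H. z x)"
    by (simp only: enn2real_ennreal)
  then show ?thesis unfolding E ei unfolding S_def .
qed

text \<open>Integrability is part of the conclusion: the integral of a non-integrable function is 0
  by default, and the inequality alone would then say nothing.\<close>

lemma first_variation_nonpos:
  assumes card: "CARD('n) = m + 1" and M: "proper_hypersurface \<Omega> M" and stat: "F_stationary m \<Omega> F M"
    and dg: "\<And>x. (g has_derivative blinfun_apply (g' x)) (at x)" and cg': "continuous_on UNIV g'"
    and sg: "compact (support g)" "support g \<subseteq> \<Omega> - boundary_points M" "support g \<subseteq> U"
    and U: "open U" "compact (closure U)" "closure U \<subseteq> \<Omega>"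
  shows "set_integrable (hausdorff_measure m) (M \<inter> U) (\<lambda>x. first_variation x (unit_normal M x) (g x) (g' x))"
    and "(LINT x : M \<inter> U | hausdorff_measure m. first_variation x (unit_normal M x) (g x) (g' x)) \<le> 0"
proof -
  let ?H = "hausdorff_measure m :: (real^'n) measure" and ?\<nu> = "unit_normal M"
  have M1: "C1_surface M" by (rule proper_hypersurface_C1_surface[OF M])
  have M\<Omega>: "M \<subseteq> \<Omega>" using M by (simp add: proper_hypersurface_def)
  obtain T where T: "closed T" "M = \<Omega> \<inter> T" using M by (auto simp: proper_hypersurface_def closedin_closed)
  have Mb: "M \<in> sets borel" unfolding T(2) using open_domain T(1) by auto
  have cpt: "compact (M \<inter> K)" if "compact K" "K \<subseteq> \<Omega>" for K by (rule compact_hypersurface_Int(1)[OF M that])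
  have adm: "admissible_variation \<Omega> M g U"
    using dg cg' sg U unfolding admissible_variation_def C1_on_def by auto
  have g0: "g x = 0" if "x \<notin> support g" for x
    using that closure_subset[of "{x. g x \<noteq> 0}"] by (auto simp: support_def)
  \<comment> \<open>Outside its support the field and its derivative vanish, so compactness of the
    support bounds both on the whole space, as \<open>small_deformation\<close> demands.\<close>
  have g'0: "g' x = 0" if "x \<notin> support g" for x
  proof -
    have "open (- support g)" by (simp add: support_def open_Compl)
    then have "(g has_derivative (\<lambda>_. 0)) (at x)"
      using that by (intro has_derivative_transform_within_open[OF has_derivative_const, of "- support g"]) (auto simp: g0)
    then have "blinfun_apply (g' x) = (\<lambda>_. 0)" by (rule has_derivative_unique[OF dg])
    then show ?thesis by (intro blinfun_eqI) simp
  qed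
  have cg: "continuous_on S g" for S by (intro continuous_at_imp_continuous_on ballI) (rule has_derivative_continuous[OF dg])
  have "bounded (g' ` support g)" "bounded (g ` support g)"
    by (intro compact_imp_bounded compact_continuous_image sg(1) cg continuous_on_subset[OF cg'] subset_UNIV)+
  then obtain R1 R2 where R12: "0 < R1" "\<And>x. x \<in> support g \<Longrightarrow> norm (g' x) \<le> R1" "0 < R2" "\<And>x. x \<in> support g \<Longrightarrow> norm (g x) \<le> R2"
    unfolding bounded_pos by blast
  define R where "R = max R1 R2"
  have R: "0 < R" "norm (g' x) \<le> R" "norm (g x) \<le> R" for x
    using R12(1) R12(2)[of x] R12(4)[of x] g0[of x] g'0[of x] by (cases "x \<in> support g"; auto simp: R_def)+
  obtain d0 where d0: "0 < d0" "(\<Union>x\<in>support g. ball x d0) \<subseteq> U"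
    using compact_subset_open_imp_ball_epsilon_subset[OF sg(1) U(1) sg(3)] by metis
  define S where "S = M \<inter> U"
  have Sb: "S \<in> sets borel" unfolding S_def using Mb U(1) by auto
  have SM: "S \<subseteq> M" "S \<subseteq> M \<inter> closure U" unfolding S_def using closure_subset[of U] by auto
  have cC: "compact (M \<inter> closure U)" by (rule cpt[OF U(2,3)])
  have "hausdorff_outer m S \<le> hausdorff_outer m (M \<inter> closure U)" by (rule hausdorff_outer_mono[OF SM(2)])
  also have "\<dots> < \<infinity>" by (rule C1_surface_area_finite[OF card M1 cC])
  finally have fin: "hausdorff_outer m S < \<infinity>" .
  define W where "W x = F x (?\<nu> x)" for x
  define I where "I x = first_variation x (?\<nu> x) (g x) (g' x)" for x
  have sub: "M \<times> sphere 0 1 \<subseteq> \<Omega> \<times> (UNIV - {0})" using M\<Omega> by auto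
  have cW: "continuous_on M W"
    unfolding W_def
    by (rule continuous_on_even_normal[OF M1 continuous_on_subset[OF cont_F sub]]) (rule F_even; use M\<Omega> in auto)
  have cI: "continuous_on M I"
    unfolding I_def
  proof (rule continuous_on_even_normal[OF M1])
    have c1: "continuous_on (M \<times> sphere 0 1) (\<lambda>p. g' (fst p))"
      by (rule continuous_on_compose2[OF cg']) (auto intro!: continuous_intros)
    have c2: "continuous_on (M \<times> sphere 0 1) (\<lambda>p. g (fst p))"
      by (rule continuous_on_compose2[OF cg[of UNIV]]) (auto intro!: continuous_intros)
    have "continuous_on (M \<times> sphere 0 1) (\<lambda>p. F' p (g (fst p), tr (g' (fst p)) *\<^sub>R snd p - adjoint (g' (fst p)) (snd p)))"
      unfolding adjoint_blinfun_components tr_def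
      by (intro continuous_intros continuous_on_subset[OF cont_F' sub] c1 c2)
    then show "continuous_on (M \<times> sphere 0 1) (\<lambda>(x, \<nu>). first_variation x \<nu> (g x) (g' x))"
      by (simp add: first_variation_def case_prod_beta)
  qed (rule first_variation_even; use M\<Omega> in auto)
  have "bounded (W ` (M \<inter> closure U))" "bounded (I ` (M \<inter> closure U))"
    by (intro compact_imp_bounded compact_continuous_image cC continuous_on_subset[OF cW] continuous_on_subset[OF cI] Int_lower1)+
  then obtain B1 B2 where B12: "\<And>x. x \<in> M \<inter> closure U \<Longrightarrow> norm (W x) \<le> B1" "\<And>x. x \<in> M \<inter> closure U \<Longrightarrow> norm (I x) \<le> B2"
    unfolding bounded_iff by blast
  have iW: "set_integrable ?H S W"
    using B12(1) SM by (intro set_integrable_hausdorff[OF Sb continuous_on_subset[OF cW SM(1)] _ fin, of B1]) force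
  have iI: "set_integrable ?H S I"
    using B12(2) SM by (intro set_integrable_hausdorff[OF Sb continuous_on_subset[OF cI SM(1)] _ fin, of B2]) force
  then show "set_integrable ?H (M \<inter> U) (\<lambda>x. first_variation x (?\<nu> x) (g x) (g' x))" by (simp add: I_def[abs_def] S_def)
  have ic: "set_integrable ?H S (\<lambda>x. c)" for c :: real
    by (rule set_integrable_hausdorff[OF Sb continuous_on_const _ fin, of c "\<bar>c\<bar>"]) simp
  let ?E = "deformed_energy m F M U g"
  define \<mu> where "\<mu> = measure ?H S"
  define a where "a = (LINT x : S | ?H. I x)"
  have E0: "?E 0 = (LINT x : S | ?H. W x)"
    by (simp add: deformed_energy_def energy_def S_def W_def)
  have upper: "\<exists>d>0. \<forall>t. \<bar>t\<bar> < d \<longrightarrow> ?E t \<le> ?E 0 + t * a + \<epsilon> * \<bar>t\<bar> * \<mu>" if \<epsilon>: "0 < \<epsilon>" for \<epsilon>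
  proof -
    obtain d1 where d1: "0 < d1"
      "\<And>x \<nu> v A t. x \<in> closure U \<Longrightarrow> norm \<nu> = 1 \<Longrightarrow> norm v \<le> R \<Longrightarrow> norm A \<le> R \<Longrightarrow> \<bar>t\<bar> < d1 \<Longrightarrow>
        F (x + t *\<^sub>R v) (cofactor (id_blinfun + t *\<^sub>R A) \<nu>) \<le> F x \<nu> + t * first_variation x \<nu> v A + \<epsilon> * \<bar>t\<bar>"
      by (rule first_variation_expansion[OF U(2,3) less_imp_le[OF R(1)] \<epsilon>]) blast
    \<comment> \<open>The three bounds give the expansion of the integrand, the contraction property
      \<open>|t| R \<le> 1/2\<close>, and that displaced points of the support stay in
      \<open>U\<close>.\<close>
    define d where "d = min d1 (min (1 / (2 * R)) (d0 / R))"
    have "0 < d" using d1(1) R(1) d0(1) by (simp add: d_def)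
    moreover have "?E t \<le> ?E 0 + t * a + \<epsilon> * \<bar>t\<bar> * \<mu>" if t: "\<bar>t\<bar> < d" for t
    proof -
      have t': "\<bar>t\<bar> < d1" "\<bar>t\<bar> * R \<le> 1/2" "\<bar>t\<bar> * R < d0"
        using t R(1) by (auto simp: d_def field_simps)
      have sd: "small_deformation g g' R t" using dg cg' R t'(2) by unfold_locales auto
      have inU: "x + t *\<^sub>R g x \<in> U" if "x \<in> U" for x
      proof (cases "x \<in> support g")
        case True
        have "norm (t *\<^sub>R g x) \<le> \<bar>t\<bar> * R" using R(3)[of x] by (simp add: mult_left_mono)
        then have "x + t *\<^sub>R g x \<in> ball x d0" using t'(3) by (simp add: dist_norm)
        then show ?thesis using d0(2) True by blast
      qed (use that g0 in auto)
      have zi: "set_integrable ?H S (\<lambda>x. W x + (t * I x + \<epsilon> * \<bar>t\<bar>))"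
        by (intro set_integral_add(1) iW set_integrable_mult_right iI ic)
      have "?E t \<le> (LINT x : M \<inter> U | ?H. W x + (t * I x + \<epsilon> * \<bar>t\<bar>))"
      proof (rule deformed_energy_le[OF card M1 M\<Omega> cpt Mb sd U(1)])
        show "x + t *\<^sub>R g x \<in> U \<inter> \<Omega>" if "x \<in> U" for x using inU[OF that] U(3) closure_subset[of U] by auto
        show "g x = 0" if "x \<notin> U" for x using that sg(3) g0 by auto
        show "set_integrable ?H (M \<inter> U) (\<lambda>x. W x + (t * I x + \<epsilon> * \<bar>t\<bar>))" using zi by (simp add: S_def)
        fix x assume "x \<in> M \<inter> U"
        then have "x \<in> closure U" "x \<in> M" using closure_subset[of U] by auto
        then show "F (x + t *\<^sub>R g x) (cofactor (id_blinfun + t *\<^sub>R g' x) (?\<nu> x)) \<le> W x + (t * I x + \<epsilon> * \<bar>t\<bar>)"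
          using d1(2)[OF _ C1_surface_normal(1)[OF M1] R(3) R(2) t'(1)] unfolding W_def I_def by (simp add: add.assoc)
      qed
      also have "\<dots> = (LINT x : S | ?H. W x) + ((LINT x : S | ?H. t * I x) + (LINT x : S | ?H. \<epsilon> * \<bar>t\<bar>))"
        unfolding S_def[symmetric]
        by (subst set_integral_add(2)[OF iW set_integral_add(1)[OF set_integrable_mult_right[OF iI] ic]],
            subst set_integral_add(2)[OF set_integrable_mult_right[OF iI] ic]) simp
      also have "(LINT x : S | ?H. t * I x) = t * a" by (simp add: a_def)
      also have "(LINT x : S | ?H. \<epsilon> * \<bar>t\<bar>) = \<epsilon> * \<bar>t\<bar> * \<mu>"
        using fin Sb by (simp add: \<mu>_def set_lebesgue_integral_def borel_sets_hausdorff_measure emeasure_hausdorff_borel)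
      finally show ?thesis by (simp add: E0)
    qed
    ultimately show ?thesis by blast
  qed
  have "(?E has_real_derivative 0) (at 0)" using stat adm by (auto simp: F_stationary_def)
  then have lim: "((\<lambda>h. (?E h - ?E 0) / h) \<longlongrightarrow> 0) (at 0)" by (simp add: has_field_derivative_iff)
  have "a \<le> 0"
  proof (rule ccontr)
    assume "\<not> a \<le> 0"
    then have a: "0 < a" by simp
    \<comment> \<open>This makes \<open>\<epsilon> \<mu> \<le> a / 4\<close>. Dividing the upper
      bound by a negative \<open>t\<close> reverses it and shows that the difference quotient is at
      least \<open>3 a / 4\<close>, although it tends to 0.\<close>
    define \<epsilon> where "\<epsilon> = a / (4 * (\<mu> + 1))"
    have \<mu>: "0 \<le> \<mu>" by (simp add: \<mu>_def)
    then have \<epsilon>: "0 < \<epsilon>" "\<epsilon> * \<mu> \<le> a / 4" using a by (auto simp: \<epsilon>_def field_simps)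
    obtain d where d: "0 < d" "\<And>t. \<bar>t\<bar> < d \<Longrightarrow> ?E t \<le> ?E 0 + t * a + \<epsilon> * \<bar>t\<bar> * \<mu>" using upper[OF \<epsilon>(1)] by blast
    have "\<forall>\<^sub>F h in at 0. (?E h - ?E 0) / h < a / 4" using lim a by (intro order_tendstoD(2)) auto
    then obtain d2 where d2: "0 < d2" "\<And>h. h \<noteq> 0 \<Longrightarrow> \<bar>h\<bar> < d2 \<Longrightarrow> (?E h - ?E 0) / h < a / 4"
      unfolding eventually_at by (auto simp: dist_norm)
    define t where "t = - (min d d2) / 2"
    have t: "t < 0" "\<bar>t\<bar> < d" "\<bar>t\<bar> < d2" using d(1) d2(1) by (auto simp: t_def)
    have "?E t - ?E 0 \<le> t * a + \<epsilon> * \<bar>t\<bar> * \<mu>" using d(2)[OF t(2)] by simp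
    also have "\<epsilon> * \<bar>t\<bar> * \<mu> = \<bar>t\<bar> * (\<epsilon> * \<mu>)" by simp
    also have "\<bar>t\<bar> * (\<epsilon> * \<mu>) \<le> \<bar>t\<bar> * (a / 4)" using \<epsilon>(2) by (intro mult_left_mono) auto
    finally have "?E t - ?E 0 \<le> t * (3 * a / 4)" using t(1) by (simp add: algebra_simps)
    then have "3 * a / 4 \<le> (?E t - ?E 0) / t" using t(1) by (simp add: neg_le_divide_eq mult.commute)
    then show False using d2(2)[of t] t a by simp
  qed
  then show "(LINT x : M \<inter> U | ?H. first_variation x (?\<nu> x) (g x) (g' x)) \<le> 0"
    by (simp add: a_def I_def[abs_def] S_def)
qed

end

section \<open>Calculus of elliptic integrands\<close>

lemma partial_eq:
  assumes "(f has_derivative f') (at x)"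
  shows "partial i f x = f' (axis i 1)"
proof -
  have "((\<lambda>t. x + t *\<^sub>R axis i 1) has_derivative (\<lambda>t. t *\<^sub>R axis i 1)) (at (0::real))"
    by (auto intro!: derivative_eq_intros)
  moreover have "(f has_derivative f') (at (x + 0 *\<^sub>R axis i 1))" using assms by simp
  ultimately have "((\<lambda>t. f (x + t *\<^sub>R axis i 1)) has_derivative (\<lambda>t. f' (t *\<^sub>R axis i 1))) (at 0)"
    by (rule has_derivative_compose)
  moreover have "f' (t *\<^sub>R axis i 1) = f' (axis i 1) * t" for t
    using linear_scale[OF has_derivative_linear[OF assms]] by simp
  ultimately have "((\<lambda>t. f (x + t *\<^sub>R axis i 1)) has_real_derivative f' (axis i 1)) (at 0)"
    by (simp add: has_field_derivative_def)
  then show ?thesis unfolding partial_def by (rule DERIV_imp_deriv)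
qed

lemma partial_eq_local:
  assumes "(h has_derivative h') (at x)" "open S" "x \<in> S" "\<And>y. y \<in> S \<Longrightarrow> f y = h y"
  shows "partial i f x = h' (axis i 1)"
  by (rule partial_eq[OF has_derivative_transform_within_open[OF assms(1-3)]]) (simp add: assms(4))

locale elliptic = integrand \<Omega> F F' for \<Omega> :: "(real^'n) set" and F F' +
  fixes F'' :: "(real^'n) \<times> (real^'n) \<Rightarrow> ((real^'n) \<times> (real^'n)) \<Rightarrow>\<^sub>L (((real^'n) \<times> (real^'n)) \<Rightarrow>\<^sub>L real)"
  assumes deriv_F': "\<And>z. z \<in> \<Omega> \<times> (UNIV - {0}) \<Longrightarrow> (F' has_derivative blinfun_apply (F'' z)) (at z)"
    and cont_F'': "continuous_on (\<Omega> \<times> (UNIV - {0})) F''"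
    and convex: "\<And>x. x \<in> \<Omega> \<Longrightarrow> convex_on UNIV (\<lambda>\<nu>. if \<nu> = 0 then 0 else F x \<nu>)"
    and elliptic: "\<And>x \<nu> \<eta>. x \<in> \<Omega> \<Longrightarrow> norm \<nu> = 1 \<Longrightarrow> \<eta> \<noteq> 0 \<Longrightarrow> \<eta> \<bullet> \<nu> = 0 \<Longrightarrow>
        (\<Sum>i\<in>UNIV. \<Sum>j\<in>UNIV. dF2 F i j x \<nu> * \<eta> $ i * \<eta> $ j) > 0"
begin

definition F\<nu> :: "(real^'n) \<times> (real^'n) \<Rightarrow> real^'n" where
  "F\<nu> z = (\<chi> j. F' z (0, axis j 1))"

definition F\<nu>' :: "(real^'n) \<times> (real^'n) \<Rightarrow> (real^'n) \<times> (real^'n) \<Rightarrow> real^'n" where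
  "F\<nu>' z w = (\<chi> j. F'' z w (0, axis j 1))"

lemma F\<nu>_inner: "F\<nu> z \<bullet> b = F' z (0, b)"
proof -
  have b: "(0, b) = (\<Sum>j\<in>UNIV. b $ j *\<^sub>R (0 :: real^'n, axis j 1))"
    using basis_expansion[of b] by (simp add: scalar_mult_eq_scaleR sum_prod)
  show ?thesis by (subst b) (simp only: blinfun.sum_right blinfun.scaleR_right, simp add: inner_vec_def F\<nu>_def mult.commute)
qed

lemma deriv_F\<nu>: "z \<in> \<Omega> \<times> (UNIV - {0}) \<Longrightarrow> (F\<nu> has_derivative F\<nu>' z) (at z)"
proof (subst has_derivative_componentwise_within, rule ballI)
  fix b :: "real^'n" assume z: "z \<in> \<Omega> \<times> (UNIV - {0})" and "b \<in> Basis"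
  then obtain j where b: "b = axis j 1" by (auto simp: Basis_vec_def)
  have "((\<lambda>z. F' z (0, axis j 1)) has_derivative (\<lambda>w. F'' z w (0, axis j 1))) (at z)"
    by (rule bounded_linear.has_derivative[OF blinfun.bounded_linear_left deriv_F'[OF z]])
  then show "((\<lambda>x. F\<nu> x \<bullet> b) has_derivative (\<lambda>x. F\<nu>' z x \<bullet> b)) (at z)"
    by (simp add: b F\<nu>_def F\<nu>'_def inner_axis)
qed

lemma F\<nu>'_linear: "bounded_linear (F\<nu>' z)"
  unfolding linear_conv_bounded_linear[symmetric]
  by (rule linearI) (simp_all add: F\<nu>'_def vec_eq_iff blinfun.bilinear_simps)

lemma cont_F\<nu>: "continuous_on (\<Omega> \<times> (UNIV - {0})) F\<nu>"
  unfolding F\<nu>_def by (intro continuous_intros cont_F')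

lemma cont_F\<nu>':
  assumes "continuous_on S q" "q ` S \<subseteq> \<Omega> \<times> (UNIV - {0})" "continuous_on S w"
  shows "continuous_on S (\<lambda>s. F\<nu>' (q s) (w s))"
  unfolding F\<nu>'_def using continuous_on_compose2[OF cont_F'' assms(1,2)] assms(3) by (intro continuous_intros)

lemma F'_Pair: "F' z (a, b) = F' z (a, 0) + F\<nu> z \<bullet> b"
  unfolding F\<nu>_inner using blinfun.add_right[of "F' z" "(a, 0)" "(0, b)"] by simp

context
  fixes x \<nu> :: "real^'n" assumes x: "x \<in> \<Omega>" and \<nu>: "\<nu> \<noteq> 0"
begin

lemma phase: "c \<noteq> 0 \<Longrightarrow> (x, c *\<^sub>R \<nu>) \<in> \<Omega> \<times> (UNIV - {0})" "(x, \<nu>) \<in> \<Omega> \<times> (UNIV - {0})"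
  using x \<nu> by auto

lemma F'_scale: "c \<noteq> 0 \<Longrightarrow> F' (x, c *\<^sub>R \<nu>) (v, c *\<^sub>R w) = \<bar>c\<bar> * F' (x, \<nu>) (v, w)"
proof -
  assume c: "c \<noteq> 0"
  have "((\<lambda>z. (fst z, c *\<^sub>R snd z)) has_derivative (\<lambda>z. (fst z, c *\<^sub>R snd z))) (at (x, \<nu>))"
    by (auto intro!: derivative_eq_intros)
  moreover have "((\<lambda>(x, \<nu>). F x \<nu>) has_derivative blinfun_apply (F' (x, c *\<^sub>R \<nu>))) (at (fst (x, \<nu>), c *\<^sub>R snd (x, \<nu>)))"
    using deriv_F[OF phase(1)[OF c]] by simp
  ultimately have "((\<lambda>z. (\<lambda>(x, \<nu>). F x \<nu>) (fst z, c *\<^sub>R snd z)) has_derivative (\<lambda>z. F' (x, c *\<^sub>R \<nu>) (fst z, c *\<^sub>R snd z))) (at (x, \<nu>))"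
    by (rule has_derivative_compose)
  then have "((\<lambda>z. \<bar>c\<bar> * (\<lambda>(x, \<nu>). F x \<nu>) z) has_derivative (\<lambda>z. F' (x, c *\<^sub>R \<nu>) (fst z, c *\<^sub>R snd z))) (at (x, \<nu>))"
  proof (rule has_derivative_transform_within_open[OF _ open_phase phase(2)])
    fix y assume "y \<in> \<Omega> \<times> (UNIV - {0 :: real^'n})"
    then show "(\<lambda>(x, \<nu>). F x \<nu>) (fst y, c *\<^sub>R snd y) = \<bar>c\<bar> * (\<lambda>(x, \<nu>). F x \<nu>) y" using c by (cases y) (simp add: F_scale)
  qed
  moreover have "((\<lambda>z. \<bar>c\<bar> * (\<lambda>(x, \<nu>). F x \<nu>) z) has_derivative (\<lambda>z. \<bar>c\<bar> * F' (x, \<nu>) z)) (at (x, \<nu>))"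
    by (intro has_derivative_mult_right deriv_F phase)
  ultimately have "(\<lambda>z. F' (x, c *\<^sub>R \<nu>) (fst z, c *\<^sub>R snd z)) = (\<lambda>z. \<bar>c\<bar> * F' (x, \<nu>) z)"
    by (rule has_derivative_unique)
  from fun_cong[OF this, of "(v, w)"] show ?thesis by simp
qed

lemma F\<nu>_scale: "c \<noteq> 0 \<Longrightarrow> F\<nu> (x, c *\<^sub>R \<nu>) = sgn c *\<^sub>R F\<nu> (x, \<nu>)"
proof (rule vector_eq_rdot[THEN iffD1], rule allI)
  fix b assume c: "c \<noteq> 0"
  have "c * F' (x, c *\<^sub>R \<nu>) (0, b) = \<bar>c\<bar> * F' (x, \<nu>) (0, b)"
    using F'_scale[OF c, of 0 b] blinfun.scaleR_right[of "F' (x, c *\<^sub>R \<nu>)" c "(0, b)"] by simp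
  then show "F\<nu> (x, c *\<^sub>R \<nu>) \<bullet> b = (sgn c *\<^sub>R F\<nu> (x, \<nu>)) \<bullet> b"
  proof (cases "0 < c")
    case False
    then have "c * F' (x, c *\<^sub>R \<nu>) (0, b) = c * (- F' (x, \<nu>) (0, b))" using \<open>c * _ = _\<close> by simp
    then have "F' (x, c *\<^sub>R \<nu>) (0, b) = - F' (x, \<nu>) (0, b)" by (rule mult_left_cancel[OF c, THEN iffD1])
    then show ?thesis using c False by (simp add: F\<nu>_inner sgn_if)
  qed (use \<open>c * _ = _\<close> in \<open>simp add: F\<nu>_inner\<close>)
qed

lemma euler: "F\<nu> (x, \<nu>) \<bullet> \<nu> = F x \<nu>"
proof -
  have "((\<lambda>s. (x, s *\<^sub>R \<nu>)) has_derivative (\<lambda>s. (0, s *\<^sub>R \<nu>))) (at (1::real))"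
    by (auto intro!: derivative_eq_intros)
  moreover have "((\<lambda>(x, \<nu>). F x \<nu>) has_derivative blinfun_apply (F' (x, \<nu>))) (at (x, 1 *\<^sub>R \<nu>))"
    using deriv_F[OF phase(2)] by simp
  ultimately have "((\<lambda>s. (\<lambda>(x, \<nu>). F x \<nu>) (x, s *\<^sub>R \<nu>)) has_derivative (\<lambda>s. F' (x, \<nu>) (0, s *\<^sub>R \<nu>))) (at 1)"
    by (rule has_derivative_compose)
  then have "((\<lambda>s. s * F x \<nu>) has_derivative (\<lambda>s. F' (x, \<nu>) (0, s *\<^sub>R \<nu>))) (at 1)"
    by (rule has_derivative_transform_within_open[of _ _ _ _ "{0<..}"]) (auto simp: F_scale[OF x \<nu>])
  moreover have "((\<lambda>s. s * F x \<nu>) has_derivative (\<lambda>s. s * F x \<nu>)) (at 1)"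
    by (auto intro!: derivative_eq_intros)
  ultimately have "(\<lambda>s. F' (x, \<nu>) (0, s *\<^sub>R \<nu>)) = (\<lambda>s. s * F x \<nu>)" by (rule has_derivative_unique)
  from fun_cong[OF this, of 1] show ?thesis by (simp add: F\<nu>_inner)
qed

end

text \<open>Differentiate Euler's relation \<open>F\<nu> \<bullet> \<nu> = F\<close>: the term
  \<open>F\<nu> \<bullet> b\<close> occurs on both sides and cancels.\<close>

lemma F\<nu>'_inner:
  assumes x: "x \<in> \<Omega>" and \<nu>: "\<nu> \<noteq> 0"
  shows "F\<nu>' (x, \<nu>) (a, b) \<bullet> \<nu> = F' (x, \<nu>) (a, 0)"
proof -
  have z: "(x, \<nu>) \<in> \<Omega> \<times> (UNIV - {0})" using assms by simp
  have "((\<lambda>z. F\<nu> z \<bullet> snd z) has_derivative (\<lambda>w. F\<nu> (x, \<nu>) \<bullet> snd w + F\<nu>' (x, \<nu>) w \<bullet> snd (x, \<nu>))) (at (x, \<nu>))"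
    by (intro has_derivative_inner deriv_F\<nu> z has_derivative_snd has_derivative_ident)
  then have "((\<lambda>(x, \<nu>). F x \<nu>) has_derivative (\<lambda>w. F\<nu> (x, \<nu>) \<bullet> snd w + F\<nu>' (x, \<nu>) w \<bullet> snd (x, \<nu>))) (at (x, \<nu>))"
  proof (rule has_derivative_transform_within_open[OF _ open_phase z])
    fix y assume "y \<in> \<Omega> \<times> (UNIV - {0 :: real^'n})"
    then show "F\<nu> y \<bullet> snd y = (\<lambda>(x, \<nu>). F x \<nu>) y" by (cases y) (simp add: euler)
  qed
  then have "(\<lambda>w. F\<nu> (x, \<nu>) \<bullet> snd w + F\<nu>' (x, \<nu>) w \<bullet> snd (x, \<nu>)) = blinfun_apply (F' (x, \<nu>))"
    using deriv_F[OF z] by (rule has_derivative_unique)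
  from fun_cong[OF this, of "(a, b)"] show ?thesis using F'_Pair[of "(x, \<nu>)" a b] by simp
qed

lemma F\<nu>'_scale:
  assumes x: "x \<in> \<Omega>" and \<nu>: "\<nu> \<noteq> 0" and c: "0 < c"
  shows "F\<nu>' (x, c *\<^sub>R \<nu>) (a, c *\<^sub>R b) = F\<nu>' (x, \<nu>) (a, b)"
proof -
  have z: "(x, \<nu>) \<in> \<Omega> \<times> (UNIV - {0})" "(x, c *\<^sub>R \<nu>) \<in> \<Omega> \<times> (UNIV - {0})" using assms by auto
  have "((\<lambda>z. (fst z, c *\<^sub>R snd z)) has_derivative (\<lambda>z. (fst z, c *\<^sub>R snd z))) (at (x, \<nu>))"
    by (auto intro!: derivative_eq_intros)
  moreover have "(F\<nu> has_derivative F\<nu>' (x, c *\<^sub>R \<nu>)) (at (fst (x, \<nu>), c *\<^sub>R snd (x, \<nu>)))"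
    using deriv_F\<nu>[OF z(2)] by simp
  ultimately have "((\<lambda>z. F\<nu> (fst z, c *\<^sub>R snd z)) has_derivative (\<lambda>z. F\<nu>' (x, c *\<^sub>R \<nu>) (fst z, c *\<^sub>R snd z))) (at (x, \<nu>))"
    by (rule has_derivative_compose)
  then have "(F\<nu> has_derivative (\<lambda>z. F\<nu>' (x, c *\<^sub>R \<nu>) (fst z, c *\<^sub>R snd z))) (at (x, \<nu>))"
  proof (rule has_derivative_transform_within_open[OF _ open_phase z(1)])
    fix y assume "y \<in> \<Omega> \<times> (UNIV - {0 :: real^'n})"
    then show "F\<nu> (fst y, c *\<^sub>R snd y) = F\<nu> y" using c by (cases y) (simp add: F\<nu>_scale)
  qed
  then have "(\<lambda>z. F\<nu>' (x, c *\<^sub>R \<nu>) (fst z, c *\<^sub>R snd z)) = F\<nu>' (x, \<nu>)" using deriv_F\<nu>[OF z(1)] by (rule has_derivative_unique)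
  from fun_cong[OF this, of "(a, b)"] show ?thesis by simp
qed

lemma F\<nu>'_radial:
  assumes x: "x \<in> \<Omega>" and \<nu>: "\<nu> \<noteq> 0"
  shows "F\<nu>' (x, \<nu>) (0, \<nu>) = 0"
proof -
  have "((\<lambda>s. (x, s *\<^sub>R \<nu>)) has_derivative (\<lambda>s. (0, s *\<^sub>R \<nu>))) (at (1::real))"
    by (auto intro!: derivative_eq_intros)
  moreover have "(F\<nu> has_derivative F\<nu>' (x, \<nu>)) (at (x, 1 *\<^sub>R \<nu>))"
    using deriv_F\<nu>[of "(x, \<nu>)"] assms by simp
  ultimately have "((\<lambda>s. F\<nu> (x, s *\<^sub>R \<nu>)) has_derivative (\<lambda>s. F\<nu>' (x, \<nu>) (0, s *\<^sub>R \<nu>))) (at 1)"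
    by (rule has_derivative_compose)
  then have "((\<lambda>s. F\<nu> (x, \<nu>)) has_derivative (\<lambda>s. F\<nu>' (x, \<nu>) (0, s *\<^sub>R \<nu>))) (at 1)"
    by (rule has_derivative_transform_within_open[of _ _ _ _ "{0<..}"]) (auto simp: F\<nu>_scale[OF x \<nu>])
  moreover have "((\<lambda>s. F\<nu> (x, \<nu>)) has_derivative (\<lambda>s. 0)) (at (1::real))" by simp
  ultimately have "(\<lambda>s::real. F\<nu>' (x, \<nu>) (0, s *\<^sub>R \<nu>)) = (\<lambda>s. 0)" by (rule has_derivative_unique)
  from fun_cong[OF this, of 1] show ?thesis by simp
qed

lemma dF_eq: "x \<in> \<Omega> \<Longrightarrow> \<nu> \<noteq> 0 \<Longrightarrow> dF F j x \<nu> = F\<nu> (x, \<nu>) $ j"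
proof -
  assume z: "x \<in> \<Omega>" "\<nu> \<noteq> 0"
  have "((\<lambda>\<nu>. (x, \<nu>)) has_derivative (\<lambda>w. (0, w))) (at \<nu>)" by (auto intro!: derivative_eq_intros)
  moreover have "((\<lambda>(x, \<nu>). F x \<nu>) has_derivative blinfun_apply (F' (x, \<nu>))) (at (x, \<nu>))" using z by (intro deriv_F) simp
  ultimately have "((\<lambda>\<nu>. (\<lambda>(x, \<nu>). F x \<nu>) (x, \<nu>)) has_derivative (\<lambda>w. F' (x, \<nu>) (0, w))) (at \<nu>)" by (rule has_derivative_compose)
  then have "(F x has_derivative (\<lambda>w. F' (x, \<nu>) (0, w))) (at \<nu>)" by simp
  then show ?thesis unfolding dF_def by (simp add: partial_eq F\<nu>_def)
qed

lemma dF2_eq: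
  assumes z: "x \<in> \<Omega>" "\<nu> \<noteq> 0"
  shows "dF2 F i j x \<nu> = F\<nu>' (x, \<nu>) (0, axis i 1) $ j"
  unfolding dF2_def
proof (rule partial_eq_local[where S = "UNIV - {0}" and h = "\<lambda>\<nu>. F\<nu> (x, \<nu>) $ j"])
  have "((\<lambda>\<nu>. (x, \<nu>)) has_derivative (\<lambda>w. (0, w))) (at \<nu>)" by (auto intro!: derivative_eq_intros)
  moreover have "(F\<nu> has_derivative F\<nu>' (x, \<nu>)) (at (x, \<nu>))" using z by (intro deriv_F\<nu>) simp
  ultimately have "((\<lambda>\<nu>. F\<nu> (x, \<nu>)) has_derivative (\<lambda>w. F\<nu>' (x, \<nu>) (0, w))) (at \<nu>)" by (rule has_derivative_compose)
  then show "((\<lambda>\<nu>. F\<nu> (x, \<nu>) $ j) has_derivative (\<lambda>w. F\<nu>' (x, \<nu>) (0, w) $ j)) (at \<nu>)"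
    by (rule bounded_linear.has_derivative[OF bounded_linear_vec_nth])
qed (use z dF_eq in auto)

lemma dxF_eq:
  assumes z: "x \<in> \<Omega>" "\<nu> \<noteq> 0"
  shows "dxF F i j x \<nu> = F\<nu>' (x, \<nu>) (axis i 1, 0) $ j"
  unfolding dxF_def
proof (rule partial_eq_local[where S = \<Omega> and h = "\<lambda>y. F\<nu> (y, \<nu>) $ j"])
  have "((\<lambda>y. (y, \<nu>)) has_derivative (\<lambda>w. (w, 0))) (at x)" by (auto intro!: derivative_eq_intros)
  moreover have "(F\<nu> has_derivative F\<nu>' (x, \<nu>)) (at (x, \<nu>))" using z by (intro deriv_F\<nu>) simp
  ultimately have "((\<lambda>y. F\<nu> (y, \<nu>)) has_derivative (\<lambda>w. F\<nu>' (x, \<nu>) (w, 0))) (at x)" by (rule has_derivative_compose)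
  then show "((\<lambda>y. F\<nu> (y, \<nu>) $ j) has_derivative (\<lambda>w. F\<nu>' (x, \<nu>) (w, 0) $ j)) (at x)"
    by (rule bounded_linear.has_derivative[OF bounded_linear_vec_nth])
qed (use z open_domain dF_eq in auto)

lemma F\<nu>'_expand: "F\<nu>' z (0, b) = (\<Sum>i\<in>UNIV. b $ i *\<^sub>R F\<nu>' z (0, axis i 1))"
proof -
  have b: "(0, b) = (\<Sum>j\<in>UNIV. b $ j *\<^sub>R (0 :: real^'n, axis j 1))"
    using basis_expansion[of b] by (simp add: scalar_mult_eq_scaleR sum_prod)
  have l: "linear (F\<nu>' z)" using F\<nu>'_linear[of z] by (simp add: linear_conv_bounded_linear)
  show ?thesis by (subst b) (simp only: linear_sum[OF l] linear_scale[OF l])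
qed

text \<open>Ellipticity is assumed for unit normals; the second derivative has degree -1 in the
  normal, which transfers it to every nonzero \<open>N\<close>.\<close>

lemma elliptic_pos:
  assumes x: "x \<in> \<Omega>" and N: "N \<noteq> 0" and \<eta>: "\<eta> \<noteq> 0" "\<eta> \<bullet> N = 0"
  shows "0 < F\<nu>' (x, N) (0, \<eta>) \<bullet> \<eta>"
proof -
  let ?c = "inverse (norm N)"
  have c: "0 < ?c" and n: "norm (?c *\<^sub>R N) = 1" "?c *\<^sub>R N \<noteq> 0" using N by auto
  have "0 < (\<Sum>i\<in>UNIV. \<Sum>j\<in>UNIV. dF2 F i j x (?c *\<^sub>R N) * \<eta> $ i * \<eta> $ j)"
    using \<eta> by (intro elliptic[OF x n(1)]) auto
  also have "\<dots> = F\<nu>' (x, ?c *\<^sub>R N) (0, \<eta>) \<bullet> \<eta>"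
    by (subst F\<nu>'_expand) (simp only: inner_sum_left inner_scaleR_left, simp add: inner_vec_def dF2_eq[OF x n(2)] sum_distrib_left ac_simps)
  also have "F\<nu>' (x, ?c *\<^sub>R N) (0, \<eta>) = F\<nu>' (x, ?c *\<^sub>R N) (0, ?c *\<^sub>R (norm N *\<^sub>R \<eta>))" using N by simp
  also have "\<dots> = F\<nu>' (x, N) (0, norm N *\<^sub>R \<eta>)" by (rule F\<nu>'_scale[OF x N c])
  also have "\<dots> = norm N *\<^sub>R F\<nu>' (x, N) (0, \<eta>)"
    using linear_scale[of "F\<nu>' (x, N)" "norm N" "(0, \<eta>)"] F\<nu>'_linear[of "(x, N)"] by (simp add: linear_conv_bounded_linear)
  finally show ?thesis using N by (simp add: zero_less_mult_iff)
qed

section \<open>Convexity: supporting planes and their equality case\<close>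

lemma F_subadditive:
  assumes x: "x \<in> \<Omega>" and "a \<noteq> 0" "b \<noteq> 0" "a + b \<noteq> 0"
  shows "F x (a + b) \<le> F x a + F x b"
proof -
  have h: "1 - 1/2 = (1/2 :: real)" by simp
  have "(\<lambda>\<nu>. if \<nu> = 0 then 0 else F x \<nu>) ((1 - 1/2) *\<^sub>R a + (1/2) *\<^sub>R b)
      \<le> (1 - 1/2) * (\<lambda>\<nu>. if \<nu> = 0 then 0 else F x \<nu>) a + 1/2 * (\<lambda>\<nu>. if \<nu> = 0 then 0 else F x \<nu>) b"
    by (rule convex_onD[OF convex[OF x]]) auto
  then have "(if (1/2) *\<^sub>R a + (1/2) *\<^sub>R b = 0 then 0 else F x ((1/2) *\<^sub>R a + (1/2) *\<^sub>R b))
      \<le> 1/2 * (if a = 0 then 0 else F x a) + 1/2 * (if b = 0 then 0 else F x b)"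
    by (simp only: h)
  moreover have "(1/2) *\<^sub>R a + (1/2) *\<^sub>R b = (1/2) *\<^sub>R (a + b)" by (simp add: scaleR_add_right)
  ultimately show ?thesis using assms F_scale[OF x assms(4), of "1/2"] by simp
qed

text \<open>Subadditivity and homogeneity bound the difference quotient of \<open>F x\<close> at
  \<open>\<nu>\<close> in direction \<open>y\<close> by \<open>F x y\<close> for small
  \<open>t > 0\<close>; then \<open>t\<close> tends to 0.\<close>

lemma F_supporting:
  assumes x: "x \<in> \<Omega>" and \<nu>: "\<nu> \<noteq> 0" and y: "y \<noteq> 0"
  shows "F\<nu> (x, \<nu>) \<bullet> y \<le> F x y"
proof -
  have "((\<lambda>t. (x, \<nu> + t *\<^sub>R y)) has_derivative (\<lambda>t. (0, t *\<^sub>R y))) (at (0::real))"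
    by (auto intro!: derivative_eq_intros)
  moreover have "((\<lambda>(x, \<nu>). F x \<nu>) has_derivative blinfun_apply (F' (x, \<nu>))) (at (x, \<nu> + 0 *\<^sub>R y))"
    using deriv_F[of "(x, \<nu>)"] x \<nu> by simp
  ultimately have "((\<lambda>t. (\<lambda>(x, \<nu>). F x \<nu>) (x, \<nu> + t *\<^sub>R y)) has_derivative (\<lambda>t. F' (x, \<nu>) (0, t *\<^sub>R y))) (at 0)"
    by (rule has_derivative_compose)
  moreover have "F' (x, \<nu>) (0, t *\<^sub>R y) = (F\<nu> (x, \<nu>) \<bullet> y) * t" for t by (simp add: F\<nu>_inner[symmetric])
  ultimately have "((\<lambda>t. F x (\<nu> + t *\<^sub>R y)) has_real_derivative F\<nu> (x, \<nu>) \<bullet> y) (at 0)"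
    by (simp add: has_field_derivative_def)
  then have "((\<lambda>t. (F x (\<nu> + t *\<^sub>R y) - F x \<nu>) / t) \<longlongrightarrow> F\<nu> (x, \<nu>) \<bullet> y) (at 0)"
    by (simp add: has_field_derivative_iff)
  then have "((\<lambda>t. (F x (\<nu> + t *\<^sub>R y) - F x \<nu>) / t) \<longlongrightarrow> F\<nu> (x, \<nu>) \<bullet> y) (at_right 0)"
    by (rule tendsto_within_subset) simp
  moreover have "\<forall>\<^sub>F t in at_right 0. (F x (\<nu> + t *\<^sub>R y) - F x \<nu>) / t \<le> F x y"
  proof -
    have "((\<lambda>t. \<nu> + t *\<^sub>R y) \<longlongrightarrow> \<nu> + 0 *\<^sub>R y) (at_right 0)" by (intro tendsto_intros)
    then have "\<forall>\<^sub>F t in at_right 0. \<nu> + t *\<^sub>R y \<noteq> 0" using \<nu> by (auto intro: tendsto_imp_eventually_ne)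
    moreover have "\<forall>\<^sub>F t in at_right (0::real). 0 < t" by (rule eventually_at_right_less)
    ultimately show ?thesis
    proof eventually_elim
      case (elim t)
      have "F x (\<nu> + t *\<^sub>R y) \<le> F x \<nu> + F x (t *\<^sub>R y)" using elim y by (intro F_subadditive[OF x \<nu>]) auto
      then show ?case using elim F_scale[OF x y, of t] by (simp add: field_simps)
    qed
  qed
  ultimately show ?thesis by (intro tendsto_upperbound) auto
qed

lemma F_supporting_abs:
  assumes "x \<in> \<Omega>" "\<nu> \<noteq> 0" "y \<noteq> 0"
  shows "\<bar>F\<nu> (x, \<nu>) \<bullet> y\<bar> \<le> F x y"
  using F_supporting[OF assms] F_supporting[OF assms(1,2), of "- y"] F_even[OF assms(1,3)] assms(3) by auto

text \<open>Equality makes \<open>F x\<close> affine along the ray \<open>N + t \<nu>\<close>,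
  \<open>t > 0\<close>: subadditivity bounds it above and the supporting plane at \<open>N\<close>
  below. So the second derivative at \<open>N\<close> in direction \<open>\<nu>\<close> vanishes,
  which ellipticity permits only for multiples of \<open>N\<close>.\<close>

lemma F_supporting_strict:
  assumes x: "x \<in> \<Omega>" and N: "N \<noteq> 0" and \<nu>: "\<nu> \<noteq> 0" and eq: "F\<nu> (x, N) \<bullet> \<nu> = F x \<nu>"
  shows "\<exists>a. \<nu> = a *\<^sub>R N"
proof (rule ccontr)
  assume no: "\<nexists>a. \<nu> = a *\<^sub>R N"
  have nz: "N + t *\<^sub>R \<nu> \<noteq> 0" for t
  proof
    assume e: "N + t *\<^sub>R \<nu> = 0"
    then have "t \<noteq> 0" using N by auto
    have "\<nu> = inverse t *\<^sub>R (t *\<^sub>R \<nu>)" using \<open>t \<noteq> 0\<close> by simp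
    also have "t *\<^sub>R \<nu> = - N" using e by (simp add: add_eq_0_iff)
    finally have "\<nu> = (- inverse t) *\<^sub>R N" by simp
    then show False using no by blast
  qed
  have lin: "F x (N + t *\<^sub>R \<nu>) = F x N + t * F x \<nu>" if "0 < t" for t
  proof (rule antisym)
    have "F x (N + t *\<^sub>R \<nu>) \<le> F x N + F x (t *\<^sub>R \<nu>)" using that \<nu> nz by (intro F_subadditive[OF x N]) auto
    then show "F x (N + t *\<^sub>R \<nu>) \<le> F x N + t * F x \<nu>" using that F_scale[OF x \<nu>, of t] by simp
    have "F\<nu> (x, N) \<bullet> (N + t *\<^sub>R \<nu>) \<le> F x (N + t *\<^sub>R \<nu>)" by (rule F_supporting[OF x N nz])
    then show "F x N + t * F x \<nu> \<le> F x (N + t *\<^sub>R \<nu>)" by (simp add: inner_add_right euler[OF x N] eq)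
  qed
  have path: "((\<lambda>t. (x, N + t *\<^sub>R \<nu>)) has_derivative (\<lambda>t. (0, t *\<^sub>R \<nu>))) (at (s::real))" for s
    by (auto intro!: derivative_eq_intros)
  have const: "F\<nu> (x, N + s *\<^sub>R \<nu>) \<bullet> \<nu> = F x \<nu>" if s: "0 < s" for s
  proof -
    have "((\<lambda>(x, \<nu>). F x \<nu>) has_derivative blinfun_apply (F' (x, N + s *\<^sub>R \<nu>))) (at (x, N + s *\<^sub>R \<nu>))"
      using x nz by (intro deriv_F) auto
    then have "((\<lambda>t. (\<lambda>(x, \<nu>). F x \<nu>) (x, N + t *\<^sub>R \<nu>)) has_derivative (\<lambda>t. F' (x, N + s *\<^sub>R \<nu>) (0, t *\<^sub>R \<nu>))) (at s)"
      by (rule has_derivative_compose[OF path])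
    then have "((\<lambda>t. F x N + t * F x \<nu>) has_derivative (\<lambda>t. F' (x, N + s *\<^sub>R \<nu>) (0, t *\<^sub>R \<nu>))) (at s)"
      by (rule has_derivative_transform_within_open[of _ _ _ _ "{0<..}"]) (use s lin in auto)
    moreover have "((\<lambda>t. F x N + t * F x \<nu>) has_derivative (\<lambda>t. t * F x \<nu>)) (at s)" by (auto intro!: derivative_eq_intros)
    ultimately have "(\<lambda>t. F' (x, N + s *\<^sub>R \<nu>) (0, t *\<^sub>R \<nu>)) = (\<lambda>t. t * F x \<nu>)" by (rule has_derivative_unique)
    from fun_cong[OF this, of 1] show ?thesis by (simp add: F\<nu>_inner)
  qed
  \<comment> \<open>The derivative along the ray is constant for \<open>t > 0\<close> and by
    \<open>eq\<close> has the same value at 0, so the right-sided difference quotients that define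
    \<open>?D \<bullet> \<nu>\<close> are all 0.\<close>
  let ?D = "F\<nu>' (x, N) (0, \<nu>)"
  have "(F\<nu> has_derivative F\<nu>' (x, N)) (at (x, N + 0 *\<^sub>R \<nu>))" using deriv_F\<nu>[of "(x, N)"] x N by simp
  then have "((\<lambda>t. F\<nu> (x, N + t *\<^sub>R \<nu>)) has_derivative (\<lambda>t. F\<nu>' (x, N) (0, t *\<^sub>R \<nu>))) (at 0)"
    by (rule has_derivative_compose[OF path])
  then have "((\<lambda>t. F\<nu> (x, N + t *\<^sub>R \<nu>) \<bullet> \<nu>) has_derivative (\<lambda>t. F\<nu>' (x, N) (0, t *\<^sub>R \<nu>) \<bullet> \<nu>)) (at 0)"
    by (rule has_derivative_inner_left)
  moreover
  have lF: "linear (F\<nu>' (x, N))" using F\<nu>'_linear by (simp add: linear_conv_bounded_linear)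
  then have "F\<nu>' (x, N) (0, t *\<^sub>R \<nu>) \<bullet> \<nu> = (?D \<bullet> \<nu>) * t" for t using linear_scale[OF lF, of t "(0, \<nu>)"] by simp
  ultimately have "((\<lambda>t. F\<nu> (x, N + t *\<^sub>R \<nu>) \<bullet> \<nu>) has_real_derivative ?D \<bullet> \<nu>) (at 0)"
    by (simp add: has_field_derivative_def)
  then have "((\<lambda>t. (F\<nu> (x, N + t *\<^sub>R \<nu>) \<bullet> \<nu> - F\<nu> (x, N) \<bullet> \<nu>) / t) \<longlongrightarrow> ?D \<bullet> \<nu>) (at 0)"
    by (simp add: has_field_derivative_iff)
  then have lim: "((\<lambda>t. (F\<nu> (x, N + t *\<^sub>R \<nu>) \<bullet> \<nu> - F\<nu> (x, N) \<bullet> \<nu>) / t) \<longlongrightarrow> ?D \<bullet> \<nu>) (at_right 0)"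
    by (rule tendsto_within_subset) simp
  have "\<forall>\<^sub>F t in at_right (0::real). 0 < t" by (rule eventually_at_right_less)
  then have "\<forall>\<^sub>F t in at_right 0. (F\<nu> (x, N + t *\<^sub>R \<nu>) \<bullet> \<nu> - F\<nu> (x, N) \<bullet> \<nu>) / t = 0"
    by eventually_elim (simp add: const eq)
  then have "((\<lambda>t. (F\<nu> (x, N + t *\<^sub>R \<nu>) \<bullet> \<nu> - F\<nu> (x, N) \<bullet> \<nu>) / t) \<longlongrightarrow> 0) (at_right 0)" by (rule tendsto_eventually)
  then have D0: "?D \<bullet> \<nu> = 0" by (rule tendsto_unique[OF trivial_limit_at_right_real lim])
  \<comment> \<open>The component along \<open>N\<close> is annihilated by
    \<open>F\<nu>'_radial\<close>, and \<open>?D\<close> is orthogonal to \<open>N\<close> by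
    \<open>F\<nu>'_inner\<close>. What is left is the quadratic form at the orthogonal component
    \<open>\<eta>\<close>, which is nonzero.\<close>
  define a where "a = (\<nu> \<bullet> N) / (N \<bullet> N)"
  define \<eta> where "\<eta> = \<nu> - a *\<^sub>R N"
  have \<eta>: "\<eta> \<noteq> 0" "\<eta> \<bullet> N = 0" using no N by (auto simp: \<eta>_def a_def inner_diff_left)
  have \<nu>e: "\<nu> = a *\<^sub>R N + \<eta>" by (simp add: \<eta>_def)
  have "?D = a *\<^sub>R F\<nu>' (x, N) (0, N) + F\<nu>' (x, N) (0, \<eta>)"
    using linear_add[OF lF, of "a *\<^sub>R (0, N)" "(0, \<eta>)"] linear_scale[OF lF, of a "(0, N)"] by (simp add: \<nu>e)
  then have D: "?D = F\<nu>' (x, N) (0, \<eta>)" by (simp add: F\<nu>'_radial[OF x N])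
  have "?D \<bullet> \<nu> = F\<nu>' (x, N) (0, \<eta>) \<bullet> \<eta>"
  proof -
    have "F\<nu>' (x, N) (0, \<eta>) \<bullet> N = F' (x, N) (0, 0)" by (rule F\<nu>'_inner[OF x N])
    also have "(0, 0) = (0 :: (real^'n) \<times> (real^'n))" by (simp add: zero_prod_def)
    finally have "F\<nu>' (x, N) (0, \<eta>) \<bullet> N = 0" by simp
    then show ?thesis unfolding D by (subst \<nu>e) (simp add: inner_add_right)
  qed
  then show False using D0 elliptic_pos[OF x N \<eta>] by simp
qed

text \<open>The excess of \<open>\<nu>\<close> against the level sets of the barrier, whose normal is \<open>N\<close>.\<close>

definition tilt :: "real^'n \<Rightarrow> real^'n \<Rightarrow> real^'n \<Rightarrow> real" where
  "tilt x N \<nu> = F x \<nu> * F x N - (F\<nu> (x, \<nu>) \<bullet> N) * (F\<nu> (x, N) \<bullet> \<nu>)"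

lemma tilt_nonneg:
  assumes "x \<in> \<Omega>" "N \<noteq> 0" "\<nu> \<noteq> 0"
  shows "0 \<le> tilt x N \<nu>"
proof -
  have "\<bar>(F\<nu> (x, \<nu>) \<bullet> N) * (F\<nu> (x, N) \<bullet> \<nu>)\<bar> \<le> F x N * F x \<nu>"
    unfolding abs_mult using assms F_pos[of x N] F_pos[of x \<nu>] by (intro mult_mono F_supporting_abs) auto
  then show ?thesis by (simp add: tilt_def abs_le_iff mult.commute)
qed

text \<open>Equality in a product of two supporting inequalities with positive bounds forces
  equality in each up to sign. Evenness of \<open>F\<close> removes the sign, and the strict case
  applies.\<close>

lemma tilt_zero:
  assumes "x \<in> \<Omega>" "N \<noteq> 0" "\<nu> \<noteq> 0" "tilt x N \<nu> = 0"
  shows "\<exists>a. \<nu> = a *\<^sub>R N"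
proof -
  have pos: "0 < F x N" "0 < F x \<nu>" using assms F_pos by auto
  let ?p = "\<bar>F\<nu> (x, \<nu>) \<bullet> N\<bar>" and ?q = "\<bar>F\<nu> (x, N) \<bullet> \<nu>\<bar>"
  have le: "?p \<le> F x N" "?q \<le> F x \<nu>" using assms by (auto intro: F_supporting_abs)
  have "F x N * F x \<nu> = \<bar>(F\<nu> (x, \<nu>) \<bullet> N) * (F\<nu> (x, N) \<bullet> \<nu>)\<bar>"
  proof -
    have "(F\<nu> (x, \<nu>) \<bullet> N) * (F\<nu> (x, N) \<bullet> \<nu>) = F x \<nu> * F x N" using assms(4) by (simp add: tilt_def)
    then show ?thesis using pos by (simp add: abs_mult)
  qed
  also have "\<dots> \<le> F x N * ?q" unfolding abs_mult using le by (intro mult_right_mono) auto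
  finally have "F x \<nu> \<le> ?q" using pos by simp
  then have "?q = F x \<nu>" using le by simp
  then consider "F\<nu> (x, N) \<bullet> \<nu> = F x \<nu>" | "F\<nu> (x, N) \<bullet> (- \<nu>) = F x (- \<nu>)"
    using F_even[OF assms(1,3)] by (auto simp: abs_if split: if_splits)
  then show ?thesis
  proof cases
    case 1
    then show ?thesis by (rule F_supporting_strict[OF assms(1-3)])
  next
    case 2
    then have "\<exists>a. - \<nu> = a *\<^sub>R N" using F_supporting_strict[OF assms(1,2), of "- \<nu>"] assms(3) by simp
    then show ?thesis by (metis minus_equation_iff scaleR_minus_left)
  qed
qed

end

section \<open>Cutoff functions\<close>

lemma DERIV_max_square: "((\<lambda>u. (max 0 u)\<^sup>2) has_real_derivative 2 * max 0 u) (at (u::real))"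
proof -
  consider "0 < u" | "u < 0" | "u = 0" by linarith
  then show ?thesis
  proof cases
    case 1
    have "((\<lambda>u. u\<^sup>2) has_real_derivative 2 * u) (at u)" by (auto intro!: derivative_eq_intros)
    then have "((\<lambda>u. (max 0 u)\<^sup>2) has_real_derivative 2 * u) (at u)"
      by (rule has_field_derivative_transform_within_open[where S = "{0<..}"]) (use 1 in auto)
    then show ?thesis using 1 by simp
  next
    case 2
    have "((\<lambda>u. 0) has_real_derivative 0) (at u)" by simp
    then have "((\<lambda>u. (max 0 u)\<^sup>2) has_real_derivative 0) (at u)"
      by (rule has_field_derivative_transform_within_open[where S = "{..<0}"]) (use 2 in auto)
    then show ?thesis using 2 by simp
  next
    case 3
    have "((\<lambda>h. (max 0 h)\<^sup>2 / h) \<longlongrightarrow> 0) (at (0::real))"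
    proof (rule tendsto_0_le[where K = 1])
      show "((\<lambda>h. h) \<longlongrightarrow> 0) (at (0::real))" by (rule tendsto_ident_at)
      show "\<forall>\<^sub>F h in at (0::real). norm ((max 0 h)\<^sup>2 / h) \<le> norm h * 1"
        by (rule always_eventually) (auto simp: max_def power2_eq_square)
    qed
    then show ?thesis using 3 by (simp add: has_field_derivative_iff)
  qed
qed

text \<open>\<open>q u / (q u + q (1 - u))\<close> with \<open>q\<close> the square of the positive
  part: the two squares never vanish together, and both ends are met with zero derivative.\<close>

lemma smooth_step_exists:
  obtains \<sigma> \<sigma>' :: "real \<Rightarrow> real" and K where
    "\<And>u. (\<sigma> has_real_derivative \<sigma>' u) (at u)" "continuous_on UNIV \<sigma>'" "\<And>u. 0 \<le> \<sigma> u" "\<And>u. \<sigma> u \<le> 1"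
    "\<And>u. u \<le> 0 \<Longrightarrow> \<sigma> u = 0" "\<And>u. 1 \<le> u \<Longrightarrow> \<sigma> u = 1" "\<And>u. u \<le> 0 \<or> 1 \<le> u \<Longrightarrow> \<sigma>' u = 0" "0 < K" "\<And>u. \<bar>\<sigma>' u\<bar> \<le> K"
proof -
  let ?q = "\<lambda>u::real. (max 0 u)\<^sup>2"
  let ?D = "\<lambda>u. ?q u + ?q (1 - u)"
  define \<sigma> where "\<sigma> u = ?q u / ?D u" for u
  define \<sigma>' where "\<sigma>' u = (2 * max 0 u * ?D u - ?q u * (2 * max 0 u + - (2 * max 0 (1 - u)))) / (?D u * ?D u)" for u
  have D: "0 < ?D u" for u
  proof (cases "0 < u")
    case True
    then show ?thesis by (intro add_pos_nonneg) auto
  next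
    case False
    then show ?thesis by (intro add_nonneg_pos) auto
  qed
  have dq: "((\<lambda>u. ?q (1 - u)) has_real_derivative - (2 * max 0 (1 - u))) (at u)" for u
  proof -
    have "((\<lambda>u::real. 1 - u) has_real_derivative - 1) (at u)" by (auto intro!: derivative_eq_intros)
    from DERIV_chain2[where f = "\<lambda>u. (max 0 u)\<^sup>2" and g = "\<lambda>u. 1 - u", OF DERIV_max_square this]
    show ?thesis by simp
  qed
  have der: "(\<sigma> has_real_derivative \<sigma>' u) (at u)" for u
    unfolding \<sigma>_def[abs_def] \<sigma>'_def
    by (intro DERIV_divide DERIV_max_square DERIV_add dq) (use D[of u] in linarith)
  have cont: "continuous_on S \<sigma>'" for S
    unfolding \<sigma>'_def using D by (intro continuous_intros) (metis mult_eq_0_iff less_irrefl)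
  have z: "\<sigma>' u = 0" if "u \<le> 0 \<or> 1 \<le> u" for u using that by (auto simp: \<sigma>'_def max_def power2_eq_square)
  have "bounded (\<sigma>' ` {0..1})" by (intro compact_imp_bounded compact_continuous_image cont) simp
  then obtain K where K: "0 < K" "\<And>u. u \<in> {0..1} \<Longrightarrow> norm (\<sigma>' u) \<le> K" unfolding bounded_pos by auto
  show thesis
  proof (rule that[of \<sigma> \<sigma>' K])
    show "\<bar>\<sigma>' u\<bar> \<le> K" for u using K(1) K(2)[of u] z[of u] by (cases "u \<in> {0..1}") auto
    show "0 \<le> \<sigma> u" for u unfolding \<sigma>_def by simp
    show "\<sigma> u \<le> 1" for u unfolding \<sigma>_def using D[of u] by (subst divide_le_eq_1_pos) auto
    show "\<sigma> u = 1" if "1 \<le> u" for u using that D[of u] by (simp add: \<sigma>_def)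
    show "\<sigma> u = 0" if "u \<le> 0" for u using that by (simp add: \<sigma>_def)
  qed (use der cont z K(1) in auto)
qed

section \<open>Scalar cutoffs with gradient bounds\<close>

definition C1_fun :: "(real^'n \<Rightarrow> real) \<Rightarrow> (real^'n \<Rightarrow> real^'n) \<Rightarrow> bool" where
  "C1_fun f Df \<longleftrightarrow> (\<forall>x. (f has_derivative (\<lambda>h. Df x \<bullet> h)) (at x)) \<and> continuous_on UNIV Df"

lemma C1_fun_continuous: "C1_fun f Df \<Longrightarrow> continuous_on UNIV f"
  unfolding C1_fun_def by (meson continuous_at_imp_continuous_on has_derivative_continuous)

lemma C1_fun_mult:
  assumes "C1_fun f Df" "C1_fun g Dg"
  shows "C1_fun (\<lambda>x. f x * g x) (\<lambda>x. f x *\<^sub>R Dg x + g x *\<^sub>R Df x)"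
  using assms C1_fun_continuous[OF assms(1)] C1_fun_continuous[OF assms(2)] unfolding C1_fun_def
  by (auto intro!: continuous_intros derivative_eq_intros simp: inner_add_left)

lemma radial_cutoff_exists:
  obtains K where "0 < K"
    "\<And>(c :: real^'n) \<rho>. 0 < \<rho> \<Longrightarrow> \<exists>\<theta> D\<theta>. C1_fun \<theta> D\<theta> \<and> (\<forall>x. 0 \<le> \<theta> x \<and> \<theta> x \<le> 1) \<and>
      (\<forall>x. norm (x - c) \<le> \<rho> \<longrightarrow> \<theta> x = 1 \<and> D\<theta> x = 0) \<and> (\<forall>x. 2 * \<rho> \<le> norm (x - c) \<longrightarrow> \<theta> x = 0 \<and> D\<theta> x = 0) \<and>
      (\<forall>x. norm (D\<theta> x) \<le> K / \<rho>)"
proof -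
  obtain \<sigma> \<sigma>' :: "real \<Rightarrow> real" and K where \<sigma>:
    "\<And>u. (\<sigma> has_real_derivative \<sigma>' u) (at u)" "continuous_on UNIV \<sigma>'" "\<And>u. 0 \<le> \<sigma> u" "\<And>u. \<sigma> u \<le> 1"
    "\<And>u. u \<le> 0 \<Longrightarrow> \<sigma> u = 0" "\<And>u. 1 \<le> u \<Longrightarrow> \<sigma> u = 1" "\<And>u. u \<le> 0 \<or> 1 \<le> u \<Longrightarrow> \<sigma>' u = 0" "0 < K" "\<And>u. \<bar>\<sigma>' u\<bar> \<le> K"
    by (rule smooth_step_exists) blast
  show thesis
  proof (rule that)
    show "0 < 4 * K / 3" using \<sigma>(8) by simp
    fix c :: "real^'n" and \<rho> :: real assume \<rho>: "0 < \<rho>"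
    \<comment> \<open>Affine in the squared distance, with value 1 at radius \<open>\<rho>\<close>
      and 0 at \<open>2 \<rho>\<close>; squaring avoids the singularity of the norm at the
      centre.\<close>
    define s where "s x = (4 * \<rho>\<^sup>2 - (x - c) \<bullet> (x - c)) / (3 * \<rho>\<^sup>2)" for x
    define D where "D x = (\<sigma>' (s x) * (- 2 / (3 * \<rho>\<^sup>2))) *\<^sub>R (x - c)" for x
    have ds: "(s has_derivative (\<lambda>h. (- 2 / (3 * \<rho>\<^sup>2)) * ((x - c) \<bullet> h))) (at x)" for x
      unfolding s_def[abs_def] using \<rho>
      by (auto intro!: derivative_eq_intros simp: inner_commute fun_eq_iff field_simps)
    have cs: "continuous_on UNIV s" unfolding s_def using \<rho> by (intro continuous_intros) auto
    have "((\<lambda>x. \<sigma> (s x)) has_derivative (\<lambda>h. D x \<bullet> h)) (at x)" for x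
    proof -
      have "((\<lambda>x. \<sigma> (s x)) has_derivative (\<lambda>h. \<sigma>' (s x) * ((- 2 / (3 * \<rho>\<^sup>2)) * ((x - c) \<bullet> h)))) (at x)"
        by (rule has_derivative_compose[OF ds]) (use \<sigma>(1) in \<open>simp add: has_field_derivative_def\<close>)
      then show ?thesis by (simp add: D_def mult.assoc)
    qed
    moreover have "continuous_on UNIV D"
      unfolding D_def by (intro continuous_intros continuous_on_compose2[OF \<sigma>(2) cs]) auto
    ultimately have C1: "C1_fun (\<lambda>x. \<sigma> (s x)) D" by (simp add: C1_fun_def)
    have inner_ball: "1 \<le> s x" if "norm (x - c) \<le> \<rho>" for x
    proof -
      have "(x - c) \<bullet> (x - c) \<le> \<rho>\<^sup>2" using power_mono[OF that, of 2] by (simp add: power2_norm_eq_inner)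
      then show ?thesis using \<rho> by (simp add: s_def)
    qed
    have outer_ball: "s x \<le> 0" if "2 * \<rho> \<le> norm (x - c)" for x
    proof -
      have "(2 * \<rho>)\<^sup>2 \<le> (x - c) \<bullet> (x - c)" using power_mono[OF that, of 2] \<rho> by (simp add: power2_norm_eq_inner)
      then show ?thesis using \<rho> by (simp add: s_def power_mult_distrib divide_nonpos_pos)
    qed
    have bd: "norm (D x) \<le> 4 * K / 3 / \<rho>" for x
    proof (cases "2 * \<rho> \<le> norm (x - c)")
      case True
      then have "D x = 0" using \<sigma>(7)[of "s x"] outer_ball by (simp add: D_def)
      then show ?thesis using \<sigma>(8) \<rho> by simp
    next
      case False
      have "norm (D x) = \<bar>\<sigma>' (s x)\<bar> * (2 / (3 * \<rho>\<^sup>2)) * norm (x - c)" using \<rho> by (simp add: D_def abs_mult)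
      also have "\<dots> \<le> K * (2 / (3 * \<rho>\<^sup>2)) * (2 * \<rho>)"
        using False \<sigma>(8,9) \<rho> by (intro mult_mono) auto
      also have "\<dots> = 4 * K / 3 / \<rho>" using \<rho> by (simp add: field_simps power2_eq_square)
      finally show ?thesis .
    qed
    show "\<exists>\<theta> D\<theta>. C1_fun \<theta> D\<theta> \<and> (\<forall>x. 0 \<le> \<theta> x \<and> \<theta> x \<le> 1) \<and>
      (\<forall>x. norm (x - c) \<le> \<rho> \<longrightarrow> \<theta> x = 1 \<and> D\<theta> x = 0) \<and> (\<forall>x. 2 * \<rho> \<le> norm (x - c) \<longrightarrow> \<theta> x = 0 \<and> D\<theta> x = 0) \<and>
      (\<forall>x. norm (D\<theta> x) \<le> 4 * K / 3 / \<rho>)"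
      using C1 \<sigma>(3-7) inner_ball outer_ball bd
      by (intro exI[of _ "\<lambda>x. \<sigma> (s x)"] exI[of _ D]) (simp add: D_def)
  qed
qed

lemma C1_fun_prod:
  assumes "finite I" "\<And>i. i \<in> I \<Longrightarrow> C1_fun (f i) (Df i)" "\<And>i x. i \<in> I \<Longrightarrow> 0 \<le> f i x \<and> f i x \<le> 1"
  shows "\<exists>D. C1_fun (\<lambda>x. \<Prod>i\<in>I. f i x) D \<and> (\<forall>x. norm (D x) \<le> (\<Sum>i\<in>I. norm (Df i x))) \<and>
    (\<forall>x. 1 - (\<Prod>i\<in>I. f i x) \<le> (\<Sum>i\<in>I. 1 - f i x))"
  using assms
proof (induction I)
  case empty
  show ?case by (intro exI[of _ "\<lambda>_. 0"]) (auto simp: C1_fun_def)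
next
  case (insert j I)
  then obtain D where D: "C1_fun (\<lambda>x. \<Prod>i\<in>I. f i x) D" "\<And>x. norm (D x) \<le> (\<Sum>i\<in>I. norm (Df i x))"
    "\<And>x. 1 - (\<Prod>i\<in>I. f i x) \<le> (\<Sum>i\<in>I. 1 - f i x)" by blast
  have P: "0 \<le> (\<Prod>i\<in>I. f i x)" "(\<Prod>i\<in>I. f i x) \<le> 1" for x
    using insert.prems(2) by (auto intro!: prod_nonneg prod_le_1)
  have fj: "0 \<le> f j x" "f j x \<le> 1" for x using insert.prems(2)[of j x] by auto
  have "C1_fun (\<lambda>x. f j x * (\<Prod>i\<in>I. f i x)) (\<lambda>x. f j x *\<^sub>R D x + (\<Prod>i\<in>I. f i x) *\<^sub>R Df j x)"
    by (rule C1_fun_mult[OF insert.prems(1) D(1)]) simp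
  moreover have "norm (f j x *\<^sub>R D x + (\<Prod>i\<in>I. f i x) *\<^sub>R Df j x) \<le> norm (Df j x) + (\<Sum>i\<in>I. norm (Df i x))" for x
  proof -
    have "norm (f j x *\<^sub>R D x) \<le> 1 * (\<Sum>i\<in>I. norm (Df i x))"
      unfolding norm_scaleR using fj[of x] D(2)[of x] by (intro mult_mono) auto
    moreover have "norm ((\<Prod>i\<in>I. f i x) *\<^sub>R Df j x) \<le> 1 * norm (Df j x)"
      unfolding norm_scaleR using P[of x] by (intro mult_right_mono) auto
    ultimately show ?thesis
      using norm_triangle_ineq[of "f j x *\<^sub>R D x" "(\<Prod>i\<in>I. f i x) *\<^sub>R Df j x"] by linarith
  qed
  moreover have "1 - f j x * (\<Prod>i\<in>I. f i x) \<le> (1 - f j x) + (\<Sum>i\<in>I. 1 - f i x)" for x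
  proof -
    have "0 \<le> (1 - f j x) * (1 - (\<Prod>i\<in>I. f i x))" using fj[of x] P[of x] by simp
    then show ?thesis using D(3)[of x] by (simp add: algebra_simps)
  qed
  ultimately show ?case
    using insert.hyps by (intro exI[of _ "\<lambda>x. f j x *\<^sub>R D x + (\<Prod>i\<in>I. f i x) *\<^sub>R Df j x"]) simp
qed

text \<open>One Borel majorant \<open>e\<close> serves both the gradient and the deficit
  \<open>1 - \<zeta>\<close>, so a single integral over \<open>M\<close> controls the two errors of
  the cutoff. The bound \<open>E\<close> need not be small: the area estimate tolerates any error
  that is uniform along the sequence.\<close>

definition vanishing_cutoff :: "nat \<Rightarrow> (real^'n) set \<Rightarrow> (real^'n) set \<Rightarrow> real \<Rightarrow> bool" where
  "vanishing_cutoff m M B E \<longleftrightarrow>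
    (\<exists>\<zeta> D\<zeta> e W. C1_fun \<zeta> D\<zeta> \<and> (\<forall>x. 0 \<le> \<zeta> x \<and> \<zeta> x \<le> 1) \<and> open W \<and> B \<subseteq> W \<and> (\<forall>x\<in>W. \<zeta> x = 0) \<and>
      e \<in> borel_measurable borel \<and> (\<forall>x. 0 \<le> e x \<and> norm (D\<zeta> x) \<le> e x \<and> 1 - \<zeta> x \<le> e x) \<and>
      (\<integral>\<^sup>+x. ennreal (e x) * indicator M x \<partial>hausdorff_measure m) \<le> ennreal E)"

text \<open>A set of finite \<open>m - 1\<close>-dimensional measure in an \<open>m\<close>-dimensional surface is removed at the cost of
  a gradient bounded in \<open>L\<^sup>1\<close>: on a ball of radius \<open>\<rho>\<close> the gradient is of order \<open>1 / \<rho>\<close> and the area of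
  order \<open>\<rho>\<^sup>m\<close>.\<close>

lemma boundary_cutoff:
  assumes card: "CARD('n) = m + 1" and m: "1 \<le> m"
  obtains C where "0 \<le> C"
    "\<And>(M :: (real^'n) set) B b. C1_surface M \<Longrightarrow> M \<in> sets borel \<Longrightarrow> compact B \<Longrightarrow> B \<subseteq> M \<Longrightarrow> 0 \<le> b \<Longrightarrow>
      hausdorff_outer (m - 1) B < ennreal b \<Longrightarrow>
      vanishing_cutoff m M B (C * (b + 1))"
proof -
  obtain K where K: "0 < K"
    "\<And>(c :: real^'n) \<rho>. 0 < \<rho> \<Longrightarrow> \<exists>\<theta> D\<theta>. C1_fun \<theta> D\<theta> \<and> (\<forall>x. 0 \<le> \<theta> x \<and> \<theta> x \<le> 1) \<and>
      (\<forall>x. norm (x - c) \<le> \<rho> \<longrightarrow> \<theta> x = 1 \<and> D\<theta> x = 0) \<and> (\<forall>x. 2 * \<rho> \<le> norm (x - c) \<longrightarrow> \<theta> x = 0 \<and> D\<theta> x = 0) \<and>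
      (\<forall>x. norm (D\<theta> x) \<le> K / \<rho>)"
    by (rule radial_cutoff_exists) blast
  obtain A where A: "0 \<le> A" "\<And>(M :: (real^'n) set) B. C1_surface M \<Longrightarrow> compact B \<Longrightarrow> B \<subseteq> M \<Longrightarrow>
      \<exists>r0>0. \<forall>c\<in>B. \<forall>r. 0 < r \<longrightarrow> r < r0 \<longrightarrow> hausdorff_outer m (M \<inter> cball c r) \<le> ennreal (A * r ^ m)"
    by (rule C1_surface_area_ratio[OF card]) blast
  define \<omega> where "\<omega> = unit_ball_vol (real (m - 1))"
  have \<omega>: "0 < \<omega>" by (simp add: \<omega>_def unit_ball_vol_pos)
  \<comment> \<open>\<open>K + 1\<close> comes from the majorant of the cutoffs,
    \<open>A * 2 ^ m\<close> from the area in balls of doubled radius, and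
    \<open>2 ^ (m - 1) / \<omega>\<close> converts weights of covering sets into powers of
    diameters.\<close>
  define C where "C = (K + 1) * A * 2 ^ m * (2 ^ (m - 1) / \<omega> + 1)"
  show thesis
  proof (rule that)
    show C0: "0 \<le> C" using K(1) A(1) \<omega> by (simp add: C_def)
    fix M B :: "(real^'n) set" and b :: real
    assume M: "C1_surface M" "M \<in> sets borel" and B: "compact B" "B \<subseteq> M" and b: "0 \<le> b" "hausdorff_outer (m - 1) B < ennreal b"
    obtain r0 where r0: "0 < r0" "\<And>c r. c \<in> B \<Longrightarrow> 0 < r \<Longrightarrow> r < r0 \<Longrightarrow> hausdorff_outer m (M \<inter> cball c r) \<le> ennreal (A * r ^ m)"
      using A(2)[OF M(1) B] by blast
    \<comment> \<open>Radii will be below \<open>2 d\<close>: then \<open>2 \<rho> < r0\<close>, so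
      the area ratio applies, and \<open>\<rho> \<le> 1\<close>, so \<open>1 / \<rho>\<close> also
      dominates the deficit.\<close>
    define d where "d = min (r0 / 8) (1 / 4)"
    have d: "0 < d" "4 * d < r0" "2 * d < 1" using r0(1) by (auto simp: d_def min_def)
    have "hausdorff_premeasure (m - 1) d B < ennreal b"
      using hausdorff_premeasure_le_outer[OF d(1)] b(2) by (rule order_le_less_trans)
    then obtain S where S: "B \<subseteq> (\<Union>i::nat. S i)" "\<And>i. bounded (S i)" "\<And>i. diameter (S i) \<le> d"
      "(\<Sum>i. hausdorff_weight (m - 1) (S i)) < ennreal b"
      unfolding hausdorff_premeasure_def INF_less_iff by blast
    \<comment> \<open>Only covering sets that meet \<open>B\<close> are kept. Their centres then lie
      in \<open>B\<close>, where area ratios are known, and being nonempty they have the weight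
      given by the formula.\<close>
    define J where "J = {j. S j \<inter> B \<noteq> {}}"
    \<comment> \<open>The radius slightly exceeds the diameter, so that open balls cover
      \<open>B\<close> and even a singleton gets a positive radius. The excesses
      \<open>(1/2) ^ Suc j\<close> add up to at most 1, whence \<open>b + 1\<close> in the
      bound.\<close>
    have "\<exists>c \<rho>. c \<in> S j \<inter> B \<and> diameter (S j) < \<rho> \<and> \<rho> < 2 * d \<and> \<rho> ^ (m - 1) < diameter (S j) ^ (m - 1) + (1/2) ^ Suc j"
      if jJ: "j \<in> J" for j
    proof -
      let ?a = "diameter (S j)"
      have "((\<lambda>\<rho>. \<rho> ^ (m - 1)) \<longlongrightarrow> ?a ^ (m - 1)) (at_right ?a)" by (intro tendsto_intros)
      then have "\<forall>\<^sub>F \<rho> in at_right ?a. \<rho> ^ (m - 1) < ?a ^ (m - 1) + (1/2) ^ Suc j" by (rule order_tendstoD) simp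
      moreover have "\<forall>\<^sub>F \<rho> in at_right ?a. ?a < \<rho> \<and> \<rho> < 2 * d"
        using S(3)[of j] d(1) by (auto simp: eventually_at_right_field intro!: exI[of _ "2 * d"])
      ultimately have "\<forall>\<^sub>F \<rho> in at_right ?a. \<rho> ^ (m - 1) < ?a ^ (m - 1) + (1/2) ^ Suc j \<and> ?a < \<rho> \<and> \<rho> < 2 * d"
        by (rule eventually_conj)
      from eventually_happens[OF this]
      obtain \<rho> where "\<rho> ^ (m - 1) < ?a ^ (m - 1) + (1/2) ^ Suc j" "?a < \<rho>" "\<rho> < 2 * d" by auto
      moreover obtain c where "c \<in> S j \<inter> B" using jJ unfolding J_def by blast
      ultimately show ?thesis by (intro exI[of _ c] exI[of _ \<rho>]) simp
    qed
    then obtain c \<rho> where c\<rho>: "\<And>j. j \<in> J \<Longrightarrow> c j \<in> S j \<inter> B \<and> diameter (S j) < \<rho> j \<and> \<rho> j < 2 * d \<and>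
        \<rho> j ^ (m - 1) < diameter (S j) ^ (m - 1) + (1/2) ^ Suc j" by metis
    have \<rho>: "0 < \<rho> j" "\<rho> j \<le> 1" "2 * \<rho> j < r0" if "j \<in> J" for j
      using c\<rho>[OF that] d diameter_ge_0[OF S(2), of j] by auto
    have "B \<subseteq> (\<Union>j\<in>J. ball (c j) (\<rho> j))"
    proof
      fix x assume x: "x \<in> B"
      then obtain j where j: "x \<in> S j" using S(1) by auto
      then have "j \<in> J" using x by (auto simp: J_def)
      moreover have "dist (c j) x \<le> diameter (S j)"
        using c\<rho>[OF \<open>j \<in> J\<close>] j by (intro diameter_bounded_bound S(2)) auto
      ultimately show "x \<in> (\<Union>j\<in>J. ball (c j) (\<rho> j))" using c\<rho>[of j] by (intro UN_I[of j]) auto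
    qed
    then obtain I where I: "I \<subseteq> J" "finite I" "B \<subseteq> (\<Union>j\<in>I. ball (c j) (\<rho> j))"
      using compactE_image[OF B(1), of J "\<lambda>j. ball (c j) (\<rho> j)"] by auto
    have "\<forall>j\<in>I. \<exists>\<theta> D\<theta>. C1_fun \<theta> D\<theta> \<and> (\<forall>x. 0 \<le> \<theta> x \<and> \<theta> x \<le> 1) \<and>
      (\<forall>x. norm (x - c j) \<le> \<rho> j \<longrightarrow> \<theta> x = 1 \<and> D\<theta> x = 0) \<and> (\<forall>x. 2 * \<rho> j \<le> norm (x - c j) \<longrightarrow> \<theta> x = 0 \<and> D\<theta> x = 0) \<and>
      (\<forall>x. norm (D\<theta> x) \<le> K / \<rho> j)"
      using K(2) \<rho>(1) I(1) by blast
    then obtain \<theta> D\<theta> where "\<forall>j\<in>I. C1_fun (\<theta> j) (D\<theta> j) \<and> (\<forall>x. 0 \<le> \<theta> j x \<and> \<theta> j x \<le> 1) \<and>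
      (\<forall>x. norm (x - c j) \<le> \<rho> j \<longrightarrow> \<theta> j x = 1 \<and> D\<theta> j x = 0) \<and> (\<forall>x. 2 * \<rho> j \<le> norm (x - c j) \<longrightarrow> \<theta> j x = 0 \<and> D\<theta> j x = 0) \<and>
      (\<forall>x. norm (D\<theta> j x) \<le> K / \<rho> j)"
      unfolding bchoice_iff by blast
    then have \<theta>: "\<And>j. j \<in> I \<Longrightarrow> C1_fun (\<theta> j) (D\<theta> j)" "\<And>j x. j \<in> I \<Longrightarrow> 0 \<le> \<theta> j x \<and> \<theta> j x \<le> 1"
      "\<And>j x. j \<in> I \<Longrightarrow> norm (x - c j) \<le> \<rho> j \<Longrightarrow> \<theta> j x = 1"
      "\<And>j x. j \<in> I \<Longrightarrow> 2 * \<rho> j \<le> norm (x - c j) \<Longrightarrow> \<theta> j x = 0 \<and> D\<theta> j x = 0"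
      "\<And>j x. j \<in> I \<Longrightarrow> norm (D\<theta> j x) \<le> K / \<rho> j"
      by simp_all
    have f1: "C1_fun (\<lambda>x. 1 - \<theta> j x) (\<lambda>x. - D\<theta> j x)" if "j \<in> I" for j
      using \<theta>(1)[OF that] unfolding C1_fun_def by (auto intro!: derivative_eq_intros continuous_intros)
    have "\<exists>D. C1_fun (\<lambda>x. \<Prod>j\<in>I. 1 - \<theta> j x) D \<and> (\<forall>x. norm (D x) \<le> (\<Sum>j\<in>I. norm (- D\<theta> j x))) \<and>
      (\<forall>x. 1 - (\<Prod>j\<in>I. 1 - \<theta> j x) \<le> (\<Sum>j\<in>I. 1 - (1 - \<theta> j x)))"
      by (rule C1_fun_prod[OF I(2), where f = "\<lambda>j x. 1 - \<theta> j x" and Df = "\<lambda>j x. - D\<theta> j x"]) (use f1 \<theta>(2) in auto)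
    then obtain D where D: "C1_fun (\<lambda>x. \<Prod>j\<in>I. 1 - \<theta> j x) D" "\<And>x. norm (D x) \<le> (\<Sum>j\<in>I. norm (- D\<theta> j x))"
      "\<And>x. 1 - (\<Prod>j\<in>I. 1 - \<theta> j x) \<le> (\<Sum>j\<in>I. 1 - (1 - \<theta> j x))" by blast
    define e where "e x = (\<Sum>j\<in>I. (K + 1) / \<rho> j * indicator (cball (c j) (2 * \<rho> j)) x)" for x
    have \<rho>I: "0 < \<rho> j" "\<rho> j \<le> 1" "2 * \<rho> j < r0" if "j \<in> I" for j using \<rho> I(1) that by auto
    have e1: "norm (D\<theta> j x) \<le> (K + 1) / \<rho> j * indicator (cball (c j) (2 * \<rho> j)) x \<and> \<theta> j x \<le> (K + 1) / \<rho> j * indicator (cball (c j) (2 * \<rho> j)) x"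
      if j: "j \<in> I" for j x
    proof (cases "2 * \<rho> j \<le> norm (x - c j)")
      case True
      then show ?thesis using \<theta>(4)[OF j True] \<rho>I(1)[OF j] K(1) by simp
    next
      case False
      then have "x \<in> cball (c j) (2 * \<rho> j)" by (simp add: dist_norm norm_minus_commute)
      moreover have "K / \<rho> j \<le> (K + 1) / \<rho> j" using \<rho>I(1)[OF j] by (simp add: divide_right_mono)
      moreover have "1 \<le> (K + 1) / \<rho> j" using \<rho>I(1,2)[OF j] K(1) by (simp add: le_divide_eq)
      ultimately show ?thesis using \<theta>(5)[OF j, of x] \<theta>(2)[OF j, of x] by auto
    qed
    have sums: "(\<Sum>j\<in>I. \<rho> j ^ (m - 1)) \<le> 2 ^ (m - 1) / \<omega> * b + 1"
    proof -
      let ?a = "\<lambda>j. diameter (S j)"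
      have "(\<Sum>j\<in>I. \<rho> j ^ (m - 1)) \<le> (\<Sum>j\<in>I. ?a j ^ (m - 1) + (1/2) ^ Suc j)"
        using c\<rho> I(1) by (intro sum_mono) (auto intro: less_imp_le)
      also have "\<dots> = (\<Sum>j\<in>I. ?a j ^ (m - 1)) + (\<Sum>j\<in>I. (1/2) ^ Suc j)" by (rule sum.distrib)
      also have "(\<Sum>j\<in>I. (1/2) ^ Suc j) \<le> (1::real)"
        using sum_le_suminf[of "\<lambda>j. (1/2::real) ^ Suc j" I] I(2) power_half_series by (auto simp: sums_iff)
      also have "(\<Sum>j\<in>I. ?a j ^ (m - 1)) \<le> 2 ^ (m - 1) / \<omega> * b"
      proof -
        have w: "hausdorff_weight (m - 1) (S j) = ennreal (\<omega> / 2 ^ (m - 1) * ?a j ^ (m - 1))" if "j \<in> I" for j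
          using that I(1) by (auto simp: hausdorff_weight_def J_def \<omega>_def power_divide)
        have "ennreal (\<Sum>j\<in>I. \<omega> / 2 ^ (m - 1) * ?a j ^ (m - 1)) = (\<Sum>j\<in>I. ennreal (\<omega> / 2 ^ (m - 1) * ?a j ^ (m - 1)))"
          using \<omega> diameter_ge_0[OF S(2)] by (intro sum_ennreal[symmetric]) auto
        also have "\<dots> = (\<Sum>j\<in>I. hausdorff_weight (m - 1) (S j))" using w by simp
        also have "\<dots> \<le> (\<Sum>j. hausdorff_weight (m - 1) (S j))" by (rule sum_le_suminf) (auto simp: I(2))
        also have "\<dots> < ennreal b" by (rule S(4))
        finally have lt: "ennreal (\<Sum>j\<in>I. \<omega> / 2 ^ (m - 1) * ?a j ^ (m - 1)) < ennreal b" .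
        have "0 \<le> (\<Sum>j\<in>I. \<omega> / 2 ^ (m - 1) * ?a j ^ (m - 1))"
          using \<omega> diameter_ge_0[OF S(2)] by (intro sum_nonneg) auto
        then have "(\<Sum>j\<in>I. \<omega> / 2 ^ (m - 1) * ?a j ^ (m - 1)) < b" using lt by (simp only: ennreal_less_iff)
        then have "\<omega> / 2 ^ (m - 1) * (\<Sum>j\<in>I. ?a j ^ (m - 1)) < b" by (simp add: sum_distrib_left)
        then show ?thesis using \<omega> by (simp add: field_simps)
      qed
      finally show ?thesis by simp
    qed
    have int: "(\<integral>\<^sup>+x. ennreal (e x) * indicator M x \<partial>hausdorff_measure m) \<le> ennreal (C * (b + 1))"
    proof -
      let ?k = "\<lambda>j. (K + 1) / \<rho> j"
      have kpos: "0 \<le> ?k j" if "j \<in> I" for j using \<rho>I(1)[OF that] K(1) by simp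
      have "ennreal (e x) * indicator M x = (\<Sum>j\<in>I. ennreal (?k j) * indicator (M \<inter> cball (c j) (2 * \<rho> j)) x)" for x
      proof -
        have "ennreal (e x) = (\<Sum>j\<in>I. ennreal (?k j * indicator (cball (c j) (2 * \<rho> j)) x))"
          unfolding e_def using kpos by (intro sum_ennreal[symmetric] mult_nonneg_nonneg) auto
        also have "\<dots> * indicator M x = (\<Sum>j\<in>I. ennreal (?k j) * indicator (M \<inter> cball (c j) (2 * \<rho> j)) x)"
          unfolding sum_distrib_right
        proof (rule sum.cong[OF refl])
          show "ennreal (?k j * indicator (cball (c j) (2 * \<rho> j)) x) * indicator M x
            = ennreal (?k j) * indicator (M \<inter> cball (c j) (2 * \<rho> j)) x" for j
            by (cases "x \<in> cball (c j) (2 * \<rho> j)"; cases "x \<in> M") (simp_all del: mem_cball)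
        qed
        finally show ?thesis .
      qed
      then have "(\<integral>\<^sup>+x. ennreal (e x) * indicator M x \<partial>hausdorff_measure m)
          = (\<integral>\<^sup>+x. (\<Sum>j\<in>I. ennreal (?k j) * indicator (M \<inter> cball (c j) (2 * \<rho> j)) x) \<partial>hausdorff_measure m)" by simp
      also have "\<dots> = (\<Sum>j\<in>I. \<integral>\<^sup>+x. ennreal (?k j) * indicator (M \<inter> cball (c j) (2 * \<rho> j)) x \<partial>hausdorff_measure m)"
        using M(2) by (intro nn_integral_sum measurable_hausdorff_measure borel_measurable_times_ennreal borel_measurable_const
            borel_measurable_indicator sets.Int) auto
      also have "\<dots> = (\<Sum>j\<in>I. ennreal (?k j) * hausdorff_outer m (M \<inter> cball (c j) (2 * \<rho> j)))"
        using M(2) by (intro sum.cong refl, subst nn_integral_cmult_indicator)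
          (auto simp: borel_sets_hausdorff_measure emeasure_hausdorff_borel)
      also have "\<dots> \<le> (\<Sum>j\<in>I. ennreal (?k j) * ennreal (A * (2 * \<rho> j) ^ m))"
      proof (intro sum_mono mult_left_mono r0(2))
        fix j assume "j \<in> I"
        then show "c j \<in> B" "0 < 2 * \<rho> j" "2 * \<rho> j < r0" using c\<rho> I(1) \<rho>I by auto
      qed auto
      also have "\<dots> = (\<Sum>j\<in>I. ennreal ((K + 1) * A * 2 ^ m * \<rho> j ^ (m - 1)))"
      proof (intro sum.cong refl)
        fix j assume j: "j \<in> I"
        \<comment> \<open>One factor \<open>\<rho> j\<close> of the area cancels the
          \<open>1 / \<rho> j\<close> of the gradient and leaves the power that the boundary measure
          controls; this uses \<open>1 \<le> m\<close>.\<close>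
        have "\<rho> j ^ m = \<rho> j * \<rho> j ^ (m - 1)" using m by (cases m) auto
        then have "?k j * (A * (2 * \<rho> j) ^ m) = (K + 1) * A * 2 ^ m * \<rho> j ^ (m - 1)"
          using \<rho>I(1)[OF j] by (simp add: power_mult_distrib)
        then show "ennreal (?k j) * ennreal (A * (2 * \<rho> j) ^ m) = ennreal ((K + 1) * A * 2 ^ m * \<rho> j ^ (m - 1))"
          using kpos[OF j] A(1) \<rho>I(1)[OF j] by (subst ennreal_mult[symmetric]) auto
      qed
      also have "\<dots> = ennreal (\<Sum>j\<in>I. (K + 1) * A * 2 ^ m * \<rho> j ^ (m - 1))"
        using K(1) A(1) \<rho>I(1) by (intro sum_ennreal mult_nonneg_nonneg zero_le_power) (auto simp: less_imp_le)
      also have "\<dots> \<le> ennreal (C * (b + 1))"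
      proof (rule ennreal_leI)
        have "(\<Sum>j\<in>I. (K + 1) * A * 2 ^ m * \<rho> j ^ (m - 1)) = (K + 1) * A * 2 ^ m * (\<Sum>j\<in>I. \<rho> j ^ (m - 1))"
          by (simp add: sum_distrib_left)
        also have "\<dots> \<le> (K + 1) * A * 2 ^ m * (2 ^ (m - 1) / \<omega> * b + 1)"
          using sums K(1) A(1) by (intro mult_left_mono) auto
        also have "\<dots> \<le> (K + 1) * A * 2 ^ m * ((2 ^ (m - 1) / \<omega> + 1) * (b + 1))"
        proof (rule mult_left_mono)
          have "(0::real) \<le> 2 ^ (m - 1) / \<omega>" using \<omega> by simp
          then show "2 ^ (m - 1) / \<omega> * b + 1 \<le> (2 ^ (m - 1) / \<omega> + 1) * (b + 1)"
            using b(1) by (simp add: distrib_left distrib_right)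
        qed (use K(1) A(1) in simp)
        finally show "(\<Sum>j\<in>I. (K + 1) * A * 2 ^ m * \<rho> j ^ (m - 1)) \<le> C * (b + 1)" by (simp add: C_def mult.assoc)
      qed
      finally show ?thesis .
    qed
    let ?\<zeta> = "\<lambda>x. \<Prod>j\<in>I. 1 - \<theta> j x"
    let ?W = "\<Union>j\<in>I. ball (c j) (\<rho> j)"
    have "norm (D x) \<le> e x" for x
      using D(2)[of x] sum_mono[of I "\<lambda>j. norm (D\<theta> j x)" "\<lambda>j. (K + 1) / \<rho> j * indicator (cball (c j) (2 * \<rho> j)) x"] e1
      by (simp add: e_def)
    moreover have "1 - ?\<zeta> x \<le> e x" for x
      using D(3)[of x] sum_mono[of I "\<lambda>j. \<theta> j x" "\<lambda>j. (K + 1) / \<rho> j * indicator (cball (c j) (2 * \<rho> j)) x"] e1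
      by (simp add: e_def)
    moreover have "0 \<le> e x" for x unfolding e_def using \<rho>I(1) K(1) by (intro sum_nonneg mult_nonneg_nonneg divide_nonneg_pos) auto
    moreover have "0 \<le> ?\<zeta> x \<and> ?\<zeta> x \<le> 1" for x using \<theta>(2) by (auto intro!: prod_nonneg prod_le_1)
    moreover have "?\<zeta> x = 0" if xW: "x \<in> ?W" for x
    proof -
      obtain j where "j \<in> I" "x \<in> ball (c j) (\<rho> j)" using xW by auto
      then have "\<theta> j x = 1" by (intro \<theta>(3)) (auto simp: dist_norm norm_minus_commute)
      then show ?thesis using I(2) \<open>j \<in> I\<close> by (intro prod_zero) auto
    qed
    moreover have "e \<in> borel_measurable borel" unfolding e_def[abs_def]
      by (intro borel_measurable_sum borel_measurable_times borel_measurable_const borel_measurable_indicator) simp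
    moreover have "open ?W" by auto
    ultimately show "vanishing_cutoff m M B (C * (b + 1))"
      unfolding vanishing_cutoff_def using D(1) I(3) int
      by (intro exI[of _ ?\<zeta>] exI[of _ D] exI[of _ e] exI[of _ ?W] conjI allI ballI) simp_all
  qed
qed

section \<open>The barrier argument\<close>

text \<open>Turns a field known only near \<open>p\<close> into a global test field. The open sets
  \<open>D\<close> and \<open>- C\<close> cover the space, and on their overlap the function and
  hence its derivative vanish.\<close>

lemma C1_zero_extension:
  fixes h :: "'a::euclidean_space \<Rightarrow> 'b::real_normed_vector"
  assumes "open D" "closed C" "C \<subseteq> D" and dh: "\<And>x. x \<in> D \<Longrightarrow> (h has_derivative blinfun_apply (h' x)) (at x)"
    and ch: "continuous_on D h'" and z: "\<And>x. x \<in> D - C \<Longrightarrow> h x = 0"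
  shows "((\<lambda>x. if x \<in> D then h x else 0) has_derivative blinfun_apply (if x \<in> D then h' x else 0)) (at x)"
    and "continuous_on UNIV (\<lambda>x. if x \<in> D then h' x else 0)"
proof -
  have z': "h' x = 0" if x: "x \<in> D - C" for x
  proof -
    have "(h has_derivative (\<lambda>_. 0)) (at x)"
      by (rule has_derivative_transform_within_open[OF has_derivative_const _ x])
        (use assms in \<open>auto simp: z open_Diff\<close>)
    then have "blinfun_apply (h' x) = (\<lambda>_. 0)" using dh[of x] x by (intro has_derivative_unique) auto
    then show ?thesis by (intro blinfun_eqI) simp
  qed
  show "((\<lambda>x. if x \<in> D then h x else 0) has_derivative blinfun_apply (if x \<in> D then h' x else 0)) (at x)"
  proof (cases "x \<in> D")
    case True
    then show ?thesis
      using has_derivative_transform_within_open[OF dh[OF True] \<open>open D\<close> True, of "\<lambda>x. if x \<in> D then h x else 0"] by simp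
  next
    case False
    then have "x \<in> - C" using assms(3) by auto
    have "((\<lambda>x. if x \<in> D then h x else 0) has_derivative (\<lambda>_. 0)) (at x)"
      by (rule has_derivative_transform_within_open[OF has_derivative_const _ \<open>x \<in> - C\<close>])
        (use assms(2) z in \<open>auto simp: open_Compl\<close>)
    then show ?thesis using False by (simp add: zero_blinfun.rep_eq)
  qed
  have "continuous_on (D \<union> - C) (\<lambda>x. if x \<in> D then h' x else 0)"
  proof (rule continuous_on_open_Un)
    show "continuous_on D (\<lambda>x. if x \<in> D then h' x else 0)" using ch by (rule continuous_on_eq) simp
    have "continuous_on (- C) (\<lambda>x. 0 :: 'a \<Rightarrow>\<^sub>L 'b)" by simp
    then show "continuous_on (- C) (\<lambda>x. if x \<in> D then h' x else 0)"
      by (rule continuous_on_eq) (use z' in auto)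
  qed (use assms in \<open>auto simp: open_Compl\<close>)
  moreover have "D \<union> - C = UNIV" using assms(3) by auto
  ultimately show "continuous_on UNIV (\<lambda>x. if x \<in> D then h' x else 0)" by simp
qed

text \<open>On the compact set where \<open>A \<le> 0\<close> the function \<open>B\<close> is
  positive, hence bounded below there; \<open>\<Lambda>\<close> is \<open>1\<close> minus the
  minimum of \<open>A\<close> over the minimum of \<open>B\<close>.\<close>

lemma compact_penalty:
  fixes A B :: "'a::topological_space \<Rightarrow> real"
  assumes K: "compact K" and cA: "continuous_on K A" and cB: "continuous_on K B"
    and B: "\<And>x. x \<in> K \<Longrightarrow> 0 \<le> B x" and pos: "\<And>x. x \<in> K \<Longrightarrow> B x = 0 \<Longrightarrow> 0 < A x"
  obtains \<Lambda> where "0 < \<Lambda>" "\<And>x. x \<in> K \<Longrightarrow> 0 < A x + \<Lambda> * B x"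
proof -
  define Z where "Z = {x \<in> K. A x \<le> 0}"
  have cZ: "compact Z"
  proof -
    have "closedin (top_of_set K) (K \<inter> A -` {..0})" by (rule continuous_closedin_preimage[OF cA]) simp
    then show ?thesis using K closedin_compact by (auto simp: Z_def vimage_def Int_def)
  qed
  show thesis
  proof (cases "Z = {}")
    case True
    show thesis
    proof (rule that[of 1])
      fix x assume x: "x \<in> K"
      then have "0 < A x" using True by (auto simp: Z_def not_le)
      then show "0 < A x + 1 * B x" using B[OF x] by simp
    qed simp
  next
    case False
    have ZK: "Z \<subseteq> K" by (auto simp: Z_def)
    obtain y where y: "y \<in> Z" "\<And>x. x \<in> Z \<Longrightarrow> B y \<le> B x"
      using continuous_attains_inf[OF cZ False continuous_on_subset[OF cB ZK]] by blast
    obtain w where w: "w \<in> Z" "\<And>x. x \<in> Z \<Longrightarrow> A w \<le> A x"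
      using continuous_attains_inf[OF cZ False continuous_on_subset[OF cA ZK]] by blast
    have By: "0 < B y" using B[of y] pos[of y] y(1) by (force simp: Z_def)
    have Aw: "A w \<le> 0" using w(1) by (simp add: Z_def)
    define \<Lambda> where "\<Lambda> = (1 - A w) / B y"
    have \<Lambda>: "0 < \<Lambda>" using By Aw by (simp add: \<Lambda>_def)
    show thesis
    proof (rule that[OF \<Lambda>])
      fix x assume x: "x \<in> K"
      show "0 < A x + \<Lambda> * B x"
      proof (cases "x \<in> Z")
        case True
        have "\<Lambda> * B y \<le> \<Lambda> * B x" using y(2)[OF True] \<Lambda> by (intro mult_left_mono) auto
        moreover have "\<Lambda> * B y = 1 - A w" using By by (simp add: \<Lambda>_def)
        ultimately show ?thesis using w(2)[OF True] by linarith
      next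
        case False
        then have "0 < A x" using x by (auto simp: Z_def not_le)
        then show ?thesis using B[OF x] \<Lambda> by (simp add: add_pos_nonneg)
      qed
    qed
  qed
qed

text \<open>Half of the minimum over the slice \<open>{p} \<times> S\<close> survives nearby, by
  uniform continuity on a compact product.\<close>

lemma positive_near_slice:
  fixes \<Phi> :: "'a::metric_space \<times> 'b::metric_space \<Rightarrow> real"
  assumes "compact S" "open D" "p \<in> D" "continuous_on (D \<times> S) \<Phi>" "\<And>\<nu>. \<nu> \<in> S \<Longrightarrow> 0 < \<Phi> (p, \<nu>)"
    and lc: "0 < R0" "compact (cball p R0)" "cball p R0 \<subseteq> D"
  obtains R c where "0 < R" "R \<le> R0" "0 < c" "\<And>x \<nu>. x \<in> cball p R \<Longrightarrow> \<nu> \<in> S \<Longrightarrow> c \<le> \<Phi> (x, \<nu>)"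
proof (cases "S = {}")
  case True
  then show ?thesis using that[of R0 1] lc(1) by auto
next
  case False
  let ?K = "cball p R0 \<times> S"
  have cK: "compact ?K" by (intro compact_Times assms)
  have c\<Phi>: "continuous_on ?K \<Phi>" by (rule continuous_on_subset[OF assms(4)]) (use lc(3) in auto)
  have "continuous_on ({p} \<times> S) \<Phi>" by (rule continuous_on_subset[OF c\<Phi>]) (use lc(1) in auto)
  moreover have "compact ({p} \<times> S)" by (intro compact_Times assms) simp
  ultimately obtain z where z: "z \<in> {p} \<times> S" "\<And>w. w \<in> {p} \<times> S \<Longrightarrow> \<Phi> z \<le> \<Phi> w"
    using continuous_attains_inf[of "{p} \<times> S" \<Phi>] False by auto
  have pos: "0 < \<Phi> z" using z(1) assms(5) by auto
  have "uniformly_continuous_on ?K \<Phi>" by (rule compact_uniformly_continuous[OF c\<Phi> cK])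
  then obtain d where d: "0 < d" "\<And>w w'. w \<in> ?K \<Longrightarrow> w' \<in> ?K \<Longrightarrow> dist w' w < d \<Longrightarrow> dist (\<Phi> w') (\<Phi> w) < \<Phi> z / 2"
    unfolding uniformly_continuous_on_def using pos by (metis half_gt_zero)
  show ?thesis
  proof (rule that[of "min R0 (d/2)" "\<Phi> z / 2"])
    fix x \<nu> assume x: "x \<in> cball p (min R0 (d / 2))" and \<nu>: "\<nu> \<in> S"
    have "dist (x, \<nu>) (p, \<nu>) = dist p x" by (simp add: dist_Pair_Pair dist_commute)
    then have "dist (x, \<nu>) (p, \<nu>) < d" using x d(1) by auto
    then have "dist (\<Phi> (x, \<nu>)) (\<Phi> (p, \<nu>)) < \<Phi> z / 2" using x \<nu> lc(1) by (intro d(2)) auto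
    moreover have "\<Phi> z \<le> \<Phi> (p, \<nu>)" using \<nu> by (intro z(2)) auto
    ultimately show "\<Phi> z / 2 \<le> \<Phi> (x, \<nu>)" unfolding dist_real_def by linarith
  qed (use lc(1) d(1) pos in auto)
qed

section \<open>First variation of the test field and the area estimate near \<open>p\<close>\<close>

context elliptic
begin

text \<open>Product rule for the field \<open>s G\<close>, with \<open>b\<close> in the role of the
  gradient of \<open>s\<close>. For \<open>b = N\<close> and \<open>G = F\<nu> (x, N)\<close> the
  additional bracket is \<open>tilt\<close>, because Euler's relation gives
  \<open>N \<bullet> G = F x N\<close>.\<close>

lemma first_variation_scaled:
  fixes A A0 :: "(real^'n) \<Rightarrow>\<^sub>L (real^'n)"
  assumes "\<And>a. blinfun_apply A a = (b \<bullet> a) *\<^sub>R G + s *\<^sub>R A0 a" "x \<in> \<Omega>" "\<nu> \<noteq> 0"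
  shows "first_variation x \<nu> (s *\<^sub>R G) A =
    s * first_variation x \<nu> G A0 + (F x \<nu> * (b \<bullet> G) - (F\<nu> (x, \<nu>) \<bullet> b) * (G \<bullet> \<nu>))"
proof -
  have tr: "tr A = b \<bullet> G + s * tr A0"
    by (simp add: tr_def assms(1) sum.distrib sum_distrib_left inner_vec_def[of b G] inner_axis)
  have ad: "adjoint A \<nu> = (G \<bullet> \<nu>) *\<^sub>R b + s *\<^sub>R adjoint A0 \<nu>"
    by (simp add: adjoint_blinfun_components assms(1) vec_eq_iff inner_add_right inner_axis inner_commute[of \<nu> G])
  have "tr A *\<^sub>R \<nu> - adjoint A \<nu> = s *\<^sub>R (tr A0 *\<^sub>R \<nu> - adjoint A0 \<nu>) + ((b \<bullet> G) *\<^sub>R \<nu> - (G \<bullet> \<nu>) *\<^sub>R b)"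
    unfolding tr ad by (simp add: algebra_simps)
  moreover have "F' (x, \<nu>) (s *\<^sub>R G, 0) = s * F' (x, \<nu>) (G, 0)"
    using blinfun.scaleR_right[of "F' (x, \<nu>)" s "(G, 0)"] by simp
  ultimately show ?thesis
    using euler[OF assms(2,3)] F'_Pair[of "(x, \<nu>)" "s *\<^sub>R G" "tr A *\<^sub>R \<nu> - adjoint A \<nu>"]
      F'_Pair[of "(x, \<nu>)" G "tr A0 *\<^sub>R \<nu> - adjoint A0 \<nu>"]
    unfolding first_variation_def
    by (simp only: inner_add_right inner_diff_right inner_scaleR_right) (simp add: algebra_simps)
qed

text \<open>The adjoint term is \<open>A0 (F\<nu> (x, \<nu>)) \<bullet> \<nu>\<close>, which by the
  differentiated Euler relation is the position derivative of \<open>F\<close> along the field. It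
  cancels the position term, and only the trace remains. The two signs from odd
  \<open>F\<nu>\<close> and from \<open>c\<close> combine to \<open>|c|\<close>.\<close>

lemma first_variation_center:
  fixes A0 :: "(real^'n) \<Rightarrow>\<^sub>L (real^'n)"
  assumes "\<And>a. blinfun_apply A0 a = F\<nu>' (x, N) (a, H a)" "x \<in> \<Omega>" "N \<noteq> 0" "c \<noteq> 0"
  shows "first_variation x (c *\<^sub>R N) (F\<nu> (x, N)) A0 = F x (c *\<^sub>R N) * tr A0"
proof -
  let ?\<nu> = "c *\<^sub>R N" and ?G = "F\<nu> (x, N)"
  have \<nu>: "?\<nu> \<noteq> 0" using assms by simp
  have lA: "linear A0" by (simp add: linear_conv_bounded_linear blinfun.bounded_linear_right)
  have s: "F\<nu> (x, ?\<nu>) = sgn c *\<^sub>R ?G" by (rule F\<nu>_scale[OF assms(2-4)])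
  have "F\<nu> (x, ?\<nu>) \<bullet> adjoint A0 ?\<nu> = A0 (F\<nu> (x, ?\<nu>)) \<bullet> ?\<nu>"
    by (simp add: adjoint_clauses(1)[OF lA])
  also have "\<dots> = \<bar>c\<bar> * (A0 ?G \<bullet> N)"
    unfolding s by (simp add: blinfun.scaleR_right abs_sgn mult.assoc[symmetric] mult.commute)
  also have "A0 ?G \<bullet> N = F' (x, N) (?G, 0)" unfolding assms(1) by (rule F\<nu>'_inner[OF assms(2,3)])
  also have "\<bar>c\<bar> * F' (x, N) (?G, 0) = F' (x, ?\<nu>) (?G, 0)" using F'_scale[OF assms(2-4), of ?G 0] by simp
  finally show ?thesis
    using euler[OF assms(2) \<nu>] F'_Pair[of "(x, ?\<nu>)" ?G "tr A0 *\<^sub>R ?\<nu> - adjoint A0 ?\<nu>"]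
    unfolding first_variation_def
    by (simp only: inner_diff_right inner_scaleR_right[of _ "tr A0"]) (simp add: mult.commute)
qed

text \<open>The order of quantifiers is the point. \<open>r\<close> precedes
  \<open>\<delta>\<close>, which may thus depend on it; \<open>\<rho>\<close> and \<open>C\<close>
  follow \<open>\<delta>\<close> but precede the surface, so the estimate is uniform along a
  sequence. \<open>a\<close> bounds the area where \<open>D \<eta>\<close> acts, \<open>E\<close>
  the cost of removing the boundary.\<close>

lemma barrier_estimate:
  fixes ft :: "real^'n \<Rightarrow> real" and N :: "real^'n \<Rightarrow> real^'n" and H :: "real^'n \<Rightarrow> ((real^'n) \<Rightarrow>\<^sub>L (real^'n))"
  assumes card: "CARD('n) = m + 1" and D: "open D" "p \<in> D" "D \<subseteq> \<Omega>"
    and dft: "\<And>x. x \<in> D \<Longrightarrow> (ft has_derivative (\<lambda>h. N x \<bullet> h)) (at x)"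
    and dN: "\<And>x. x \<in> D \<Longrightarrow> (N has_derivative blinfun_apply (H x)) (at x)" and cH: "continuous_on D H"
    and N0: "N p \<noteq> 0" and trace: "0 < tr (\<lambda>a. F\<nu>' (p, N p) (a, H p a))" and ftp: "ft p = 0"
    and R0: "0 < R0"
  obtains r where "0 < r" "3 * r \<le> R0" "cball p (3 * r) \<subseteq> \<Omega>"
    "\<And>\<delta>. 0 < \<delta> \<Longrightarrow> \<exists>\<rho>>0. \<exists>C\<ge>0. \<forall>M a E. proper_hypersurface \<Omega> M \<longrightarrow> F_stationary m \<Omega> F M \<longrightarrow>
      vanishing_cutoff m M (boundary_points M \<inter> cball p (2 * r)) E \<longrightarrow> 0 \<le> E \<longrightarrow> 0 \<le> a \<longrightarrow>
      hausdorff_outer m (M \<inter> {x. r \<le> dist p x \<and> dist p x \<le> 2 * r \<and> - \<delta> \<le> ft x}) \<le> ennreal a \<longrightarrow>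
      hausdorff_outer m (M \<inter> ball p \<rho>) \<le> ennreal (C * (a + E))"
proof -
  have cN: "continuous_on D N" by (intro continuous_at_imp_continuous_on ballI) (rule has_derivative_continuous[OF dN])
  have cft: "continuous_on D ft" by (intro continuous_at_imp_continuous_on ballI) (rule has_derivative_continuous[OF dft])
  define D0 where "D0 = D \<inter> N -` (- {0})"
  have D0: "open D0" "p \<in> D0" "D0 \<subseteq> D" "D0 \<subseteq> \<Omega>"
    using continuous_open_preimage[OF cN D(1), of "- {0}"] D N0 by (auto simp: D0_def)
  have N0': "N x \<noteq> 0" if "x \<in> D0" for x using that by (auto simp: D0_def)
  define G where "G x = F\<nu> (x, N x)" for x
  define G' where "G' x = Blinfun (\<lambda>a. F\<nu>' (x, N x) (a, H x a))" for x
  have G'a: "blinfun_apply (G' x) a = F\<nu>' (x, N x) (a, H x a)" for x a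
  proof -
    have "bounded_linear (\<lambda>a. F\<nu>' (x, N x) (a, H x a))"
      by (intro bounded_linear_compose[OF F\<nu>'_linear] bounded_linear_Pair bounded_linear_ident blinfun.bounded_linear_right)
    then show ?thesis unfolding G'_def by (simp add: bounded_linear_Blinfun_apply)
  qed
  have zD0: "(\<lambda>x. (x, N x)) ` D0 \<subseteq> \<Omega> \<times> (UNIV - {0})" using D0 N0' by auto
  have cxN: "continuous_on D0 (\<lambda>x. (x, N x))" by (intro continuous_intros continuous_on_subset[OF cN D0(3)])
  have dG: "(G has_derivative G' x) (at x)" if x: "x \<in> D0" for x
  proof -
    have "((\<lambda>x. (x, N x)) has_derivative (\<lambda>a. (a, H x a))) (at x)"
      using x D0 by (intro has_derivative_Pair has_derivative_ident dN) auto
    moreover have "(F\<nu> has_derivative F\<nu>' (x, N x)) (at (x, N x))" using x zD0 by (intro deriv_F\<nu>) auto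
    ultimately have "((\<lambda>x. F\<nu> (x, N x)) has_derivative (\<lambda>a. F\<nu>' (x, N x) (a, H x a))) (at x)"
      by (rule has_derivative_compose)
    then show ?thesis by (simp add: G_def[abs_def] G'a[abs_def])
  qed
  have cG': "continuous_on D0 G'"
    by (intro continuous_on_blinfun_componentwise)
      (auto simp: G'a intro!: cont_F\<nu>' cxN zD0 continuous_intros continuous_on_subset[OF cH D0(3)])
  have cG: "continuous_on D0 G" by (intro continuous_at_imp_continuous_on ballI) (rule has_derivative_continuous[OF dG])
  let ?S = "sphere (0 :: real^'n) 1"
  have phase1: "continuous_on (D0 \<times> ?S) (\<lambda>q. (fst q, snd q))" "(\<lambda>q. (fst q, snd q)) ` (D0 \<times> ?S) \<subseteq> \<Omega> \<times> (UNIV - {0})"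
    using D0(4) by (auto intro!: continuous_intros)
  have phase2: "continuous_on (D0 \<times> ?S) (\<lambda>q. (fst q, N (fst q)))" "(\<lambda>q. (fst q, N (fst q))) ` (D0 \<times> ?S) \<subseteq> \<Omega> \<times> (UNIV - {0})"
  proof -
    have "continuous_on (D0 \<times> ?S) (\<lambda>q. N (fst q))"
      by (rule continuous_on_compose2[OF cN]) (use D0(3) in \<open>auto intro!: continuous_intros\<close>)
    then show "continuous_on (D0 \<times> ?S) (\<lambda>q. (fst q, N (fst q)))" by (intro continuous_intros)
    show "(\<lambda>q. (fst q, N (fst q))) ` (D0 \<times> ?S) \<subseteq> \<Omega> \<times> (UNIV - {0})" using D0(4) N0' by auto
  qed
  have cA: "continuous_on (D0 \<times> ?S) (\<lambda>q. first_variation (fst q) (snd q) (G (fst q)) (G' (fst q)))"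
  proof -
    have c1: "continuous_on (D0 \<times> ?S) (\<lambda>q. G' (fst q))" and c2: "continuous_on (D0 \<times> ?S) (\<lambda>q. G (fst q))"
      by (auto intro!: continuous_on_compose2[OF cG'] continuous_on_compose2[OF cG] continuous_intros)
    show ?thesis
      unfolding first_variation_def adjoint_blinfun_components tr_def
      by (intro continuous_intros continuous_on_compose2[OF cont_F' phase1] c1 c2)
  qed
  have cB: "continuous_on (D0 \<times> ?S) (\<lambda>q. tilt (fst q) (N (fst q)) (snd q))"
  proof -
    have "continuous_on (D0 \<times> ?S) (\<lambda>q. F (fst q) (snd q))" "continuous_on (D0 \<times> ?S) (\<lambda>q. F (fst q) (N (fst q)))"
      using continuous_on_compose2[OF cont_F phase1] continuous_on_compose2[OF cont_F phase2] by (simp_all add: case_prod_unfold)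
    moreover have "continuous_on (D0 \<times> ?S) (\<lambda>q. N (fst q))"
      using continuous_on_snd[OF phase2(1)] by simp
    ultimately show ?thesis
      unfolding tilt_def by (intro continuous_intros continuous_on_compose2[OF cont_F\<nu> phase1] continuous_on_compose2[OF cont_F\<nu> phase2])
  qed
  have pD: "p \<in> \<Omega>" using D0 by auto
  \<comment> \<open>The choice is made at the single point \<open>p\<close>. Joint continuity of
    \<open>first_variation\<close> and \<open>tilt\<close> in position and normal then extends the
    inequality to a ball, at the price of the constant \<open>c1\<close>.\<close>
  obtain \<Lambda> where \<Lambda>: "0 < \<Lambda>" "\<And>\<nu>. \<nu> \<in> ?S \<Longrightarrow> 0 < first_variation p \<nu> (G p) (G' p) + \<Lambda> * tilt p (N p) \<nu>"
  proof (rule compact_penalty[of ?S "\<lambda>\<nu>. first_variation p \<nu> (G p) (G' p)" "\<lambda>\<nu>. tilt p (N p) \<nu>"])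
    have pS: "continuous_on ?S (\<lambda>\<nu>. (p, \<nu>))" "(\<lambda>\<nu>. (p, \<nu>)) ` ?S \<subseteq> D0 \<times> ?S" using D0(2) by (auto intro!: continuous_intros)
    show "continuous_on ?S (\<lambda>\<nu>. first_variation p \<nu> (G p) (G' p))" using continuous_on_compose2[OF cA pS] by simp
    show "continuous_on ?S (\<lambda>\<nu>. tilt p (N p) \<nu>)" using continuous_on_compose2[OF cB pS] by simp
    fix \<nu> :: "real^'n" assume "\<nu> \<in> ?S"
    then have \<nu>: "\<nu> \<noteq> 0" by auto
    then show "0 \<le> tilt p (N p) \<nu>" by (intro tilt_nonneg pD N0)
    assume "tilt p (N p) \<nu> = 0"
    then obtain c where c: "\<nu> = c *\<^sub>R N p" using tilt_zero[OF pD N0 \<nu>] by blast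
    then have "c \<noteq> 0" using \<nu> by auto
    have "first_variation p \<nu> (G p) (G' p) = F p \<nu> * tr (G' p)"
      unfolding c G_def by (rule first_variation_center[OF G'a pD N0 \<open>c \<noteq> 0\<close>])
    moreover have "0 < tr (G' p)" using trace by (simp add: tr_def G'a)
    ultimately show "0 < first_variation p \<nu> (G p) (G' p)" using F_pos[OF pD \<nu>] by simp
  qed auto
  obtain r1 where r1: "0 < r1" "cball p r1 \<subseteq> D0" using D0(1,2) open_contains_cball by blast
  have "continuous_on (D0 \<times> ?S) (\<lambda>q. first_variation (fst q) (snd q) (G (fst q)) (G' (fst q)) + \<Lambda> * tilt (fst q) (N (fst q)) (snd q))"
    by (intro continuous_intros cA cB)
  then obtain R c1 where R: "0 < R" "R \<le> min R0 r1" "0 < c1"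
    "\<And>x \<nu>. x \<in> cball p R \<Longrightarrow> \<nu> \<in> ?S \<Longrightarrow> c1 \<le> first_variation x \<nu> (G x) (G' x) + \<Lambda> * tilt x (N x) \<nu>"
    by (rule positive_near_slice[where S = ?S and D = D0 and p = p and ?R0.0 = "min R0 r1", rotated 3])
      (use D0 \<Lambda>(2) R0 r1 in auto)
  \<comment> \<open>\<open>\<eta>\<close> falls from 1 to 0 between radii \<open>r\<close> and
    \<open>2 r\<close>; the last third keeps the support compact inside the open ball of radius
    \<open>3 r\<close>.\<close>
  define r where "r = R / 3"
  have r: "0 < r" "3 * r = R" using R(1) by (auto simp: r_def)
  have rD0: "cball p (3 * r) \<subseteq> D0" using r(2) R(2) r1(2) by auto
  have sub23: "cball p (2 * r) \<subseteq> cball p (3 * r)" "cball p (2 * r) \<subseteq> ball p (3 * r)" using r(1) by auto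
  obtain K where "0 < K" and K: "\<exists>\<theta> D\<theta>. C1_fun \<theta> D\<theta> \<and> (\<forall>x. 0 \<le> \<theta> x \<and> \<theta> x \<le> 1) \<and>
      (\<forall>x. norm (x - p) \<le> r \<longrightarrow> \<theta> x = 1 \<and> D\<theta> x = 0) \<and> (\<forall>x. 2 * r \<le> norm (x - p) \<longrightarrow> \<theta> x = 0 \<and> D\<theta> x = 0) \<and>
      (\<forall>x. norm (D\<theta> x) \<le> K / r)"
    using r(1) by (metis radial_cutoff_exists)
  obtain \<eta> D\<eta> where \<eta>: "C1_fun \<eta> D\<eta>" "\<And>x. 0 \<le> \<eta> x \<and> \<eta> x \<le> 1" "\<And>x. norm (x - p) \<le> r \<Longrightarrow> \<eta> x = 1 \<and> D\<eta> x = 0"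
    "\<And>x. 2 * r \<le> norm (x - p) \<Longrightarrow> \<eta> x = 0 \<and> D\<eta> x = 0" "\<And>x. norm (D\<eta> x) \<le> K / r"
    using K by blast
  have KS: "cball p (2*r) \<times> ?S \<subseteq> D0 \<times> ?S" "cball p (2*r) \<subseteq> D0" using sub23(1) rD0 by auto
  have "continuous_on (cball p (2*r) \<times> ?S) (\<lambda>q. F (fst q) (snd q))"
    using continuous_on_subset[OF continuous_on_compose2[OF cont_F phase1] KS(1)] by (simp add: case_prod_unfold)
  then have "bounded ((\<lambda>q. F (fst q) (snd q)) ` (cball p (2*r) \<times> ?S))"
    by (intro compact_imp_bounded compact_continuous_image compact_Times compact_cball compact_sphere)
  then obtain BF where BF: "0 < BF" "\<And>x \<nu>. x \<in> cball p (2*r) \<Longrightarrow> norm \<nu> = 1 \<Longrightarrow> norm (F x \<nu>) \<le> BF"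
    unfolding bounded_pos by force
  have "continuous_on (cball p (2*r) \<times> ?S) (\<lambda>q. F\<nu> (fst q, snd q))"
    by (rule continuous_on_subset[OF continuous_on_compose2[OF cont_F\<nu> phase1] KS(1)])
  then have "bounded ((\<lambda>q. F\<nu> (fst q, snd q)) ` (cball p (2*r) \<times> ?S))"
    by (intro compact_imp_bounded compact_continuous_image compact_Times compact_cball compact_sphere)
  then obtain BF\<nu> where BF\<nu>: "0 < BF\<nu>" "\<And>x \<nu>. x \<in> cball p (2*r) \<Longrightarrow> norm \<nu> = 1 \<Longrightarrow> norm (F\<nu> (x, \<nu>)) \<le> BF\<nu>"
    unfolding bounded_pos by force
  have "bounded (G ` cball p (2*r))"
    by (intro compact_imp_bounded compact_continuous_image compact_cball continuous_on_subset[OF cG KS(2)])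
  then obtain BG where BG: "0 < BG" "\<And>x. x \<in> cball p (2*r) \<Longrightarrow> norm (G x) \<le> BG"
    unfolding bounded_pos by blast
  note B = BF BF\<nu> BG
  \<comment> \<open>Bounds the error form \<open>?Q\<close> below: its value at \<open>w\<close> is
    at most \<open>CQ * norm w\<close>.\<close>
  define CQ where "CQ = BF * BG + BF\<nu> * BG"
  have CQ: "0 \<le> CQ" using B by (simp add: CQ_def)
  show thesis
  proof (rule that[OF r(1)])
    show "3 * r \<le> R0" "cball p (3 * r) \<subseteq> \<Omega>" using r R(2) rD0 D0(4) by auto
    fix \<delta> :: real assume \<delta>: "0 < \<delta>"
    \<comment> \<open>The square makes \<open>\<psi>\<close> continuously differentiable across
      \<open>- \<delta>\<close>, below which it vanishes; the exponential yields
      \<open>\<psi>' \<ge> \<Lambda> \<psi>\<close>.\<close>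
    define \<psi> where "\<psi> u = exp (\<Lambda> * u) * (max 0 (u + \<delta>))\<^sup>2" for u
    define \<psi>' where "\<psi>' u = \<Lambda> * \<psi> u + exp (\<Lambda> * u) * (2 * max 0 (u + \<delta>))" for u
    have d\<psi>: "(\<psi> has_real_derivative \<psi>' u) (at u)" for u
    proof -
      have d1: "((\<lambda>u. u + \<delta>) has_real_derivative 1) (at u)" by (auto intro!: derivative_eq_intros)
      from DERIV_chain2[where f = "\<lambda>u. (max 0 u)\<^sup>2" and g = "\<lambda>u. u + \<delta>", OF DERIV_max_square this]
      have "((\<lambda>u. (max 0 (u + \<delta>))\<^sup>2) has_real_derivative 2 * max 0 (u + \<delta>)) (at u)" by simp
      moreover have "((\<lambda>u. exp (\<Lambda> * u)) has_real_derivative exp (\<Lambda> * u) * \<Lambda>) (at u)" by (auto intro!: derivative_eq_intros)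
      ultimately have "(\<psi> has_real_derivative exp (\<Lambda> * u) * \<Lambda> * (max 0 (u + \<delta>))\<^sup>2 + 2 * max 0 (u + \<delta>) * exp (\<Lambda> * u)) (at u)"
        unfolding \<psi>_def[abs_def] by (rule DERIV_mult[rotated])
      then show ?thesis by (simp add: \<psi>'_def \<psi>_def ac_simps)
    qed
    have c\<psi>: "continuous_on A \<psi>" "continuous_on A \<psi>'" for A unfolding \<psi>'_def \<psi>_def by (intro continuous_intros)+
    have \<psi>: "0 \<le> \<psi> u" "\<Lambda> * \<psi> u \<le> \<psi>' u" "u < - \<delta> \<Longrightarrow> \<psi> u = 0" for u by (auto simp: \<psi>_def \<psi>'_def)
    have c\<psi>ft: "continuous_on D (\<lambda>x. \<psi> (ft x))" by (rule continuous_on_compose2[OF c\<psi>(1)[of UNIV] cft]) auto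
    have "bounded ((\<lambda>x. \<psi> (ft x)) ` cball p (2*r))"
      using sub23(1) rD0 D0(3) by (intro compact_imp_bounded compact_continuous_image continuous_on_subset[OF c\<psi>ft]) auto
    then obtain P where P: "0 < P" "\<And>x. x \<in> cball p (2*r) \<Longrightarrow> \<psi> (ft x) \<le> P"
      unfolding bounded_pos by (auto simp: abs_le_iff)
    \<comment> \<open>Half of \<open>\<psi> (ft p) = \<delta>^2\<close>, so that
      \<open>c2 \<le> \<psi> (ft x)\<close> holds in a whole ball around \<open>p\<close>.\<close>
    define c2 where "c2 = \<delta>\<^sup>2 / 2"
    have c2: "0 < c2" using \<delta> by (simp add: c2_def)
    have "c2 < \<psi> (ft p)" using \<delta> by (simp add: c2_def ftp \<psi>_def)
    moreover have "isCont (\<lambda>x. \<psi> (ft x)) p" using c\<psi>ft D(1,2) by (simp add: continuous_on_eq_continuous_at)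
    ultimately have "\<forall>\<^sub>F x in at p. c2 < \<psi> (ft x)" by (intro order_tendstoD(1)) (auto simp: isCont_def)
    then obtain \<rho>0 where \<rho>0: "0 < \<rho>0" "\<And>x. x \<noteq> p \<Longrightarrow> dist x p < \<rho>0 \<Longrightarrow> c2 < \<psi> (ft x)"
      unfolding eventually_at by blast
    define \<rho> where "\<rho> = min \<rho>0 r"
    have \<rho>: "0 < \<rho>" "\<rho> \<le> r" using \<rho>0(1) r(1) by (auto simp: \<rho>_def)
    have \<rho>3: "c2 \<le> \<psi> (ft x)" if "x \<in> ball p \<rho>" for x
      using that \<rho>0(2)[of x] \<open>c2 < \<psi> (ft p)\<close> by (cases "x = p") (auto simp: \<rho>_def dist_commute)
    let ?A = "{x. r \<le> dist p x \<and> dist p x \<le> 2 * r \<and> - \<delta> \<le> ft x}"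
    \<comment> \<open>\<open>c3\<close> is the gain on \<open>ball p \<rho>\<close>,
      \<open>c4\<close> the loss from \<open>D \<eta>\<close> in the annulus, and \<open>c5\<close>
      the loss from \<open>\<zeta>\<close>: \<open>c3\<close> for its deficit and
      \<open>P * CQ\<close> for its gradient.\<close>
    define c3 where "c3 = c1 * c2"
    define c4 where "c4 = P * CQ * (K / r)"
    define c5 where "c5 = c3 + P * CQ"
    have c345: "0 < c3" "0 \<le> c4" "0 \<le> c5" using R(3) c2 P(1) CQ \<open>0 < K\<close> r(1) by (auto simp: c3_def c4_def c5_def)
    show "\<exists>\<rho>>0. \<exists>C\<ge>0. \<forall>M a E. proper_hypersurface \<Omega> M \<longrightarrow> F_stationary m \<Omega> F M \<longrightarrow>
      vanishing_cutoff m M (boundary_points M \<inter> cball p (2 * r)) E \<longrightarrow> 0 \<le> E \<longrightarrow> 0 \<le> a \<longrightarrow>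
      hausdorff_outer m (M \<inter> ?A) \<le> ennreal a \<longrightarrow>
      hausdorff_outer m (M \<inter> ball p \<rho>) \<le> ennreal (C * (a + E))"
    proof (rule exI[of _ \<rho>], rule conjI[OF \<rho>(1)], rule exI[of _ "(c4 + c5) / c3"], intro conjI allI impI)
      show "0 \<le> (c4 + c5) / c3" using c345 by simp
    next
      fix M :: "(real^'n) set" and a E :: real
      assume M: "proper_hypersurface \<Omega> M" "F_stationary m \<Omega> F M"
        and cutoff: "vanishing_cutoff m M (boundary_points M \<inter> cball p (2 * r)) E" and E0: "0 \<le> E"
        and a: "0 \<le> a" "hausdorff_outer m (M \<inter> ?A) \<le> ennreal a"
      obtain \<zeta> D\<zeta> e W where \<zeta>: "C1_fun \<zeta> D\<zeta>" "\<forall>x. 0 \<le> \<zeta> x \<and> \<zeta> x \<le> 1"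
        and W: "open W" "boundary_points M \<inter> cball p (2 * r) \<subseteq> W" "\<forall>x\<in>W. \<zeta> x = 0"
        and e: "e \<in> borel_measurable borel" "\<forall>x. 0 \<le> e x \<and> norm (D\<zeta> x) \<le> e x \<and> 1 - \<zeta> x \<le> e x"
        and E: "(\<integral>\<^sup>+x. ennreal (e x) * indicator M x \<partial>hausdorff_measure m) \<le> ennreal E" "0 \<le> E"
        using cutoff E0 unfolding vanishing_cutoff_def by blast
      let ?H = "hausdorff_measure m :: (real^'n) measure" and ?\<nu> = "unit_normal M" and ?U = "ball p (3 * r)"
      have M1: "C1_surface M" by (rule proper_hypersurface_C1_surface[OF M(1)])
      define \<kappa> where "\<kappa> x = \<zeta> x * \<eta> x" for x
      define D\<kappa> where "D\<kappa> x = \<zeta> x *\<^sub>R D\<eta> x + \<eta> x *\<^sub>R D\<zeta> x" for x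
      have \<kappa>: "C1_fun \<kappa> D\<kappa>" unfolding \<kappa>_def[abs_def] D\<kappa>_def[abs_def] by (rule C1_fun_mult[OF \<zeta>(1) \<eta>(1)])
      have \<kappa>01: "0 \<le> \<kappa> x" for x using \<zeta>(2) \<eta>(2)[of x] by (simp add: \<kappa>_def)
      define s where "s x = \<kappa> x * \<psi> (ft x)" for x
      \<comment> \<open>The gradient of \<open>s\<close>: the part along \<open>N\<close> is
        favourable and carries \<open>\<psi>'\<close>, the part along \<open>D\<kappa>\<close> is
        treated as an error.\<close>
      define b where "b x = (\<kappa> x * \<psi>' (ft x)) *\<^sub>R N x + \<psi> (ft x) *\<^sub>R D\<kappa> x" for x
      have U0: "?U \<subseteq> D0" "?U \<subseteq> D" using order_trans[OF ball_subset_cball rD0] D0(3) by blast+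
      have ds: "(s has_derivative (\<lambda>h. b x \<bullet> h)) (at x)" if x: "x \<in> D" for x
      proof -
        have "((\<lambda>x. \<psi> (ft x)) has_derivative (\<lambda>h. \<psi>' (ft x) * (N x \<bullet> h))) (at x)"
          by (rule has_derivative_compose[OF dft[OF x]]) (use d\<psi> in \<open>simp add: has_field_derivative_def\<close>)
        moreover have "(\<kappa> has_derivative (\<lambda>h. D\<kappa> x \<bullet> h)) (at x)" using \<kappa> by (simp add: C1_fun_def)
        ultimately have "(s has_derivative (\<lambda>h. \<kappa> x * (\<psi>' (ft x) * (N x \<bullet> h)) + (D\<kappa> x \<bullet> h) * \<psi> (ft x))) (at x)"
          unfolding s_def[abs_def] by (rule has_derivative_mult[rotated])
        then show ?thesis by (simp add: b_def inner_add_left ac_simps)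
      qed
      have c\<kappa>: "continuous_on A \<kappa>" "continuous_on A D\<kappa>" for A
        using C1_fun_continuous[OF \<kappa>] \<kappa> by (auto simp: C1_fun_def intro: continuous_on_subset)
      have cft0: "continuous_on ?U ft" and cN0: "continuous_on ?U N" using U0(2) cft cN by (auto intro: continuous_on_subset)
      have c\<psi>0: "continuous_on ?U (\<lambda>x. \<psi> (ft x))" "continuous_on ?U (\<lambda>x. \<psi>' (ft x))"
        by (auto intro!: continuous_on_compose2[OF c\<psi>(1)[of UNIV] cft0] continuous_on_compose2[OF c\<psi>(2)[of UNIV] cft0])
      have cs: "continuous_on ?U s" unfolding s_def by (intro continuous_intros c\<kappa> c\<psi>0)
      have cb: "continuous_on ?U b" unfolding b_def by (intro continuous_intros c\<kappa> c\<psi>0 cN0)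
      define h' where "h' x = Blinfun (\<lambda>v. (b x \<bullet> v) *\<^sub>R G x + s x *\<^sub>R G' x v)" for x
      have h'a: "blinfun_apply (h' x) v = (b x \<bullet> v) *\<^sub>R G x + s x *\<^sub>R G' x v" for x v
      proof -
        have "bounded_linear (\<lambda>v. (b x \<bullet> v) *\<^sub>R G x + s x *\<^sub>R G' x v)"
          by (intro bounded_linear_add bounded_linear_scaleR_const bounded_linear_inner_right bounded_linear_const_scaleR blinfun.bounded_linear_right)
        then show ?thesis unfolding h'_def by (simp add: bounded_linear_Blinfun_apply)
      qed
      define g where "g x = (if x \<in> ?U then s x *\<^sub>R G x else 0)" for x
      define g' where "g' x = (if x \<in> ?U then h' x else 0)" for x
      have \<kappa>0: "\<kappa> x = 0 \<and> D\<kappa> x = 0" if "2 * r \<le> dist p x" for x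
        using \<eta>(4)[of x] that by (simp add: \<kappa>_def D\<kappa>_def dist_norm norm_minus_commute)
      have dh: "((\<lambda>x. s x *\<^sub>R G x) has_derivative blinfun_apply (h' x)) (at x)" if x: "x \<in> ?U" for x
      proof -
        have "x \<in> D" "x \<in> D0" using x U0 by auto
        then have "((\<lambda>x. s x *\<^sub>R G x) has_derivative (\<lambda>v. s x *\<^sub>R G' x v + (b x \<bullet> v) *\<^sub>R G x)) (at x)"
          by (intro has_derivative_scaleR ds dG)
        then show ?thesis by (simp add: h'a[abs_def] add.commute)
      qed
      have ch: "continuous_on ?U h'"
        by (rule continuous_on_blinfun_componentwise)
          (auto simp: h'a intro!: continuous_intros cb cs continuous_on_subset[OF cG U0(1)] continuous_on_subset[OF cG' U0(1)])
      have hz: "s x *\<^sub>R G x = 0" if x: "x \<in> ?U - cball p (2 * r)" for x using x \<kappa>0[of x] by (simp add: s_def)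
      note ext = C1_zero_extension[OF open_ball closed_cball sub23(2) dh ch hz]
      have dg: "(g has_derivative blinfun_apply (g' x)) (at x)" for x using ext(1)[of x] unfolding g_def[abs_def] g'_def .
      have cg': "continuous_on UNIV g'" using ext(2) unfolding g'_def[abs_def] .
      have "{x. g x \<noteq> 0} \<subseteq> cball p (2 * r) \<inter> - W"
      proof
        fix x assume "x \<in> {x. g x \<noteq> 0}"
        then have "\<kappa> x \<noteq> 0" by (auto simp: g_def s_def split: if_splits)
        then show "x \<in> cball p (2 * r) \<inter> - W"
          using \<kappa>0[of x] W(3) by (cases "2 * r \<le> dist p x") (auto simp: \<kappa>_def)
      qed
      then have sp: "support g \<subseteq> cball p (2 * r) \<inter> - W"
        unfolding support_def using W(1) by (intro closure_minimal) auto
      have "bounded (support g)" by (rule bounded_subset[OF bounded_cball]) (use sp in blast)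
      then have "compact (support g)" by (simp add: compact_eq_bounded_closed support_def)
      moreover have "cball p (2 * r) \<subseteq> \<Omega>" using order_trans[OF sub23(1) rD0] D0(4) by blast
      ultimately have sg: "compact (support g)" "support g \<subseteq> \<Omega> - boundary_points M" "support g \<subseteq> ?U"
        using sp W(2) sub23(2) by blast+
      have "closure ?U \<subseteq> cball p (3 * r)" by (intro closure_minimal) auto
      then have cU: "compact (closure ?U)" "closure ?U \<subseteq> \<Omega>" using rD0 D0(4) by (auto simp: compact_closure)
      let ?I = "\<lambda>x. first_variation x (?\<nu> x) (g x) (g' x)"
      have iI: "set_integrable ?H (M \<inter> ?U) ?I" and le0: "(LINT x : M \<inter> ?U | ?H. ?I x) \<le> 0"
        using first_variation_nonpos[OF card M dg cg' sg open_ball cU] by blast+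
      \<comment> \<open>The inequality to be integrated. Every error is attached to
        \<open>?A\<close> or to \<open>e\<close>, because \<open>D \<eta>\<close> vanishes inside
        radius \<open>r\<close> and \<open>\<psi> (ft x)\<close> below
        \<open>- \<delta>\<close>.\<close>
      have pw: "c3 * indicator (ball p \<rho>) x \<le> ?I x + (c4 * indicator ?A x + c5 * e x)" if x: "x \<in> M \<inter> ?U" for x
      proof -
        let ?n = "?\<nu> x"
        have n: "norm ?n = 1" "?n \<noteq> 0" using C1_surface_normal(1)[OF M1, of x] x by auto
        have xO: "x \<in> \<Omega>" "x \<in> D0" using x U0 D0(4) by auto
        have ee: "0 \<le> e x" "norm (D\<zeta> x) \<le> e x" "1 - \<zeta> x \<le> e x" using e(2) by auto
        let ?Q = "\<lambda>w. F x ?n * (w \<bullet> G x) - (F\<nu> (x, ?n) \<bullet> w) * (G x \<bullet> ?n)"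
        have "?I x = s x * first_variation x ?n (G x) (G' x) + ?Q (b x)"
          using x by (simp add: g_def g'_def first_variation_scaled[OF h'a xO(1) n(2)])
        also have "?Q (b x) = \<kappa> x * \<psi>' (ft x) * ?Q (N x) + \<psi> (ft x) * ?Q (D\<kappa> x)"
          by (simp add: b_def inner_add_left inner_add_right algebra_simps)
        also have "?Q (N x) = tilt x (N x) ?n"
          using euler[OF xO(1) N0'[OF xO(2)]] by (simp add: tilt_def G_def inner_commute)
        finally have I: "?I x = s x * first_variation x ?n (G x) (G' x) + (\<kappa> x * \<psi>' (ft x) * tilt x (N x) ?n + \<psi> (ft x) * ?Q (D\<kappa> x))" .
        show ?thesis
        proof (cases "x \<in> cball p (2 * r)")
          case False
          then have "2 * r \<le> dist p x" by simp
          then have "?I x = 0" unfolding I using \<kappa>0[of x] by (simp add: s_def)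
          moreover have "x \<notin> ball p \<rho>" using False \<rho>(2) r(1) by auto
          ultimately show ?thesis using c345 ee(1) by (simp add: indicator_def)
        next
          case True
          then have xR: "x \<in> cball p R" using r by auto
          have t0: "0 \<le> tilt x (N x) ?n" by (intro tilt_nonneg xO N0' n)
          have "(\<kappa> x * \<psi> (ft x)) * c1 \<le> (\<kappa> x * \<psi> (ft x)) * (first_variation x ?n (G x) (G' x) + \<Lambda> * tilt x (N x) ?n)"
            using R(4)[OF xR, of ?n] n(1) \<kappa>01 \<psi>(1) by (intro mult_left_mono) auto
          also have "\<dots> = s x * first_variation x ?n (G x) (G' x) + \<kappa> x * (\<Lambda> * \<psi> (ft x)) * tilt x (N x) ?n"
            by (simp add: s_def algebra_simps)
          also have "\<kappa> x * (\<Lambda> * \<psi> (ft x)) * tilt x (N x) ?n \<le> \<kappa> x * \<psi>' (ft x) * tilt x (N x) ?n"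
            using \<psi>(2) \<kappa>01 t0 by (intro mult_right_mono mult_left_mono) auto
          finally have main: "\<kappa> x * \<psi> (ft x) * c1 \<le> s x * first_variation x ?n (G x) (G' x) + \<kappa> x * \<psi>' (ft x) * tilt x (N x) ?n" by simp
          have Qb: "\<bar>?Q w\<bar> \<le> CQ * norm w" for w
          proof -
            have "\<bar>F x ?n * (w \<bullet> G x)\<bar> \<le> BF * (norm w * BG)"
            proof (unfold abs_mult, rule mult_mono)
              show "\<bar>F x ?n\<bar> \<le> BF" using B(2)[OF True n(1)] by simp
              have "norm w * norm (G x) \<le> norm w * BG" using B(6)[OF True] by (rule mult_left_mono) simp
              then show "\<bar>w \<bullet> G x\<bar> \<le> norm w * BG" using Cauchy_Schwarz_ineq2 order_trans by blast
            qed (use B(1,5) in auto)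
            moreover have "\<bar>(F\<nu> (x, ?n) \<bullet> w) * (G x \<bullet> ?n)\<bar> \<le> (BF\<nu> * norm w) * BG"
            proof (unfold abs_mult, rule mult_mono)
              have "norm (F\<nu> (x, ?n)) * norm w \<le> BF\<nu> * norm w" using B(4)[OF True n(1)] by (rule mult_right_mono) simp
              then show "\<bar>F\<nu> (x, ?n) \<bullet> w\<bar> \<le> BF\<nu> * norm w" using Cauchy_Schwarz_ineq2 order_trans by blast
              show "\<bar>G x \<bullet> ?n\<bar> \<le> BG" using Cauchy_Schwarz_ineq2[of "G x" ?n] B(6)[OF True] n(1) by simp
            qed (use B(3,5) in auto)
            ultimately have "\<bar>?Q w\<bar> \<le> BF * (norm w * BG) + (BF\<nu> * norm w) * BG" by linarith
            then show ?thesis by (simp add: CQ_def algebra_simps)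
          qed
          have "norm (D\<kappa> x) \<le> norm (D\<eta> x) + e x"
          proof -
            have "norm (\<zeta> x *\<^sub>R D\<eta> x) \<le> 1 * norm (D\<eta> x)" unfolding norm_scaleR using \<zeta>(2) by (intro mult_right_mono) auto
            moreover have "norm (\<eta> x *\<^sub>R D\<zeta> x) \<le> 1 * e x" unfolding norm_scaleR using \<eta>(2)[of x] ee by (intro mult_mono) auto
            ultimately show ?thesis unfolding D\<kappa>_def using norm_triangle_ineq[of "\<zeta> x *\<^sub>R D\<eta> x" "\<eta> x *\<^sub>R D\<zeta> x"] by linarith
          qed
          then have "\<bar>?Q (D\<kappa> x)\<bar> \<le> CQ * (norm (D\<eta> x) + e x)"
            using Qb[of "D\<kappa> x"] mult_left_mono[OF _ CQ] by (meson order_trans)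
          then have "\<bar>\<psi> (ft x) * ?Q (D\<kappa> x)\<bar> \<le> \<psi> (ft x) * (CQ * (norm (D\<eta> x) + e x))"
            unfolding abs_mult using \<psi>(1)[of "ft x"] by (simp add: mult_left_mono)
          also have "\<dots> = CQ * (\<psi> (ft x) * norm (D\<eta> x)) + CQ * (\<psi> (ft x) * e x)" by (simp add: algebra_simps)
          finally have err0: "\<bar>\<psi> (ft x) * ?Q (D\<kappa> x)\<bar> \<le> CQ * (\<psi> (ft x) * norm (D\<eta> x)) + CQ * (\<psi> (ft x) * e x)" .
          have e1: "\<psi> (ft x) * norm (D\<eta> x) \<le> P * (K / r) * indicator ?A x"
          proof (cases "x \<in> ?A")
            case inA: True
            have "\<psi> (ft x) * norm (D\<eta> x) \<le> P * (K / r)"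
              using P \<eta>(5)[of x] True by (intro mult_mono) auto
            then show ?thesis using inA by simp
          next
            case nA: False
            then have "dist p x < r \<or> ft x < - \<delta>" using True by auto
            then have "\<psi> (ft x) = 0 \<or> D\<eta> x = 0"
              using \<psi>(3)[of "ft x"] \<eta>(3)[of x] by (auto simp: dist_norm norm_minus_commute)
            then show ?thesis using nA by auto
          qed
          have e2: "\<psi> (ft x) * e x \<le> P * e x" using P(2)[OF True] ee(1) by (rule mult_right_mono)
          have err: "\<bar>\<psi> (ft x) * ?Q (D\<kappa> x)\<bar> \<le> c4 * indicator ?A x + P * CQ * e x"
            using err0 mult_left_mono[OF e1 CQ] mult_left_mono[OF e2 CQ] by (simp add: c4_def mult_ac)
          \<comment> \<open>Near \<open>p\<close> the cutoff \<open>\<kappa>\<close> equals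
            \<open>\<zeta>\<close>; replacing it by 1 costs at most \<open>c3 * e x\<close>, since
            the deficit is majorised by \<open>e\<close>.\<close>
          have "c3 * indicator (ball p \<rho>) x - c3 * e x \<le> \<kappa> x * \<psi> (ft x) * c1"
          proof (cases "x \<in> ball p \<rho>")
            case inb: True
            then have "norm (x - p) \<le> r" using \<rho>(2) by (simp add: dist_norm norm_minus_commute)
            then have k: "\<kappa> x = \<zeta> x" using \<eta>(3)[of x] by (simp add: \<kappa>_def)
            have "c3 * (1 - e x) \<le> c3 * \<zeta> x" using ee(3) c345(1) by (intro mult_left_mono) auto
            also have "\<dots> = \<zeta> x * c2 * c1" by (simp add: c3_def)
            also have "\<dots> \<le> \<kappa> x * \<psi> (ft x) * c1"
              unfolding k using \<rho>3[OF inb] \<zeta>(2) R(3) by (intro mult_right_mono mult_left_mono) auto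
            finally show ?thesis using inb by (simp add: algebra_simps)
          next
            case False
            have "0 \<le> \<kappa> x * \<psi> (ft x) * c1" using \<kappa>01 \<psi>(1) R(3) by simp
            moreover have "0 \<le> c3 * e x" using c345(1) ee(1) by simp
            ultimately show ?thesis using False by simp
          qed
          then have "c3 * indicator (ball p \<rho>) x - c3 * e x \<le> ?I x - \<psi> (ft x) * ?Q (D\<kappa> x)" unfolding I using main by linarith
          then show ?thesis using err by (simp add: c5_def algebra_simps abs_le_iff)
        qed
      qed
      have Mb: "M \<in> sets borel"
      proof -
        obtain T where "closed T" "M = \<Omega> \<inter> T" using M(1) by (auto simp: proper_hypersurface_def closedin_closed)
        then show ?thesis using open_domain by auto
      qed
      have A_sub: "?A \<subseteq> cball p (2 * r)" by auto
      have Ab: "?A \<in> sets borel"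
      proof -
        have "closedin (top_of_set (cball p (2 * r))) (cball p (2 * r) \<inter> ft -` {- \<delta>..})"
          using sub23(1) rD0 D0(3) by (intro continuous_closedin_preimage continuous_on_subset[OF cft]) auto
        then have "closed (cball p (2 * r) \<inter> ft -` {- \<delta>..})" by (rule closedin_closed_trans) simp
        moreover have "closed {x. r \<le> dist p x}" by (intro closed_Collect_le continuous_intros)
        moreover have "?A = (cball p (2 * r) \<inter> ft -` {- \<delta>..}) \<inter> {x. r \<le> dist p x}" by auto
        ultimately show ?thesis by (metis borel_closed closed_Int)
      qed
      define S where "S = M \<inter> ?U"
      have Sb: "S \<in> sets borel" using Mb by (simp add: S_def)
      have AU: "?A \<subseteq> ?U" "ball p \<rho> \<subseteq> ?U" using A_sub sub23(2) \<rho>(2) r(1) by auto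
      have fin: "hausdorff_outer m S < \<infinity>"
      proof -
        have "hausdorff_outer m S \<le> hausdorff_outer m (M \<inter> closure ?U)"
          unfolding S_def using closure_subset[of ?U] by (intro hausdorff_outer_mono) blast
        also have "\<dots> < \<infinity>"
          by (rule C1_surface_area_finite[OF card M1 compact_hypersurface_Int(1)[OF M(1) cU]])
        finally show ?thesis .
      qed
      have iX: "set_integrable ?H S (indicat_real X)" "(LINT x : S | ?H. indicat_real X x) = measure ?H (M \<inter> X)"
        if X: "X \<in> sets borel" "X \<subseteq> ?U" for X :: "(real^'n) set"
      proof -
        have SX: "S \<inter> X = M \<inter> X" using X(2) by (auto simp: S_def)
        have eq: "(\<lambda>x. indicator S x *\<^sub>R indicat_real X x) = (indicator (M \<inter> X) :: _ \<Rightarrow> real)"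
          by (auto simp: SX[symmetric] indicator_def)
        have "hausdorff_outer m (M \<inter> X) < \<infinity>"
          using hausdorff_outer_mono[of "S \<inter> X" S m] fin SX by (metis inf_le1 order_le_less_trans)
        then show "set_integrable ?H S (indicat_real X)"
          unfolding set_integrable_def eq using Mb X(1)
          by (intro integrable_real_indicator) (auto simp: borel_sets_hausdorff_measure emeasure_hausdorff_borel)
        show "(LINT x : S | ?H. indicat_real X x) = measure ?H (M \<inter> X)"
          unfolding set_lebesgue_integral_def eq by simp
      qed
      have em: "ennreal (indicator S x *\<^sub>R e x) = ennreal (e x) * indicator S x" for x by (simp add: indicator_def)
      have em2: "(\<lambda>x. indicator S x *\<^sub>R e x) \<in> borel_measurable ?H"
        by (intro measurable_hausdorff_measure borel_measurable_scaleR borel_measurable_indicator Sb e(1))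
      have eint: "(\<integral>\<^sup>+x. ennreal (indicator S x *\<^sub>R e x) \<partial>?H) \<le> ennreal E"
        unfolding em by (rule order_trans[OF nn_integral_mono E(1)]) (auto simp: S_def indicator_def)
      have e0: "0 \<le> indicator S x *\<^sub>R e x" for x using e(2) by simp
      have ie: "set_integrable ?H S e"
        unfolding set_integrable_def

        by (rule integrableI_nonneg[OF em2]) (use e0 order_le_less_trans[OF eint] in auto)
      have eE: "(LINT x : S | ?H. e x) \<le> E"
      proof -
        have "ennreal (LINT x : S | ?H. e x) = (\<integral>\<^sup>+x. ennreal (indicator S x *\<^sub>R e x) \<partial>?H)"
          unfolding set_lebesgue_integral_def using ie e0 by (intro nn_integral_eq_integral[symmetric]) (auto simp: set_integrable_def)
        then have "ennreal (LINT x : S | ?H. e x) \<le> ennreal E" using eint by (rule ord_eq_le_trans)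
        then show ?thesis using E(2) by (simp only: ennreal_le_iff)
      qed
      have bm: "ball p \<rho> \<in> sets borel" by simp
      have "c3 * measure ?H (M \<inter> ball p \<rho>) = (LINT x : S | ?H. c3 * indicator (ball p \<rho>) x)"
        by (simp add: iX(2)[OF bm AU(2)])
      also have "\<dots> \<le> (LINT x : S | ?H. ?I x + (c4 * indicator ?A x + c5 * e x))"
        by (rule set_integral_mono)
          (use pw iI iX(1)[OF bm AU(2)] iX(1)[OF Ab AU(1)] ie in \<open>auto simp: S_def intro!: set_integral_add(1) set_integrable_mult_right\<close>)
      also have "\<dots> = (LINT x : S | ?H. ?I x) + ((LINT x : S | ?H. c4 * indicator ?A x) + (LINT x : S | ?H. c5 * e x))"
        using iI iX(1)[OF Ab AU(1)] ie
        by (simp add: S_def[symmetric] set_integral_add set_integrable_mult_right)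
      also have "\<dots> \<le> 0 + (c4 * a + c5 * E)"
      proof (intro add_mono)
        show "(LINT x : S | ?H. ?I x) \<le> 0" using le0 by (simp add: S_def)
        have "measure ?H (M \<inter> ?A) \<le> a"
          using a Mb Ab by (simp add: measure_def emeasure_hausdorff_borel enn2real_leI)
        then show "(LINT x : S | ?H. c4 * indicator ?A x) \<le> c4 * a"
          using c345(2) by (simp add: iX(2)[OF Ab AU(1)] mult_left_mono)
        show "(LINT x : S | ?H. c5 * e x) \<le> c5 * E" using eE c345(3) by (simp add: mult_left_mono)
      qed
      also have "\<dots> \<le> (c4 + c5) * (a + E)" using a(1) E(2) c345 by (simp add: algebra_simps)
      finally have fin2: "measure ?H (M \<inter> ball p \<rho>) \<le> (c4 + c5) / c3 * (a + E)"
        using c345(1) by (simp add: field_simps)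
      \<comment> \<open>\<open>measure\<close> assigns 0 to sets of infinite measure, so finiteness
        has to be checked before the real estimate is turned back into one for
        \<open>hausdorff_outer\<close>.\<close>
      have "hausdorff_outer m (M \<inter> ball p \<rho>) \<le> hausdorff_outer m S"
        using AU(2) by (intro hausdorff_outer_mono) (auto simp: S_def)
      then have "emeasure ?H (M \<inter> ball p \<rho>) \<noteq> \<infinity>" using fin Mb by (auto simp: emeasure_hausdorff_borel top_unique)
      then have "hausdorff_outer m (M \<inter> ball p \<rho>) = ennreal (measure ?H (M \<inter> ball p \<rho>))"
        using Mb by (simp add: emeasure_eq_ennreal_measure emeasure_hausdorff_borel[symmetric])
      then show "hausdorff_outer m (M \<inter> ball p \<rho>) \<le> ennreal ((c4 + c5) / c3 * (a + E))"
        using fin2 by (simp add: ennreal_leI)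
    qed
  qed
qed

end

section \<open>The maximum principle on the blow-up set\<close>

text \<open>The second difference of \<open>f\<close> is symmetric in the two directions. The mean
  value theorem in one direction and differentiability of the gradient at \<open>p\<close> identify
  it as \<open>t^2 (H b \<bullet> a)\<close> up to \<open>o(t^2)\<close>; exchanging the directions
  gives the claim.\<close>

lemma second_derivative_symmetric:
  fixes f :: "'a::real_inner \<Rightarrow> real"
  assumes S: "open S" "p \<in> S" and df: "\<And>x. x \<in> S \<Longrightarrow> (f has_derivative (\<lambda>h. N x \<bullet> h)) (at x)"
    and dN: "(N has_derivative H) (at p)"
  shows "H u \<bullet> v = H v \<bullet> u"
proof -
  interpret H: bounded_linear H by (rule has_derivative_bounded_linear[OF dN])
  let ?n = "norm u + norm v"
  let ?\<Delta> = "\<lambda>t. f (p + t *\<^sub>R u + t *\<^sub>R v) - f (p + t *\<^sub>R u) - f (p + t *\<^sub>R v) + f p"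
  have est: "\<exists>d>0. \<forall>t. 0 < t \<longrightarrow> t < d \<longrightarrow>
      \<bar>f (p + t *\<^sub>R a + t *\<^sub>R b) - f (p + t *\<^sub>R a) - f (p + t *\<^sub>R b) + f p - t\<^sup>2 * (H b \<bullet> a)\<bar> \<le> t\<^sup>2 * (2 * e * (norm a + norm b) * norm a)"
    if e: "0 < e" for a b :: 'a and e :: real
  proof -
    obtain d1 where d1: "0 < d1" "\<And>y. norm (y - p) < d1 \<Longrightarrow> norm (N y - N p - H (y - p)) \<le> e * norm (y - p)"
      using dN e unfolding has_derivative_at_alt by blast
    obtain d2 where d2: "0 < d2" "ball p d2 \<subseteq> S" using S open_contains_ball by blast
    define d where "d = min d1 d2 / (norm a + norm b + 1)"
    have nab: "0 < norm a + norm b + 1" by (simp add: add_nonneg_pos)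
    have d: "0 < d" using d1(1) d2(1) nab by (simp add: d_def)
    have "\<bar>f (p + t *\<^sub>R a + t *\<^sub>R b) - f (p + t *\<^sub>R a) - f (p + t *\<^sub>R b) + f p - t\<^sup>2 * (H b \<bullet> a)\<bar> \<le> t\<^sup>2 * (2 * e * (norm a + norm b) * norm a)"
      if t: "0 < t" "t < d" for t
    proof -
      have td: "t * (norm a + norm b + 1) < min d1 d2" using t(2) nab by (simp add: d_def less_divide_eq)
      have tn: "t * (norm a + norm b) < min d1 d2"
        using td t(1) by (simp add: distrib_left)
      have small: "norm (s *\<^sub>R a + r *\<^sub>R b) \<le> t * (norm a + norm b)" if "0 \<le> s" "s \<le> t" "0 \<le> r" "r \<le> t" for s r
      proof -
        have "norm (s *\<^sub>R a + r *\<^sub>R b) \<le> s * norm a + r * norm b" using norm_triangle_ineq[of "s *\<^sub>R a" "r *\<^sub>R b"] that by simp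
        also have "\<dots> \<le> t * norm a + t * norm b" using that by (intro add_mono mult_right_mono) auto
        finally show ?thesis by (simp add: distrib_left)
      qed
      have inS: "p + s *\<^sub>R a + r *\<^sub>R b \<in> S" if "0 \<le> s" "s \<le> t" "0 \<le> r" "r \<le> t" for s r
      proof -
        have "norm (s *\<^sub>R a + r *\<^sub>R b) < d2" using small[OF that] tn by linarith
        then have "p + (s *\<^sub>R a + r *\<^sub>R b) \<in> ball p d2"
          by (metis mem_ball dist_commute dist_norm add_diff_cancel_left')
        then show ?thesis using d2(2) by (auto simp: add.assoc)
      qed
      have dir: "((\<lambda>s. f (p + s *\<^sub>R a + r *\<^sub>R b)) has_real_derivative N (p + s *\<^sub>R a + r *\<^sub>R b) \<bullet> a) (at s)"
        if "0 \<le> s" "s \<le> t" "0 \<le> r" "r \<le> t" for s r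
      proof -
        have "((\<lambda>s. p + s *\<^sub>R a + r *\<^sub>R b) has_derivative (\<lambda>h. h *\<^sub>R a)) (at s)" by (auto intro!: derivative_eq_intros)
        from has_derivative_compose[OF this df[OF inS[OF that]]]
        show ?thesis by (simp add: has_field_derivative_def mult_commute_abs)
      qed
      have "\<exists>\<xi>. 0 < \<xi> \<and> \<xi> < t \<and>
        (f (p + t *\<^sub>R a + t *\<^sub>R b) - f (p + t *\<^sub>R a + 0 *\<^sub>R b)) - (f (p + 0 *\<^sub>R a + t *\<^sub>R b) - f (p + 0 *\<^sub>R a + 0 *\<^sub>R b))
          = (t - 0) * (N (p + \<xi> *\<^sub>R a + t *\<^sub>R b) \<bullet> a - N (p + \<xi> *\<^sub>R a + 0 *\<^sub>R b) \<bullet> a)"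
        by (rule MVT2[OF t(1)], rule DERIV_diff[OF dir dir]) (use t(1) in auto)
      then obtain \<xi> where \<xi>: "0 < \<xi>" "\<xi> < t"
        "(f (p + t *\<^sub>R a + t *\<^sub>R b) - f (p + t *\<^sub>R a + 0 *\<^sub>R b)) - (f (p + 0 *\<^sub>R a + t *\<^sub>R b) - f (p + 0 *\<^sub>R a + 0 *\<^sub>R b))
          = (t - 0) * (N (p + \<xi> *\<^sub>R a + t *\<^sub>R b) \<bullet> a - N (p + \<xi> *\<^sub>R a + 0 *\<^sub>R b) \<bullet> a)"
        by blast
      let ?R = "\<lambda>w. N (p + w) - N p - H w"
      have Rb: "norm (?R (\<xi> *\<^sub>R a + r *\<^sub>R b)) \<le> e * (t * (norm a + norm b))" if r: "0 \<le> r" "r \<le> t" for r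
      proof -
        have s: "norm (\<xi> *\<^sub>R a + r *\<^sub>R b) \<le> t * (norm a + norm b)" using \<xi> r by (intro small) auto
        have "norm (?R (\<xi> *\<^sub>R a + r *\<^sub>R b)) \<le> e * norm (\<xi> *\<^sub>R a + r *\<^sub>R b)"
          using d1(2)[of "p + (\<xi> *\<^sub>R a + r *\<^sub>R b)"] s tn by simp
        also have "\<dots> \<le> e * (t * (norm a + norm b))" using s e by (intro mult_left_mono) auto
        finally show ?thesis .
      qed
      let ?D = "?R (\<xi> *\<^sub>R a + t *\<^sub>R b) - ?R (\<xi> *\<^sub>R a + 0 *\<^sub>R b)"
      have "f (p + t *\<^sub>R a + t *\<^sub>R b) - f (p + t *\<^sub>R a) - f (p + t *\<^sub>R b) + f p - t\<^sup>2 * (H b \<bullet> a) = t * (?D \<bullet> a)"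
        using \<xi>(3) by (simp add: H.add H.scaleR inner_diff_left inner_add_left add.assoc algebra_simps power2_eq_square)
      moreover have "\<bar>?D \<bullet> a\<bar> \<le> (2 * (e * (t * (norm a + norm b)))) * norm a"
      proof -
        have "norm ?D \<le> 2 * (e * (t * (norm a + norm b)))"
          using norm_triangle_ineq4[of "?R (\<xi> *\<^sub>R a + t *\<^sub>R b)" "?R (\<xi> *\<^sub>R a + 0 *\<^sub>R b)"] Rb[of t] Rb[of 0] t(1) by linarith
        then have "norm ?D * norm a \<le> (2 * (e * (t * (norm a + norm b)))) * norm a" by (rule mult_right_mono) simp
        then show ?thesis using Cauchy_Schwarz_ineq2 order_trans by blast
      qed
      ultimately have "\<bar>f (p + t *\<^sub>R a + t *\<^sub>R b) - f (p + t *\<^sub>R a) - f (p + t *\<^sub>R b) + f p - t\<^sup>2 * (H b \<bullet> a)\<bar>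
          \<le> t * ((2 * (e * (t * (norm a + norm b)))) * norm a)"
        using t(1) by (simp only: abs_mult) (simp add: mult_left_mono)
      then show ?thesis by (simp add: power2_eq_square mult_ac)
    qed
    then show ?thesis using d by blast
  qed
  have "\<bar>H v \<bullet> u - H u \<bullet> v\<bar> \<le> e" if e: "0 < e" for e
  proof -
    define e' where "e' = e / (2 * ?n * ?n + 1)"
    have e': "0 < e'" "e' * (2 * ?n * ?n) \<le> e"
      using e by (auto simp: e'_def add_nonneg_pos divide_le_eq mult_left_mono)
    obtain d1 where d1: "0 < d1" "\<And>t. 0 < t \<Longrightarrow> t < d1 \<Longrightarrow> \<bar>?\<Delta> t - t\<^sup>2 * (H v \<bullet> u)\<bar> \<le> t\<^sup>2 * (2 * e' * ?n * norm u)"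
      using est[OF e'(1), of u v] by blast
    obtain d2 where d2: "0 < d2" "\<And>t. 0 < t \<Longrightarrow> t < d2 \<Longrightarrow>
        \<bar>f (p + t *\<^sub>R v + t *\<^sub>R u) - f (p + t *\<^sub>R v) - f (p + t *\<^sub>R u) + f p - t\<^sup>2 * (H u \<bullet> v)\<bar> \<le> t\<^sup>2 * (2 * e' * (norm v + norm u) * norm v)"
      using est[OF e'(1), of v u] by blast
    define t where "t = min d1 d2 / 2"
    have t: "0 < t" "t < d1" "t < d2" using d1(1) d2(1) by (auto simp: t_def)
    have sw: "p + t *\<^sub>R v + t *\<^sub>R u = p + t *\<^sub>R u + t *\<^sub>R v" by simp
    have "\<bar>t\<^sup>2 * (H v \<bullet> u) - t\<^sup>2 * (H u \<bullet> v)\<bar> \<le> t\<^sup>2 * (2 * e' * ?n * norm u) + t\<^sup>2 * (2 * e' * (norm v + norm u) * norm v)"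
      using d1(2)[OF t(1,2)] d2(2)[OF t(1,3)] unfolding sw by linarith
    also have "\<dots> = t\<^sup>2 * (e' * (2 * ?n * ?n))" by (simp add: algebra_simps)
    also have "\<dots> \<le> t\<^sup>2 * e" using e'(2) by (rule mult_left_mono) simp
    finally have "t\<^sup>2 * \<bar>H v \<bullet> u - H u \<bullet> v\<bar> \<le> t\<^sup>2 * e" by (simp add: right_diff_distrib[symmetric] abs_mult)
    then show ?thesis using t(1) by simp
  qed
  then have "\<bar>H v \<bullet> u - H u \<bullet> v\<bar> \<le> 0" using field_le_epsilon[of "\<bar>H v \<bullet> u - H u \<bullet> v\<bar>" 0] by simp
  then show ?thesis by simp
qed

lemma C2_on_gradient:
  fixes f :: "real^'n \<Rightarrow> real"
  assumes "C2_on S f" "open S"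
  obtains N and H :: "real^'n \<Rightarrow> ((real^'n) \<Rightarrow>\<^sub>L (real^'n))" where
    "\<And>x. x \<in> S \<Longrightarrow> (f has_derivative (\<lambda>h. N x \<bullet> h)) (at x)"
    "\<And>x. x \<in> S \<Longrightarrow> (N has_derivative blinfun_apply (H x)) (at x)" "continuous_on S H"
    "\<And>x. x \<in> S \<Longrightarrow> grad f x = N x"
    "\<And>x i j. x \<in> S \<Longrightarrow> partial i (partial j f) x = H x (axis i 1) $ j"
proof -
  obtain f' and f'' :: "real^'n \<Rightarrow> (real^'n) \<Rightarrow>\<^sub>L ((real^'n) \<Rightarrow>\<^sub>L real)" where
    f: "\<And>x. x \<in> S \<Longrightarrow> (f has_derivative blinfun_apply (f' x)) (at x)"
    and f': "\<And>x. x \<in> S \<Longrightarrow> (f' has_derivative blinfun_apply (f'' x)) (at x)" and c: "continuous_on S f''"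
    using assms(1) unfolding C2_on_def C1_on_def by blast
  define N where "N x = (\<chi> j. f' x (axis j 1))" for x
  define H where "H x = Blinfun (\<lambda>a. \<chi> j. f'' x a (axis j 1))" for x
  have Ha: "blinfun_apply (H x) a = (\<chi> j. f'' x a (axis j 1))" for x a
  proof -
    have "linear (\<lambda>a. \<chi> j. f'' x a (axis j 1))"
      by (rule linearI) (simp_all add: vec_eq_iff blinfun.bilinear_simps)
    then show ?thesis unfolding H_def by (simp add: bounded_linear_Blinfun_apply linear_conv_bounded_linear)
  qed
  have inner: "f' x h = N x \<bullet> h" for x h
  proof -
    have "h = (\<Sum>j\<in>UNIV. h $ j *\<^sub>R axis j 1)" using basis_expansion[of h] by (simp add: scalar_mult_eq_scaleR)
    then have "f' x h = (\<Sum>j\<in>UNIV. f' x (h $ j *\<^sub>R axis j 1))" by (metis blinfun.sum_right)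
    then show ?thesis by (simp add: blinfun.scaleR_right N_def inner_vec_def mult.commute)
  qed
  have dNj: "((\<lambda>x. N x $ j) has_derivative (\<lambda>h. H x h $ j)) (at x)" if "x \<in> S" for x j
    unfolding N_def Ha vec_lambda_beta
    by (rule bounded_linear.has_derivative[OF blinfun.bounded_linear_left f'[OF that]])
  have p1: "partial i f x = N x $ i" if "x \<in> S" for x i using partial_eq[OF f[OF that]] by (simp add: N_def)
  show thesis
  proof (rule that[of N H])
    show "(f has_derivative (\<lambda>h. N x \<bullet> h)) (at x)" if "x \<in> S" for x using f[OF that] by (simp add: inner[abs_def])
    show "(N has_derivative blinfun_apply (H x)) (at x)" if x: "x \<in> S" for x
    proof (subst has_derivative_componentwise_within, rule ballI)
      fix b :: "real^'n" assume "b \<in> Basis"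
      then obtain j where b: "b = axis j 1" by (auto simp: Basis_vec_def)
      then show "((\<lambda>x. N x \<bullet> b) has_derivative (\<lambda>h. H x h \<bullet> b)) (at x)"
        using dNj[OF x, of j] by (simp add: inner_axis)
    qed
    show "continuous_on S H"
      by (rule continuous_on_blinfun_componentwise) (simp add: Ha, intro continuous_intros c)
    show "grad f x = N x" if "x \<in> S" for x using p1[OF that] by (simp add: grad_def vec_eq_iff)
    show "partial i (partial j f) x = H x (axis i 1) $ j" if "x \<in> S" for x i j
      by (rule partial_eq_local[OF dNj[OF that] assms(2) that]) (rule p1)
  qed
qed

lemma elliptic_integrand_elliptic:
  fixes \<Omega> :: "(real^'n) set" and F :: "real^'n \<Rightarrow> real^'n \<Rightarrow> real"
  assumes "open \<Omega>" "elliptic_integrand \<Omega> F"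
  obtains F' F'' where "elliptic \<Omega> F F' F''"
proof -
  obtain F' and F'' :: "(real^'n) \<times> (real^'n) \<Rightarrow> ((real^'n) \<times> (real^'n)) \<Rightarrow>\<^sub>L (((real^'n) \<times> (real^'n)) \<Rightarrow>\<^sub>L real)" where
    F: "\<And>z. z \<in> \<Omega> \<times> (UNIV - {0}) \<Longrightarrow> ((\<lambda>(x, \<nu>). F x \<nu>) has_derivative blinfun_apply (F' z)) (at z)"
    and F': "\<And>z. z \<in> \<Omega> \<times> (UNIV - {0}) \<Longrightarrow> (F' has_derivative blinfun_apply (F'' z)) (at z)"
    and c: "continuous_on (\<Omega> \<times> (UNIV - {0})) F''"
    using assms(2)[unfolded elliptic_integrand_def C2_on_def C1_on_def, THEN conjunct1]
    by (elim exE conjE, intro that) auto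
  have "continuous_on (\<Omega> \<times> (UNIV - {0})) F'"
    by (intro continuous_at_imp_continuous_on ballI) (rule has_derivative_continuous[OF F'])
  then have "elliptic \<Omega> F F' F''"
    using assms F F' c unfolding elliptic_integrand_def elliptic_def integrand_def elliptic_axioms_def
    by simp
  then show thesis by (rule that)
qed

section \<open>Area bounds away from the blow-up set\<close>

lemma limsup_finite_eventually:
  fixes u :: "nat \<Rightarrow> ennreal"
  assumes "limsup u < \<infinity>"
  obtains b where "0 \<le> b" "\<forall>\<^sub>F i in sequentially. u i < ennreal b"
proof -
  obtain c where c: "limsup u < c" "c < \<infinity>" using dense[OF assms] by blast
  then have "c = ennreal (enn2real c)" by simp
  then show thesis using Limsup_lessD[OF c(1)] by (intro that[of "enn2real c"]) auto
qed

lemma closed_area_blowup_set: "closed (area_blowup_set m \<Omega> M)"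
proof -
  let ?u = "\<lambda>x r. limsup (\<lambda>i. hausdorff_outer m (M i \<inter> ball x r))"
  have "open {x. \<exists>r>0. ?u x r \<noteq> \<infinity>}"
  proof (rule openI)
    fix x assume "x \<in> {x. \<exists>r>0. ?u x r \<noteq> \<infinity>}"
    then obtain r where r: "0 < r" "?u x r \<noteq> \<infinity>" by blast
    have "y \<in> {x. \<exists>r>0. ?u x r \<noteq> \<infinity>}" if y: "y \<in> ball x (r / 2)" for y
    proof -
      have "ball y (r / 2) \<subseteq> ball x r"
      proof
        fix w assume "w \<in> ball y (r / 2)"
        then show "w \<in> ball x r" using y dist_triangle[of x w y] by simp
      qed
      then have "?u y (r / 2) \<le> ?u x r"
        by (intro Limsup_mono always_eventually allI hausdorff_outer_mono) blast
      then have "?u y (r / 2) \<noteq> \<infinity>" using r(2) by (auto simp: top_unique)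
      then show ?thesis using r(1) by (auto intro!: exI[of _ "r / 2"])
    qed
    then show "\<exists>e>0. ball x e \<subseteq> {x. \<exists>r>0. ?u x r \<noteq> \<infinity>}" using r(1) by (intro exI[of _ "r / 2"]) auto
  qed
  moreover have "area_blowup_set m \<Omega> M = closure \<Omega> - {x. \<exists>r>0. ?u x r \<noteq> \<infinity>}"
    by (auto simp: area_blowup_set_def)
  ultimately show ?thesis by (simp add: closed_Diff)
qed

text \<open>Each point of \<open>K\<close> has a ball in which the areas are eventually bounded;
  finitely many balls cover \<open>K\<close>, and finitely many eventual bounds hold together from
  some index on.\<close>

lemma area_bounded_off_blowup_set:
  assumes K: "compact K" "K \<subseteq> closure \<Omega>" "K \<inter> area_blowup_set m \<Omega> M = {}"
  obtains a where "0 \<le> a" "\<forall>\<^sub>F i in sequentially. hausdorff_outer m (M i \<inter> K) \<le> ennreal a"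
proof -
  have "\<exists>r a. 0 < r \<and> 0 \<le> a \<and> (\<forall>\<^sub>F i in sequentially. hausdorff_outer m (M i \<inter> ball x r) < ennreal a)" if x: "x \<in> K" for x
  proof -
    have "x \<in> closure \<Omega>" "x \<notin> area_blowup_set m \<Omega> M" using x K(2,3) by auto
    then obtain r where r: "0 < r" "limsup (\<lambda>i. hausdorff_outer m (M i \<inter> ball x r)) \<noteq> \<infinity>"
      unfolding area_blowup_set_def by blast
    then have "limsup (\<lambda>i. hausdorff_outer m (M i \<inter> ball x r)) < \<infinity>" by (simp add: less_top)
    then show ?thesis using r(1) by (elim limsup_finite_eventually) blast
  qed
  then have "\<forall>x\<in>K. \<exists>r a. 0 < r \<and> 0 \<le> a \<and> (\<forall>\<^sub>F i in sequentially. hausdorff_outer m (M i \<inter> ball x r) < ennreal a)" by blast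
  then obtain r a where ra: "\<forall>x\<in>K. 0 < r x \<and> 0 \<le> a x \<and> (\<forall>\<^sub>F i in sequentially. hausdorff_outer m (M i \<inter> ball x (r x)) < ennreal (a x))"
    unfolding bchoice_iff by blast
  have "K \<subseteq> (\<Union>x\<in>K. ball x (r x))" using ra by force
  then obtain I where I: "I \<subseteq> K" "finite I" "K \<subseteq> (\<Union>x\<in>I. ball x (r x))"
    using compactE_image[OF K(1), of K "\<lambda>x. ball x (r x)"] by auto
  have a0: "0 \<le> a x" if "x \<in> I" for x using ra I(1) that by blast
  have "\<forall>\<^sub>F i in sequentially. \<forall>x\<in>I. hausdorff_outer m (M i \<inter> ball x (r x)) < ennreal (a x)"
    using ra I(1,2) by (intro eventually_ball_finite) auto
  then have "\<forall>\<^sub>F i in sequentially. hausdorff_outer m (M i \<inter> K) \<le> ennreal (\<Sum>x\<in>I. a x)"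
  proof eventually_elim
    case (elim i)
    have "hausdorff_outer m (M i \<inter> K) \<le> hausdorff_outer m (\<Union>x\<in>I. M i \<inter> ball x (r x))"
      using I(3) by (intro hausdorff_outer_mono) auto
    also have "\<dots> \<le> (\<Sum>x\<in>I. hausdorff_outer m (M i \<inter> ball x (r x)))" by (rule hausdorff_outer_finite_UN[OF I(2)])
    also have "\<dots> \<le> (\<Sum>x\<in>I. ennreal (a x))" using elim by (intro sum_mono) (auto intro: less_imp_le)
    also have "\<dots> = ennreal (\<Sum>x\<in>I. a x)" using a0 by (rule sum_ennreal)
    finally show ?case .
  qed
  then show thesis using a0 by (intro that[of "\<Sum>x\<in>I. a x"]) (auto intro: sum_nonneg)
qed

section \<open>The contradiction at a maximum point\<close>

context elliptic
begin

text \<open>The mixed derivative has degree 0 and the second derivative degree -1 in the normal, so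
  both terms acquire the factor \<open>norm N\<close> when the unit normal is replaced by
  \<open>N\<close>. Symmetry of the Hessian matches the order of indices in the trace.\<close>

lemma anisotropic_trace:
  assumes x: "x \<in> \<Omega>" and N: "N \<noteq> 0" and H: "\<And>i j. H (axis i 1) $ j = H (axis j 1) $ i"
  shows "(\<Sum>i\<in>UNIV. \<Sum>j\<in>UNIV. dF2 F i j x (N /\<^sub>R norm N) * H (axis i 1) $ j)
      + (\<Sum>i\<in>UNIV. dxF F i i x (N /\<^sub>R norm N)) * norm N = norm N * tr (\<lambda>a. F\<nu>' (x, N) (a, H a))"
proof -
  let ?c = "inverse (norm N)"
  have c: "0 < ?c" and n: "?c *\<^sub>R N \<noteq> 0" using N by auto
  have l: "linear (F\<nu>' (x, N))" using F\<nu>'_linear[of "(x, N)"] by (simp add: linear_conv_bounded_linear)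
  have d1: "dxF F i i x (?c *\<^sub>R N) = F\<nu>' (x, N) (axis i 1, 0) $ i" for i
    using F\<nu>'_scale[OF x N c, of "axis i 1" 0] by (simp add: dxF_eq[OF x n])
  have d2: "dF2 F i j x (?c *\<^sub>R N) = norm N * F\<nu>' (x, N) (0, axis i 1) $ j" for i j
  proof -
    have "F\<nu>' (x, ?c *\<^sub>R N) (0, axis i 1) = F\<nu>' (x, ?c *\<^sub>R N) (0, ?c *\<^sub>R (norm N *\<^sub>R axis i 1))" using N by simp
    also have "\<dots> = F\<nu>' (x, N) (0, norm N *\<^sub>R axis i 1)" by (rule F\<nu>'_scale[OF x N c])
    also have "\<dots> = norm N *\<^sub>R F\<nu>' (x, N) (0, axis i 1)"
      using linear_scale[OF l, of "norm N" "(0, axis i 1)"] by simp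
    finally show ?thesis by (simp add: dF2_eq[OF x n])
  qed
  have s: "F\<nu>' (x, N) (axis j 1, H (axis j 1)) $ j
      = F\<nu>' (x, N) (axis j 1, 0) $ j + (\<Sum>i\<in>UNIV. H (axis i 1) $ j * F\<nu>' (x, N) (0, axis i 1) $ j)" for j
  proof -
    have "F\<nu>' (x, N) (axis j 1, H (axis j 1)) = F\<nu>' (x, N) (axis j 1, 0) + F\<nu>' (x, N) (0, H (axis j 1))"
      using linear_add[OF l, of "(axis j 1, 0)" "(0, H (axis j 1))"] by simp
    then show ?thesis unfolding F\<nu>'_expand[of _ "H (axis j 1)"] by (simp add: H[of j])
  qed
  have "(\<Sum>i\<in>UNIV. \<Sum>j\<in>UNIV. dF2 F i j x (?c *\<^sub>R N) * H (axis i 1) $ j)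
      = norm N * (\<Sum>j\<in>UNIV. \<Sum>i\<in>UNIV. H (axis i 1) $ j * F\<nu>' (x, N) (0, axis i 1) $ j)"
    unfolding d2 by (subst sum.swap) (simp add: sum_distrib_left mult_ac)
  then show ?thesis by (simp add: d1 tr_def s sum.distrib algebra_simps)
qed

lemma blowup_trace_nonpos:
  fixes M :: "nat \<Rightarrow> (real^'n) set" and H :: "real^'n \<Rightarrow> ((real^'n) \<Rightarrow>\<^sub>L (real^'n))"
  assumes card: "CARD('n) = m + 1" and m: "1 \<le> m"
    and M: "\<And>i. proper_hypersurface \<Omega> (M i)" "\<And>i. F_stationary m \<Omega> F (M i)"
    and bd: "\<And>K. compact K \<Longrightarrow> K \<subseteq> \<Omega> \<Longrightarrow> limsup (\<lambda>i. hausdorff_outer (m - 1) (boundary_points (M i) \<inter> K)) < \<infinity>"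
    and df: "\<And>x. x \<in> \<Omega> \<Longrightarrow> (f has_derivative (\<lambda>h. N x \<bullet> h)) (at x)"
    and dN: "\<And>x. x \<in> \<Omega> \<Longrightarrow> (N has_derivative blinfun_apply (H x)) (at x)" and cH: "continuous_on \<Omega> H"
    and p: "p \<in> \<Omega>" "p \<in> area_blowup_set m \<Omega> M" "N p \<noteq> 0"
    and max: "0 < e" "\<And>y. y \<in> area_blowup_set m \<Omega> M \<inter> \<Omega> \<inter> ball p e \<Longrightarrow> f y \<le> f p"
  shows "tr (\<lambda>a. F\<nu>' (p, N p) (a, H p a)) \<le> 0"
proof (rule ccontr)
  let ?T = "tr (\<lambda>a. F\<nu>' (p, N p) (a, H p a))" and ?Z = "area_blowup_set m \<Omega> M"
  let ?T1 = "tr (\<lambda>a. F\<nu>' (p, N p) (0, a))"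
  assume "\<not> ?T \<le> 0"
  then have T: "0 < ?T" by simp
  \<comment> \<open>The penalty subtracts \<open>2 \<epsilon>\<close> times the identity from the
    Hessian, which changes the trace by \<open>2 \<epsilon> ?T1\<close>; this
    \<open>\<epsilon>\<close> loses less than half of \<open>?T\<close>.\<close>
  define \<epsilon> where "\<epsilon> = ?T / (4 * (\<bar>?T1\<bar> + 1))"
  have \<epsilon>: "0 < \<epsilon>" "2 * \<epsilon> * \<bar>?T1\<bar> < ?T"
    using T by (auto simp: \<epsilon>_def divide_less_eq add_nonneg_pos)
  define ft where "ft x = f x - f p - \<epsilon> * ((x - p) \<bullet> (x - p))" for x
  define N' where "N' x = N x - (2 * \<epsilon>) *\<^sub>R (x - p)" for x
  define H' where "H' x = H x - (2 * \<epsilon>) *\<^sub>R id_blinfun" for x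
  have dft: "(ft has_derivative (\<lambda>h. N' x \<bullet> h)) (at x)" if "x \<in> \<Omega>" for x
    unfolding ft_def[abs_def] N'_def
    by (rule has_derivative_eq_rhs, (rule derivative_intros df[OF that])+)
      (simp add: fun_eq_iff inner_diff_left inner_commute algebra_simps)
  have dN': "(N' has_derivative blinfun_apply (H' x)) (at x)" if "x \<in> \<Omega>" for x
    unfolding N'_def[abs_def] H'_def
    by (rule has_derivative_eq_rhs, (rule derivative_intros dN[OF that])+)
      (simp add: fun_eq_iff blinfun.bilinear_simps)
  have cH': "continuous_on \<Omega> H'" unfolding H'_def by (intro continuous_intros cH)
  have N'p: "N' p = N p" by (simp add: N'_def)
  have l: "linear (F\<nu>' (p, N p))" using F\<nu>'_linear[of "(p, N p)"] by (simp add: linear_conv_bounded_linear)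
  have "F\<nu>' (p, N p) (a, H' p a) = F\<nu>' (p, N p) (a, H p a) - (2 * \<epsilon>) *\<^sub>R F\<nu>' (p, N p) (0, a)" for a
    using linear_diff[OF l, of "(a, H p a)" "(2 * \<epsilon>) *\<^sub>R (0, a)"] linear_scale[OF l, of "2 * \<epsilon>" "(0, a)"]
    by (simp add: H'_def blinfun.bilinear_simps)
  then have "tr (\<lambda>a. F\<nu>' (p, N' p) (a, H' p a)) = ?T - 2 * \<epsilon> * ?T1"
    unfolding N'p by (simp add: tr_def sum_subtractf sum_distrib_left)
  moreover have "2 * \<epsilon> * ?T1 \<le> 2 * \<epsilon> * \<bar>?T1\<bar>" using \<epsilon>(1) by (intro mult_left_mono) auto
  ultimately have trace: "0 < tr (\<lambda>a. F\<nu>' (p, N' p) (a, H' p a))" using \<epsilon>(2) by linarith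
  have N'0: "N' p \<noteq> 0" and ftp: "ft p = 0" and e2: "0 < e / 2" using p(3) N'p max(1) by (simp_all add: ft_def)
  \<comment> \<open>The barrier is built inside radius \<open>e / 2\<close>, so that the annulus
    lies in the ball where \<open>p\<close> is a maximum on the blow-up set.\<close>
  obtain r where r: "0 < r" "3 * r \<le> e / 2" "cball p (3 * r) \<subseteq> \<Omega>"
    and barrier: "\<And>\<delta>. 0 < \<delta> \<Longrightarrow> \<exists>\<rho>>0. \<exists>C\<ge>0. \<forall>M a E. proper_hypersurface \<Omega> M \<longrightarrow> F_stationary m \<Omega> F M \<longrightarrow>
      vanishing_cutoff m M (boundary_points M \<inter> cball p (2 * r)) E \<longrightarrow> 0 \<le> E \<longrightarrow> 0 \<le> a \<longrightarrow>
      hausdorff_outer m (M \<inter> {x. r \<le> dist p x \<and> dist p x \<le> 2 * r \<and> - \<delta> \<le> ft x}) \<le> ennreal a \<longrightarrow>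
      hausdorff_outer m (M \<inter> ball p \<rho>) \<le> ennreal (C * (a + E))"
  proof (rule barrier_estimate[OF card open_domain p(1) order_refl dft dN' cH' N'0 trace ftp e2], goal_cases)
    case (3 r)
    from 3(2-5) show ?case by (rule that)
  qed simp_all
  \<comment> \<open>On the blow-up set in the annulus \<open>ft \<le> - \<epsilon> r^2\<close>,
    which is below \<open>- \<delta>\<close>; half of that depth is left as a margin.\<close>
  define \<delta> where "\<delta> = \<epsilon> * r\<^sup>2 / 2"
  have \<delta>: "0 < \<delta>" using \<epsilon>(1) r(1) by (simp add: \<delta>_def)
  let ?K = "cball p (2 * r)"
  let ?A = "{x. r \<le> dist p x \<and> dist p x \<le> 2 * r \<and> - \<delta> \<le> ft x}"
  have K\<Omega>: "?K \<subseteq> \<Omega>"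
    using r(1) by (intro order_trans[OF _ r(3)] subset_cball) simp
  obtain \<rho> C where \<rho>: "0 < \<rho>" "0 \<le> C" and est: "\<And>M a E. proper_hypersurface \<Omega> M \<Longrightarrow> F_stationary m \<Omega> F M \<Longrightarrow>
      vanishing_cutoff m M (boundary_points M \<inter> ?K) E \<Longrightarrow> 0 \<le> E \<Longrightarrow> 0 \<le> a \<Longrightarrow>
      hausdorff_outer m (M \<inter> ?A) \<le> ennreal a \<Longrightarrow>
      hausdorff_outer m (M \<inter> ball p \<rho>) \<le> ennreal (C * (a + E))"
    using barrier[OF \<delta>] by blast
  have cA: "compact ?A"
  proof -
    have "continuous_on \<Omega> ft"
      by (intro continuous_at_imp_continuous_on ballI) (rule has_derivative_continuous[OF dft])
    then have "closedin (top_of_set ?K) (?K \<inter> ft -` {- \<delta>..})"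
      by (intro continuous_closedin_preimage continuous_on_subset[OF _ K\<Omega>]) auto
    then have "compact (?K \<inter> ft -` {- \<delta>..})" by (rule closedin_compact[OF compact_cball])
    moreover have "closed {x. r \<le> dist p x}" by (intro closed_Collect_le continuous_intros)
    moreover have "?A = (?K \<inter> ft -` {- \<delta>..}) \<inter> {x. r \<le> dist p x}" by auto
    ultimately show ?thesis by (simp add: compact_Int_closed)
  qed
  have AZ: "?A \<inter> ?Z = {}"
  proof (rule ccontr)
    assume "?A \<inter> ?Z \<noteq> {}"
    then obtain x where x: "x \<in> ?Z" "r \<le> dist p x" "dist p x \<le> 2 * r" "- \<delta> \<le> ft x" by blast
    then have "x \<in> \<Omega>" "x \<in> ball p e" using K\<Omega> r(1,2) by auto
    then have "f x \<le> f p" using x(1) by (intro max) auto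
    moreover have "\<epsilon> * r\<^sup>2 \<le> \<epsilon> * ((x - p) \<bullet> (x - p))"
      using power_mono[OF x(2), of 2] r(1) \<epsilon>(1) unfolding dist_norm norm_minus_commute[of p] power2_norm_eq_inner
      by (intro mult_left_mono) auto
    moreover have "\<delta> < \<epsilon> * r\<^sup>2" using \<delta> by (simp add: \<delta>_def)
    ultimately show False using x(4) unfolding ft_def by linarith
  qed
  have "?A \<subseteq> closure \<Omega>" using K\<Omega> closure_subset[of \<Omega>] by auto
  then obtain a where a: "0 \<le> a" "\<forall>\<^sub>F i in sequentially. hausdorff_outer m (M i \<inter> ?A) \<le> ennreal a"
    using area_bounded_off_blowup_set[OF cA _ AZ] by blast
  obtain b where b: "0 \<le> b" "\<forall>\<^sub>F i in sequentially. hausdorff_outer (m - 1) (boundary_points (M i) \<inter> ?K) < ennreal b"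
    by (rule limsup_finite_eventually[OF bd[OF compact_cball K\<Omega>]])
  \<comment> \<open>\<open>C'\<close> does not depend on the surface, so the eventual bound
    \<open>b\<close> on the boundary measures makes the cutoff cost \<open>?E\<close> the same for
    all late indices.\<close>
  obtain C' where C': "0 \<le> C'"
    "\<And>(M :: (real^'n) set) B b. C1_surface M \<Longrightarrow> M \<in> sets borel \<Longrightarrow> compact B \<Longrightarrow> B \<subseteq> M \<Longrightarrow> 0 \<le> b \<Longrightarrow>
      hausdorff_outer (m - 1) B < ennreal b \<Longrightarrow>
      vanishing_cutoff m M B (C' * (b + 1))"
    by (rule boundary_cutoff[OF card m]) blast
  let ?E = "C' * (b + 1)"
  have E: "0 \<le> ?E" using C'(1) b(1) by simp
  have "\<forall>\<^sub>F i in sequentially. hausdorff_outer m (M i \<inter> ball p \<rho>) \<le> ennreal (C * (a + ?E))"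
    using a(2) b(2)
  proof eventually_elim
    case (elim i)
    have Mb: "M i \<in> sets borel"
    proof -
      obtain T where "closed T" "M i = \<Omega> \<inter> T" using M(1)[of i] by (auto simp: proper_hypersurface_def closedin_closed)
      then show ?thesis using open_domain by auto
    qed
    have "boundary_points (M i) \<inter> ?K \<subseteq> M i" by (auto simp: boundary_points_def)
    then have "vanishing_cutoff m (M i) (boundary_points (M i) \<inter> ?K) ?E"
      by (intro C'(2) proper_hypersurface_C1_surface[OF M(1)] Mb compact_hypersurface_Int(2)[OF M(1) compact_cball K\<Omega>] b(1) elim(2))
    then show ?case by (rule est[OF M _ E a(1) elim(1)])
  qed
  then have "limsup (\<lambda>i. hausdorff_outer m (M i \<inter> ball p \<rho>)) \<le> ennreal (C * (a + ?E))" by (rule Limsup_bounded)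
  then have "limsup (\<lambda>i. hausdorff_outer m (M i \<inter> ball p \<rho>)) \<noteq> \<infinity>" by (auto simp: top_unique)
  then show False using p(2) \<rho>(1) by (simp add: area_blowup_set_def)
qed

end

theorem theorem1p1:
  fixes \<Omega> :: "(real^'n) set"
    and F :: "real^'n \<Rightarrow> real^'n \<Rightarrow> real"
    and M :: "nat \<Rightarrow> (real^'n) set"
    and m :: nat and h :: real
  assumes "CARD('n) = m + 1" and "m \<ge> 1"
    and "open \<Omega>"
    and "elliptic_integrand \<Omega> F"
    and "h > 0"
    and "\<And>i. proper_hypersurface \<Omega> (M i)"
    and "\<And>i. F_stable m \<Omega> F (M i)"
    and "\<And>K. compact K \<Longrightarrow> K \<subseteq> \<Omega> \<Longrightarrow>
           limsup (\<lambda>i. hausdorff_outer (m - 1) (boundary_points (M i) \<inter> K)) < \<infinity>"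
  shows "mh_set \<Omega> F h (area_blowup_set m \<Omega> M \<inter> \<Omega>)"
  unfolding mh_set_def Let_def
proof (intro conjI allI impI)
  show "closedin (top_of_set \<Omega>) (area_blowup_set m \<Omega> M \<inter> \<Omega>)"
    using closedin_closed_Int[OF closed_area_blowup_set, of \<Omega> m \<Omega> M] by (simp add: Int_commute)
  fix f :: "real^'n \<Rightarrow> real" and p :: "real^'n"
  let ?\<nu> = "grad f p /\<^sub>R norm (grad f p)"
  assume f: "C2_on \<Omega> f" and p: "p \<in> area_blowup_set m \<Omega> M \<inter> \<Omega>"
    and "\<exists>e>0. \<forall>y\<in>area_blowup_set m \<Omega> M \<inter> \<Omega> \<inter> ball p e. f y \<le> f p" and g: "grad f p \<noteq> 0"
  then obtain e where e: "0 < e" "\<And>y. y \<in> area_blowup_set m \<Omega> M \<inter> \<Omega> \<inter> ball p e \<Longrightarrow> f y \<le> f p" by blast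
  obtain F' F'' where "elliptic \<Omega> F F' F''" by (rule elliptic_integrand_elliptic[OF assms(3,4)])
  then interpret elliptic \<Omega> F F' F'' .
  obtain N and H :: "real^'n \<Rightarrow> ((real^'n) \<Rightarrow>\<^sub>L (real^'n))" where
    N: "\<And>x. x \<in> \<Omega> \<Longrightarrow> (f has_derivative (\<lambda>h. N x \<bullet> h)) (at x)"
    and H: "\<And>x. x \<in> \<Omega> \<Longrightarrow> (N has_derivative blinfun_apply (H x)) (at x)" "continuous_on \<Omega> H"
    and grad: "\<And>x. x \<in> \<Omega> \<Longrightarrow> grad f x = N x"
    and hess: "\<And>x i j. x \<in> \<Omega> \<Longrightarrow> partial i (partial j f) x = H x (axis i 1) $ j"
    by (rule C2_on_gradient[OF f assms(3)]) blast
  have p\<Omega>: "p \<in> \<Omega>" and pZ: "p \<in> area_blowup_set m \<Omega> M" and Np: "N p \<noteq> 0" using p g grad by auto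
  \<comment> \<open>Symmetry is derived from differentiability of the gradient, the form in which
    \<open>C2_on\<close> supplies second derivatives.\<close>
  have sym: "H p (axis i 1) $ j = H p (axis j 1) $ i" for i j
    using second_derivative_symmetric[OF assms(3) p\<Omega> N H(1)[OF p\<Omega>], of "axis i 1" "axis j 1"] by (simp add: inner_axis)
  have "F_stationary m \<Omega> F (M i)" for i using assms(7) by (simp add: F_stable_def)
  from blowup_trace_nonpos[OF assms(1,2,6) this assms(8) N H p\<Omega> pZ Np e]
  have "norm (N p) * tr (\<lambda>a. F\<nu>' (p, N p) (a, H p a)) \<le> 0" by (simp add: mult_nonneg_nonpos)
  also have "0 \<le> h * norm (N p)" using assms(5) by simp
  finally show "(\<Sum>i\<in>UNIV. \<Sum>j\<in>UNIV. dF2 F i j p ?\<nu> * partial i (partial j f) p) + (\<Sum>i\<in>UNIV. dxF F i i p ?\<nu>) * norm (grad f p)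
      \<le> h * norm (grad f p)"
    using anisotropic_trace[OF p\<Omega> Np sym] by (simp add: grad[OF p\<Omega>] hess[OF p\<Omega>])
qed

end
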